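(* Consider, on $\mathbb T\times\mathbb R$, the one-dimensional McKean--Vlasov--Fokker--Planck equation $$\partial_t \mu_t = -p\,\partial_q\mu_t + (V'+W' \star \Pi \mu_t)\,\partial_p \mu_t + \gamma\,\partial_p\left(p \mu_t + \beta^{-1}\partial_p\mu_t\right)$$ with $W(q)=-\cos(2\pi q)$ and $V(q)=-\eta\cos(2\pi q)$ for a fixed $\eta\in(0,1)$. For $a\in\mathbb R$ let $$\mu_a(q,p)=Z(a)^{-1}e^{a\cos(2\pi q)}\kappa(p),\qquad Z(a)=\int_{\mathbb T}e^{a\cos(2\pi q)}\,dq,\qquad \kappa(p)=\sqrt{\tfrac{\beta}{2\pi}}\,e^{-\beta p^2/2}.$$ Then, for any $\beta>0$, there exists a unique global minimizer of the free energy $E_{\mathrm{MF}}$, given by $\mu_{\min}=\mu_{a^{\min}_\beta}$ for some $a^{\min}_\beta>0$. Furthermore, there is a unique value $\beta_{\mathrm c}>0$ such that: - for $\beta<\beta_{\mathrm c}$, the probability measure $\mu_{\min}$ is the unique steady state of the equation; - for $\beta=\beta_{\mathrm c}$, there exist exactly two steady states, given by $\mu_{\min}=\mu_{a^{\min}_\beta}$ and $\mu^{\mathrm c}=\mu_{a_{\beta_{\mathrm c}}}$, where $a_{\beta_{\mathrm c}}<0<a^{\min}_\beta$; - for $\beta>\beta_{\mathrm c}$, there exist exactly three steady states, where the first one is $\mu_{\min}=\mu_{a_\beta^{\min}}$ and the others are $\mu^i=\mu_{a^i_\beta}$, $i\in\{1,2\}$, with $a^2_\beta<a^1_\beta<0<a^{\min}_\beta$.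 Furthermore, $\mu^{\mathrm c}$ and $\mu^i$, for $i\in\{1,2\}$, are unstable critical points of $E_{\mathrm{MF}}$, that is to say, they are not local minimizers.
   Context: $\mathbb T=\mathbb R/\mathbb Z$; $\gamma>0$ is a fixed friction and $\beta>0$ the inverse temperature. $\Pi\mu$ denotes the position marginal of a probability measure $\mu$ on $\mathbb T\times\mathbb R$, and $(g\star\nu)(q)=\int_{\mathbb T}g(q-\tilde q)\,\nu(d\tilde q)$. Steady states are probability measures that are stationary solutions of the equation; equivalently, they are the measures $\nu(q)\kappa(p)\,dq\,dp$ with $\nu=Z^{-1}e^{-\beta(V+W\star\nu)}$, $Z$ the normalizing constant, and these are exactly the critical points of the free energy $$E_{\mathrm{MF}}[\rho]=\int_{\mathbb T\times\mathbb R}\Big(\tfrac1\beta\log\rho(q,p)+\tfrac{p^2}{2}+V(q)+\tfrac12 (W\star\Pi\rho)(q)\Big)\rho(q,p)\,dq\,dp$$ over probability measures $\rho$ on $\mathbb T\times\mathbb R$. *)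

theory Defs
  imports "HOL-Probability.Probability"
begin

section \<open>The torus \<open>\<real>/\<int>\<close>\<close>

quotient_type torus = real / "\<lambda>x y. x - y \<in> \<int>"
  morphisms rep_torus to_torus
proof (intro equivpI reflpI sympI transpI)
  show "x - x \<in> \<int>" for x :: real by simp
  show "y - x \<in> \<int>" if "x - y \<in> \<int>" for x y :: real
    using Ints_minus[OF that] by simp
  show "x - z \<in> \<int>" if "x - y \<in> \<int>" "y - z \<in> \<int>" for x y z :: real
    using Ints_add[OF that] by simp
qed

instantiation torus :: ab_group_add
begin

lift_definition zero_torus :: torus is "0 :: real" .

lift_definition plus_torus :: "torus \<Rightarrow> torus \<Rightarrow> torus" is "(+)"
proof -
  fix a b c d :: real
  assume "a - b \<in> \<int>" "c - d \<in> \<int>"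
  then have "(a - b) + (c - d) \<in> \<int>" by (rule Ints_add)
  then show "a + c - (b + d) \<in> \<int>" by (simp add: algebra_simps)
qed

lift_definition uminus_torus :: "torus \<Rightarrow> torus" is uminus
proof -
  fix a b :: real
  assume "a - b \<in> \<int>"
  then have "- (a - b) \<in> \<int>" by (rule Ints_minus)
  then show "- a - - b \<in> \<int>" by simp
qed

lift_definition minus_torus :: "torus \<Rightarrow> torus \<Rightarrow> torus" is "(-)"
proof -
  fix a b c d :: real
  assume "a - b \<in> \<int>" "c - d \<in> \<int>"
  then have "(a - b) - (c - d) \<in> \<int>" by (rule Ints_diff)
  then show "a - c - (b - d) \<in> \<int>" by (simp add: algebra_simps)
qed

instance
  by standard (transfer; simp add: algebra_simps)+

end

text \<open>The quotient metric: the distance from \<open>x - y\<close> to the nearest integer.\<close>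

lemma dist_nearest_int_le:
  fixes x y :: real
  assumes "x - y \<in> \<int>"
  shows "\<bar>x - of_int (round x)\<bar> \<le> \<bar>y - of_int (round y)\<bar>"
proof -
  from assms obtain k where "x - y = of_int k" by (auto elim: Ints_cases)
  then have "y - of_int (round y) = x - of_int (round y + k)" by simp
  then show ?thesis using round_diff_minimal[of x "round y + k"] by simp
qed

instantiation torus :: metric_space
begin

lift_definition dist_torus :: "torus \<Rightarrow> torus \<Rightarrow> real"
  is "\<lambda>x y. \<bar>(x - y) - of_int (round (x - y))\<bar>"
proof -
  fix a b c d :: real
  assume "a - b \<in> \<int>" "c - d \<in> \<int>"
  then have "(a - b) - (c - d) \<in> \<int>" by (rule Ints_diff)
  then have 1: "(a - c) - (b - d) \<in> \<int>" by (simp add: algebra_simps)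
  from Ints_minus[OF this] have 2: "(b - d) - (a - c) \<in> \<int>" by simp
  show "\<bar>(a - c) - of_int (round (a - c))\<bar> = \<bar>(b - d) - of_int (round (b - d))\<bar>"
    using dist_nearest_int_le[OF 1] dist_nearest_int_le[OF 2] by simp
qed

definition uniformity_torus :: "(torus \<times> torus) filter" where
  "uniformity_torus = (INF e\<in>{0<..}. principal {(x, y). dist x y < e})"

definition open_torus :: "torus set \<Rightarrow> bool" where
  "open_torus U = (\<forall>x\<in>U. eventually (\<lambda>(x', y). x' = x \<longrightarrow> y \<in> U) uniformity)"

instance
proof
  show "dist x y = 0 \<longleftrightarrow> x = y" for x y :: torus
  proof transfer
    fix x y :: real
    show "\<bar>x - y - of_int (round (x - y))\<bar> = 0 \<longleftrightarrow> x - y \<in> \<int>"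
    proof
      assume "\<bar>x - y - of_int (round (x - y))\<bar> = 0"
      then have "x - y = of_int (round (x - y))" by simp
      then show "x - y \<in> \<int>" by (metis Ints_of_int)
    next
      assume "x - y \<in> \<int>"
      then show "\<bar>x - y - of_int (round (x - y))\<bar> = 0" by (auto elim!: Ints_cases)
    qed
  qed
  show "dist x y \<le> dist x z + dist y z" for x y z :: torus
  proof transfer
    fix x y z :: real
    have "\<bar>x - y - of_int (round (x - y))\<bar>
        \<le> \<bar>x - y - of_int (round (x - z) - round (y - z))\<bar>"
      by (rule round_diff_minimal)
    also have "\<dots> \<le> \<bar>x - z - of_int (round (x - z))\<bar> + \<bar>y - z - of_int (round (y - z))\<bar>"
      by simp
    finally show "\<bar>x - y - of_int (round (x - y))\<bar>
        \<le> \<bar>x - z - of_int (round (x - z))\<bar> + \<bar>y - z - of_int (round (y - z))\<bar>" .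
  qed
qed (fact uniformity_torus_def open_torus_def)+

end

definition torus_lebesgue :: "torus measure" where
  "torus_lebesgue = distr (restrict_space lborel {0..<1}) borel to_torus"

lift_definition cos_2pi :: "torus \<Rightarrow> real" is "\<lambda>q. cos (2 * pi * q)"
proof -
  fix x y :: real
  assume "x - y \<in> \<int>"
  then obtain k where "x = y + of_int k"
    by (metis Ints_cases add.commute diff_add_cancel)
  then have "2 * pi * x = 2 * pi * y + 2 * pi * of_int k" by (simp add: algebra_simps)
  then show "cos (2 * pi * x) = cos (2 * pi * y)"
    by (simp add: cos_add cos_int_2pin sin_int_2pin)
qed

definition torus_deriv :: "(torus \<Rightarrow> real) \<Rightarrow> torus \<Rightarrow> real" where
  "torus_deriv g q = deriv (\<lambda>h. g (q + to_torus h)) 0"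

definition torus_conv :: "(torus \<Rightarrow> real) \<Rightarrow> torus measure \<Rightarrow> torus \<Rightarrow> real"
    (infixl "\<star>" 75) where
  "(g \<star> \<nu>) q = (\<integral>q'. g (q - q') \<partial>\<nu>)"

section \<open>Phase space \<open>\<real>/\<int> \<times> \<real>\<close>\<close>

definition phase_lebesgue :: "(torus \<times> real) measure" where
  "phase_lebesgue = torus_lebesgue \<Otimes>\<^sub>M lborel"

definition phase_prob :: "(torus \<times> real) measure \<Rightarrow> bool" where
  "phase_prob \<mu> \<longleftrightarrow> prob_space \<mu> \<and> sets \<mu> = sets (borel \<Otimes>\<^sub>M borel)"

definition position_marginal :: "(torus \<times> real) measure \<Rightarrow> torus measure" where
  "position_marginal \<mu> = distr \<mu> borel fst"

definition d_q :: "(torus \<times> real \<Rightarrow> real) \<Rightarrow> torus \<times> real \<Rightarrow> real" where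
  "d_q \<phi> = (\<lambda>(q, p). torus_deriv (\<lambda>x. \<phi> (x, p)) q)"

definition d_p :: "(torus \<times> real \<Rightarrow> real) \<Rightarrow> torus \<times> real \<Rightarrow> real" where
  "d_p \<phi> = (\<lambda>(q, p). deriv (\<lambda>y. \<phi> (q, y)) p)"

text \<open>\<open>C\<^sup>\<infinity>\<close>: here \<open>D i j\<close> is the continuous mixed derivative of order \<open>i\<close> in \<open>q\<close> and \<open>j\<close> in \<open>p\<close>.\<close>

definition smooth_phase :: "(torus \<times> real \<Rightarrow> real) \<Rightarrow> bool" where
  "smooth_phase \<phi> \<longleftrightarrow> (\<exists>D :: nat \<Rightarrow> nat \<Rightarrow> torus \<times> real \<Rightarrow> real. D 0 0 = \<phi> \<and>
     (\<forall>i j. continuous_on UNIV (D i j) \<and>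
       (\<forall>q p. ((\<lambda>h. D i j (q + to_torus h, p)) has_real_derivative D (Suc i) j (q, p)) (at 0) \<and>
              ((\<lambda>y. D i j (q, y)) has_real_derivative D i (Suc j) (q, p)) (at p))))"

text \<open>\<open>C\<^sup>\<infinity>\<close> with compact support; the torus being compact, only \<open>p\<close> has to be bounded.\<close>

definition test_function :: "(torus \<times> real \<Rightarrow> real) \<Rightarrow> bool" where
  "test_function \<phi> \<longleftrightarrow> smooth_phase \<phi> \<and> (\<exists>R. \<forall>q p. \<bar>p\<bar> > R \<longrightarrow> \<phi> (q, p) = 0)"

section \<open>The McKean--Vlasov--Fokker--Planck equation\<close>

definition W :: "torus \<Rightarrow> real" where
  "W q = - cos_2pi q"

definition V :: "real \<Rightarrow> torus \<Rightarrow> real" where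
  "V \<eta> q = - \<eta> * cos_2pi q"

text \<open>
  The formal adjoint, acting on test functions, of the linear operator
  \<open>\<rho> \<mapsto> - p \<partial>\<^sub>q\<rho> + (V' + W' \<star> \<Pi>\<mu>) \<partial>\<^sub>p\<rho> + \<gamma> \<partial>\<^sub>p(p \<rho> + \<beta>\<^sup>-\<^sup>1 \<partial>\<^sub>p\<rho>)\<close>.
\<close>

definition vfp_generator ::
  "real \<Rightarrow> real \<Rightarrow> real \<Rightarrow> (torus \<times> real) measure
    \<Rightarrow> (torus \<times> real \<Rightarrow> real) \<Rightarrow> torus \<times> real \<Rightarrow> real" where
  "vfp_generator \<gamma> \<beta> \<eta> \<mu> \<phi> = (\<lambda>(q, p).
      p * d_q \<phi> (q, p)
    - (torus_deriv (V \<eta>) q + (torus_deriv W \<star> position_marginal \<mu>) q) * d_p \<phi> (q, p)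
    + \<gamma> * (- p * d_p \<phi> (q, p) + 1 / \<beta> * d_p (d_p \<phi>) (q, p)))"

text \<open>Probability-measure-valued solutions on \<open>[0, \<infinity>)\<close> in the sense of distributions.\<close>

definition vfp_solution ::
  "real \<Rightarrow> real \<Rightarrow> real \<Rightarrow> (real \<Rightarrow> (torus \<times> real) measure) \<Rightarrow> bool" where
  "vfp_solution \<gamma> \<beta> \<eta> \<mu> \<longleftrightarrow>
     (\<forall>t\<ge>0. phase_prob (\<mu> t)) \<and>
     (\<forall>\<phi>. test_function \<phi> \<longrightarrow> (\<forall>t\<ge>0.
        ((\<lambda>s. \<integral>x. \<phi> x \<partial>\<mu> s) has_real_derivative
           (\<integral>x. vfp_generator \<gamma> \<beta> \<eta> (\<mu> t) \<phi> x \<partial>\<mu> t)) (at t within {0..})))"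

definition steady_state :: "real \<Rightarrow> real \<Rightarrow> real \<Rightarrow> (torus \<times> real) measure \<Rightarrow> bool" where
  "steady_state \<gamma> \<beta> \<eta> \<mu> \<longleftrightarrow> vfp_solution \<gamma> \<beta> \<eta> (\<lambda>t. \<mu>)"

definition kappa :: "real \<Rightarrow> real \<Rightarrow> real" where
  "kappa \<beta> p = sqrt (\<beta> / (2 * pi)) * exp (- \<beta> * p\<^sup>2 / 2)"

definition Z :: "real \<Rightarrow> real" where
  "Z a = (\<integral>q. exp (a * cos_2pi q) \<partial>torus_lebesgue)"

definition gibbs :: "real \<Rightarrow> real \<Rightarrow> (torus \<times> real) measure" where
  "gibbs \<beta> a = density phase_lebesgue
     (\<lambda>(q, p). ennreal (1 / Z a * exp (a * cos_2pi q) * kappa \<beta> p))"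

section \<open>The free energy\<close>

text \<open>
  Measures without a density have energy \<open>\<infinity>\<close>. For probability densities the negative part of the
  integrand is always integrable, because \<open>\<rho> log \<rho> + \<beta> p\<^sup>2 \<rho> / 2 \<ge> - exp (- \<beta> p\<^sup>2 / 2 - 1)\<close> and \<open>V\<close>, \<open>W\<close>
  are bounded; so the difference below is never \<open>\<infinity> - \<infinity>\<close>. As \<open>ln 0 = 0\<close>, the integrand is \<open>0\<close>
  where \<open>\<rho> = 0\<close>.
\<close>

definition energy_integrand ::
  "real \<Rightarrow> real \<Rightarrow> (torus \<times> real) measure \<Rightarrow> torus \<times> real \<Rightarrow> real" where
  "energy_integrand \<beta> \<eta> \<mu> = (\<lambda>(q, p).
     let \<rho> = enn2real (RN_deriv phase_lebesgue \<mu> (q, p))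
     in (1 / \<beta> * ln \<rho> + p\<^sup>2 / 2 + V \<eta> q + 1 / 2 * (W \<star> position_marginal \<mu>) q) * \<rho>)"

definition free_energy :: "real \<Rightarrow> real \<Rightarrow> (torus \<times> real) measure \<Rightarrow> ereal" where
  "free_energy \<beta> \<eta> \<mu> =
     (if absolutely_continuous phase_lebesgue \<mu>
      then enn2ereal (\<integral>\<^sup>+x. ennreal (energy_integrand \<beta> \<eta> \<mu> x) \<partial>phase_lebesgue)
         - enn2ereal (\<integral>\<^sup>+x. ennreal (- energy_integrand \<beta> \<eta> \<mu> x) \<partial>phase_lebesgue)
      else \<infinity>)"

definition global_minimizer :: "real \<Rightarrow> real \<Rightarrow> (torus \<times> real) measure \<Rightarrow> bool" where
  "global_minimizer \<beta> \<eta> \<mu> \<longleftrightarrow>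
     phase_prob \<mu> \<and> (\<forall>\<rho>. phase_prob \<rho> \<longrightarrow> free_energy \<beta> \<eta> \<mu> \<le> free_energy \<beta> \<eta> \<rho>)"

text \<open>
  Critical points are taken in the sense of the linear functional derivative: the first variation
  vanishes along every segment towards a probability measure of finite energy.
\<close>

definition mixture ::
  "real \<Rightarrow> (torus \<times> real) measure \<Rightarrow> (torus \<times> real) measure \<Rightarrow> (torus \<times> real) measure" where
  "mixture t \<mu> \<rho> = measure_of (space \<mu>) (sets \<mu>)
     (\<lambda>A. ennreal (1 - t) * emeasure \<mu> A + ennreal t * emeasure \<rho> A)"

definition critical_point :: "real \<Rightarrow> real \<Rightarrow> (torus \<times> real) measure \<Rightarrow> bool" where
  "critical_point \<beta> \<eta> \<mu> \<longleftrightarrow>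
     phase_prob \<mu> \<and> \<bar>free_energy \<beta> \<eta> \<mu>\<bar> \<noteq> \<infinity> \<and>
     (\<forall>\<rho>. phase_prob \<rho> \<and> \<bar>free_energy \<beta> \<eta> \<rho>\<bar> \<noteq> \<infinity> \<longrightarrow>
        ((\<lambda>t. (real_of_ereal (free_energy \<beta> \<eta> (mixture t \<mu> \<rho>))
                - real_of_ereal (free_energy \<beta> \<eta> \<mu>)) / t) \<longlongrightarrow> 0) (at_right 0))"

text \<open>
  Local minimality refers to the \<open>L\<^sup>2\<close> Wasserstein distance, of which \<open>wasserstein2_sq\<close> is the square.
  Since it is finer than narrow convergence, failing to be a local minimizer for it implies failing
  to be one for the narrow topology.
\<close>

definition couplings ::
  "(torus \<times> real) measure \<Rightarrow> (torus \<times> real) measure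
    \<Rightarrow> ((torus \<times> real) \<times> (torus \<times> real)) measure set" where
  "couplings \<mu> \<rho> = {\<pi>. sets \<pi> = sets (\<mu> \<Otimes>\<^sub>M \<rho>) \<and> distr \<pi> \<mu> fst = \<mu> \<and> distr \<pi> \<rho> snd = \<rho>}"

definition wasserstein2_sq ::
  "(torus \<times> real) measure \<Rightarrow> (torus \<times> real) measure \<Rightarrow> ennreal" where
  "wasserstein2_sq \<mu> \<rho> = (INF \<pi>\<in>couplings \<mu> \<rho>. \<integral>\<^sup>+z. ennreal ((dist (fst z) (snd z))\<^sup>2) \<partial>\<pi>)"

definition local_minimizer :: "real \<Rightarrow> real \<Rightarrow> (torus \<times> real) measure \<Rightarrow> bool" where
  "local_minimizer \<beta> \<eta> \<mu> \<longleftrightarrow>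
     phase_prob \<mu> \<and>
     (\<exists>\<epsilon>>0. \<forall>\<rho>. phase_prob \<rho> \<and> wasserstein2_sq \<mu> \<rho> < ennreal (\<epsilon>\<^sup>2)
        \<longrightarrow> free_energy \<beta> \<eta> \<mu> \<le> free_energy \<beta> \<eta> \<rho>)"

end

theory Submission
  imports Defs
begin

text \<open>
  Uniqueness for the stationary equation with a frozen drift \<open>D = U'\<close> follows from an entropy argument
  that needs no hypoelliptic regularity. Mollify the steady state by a von Mises kernel in \<open>q\<close> and by a
  kernel \<open>\<zeta>\<close> with \<open>\<bar>\<zeta>'\<bar> \<le> C \<zeta>\<close> in \<open>p\<close>, and test the equation for the mollified density \<open>u\<close> with
  \<open>\<Lambda> = ln u + \<beta> (p\<^sup>2 / 2 + U)\<close>. Transport and the Gibbs weight cancel up to commutators, which vanish with the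
  mollification, so \<open>\<integral> u (\<partial>\<^sub>p \<Lambda>)\<^sup>2\<close> tends to \<open>0\<close>. Hence the steady state is the product of its position
  marginal and the Maxwellian, and the equation tested with \<open>A(q) p\<close> identifies the marginal as the Gibbs
  measure of its own field. As \<open>\<eta> > 0\<close>, the field has no sine component, and self-consistency becomes
  the scalar equation \<open>a = \<beta> (\<eta> + R a)\<close> with \<open>R = Z' / Z\<close>. The concavity of \<open>R\<close> on \<open>(0, \<infinity>)\<close> determines
  the number of its roots.

  Relative to the Gibbs measure \<open>w\<close> of any field, the free energy of \<open>\<rho>\<close> is \<open>KL(\<rho> | w) / \<beta>\<close> plus a quadratic
  polynomial in the order parameter of \<open>\<rho>\<close>. With the field generated by \<open>\<rho>\<close> itself this yields the global
  minimizer; with the field of a root, the quadratic part has no linear term at that root, which yields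
  criticality. For \<open>a < 0\<close> a small rotation of the torus strictly decreases the energy.
\<close>

section \<open>The torus\<close>

text \<open>A steady state is only a measure and the noise acts on \<open>p\<close> alone, so at the
  start there is neither a density nor an integrable logarithm. The mollifiers supply both: their
  logarithmic derivatives are bounded, hence so are those of the mollified density \<open>u\<close>.
  The dissipation, however, controls a derivative in \<open>p\<close> only and by itself says
  nothing about positions; these enter through the transport term once the velocities are known to
  be Gaussian. The entropy bound is therefore consumed by a Stein identity: the integral of A(q)
  (B'(p) - \<beta> p B(p)) vanishes for bounded B, and B = sin(s p), cos(s p) turns this into a
  differential equation in s for the characteristic function of the velocity.

  On the scalar side, a negative root a = - b is a point b > 0 where the concave graph of
  \<open>R\<close> meets the line \<eta> + b / \<beta>. The graph stays below 1 and tends to 1, so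
  \<eta> < 1 is what allows the line to meet it for large \<beta>; the critical value is the case of
  tangency. Positive roots use the line b / \<beta> - \<eta>, which starts below the graph and
  crosses it once.\<close>

lift_definition sin_2pi :: "torus \<Rightarrow> real" is "\<lambda>q. sin (2 * pi * q)"
proof -
  fix x y :: real
  assume "x - y \<in> \<int>"
  then obtain k where "x = y + of_int k"
    by (metis Ints_cases add.commute diff_add_cancel)
  then have "2 * pi * x = 2 * pi * y + 2 * pi * of_int k" by (simp add: algebra_simps)
  then show "sin (2 * pi * x) = sin (2 * pi * y)"
    by (simp add: sin_add cos_int_2pin sin_int_2pin)
qed

lemma cos_2pi_to_torus [simp]: "cos_2pi (to_torus x) = cos (2 * pi * x)"
  and sin_2pi_to_torus [simp]: "sin_2pi (to_torus x) = sin (2 * pi * x)"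
  by (transfer; simp)+

lemma to_torus_add: "to_torus (x + y) = to_torus x + to_torus y"
  and to_torus_0 [simp]: "to_torus 0 = 0"
  by (transfer; simp)+

lemma to_torus_1 [simp]: "to_torus 1 = 0"
  by transfer simp

lemma dist_to_torus: "dist (to_torus x) (to_torus y) = \<bar>(x - y) - of_int (round (x - y))\<bar>"
  by transfer simp

lemma torus_cases_unit:
  obtains t where "0 \<le> t" "t < 1" "q = to_torus t"
proof -
  obtain x where x: "q = to_torus x"
    by (metis Quotient_abs_rep Quotient_torus)
  have "to_torus x = to_torus (frac x)"
    by transfer (simp add: frac_def)
  with x that[of "frac x"] show ?thesis by (simp add: frac_lt_1)
qed

lemma cos_2pi_diff: "cos_2pi (q - x) = cos_2pi q * cos_2pi x + sin_2pi q * sin_2pi x"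
  by transfer (simp add: right_diff_distrib cos_diff)

lemma sin_2pi_diff: "sin_2pi (q - x) = sin_2pi q * cos_2pi x - cos_2pi q * sin_2pi x"
  by transfer (simp add: right_diff_distrib sin_diff)

lemma cos_2pi_add: "cos_2pi (q + x) = cos_2pi q * cos_2pi x - sin_2pi q * sin_2pi x"
  by transfer (simp add: distrib_left cos_add)

lemma sin_2pi_add: "sin_2pi (q + x) = sin_2pi q * cos_2pi x + cos_2pi q * sin_2pi x"
  by transfer (simp add: distrib_left sin_add)

lemma sin_cos_2pi_squared: "(sin_2pi q)\<^sup>2 + (cos_2pi q)\<^sup>2 = 1"
  by transfer simp

lemma cos_2pi_0 [simp]: "cos_2pi 0 = 1" and sin_2pi_0 [simp]: "sin_2pi 0 = 0"
  by (transfer; simp)+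

lemma abs_cos_2pi_le [simp]: "\<bar>cos_2pi q\<bar> \<le> 1" and abs_sin_2pi_le [simp]: "\<bar>sin_2pi q\<bar> \<le> 1"
  by (transfer; simp)+

lemma cos_2pi_le [simp]: "cos_2pi q \<le> 1" and cos_2pi_ge [simp]: "- 1 \<le> cos_2pi q"
  by (transfer; simp)+

lemma sin_2pi_le [simp]: "sin_2pi q \<le> 1" and sin_2pi_ge [simp]: "- 1 \<le> sin_2pi q"
  by (transfer; simp)+

lemma dist_torus_le: "dist (to_torus x) (to_torus y) \<le> \<bar>x - y\<bar>"
  using round_diff_minimal[of "x - y" 0] by (simp add: dist_to_torus)

lemma continuous_on_to_torus: "continuous_on S to_torus"
  unfolding continuous_on_iff
  by (metis dist_real_def dist_torus_le order_le_less_trans)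

lemma compact_torus: "compact (UNIV :: torus set)"
proof -
  have "to_torus ` {0..1} = UNIV"
  proof safe
    fix q show "q \<in> to_torus ` {0..1}"
      using torus_cases_unit[of q] by (metis atLeastAtMost_iff imageI less_imp_le)
  qed auto
  then show ?thesis
    by (metis compact_Icc compact_continuous_image continuous_on_to_torus)
qed

lemma cos_2pi_continuous [continuous_intros]:
  assumes "continuous_on S f" shows "continuous_on S (\<lambda>x. cos_2pi (f x))"
proof -
  have *: "\<bar>cos_2pi q - cos_2pi x\<bar> \<le> 2 * pi * dist q x" for q x
  proof transfer
    fix q x :: real
    \<comment> \<open>The representative of \<open>x\<close> closest to \<open>q\<close>: the cosine
      does not see the change, and \<open>\<bar>q - y\<bar>\<close> is the quotient
      distance.\<close>
    define y where "y = x + of_int (round (q - x))"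
    have "cos (2 * pi * y) = cos (2 * pi * x + 2 * pi * of_int (round (q - x)))"
      by (simp add: y_def algebra_simps)
    also have "\<dots> = cos (2 * pi * x)"
      by (simp add: cos_add cos_int_2pin sin_int_2pin)
    finally have 1: "cos (2 * pi * y) = cos (2 * pi * x)" .
    have "\<bar>cos (2 * pi * q) - cos (2 * pi * y)\<bar>
        = 2 * \<bar>sin ((2 * pi * q + 2 * pi * y) / 2)\<bar> * \<bar>sin ((2 * pi * y - 2 * pi * q) / 2)\<bar>"
      by (subst cos_diff_cos) (simp add: abs_mult)
    also have "\<dots> \<le> 2 * 1 * \<bar>(2 * pi * y - 2 * pi * q) / 2\<bar>"
      by (intro mult_mono abs_sin_x_le_abs_x) auto
    also have "(2 * pi * y - 2 * pi * q) / 2 = - (pi * (q - y))" by (simp add: field_simps)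
    also have "2 * 1 * \<bar>- (pi * (q - y))\<bar> = 2 * \<bar>pi * (q - y)\<bar>" by simp
    also have "\<dots> = 2 * pi * \<bar>q - y\<bar>" by (simp add: abs_mult)
    finally show "\<bar>cos (2 * pi * q) - cos (2 * pi * x)\<bar> \<le> 2 * pi * \<bar>q - x - of_int (round (q - x))\<bar>"
      by (simp add: 1) (simp add: y_def algebra_simps)
  qed
  have "continuous_on UNIV cos_2pi"
    unfolding continuous_on_iff
  proof safe
    fix x :: torus and e :: real assume e: "e > 0"
    show "\<exists>d>0. \<forall>x'\<in>UNIV. dist x' x < d \<longrightarrow> dist (cos_2pi x') (cos_2pi x) < e"
    proof (intro exI conjI ballI impI)
      show "e / (2 * pi) > 0" using e by simp
      fix x' assume "dist x' x < e / (2 * pi)"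
      then have "2 * pi * dist x' x < e" by (simp add: field_simps)
      with *[of x' x] show "dist (cos_2pi x') (cos_2pi x) < e" by (simp add: dist_real_def)
    qed
  qed
  then show ?thesis using continuous_on_compose2[OF _ assms] by blast
qed

lemma sin_2pi_eq_cos_2pi: "sin_2pi q = cos_2pi (q - to_torus (1/4))"
  by (simp add: cos_2pi_diff)

lemma torus_add_continuous: "continuous_on S (\<lambda>q. q + a :: torus)"
proof -
  have "dist (x + a) (y + a) = dist x y" for x y :: torus
    by transfer simp
  then show ?thesis unfolding continuous_on_iff by metis
qed

lemma sin_2pi_continuous [continuous_intros]:
  assumes "continuous_on S f" shows "continuous_on S (\<lambda>x. sin_2pi (f x))"
  unfolding sin_2pi_eq_cos_2pi
  using continuous_on_compose2[OF torus_add_continuous[of UNIV "- to_torus (1/4)"] assms]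
  by (intro cos_2pi_continuous) auto

lemma measurable_to_torus [measurable]: "to_torus \<in> borel_measurable borel"
  and measurable_cos_2pi [measurable]: "cos_2pi \<in> borel_measurable borel"
  and measurable_sin_2pi [measurable]: "sin_2pi \<in> borel_measurable borel"
  and measurable_torus_add [measurable]: "(\<lambda>q. q + a :: torus) \<in> borel_measurable borel"
  by (intro borel_measurable_continuous_onI continuous_intros continuous_on_to_torus torus_add_continuous)+

lemma torus_eqI:
  assumes "cos_2pi x = cos_2pi y" "sin_2pi x = sin_2pi y" shows "x = y"
  using assms
proof transfer
  fix x y :: real
  assume "cos (2 * pi * x) = cos (2 * pi * y)" "sin (2 * pi * x) = sin (2 * pi * y)"
  then obtain k where "2 * pi * x = 2 * pi * y + 2 * pi * of_int k"
    using sin_cos_eq_iff[of "2 * pi * x" "2 * pi * y"] by blast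
  then have "2 * pi * (x - y) = 2 * pi * of_int k" by (simp add: algebra_simps)
  moreover have "2 * pi \<noteq> 0" by simp
  ultimately have "x - y = of_int k" using mult_left_cancel by blast
  then show "x - y \<in> \<int>" by (metis Ints_of_int)
qed

text \<open>Squared increments of Lipschitz functions are thereby bounded by multiples of
  \<open>1 - cos_2pi (q - x)\<close>, whose average under the von Mises kernel is exactly
  \<open>1 - R a\<close>. The proof reduces to \<open>s \<le> sin (pi * s)\<close> on
  [0, 1/2].\<close>

lemma dist_torus_le_chord: "(dist q x)\<^sup>2 \<le> 1 - cos_2pi (q - x)"
proof transfer
  fix q x :: real
  define t where "t = q - x - of_int (round (q - x))"
  have t: "\<bar>t\<bar> \<le> 1/2"
    using of_int_round_abs_le[of "q - x"] by (simp add: t_def abs_minus_commute)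
  have "cos (2 * pi * (q - x)) = cos (2 * pi * t + 2 * pi * of_int (round (q - x)))"
    by (simp add: t_def algebra_simps)
  also have "\<dots> = cos (2 * pi * t)"
    by (simp add: cos_add cos_int_2pin sin_int_2pin)
  finally have 1: "cos (2 * pi * (q - x)) = cos (2 * pi * t)" .
  have 2: "1 - cos (2 * pi * t) = 2 * (sin (pi * t))\<^sup>2"
    using cos_double_sin[of "pi * t"] by (simp add: mult.assoc mult.left_commute)
  \<comment> \<open>Up to 1/6 the cubic Taylor bound loses at most a sixth of \<open>pi * s\<close>,
    and \<open>pi > 3\<close> leaves ample room; beyond 1/6 the sine is at least 1/2 by
    monotonicity.\<close>
  have 3: "s \<le> sin (pi * s)" if "0 \<le> s" "s \<le> 1/2" for s :: real
  proof (cases "s \<le> 1/6")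
    case True
    define x where "x = pi * s"
    have x: "0 \<le> x" "x \<le> 1" using that True pi_less_4 mult_mono[of pi 4 s "1/6"] by (auto simp: x_def)
    have xx: "x \<ge> 3 * s" using pi_gt3 that by (simp add: x_def mult_right_mono)
    have "sin x \<ge> x - x^3 / 6"
    proof -
      have "\<exists>t. sin x = (\<Sum>m<3. sin_coeff m * x ^ m) + sin (t + 1/2 * real 3 * pi) / fact 3 * x ^ 3"
        by (rule Maclaurin_sin_expansion)
      then obtain t where t: "sin x = (\<Sum>m<3. sin_coeff m * x ^ m) + sin (t + 1/2 * real 3 * pi) / fact 3 * x ^ 3" ..
      have "(\<Sum>m<3. sin_coeff m * x ^ m) = x"
        by (simp add: eval_nat_numeral sin_coeff_def)
      moreover have "sin (t + 1/2 * real 3 * pi) / fact 3 * x ^ 3 \<ge> (-1) / 6 * x^3"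
      proof (rule mult_right_mono)
        have "- 1 \<le> sin (t + 1 / 2 * real 3 * pi)" by (rule sin_ge_minus_one)
        moreover have "fact 3 = (6 :: real)" by (simp add: eval_nat_numeral)
        ultimately show "- 1 / 6 \<le> sin (t + 1 / 2 * real 3 * pi) / fact 3"
          by (metis divide_right_mono zero_le_numeral)
      qed (use x in simp)
      ultimately show ?thesis using t by simp
    qed
    moreover have "x^3 \<le> x" using x power_decreasing[of 1 3 x] by simp
    ultimately show ?thesis using xx that x by (simp add: x_def)
  next
    case False
    have "sin (pi * s) \<ge> sin (pi / 6)"
      by (rule sin_monotone_2pi_le) (use that False in auto)
    then show ?thesis using that by (simp add: sin_30)
  qed
  have "\<bar>t\<bar> \<le> \<bar>sin (pi * t)\<bar>"
    using 3[of t] 3[of "-t"] t by (cases "t \<ge> 0") auto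
  then have "t\<^sup>2 \<le> (sin (pi * t))\<^sup>2" by (metis abs_le_square_iff)
  moreover have "0 \<le> (sin (pi * t))\<^sup>2" by simp
  ultimately have "t\<^sup>2 \<le> 1 - cos (2 * pi * t)" using 2 by linarith
  then show "\<bar>q - x - of_int (round (q - x))\<bar>\<^sup>2 \<le> 1 - cos (2 * pi * (q - x))"
    by (simp add: 1) (simp add: t_def)
qed

section \<open>Lebesgue measure on the torus and its translation invariance\<close>

lemma space_torus_lebesgue [simp]: "space torus_lebesgue = UNIV"
  and sets_torus_lebesgue [simp, measurable_cong]: "sets torus_lebesgue = sets borel"
  by (simp_all add: torus_lebesgue_def)

lemma measurable_to_torus_unit [measurable]:
  "to_torus \<in> measurable (restrict_space lborel {0..<1}) borel"
  by (rule measurable_restrict_space1) simp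

interpretation torus: prob_space torus_lebesgue
  unfolding torus_lebesgue_def
  by (rule prob_space.prob_space_distr) (auto intro!: prob_spaceI simp: emeasure_restrict_space)

lemma nn_integral_torus:
  assumes [measurable]: "f \<in> borel_measurable borel"
  shows "(\<integral>\<^sup>+q. f q \<partial>torus_lebesgue) = (\<integral>\<^sup>+x. f (to_torus x) * indicator {0..<1} x \<partial>lborel)"
  unfolding torus_lebesgue_def
  by (subst nn_integral_distr) (auto simp: nn_integral_restrict_space)

lemma integral_torus:
  fixes f :: "torus \<Rightarrow> real"
  assumes [measurable]: "f \<in> borel_measurable borel"
  shows "(\<integral>q. f q \<partial>torus_lebesgue) = (\<integral>x. indicator {0..<1} x * f (to_torus x) \<partial>lborel)"
  unfolding torus_lebesgue_def
  by (subst integral_distr) (auto simp: integral_restrict_space)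

lemma integrable_torus_iff:
  fixes f :: "torus \<Rightarrow> real"
  assumes [measurable]: "f \<in> borel_measurable borel"
  shows "integrable torus_lebesgue f \<longleftrightarrow> integrable lborel (\<lambda>x. indicator {0..<1} x * f (to_torus x))"
  unfolding torus_lebesgue_def
  by (subst integrable_distr_eq) (auto simp: integrable_restrict_space)

text \<open>The measure lives on the single fundamental interval [0, 1). After translation by
  \<open>h\<close> the piece sticking out into [1, 1 + h) is moved back to [0, h) by
  periodicity.\<close>

lemma nn_integral_torus_shift:
  assumes [measurable]: "f \<in> borel_measurable borel"
  shows "(\<integral>\<^sup>+q. f (q + a) \<partial>torus_lebesgue) = (\<integral>\<^sup>+q. f q \<partial>torus_lebesgue)"
proof -
  obtain h where h: "0 \<le> h" "h < 1" "a = to_torus h" by (rule torus_cases_unit)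
  define F where "F x = f (to_torus x)" for x
  have [measurable]: "F \<in> borel_measurable borel" unfolding F_def by measurable
  have per: "F (1 + x) = F x" for x by (simp add: F_def to_torus_add)
  have "(\<integral>\<^sup>+q. f (q + a) \<partial>torus_lebesgue) = (\<integral>\<^sup>+x. F (h + 1 * x) * indicator {h..<1+h} (h + 1 * x) \<partial>lborel)"
    by (subst nn_integral_torus)
       (auto simp: F_def to_torus_add h add.commute indicator_def intro!: nn_integral_cong)
  also have "\<dots> = (\<integral>\<^sup>+x. F x * indicator {h..<1+h} x \<partial>lborel)"
    by (subst nn_integral_real_affine[where c=1 and t=h, of "\<lambda>x. F x * indicator {h..<1+h} x"]) auto
  also have "\<dots> = (\<integral>\<^sup>+x. F x * indicator {h..<1} x + F x * indicator {1..<1+h} x \<partial>lborel)"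
    using h by (intro nn_integral_cong) (auto simp: indicator_def)
  also have "\<dots> = (\<integral>\<^sup>+x. F x * indicator {h..<1} x \<partial>lborel) + (\<integral>\<^sup>+x. F x * indicator {1..<1+h} x \<partial>lborel)"
    by (rule nn_integral_add) auto
  also have "(\<integral>\<^sup>+x. F x * indicator {1..<1+h} x \<partial>lborel)
       = (\<integral>\<^sup>+x. F (1 + 1 * x) * indicator {1..<1+h} (1 + 1 * x) \<partial>lborel)"
    by (subst nn_integral_real_affine[where c=1 and t=1, of "\<lambda>x. F x * indicator {1..<1+h} x"]) auto
  also have "\<dots> = (\<integral>\<^sup>+x. F x * indicator {0..<h} x \<partial>lborel)"
    by (intro nn_integral_cong) (auto simp: indicator_def per)
  also have "(\<integral>\<^sup>+x. F x * indicator {h..<1} x \<partial>lborel) + \<dots>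
     = (\<integral>\<^sup>+x. F x * indicator {h..<1} x + F x * indicator {0..<h} x \<partial>lborel)"
    by (rule nn_integral_add[symmetric]) auto
  also have "\<dots> = (\<integral>\<^sup>+x. F x * indicator {0..<1} x \<partial>lborel)"
    using h by (intro nn_integral_cong) (auto simp: indicator_def)
  finally show ?thesis by (simp add: nn_integral_torus F_def)
qed

lemma distr_torus_shift: "distr torus_lebesgue borel (\<lambda>q. q + a) = torus_lebesgue"
proof (rule measure_eqI)
  fix A assume "A \<in> sets (distr torus_lebesgue borel (\<lambda>q. q + a))"
  then have [measurable]: "A \<in> sets borel" by simp
  have "emeasure (distr torus_lebesgue borel (\<lambda>q. q + a)) A
       = (\<integral>\<^sup>+q. indicator A q \<partial>distr torus_lebesgue borel (\<lambda>q. q + a))"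
    by (subst nn_integral_indicator) simp_all
  also have "\<dots> = (\<integral>\<^sup>+q. indicator A (q + a) \<partial>torus_lebesgue)"
    by (subst nn_integral_distr) simp_all
  also have "\<dots> = (\<integral>\<^sup>+q. indicator A q \<partial>torus_lebesgue)"
    by (rule nn_integral_torus_shift) simp
  finally show "emeasure (distr torus_lebesgue borel (\<lambda>q. q + a)) A = emeasure torus_lebesgue A"
    by simp
qed simp

lemma integral_torus_shift:
  fixes f :: "torus \<Rightarrow> real"
  assumes [measurable]: "f \<in> borel_measurable borel"
  shows "(\<integral>q. f (q + a) \<partial>torus_lebesgue) = (\<integral>q. f q \<partial>torus_lebesgue)"
  by (subst (2) distr_torus_shift[of a, symmetric]) (simp add: integral_distr)

section \<open>Derivatives on the torus, integrals of derivatives, differentiation under the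
  integral\<close>

definition has_tderiv :: "(torus \<Rightarrow> real) \<Rightarrow> real \<Rightarrow> torus \<Rightarrow> bool" where
  "has_tderiv f f' q \<longleftrightarrow> ((\<lambda>h. f (q + to_torus h)) has_real_derivative f') (at 0)"

lemma has_tderiv_lift:
  "has_tderiv f f' (to_torus x) \<Longrightarrow> ((\<lambda>t. f (to_torus t)) has_real_derivative f') (at x)"
  unfolding has_tderiv_def to_torus_add[symmetric]
  using DERIV_shift[of "\<lambda>t. f (to_torus t)" f' 0 x] by (simp add: add.commute)

lemma continuous_imp_bounded_torus:
  fixes f :: "torus \<Rightarrow> real"
  assumes "continuous_on UNIV f" obtains C where "\<And>q. \<bar>f q\<bar> \<le> C"
proof -
  have "bounded (f ` UNIV)" by (intro compact_imp_bounded compact_continuous_image assms compact_torus)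
  then show ?thesis using that by (auto simp: bounded_iff)
qed

lemma integrable_bounded:
  fixes f :: "'a \<Rightarrow> real"
  assumes "finite_measure M" "f \<in> borel_measurable M" "\<And>x. \<bar>f x\<bar> \<le> C"
  shows "integrable M f"
  using assms by (intro finite_measure.integrable_const_bound[of M _ C]) auto

lemma has_integral_indicator:
  fixes f :: "real \<Rightarrow> real"
  shows "((\<lambda>x. indicator S x * f x) has_integral I) UNIV \<longleftrightarrow> (f has_integral I) S"
proof -
  have "(\<lambda>x. indicator S x * f x) = (\<lambda>x. if x \<in> S then f x else 0)"
    by (auto simp: indicator_def)
  then show ?thesis by (simp only: has_integral_restrict_UNIV)
qed

lemma measure_torus_UNIV [simp]: "measure torus_lebesgue UNIV = 1"
  using torus.prob_space by simp

text \<open>Over a full period the boundary terms of the fundamental theorem cancel, because 0 and 1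
  are the same point of the torus.\<close>

lemma integral_tderiv_zero:
  assumes d: "\<And>q. has_tderiv f (f' q) q" and i: "integrable torus_lebesgue f'"
  shows "(\<integral>q. f' q \<partial>torus_lebesgue) = 0"
proof -
  have m [measurable]: "f' \<in> borel_measurable borel" using i by auto
  have "((\<lambda>x. f' (to_torus x)) has_integral (f (to_torus 1) - f (to_torus 0))) {0..1}"
    by (rule fundamental_theorem_of_calculus)
       (auto intro!: has_tderiv_lift[OF d] has_field_derivative_at_within
             simp: has_real_derivative_iff_has_vector_derivative[symmetric])
  then have 1: "((\<lambda>x. indicator {0..1} x * f' (to_torus x)) has_integral 0) UNIV"
    by (simp only: has_integral_indicator to_torus_0 to_torus_1 diff_self)
  have "integrable lborel (\<lambda>x. indicator {0..<1} x * f' (to_torus x))"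
    using i by (simp add: integrable_torus_iff)
  then have "((\<lambda>x. indicator {0..<1} x * f' (to_torus x)) has_integral
     (\<integral>x. indicator {0..<1} x * f' (to_torus x) \<partial>lborel)) UNIV"
    by (rule has_integral_integral_lborel)
  \<comment> \<open>The measure is carried by [0, 1), the fundamental theorem speaks of [0, 1]; the
    extra endpoint is a null set.\<close>
  then have "((\<lambda>x. indicator {0..1} x * f' (to_torus x)) has_integral
     (\<integral>x. indicator {0..<1} x * f' (to_torus x) \<partial>lborel)) UNIV"
    by (rule has_integral_spike[of "{1}", rotated 2]) (auto simp: indicator_def)
  with 1 have "(\<integral>x. indicator {0..<1} x * f' (to_torus x) \<partial>lborel) = 0"
    using has_integral_unique by blast
  then show ?thesis by (simp add: integral_torus)
qed

lemma emeasure_lborel_atLeast_infinity: "emeasure lborel {T :: real..} = \<infinity>"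
proof (rule ccontr)
  assume "emeasure lborel {T..} \<noteq> \<infinity>"
  then obtain r where r: "0 \<le> r" "emeasure lborel {T..} = ennreal r"
    by (cases "emeasure lborel {T..}") auto
  have "emeasure lborel {T..T + (r + 1)} \<le> emeasure lborel {T..}"
    by (rule emeasure_mono) auto
  then have "ennreal (r + 1) \<le> ennreal r" using r by simp
  then show False using r by (simp del: ennreal_plus)
qed

text \<open>Integrability replaces decay at infinity. The integrals over [- t, t] converge to the
  full integral I; if I were nonzero, \<open>\<bar>f t - f (- t)\<bar>\<close> would stay above
  \<open>\<bar>I\<bar> / 2\<close> for all large t, against the integrability of
  \<open>f\<close>.\<close>

lemma integral_deriv_zero:
  fixes f f' :: "real \<Rightarrow> real"
  assumes d: "\<And>x. (f has_real_derivative f' x) (at x)"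
    and i: "integrable lborel f" "integrable lborel f'"
  shows "(\<integral>x. f' x \<partial>lborel) = 0"
proof (rule ccontr)
  define I where "I = (\<integral>x. f' x \<partial>lborel)"
  assume "(\<integral>x. f' x \<partial>lborel) \<noteq> 0"
  then have I: "I \<noteq> 0" by (simp add: I_def)
  have [measurable]: "f' \<in> borel_measurable borel" using i by auto
  have eq: "(\<integral>x. indicator {- t..t} x * f' x \<partial>lborel) = f t - f (- t)" if t: "t \<ge> 0" for t
  proof -
    have "(f' has_integral (f t - f (- t))) {- t..t}"
      by (rule fundamental_theorem_of_calculus)
         (use t in \<open>auto intro!: has_field_derivative_at_within d
             simp: has_real_derivative_iff_has_vector_derivative[symmetric]\<close>)
    then have 1: "((\<lambda>x. indicator {-t..t} x * f' x) has_integral (f t - f (- t))) UNIV"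
      by (simp only: has_integral_indicator)
    have "integrable lborel (\<lambda>x. indicator {-t..t} x * f' x)"
      by (rule Bochner_Integration.integrable_bound[OF i(2)]) (auto simp: indicator_def)
    then have "((\<lambda>x. indicator {-t..t} x * f' x) has_integral
       (\<integral>x. indicator {-t..t} x * f' x \<partial>lborel)) UNIV"
      by (rule has_integral_integral_lborel)
    with 1 show ?thesis using has_integral_unique by blast
  qed
  have "((\<lambda>t. (\<integral>x. indicator {- t..t} x * f' x \<partial>lborel)) \<longlongrightarrow> I) at_top"
    unfolding I_def
  proof (rule integral_dominated_convergence_at_top[where w="\<lambda>x. \<bar>f' x\<bar>"])
    show "AE x in lborel. ((\<lambda>t. indicator {- t..t} x * f' x) \<longlongrightarrow> f' x) at_top"
    proof (rule AE_I2, rule tendsto_eventually)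
      fix x :: real
      show "\<forall>\<^sub>F t in at_top. indicator {- t..t} x * f' x = f' x"
        using eventually_ge_at_top[of "\<bar>x\<bar>"] by eventually_elim (auto simp: indicator_def)
    qed
    show "\<forall>\<^sub>F i in at_top. AE x in lborel. norm (indicator {- i..i} x * f' x) \<le> \<bar>f' x\<bar>"
      by (auto simp: indicator_def)
  qed (use i in auto)
  then have "((\<lambda>t. f t - f (- t)) \<longlongrightarrow> I) at_top"
    by (rule Lim_transform_eventually)
       (use eventually_ge_at_top[of 0] in eventually_elim, simp add: eq)
  then have "\<forall>\<^sub>F t in at_top. dist (f t - f (- t)) I < \<bar>I\<bar> / 2"
    using I by (intro tendstoD) auto
  then obtain T where T: "\<And>t. t \<ge> T \<Longrightarrow> dist (f t - f (- t)) I < \<bar>I\<bar> / 2"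
    by (auto simp: eventually_at_top_linorder)
  have T2: "\<bar>I\<bar> / 2 \<le> \<bar>f t - f (- t)\<bar>" if "t \<ge> T" for t
    using T[OF that] by (simp add: dist_real_def abs_if split: if_splits)
  have "integrable lborel (\<lambda>t. f (0 + (-1) * t))"
    by (subst lborel_integrable_real_affine_iff) (use i in auto)
  then have ii: "integrable lborel (\<lambda>t. f t - f (- t))" using i by auto
  have "\<infinity> = (\<integral>\<^sup>+t. ennreal (\<bar>I\<bar> / 2) * indicator {T..} t \<partial>lborel)"
    using I emeasure_lborel_atLeast_infinity[of T] by (subst nn_integral_cmult_indicator) (auto simp: ennreal_mult_top)
  also have "\<dots> \<le> (\<integral>\<^sup>+t. ennreal \<bar>f t - f (- t)\<bar> \<partial>lborel)"
    using T2 by (intro nn_integral_mono) (simp add: indicator_def ennreal_leI del: ennreal_le_iff)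
  also have "\<dots> < \<infinity>" using ii by (simp add: integrable_iff_bounded)
  finally show False by simp
qed

text \<open>The mean value theorem bounds the difference quotients by \<open>w\<close>. Domination
  is asked for only within distance 1 of \<open>x0\<close>, so that \<open>w\<close> may depend on
  \<open>x0\<close>; sequences are shifted by \<open>N\<close> to lie in that ball.\<close>

lemma has_real_derivative_integral:
  fixes f f' :: "real \<Rightarrow> 'a \<Rightarrow> real"
  assumes d: "\<And>x y. ((\<lambda>x. f x y) has_real_derivative f' x y) (at x)"
    and b: "\<And>x y. \<bar>x - x0\<bar> < 1 \<Longrightarrow> \<bar>f' x y\<bar> \<le> w y" and w: "integrable M w"
    and i: "\<And>x. integrable M (f x)" and m: "f' x0 \<in> borel_measurable M"
  shows "((\<lambda>x. \<integral>y. f x y \<partial>M) has_real_derivative (\<integral>y. f' x0 y \<partial>M)) (at x0)"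
  unfolding has_field_derivative_iff tendsto_at_iff_sequentially comp_def
proof safe
  fix X :: "nat \<Rightarrow> real" assume X: "\<forall>i. X i \<in> UNIV - {x0}" "X \<longlonglongrightarrow> x0"
  have eq: "((\<integral>y. f (X n) y \<partial>M) - (\<integral>y. f x0 y \<partial>M)) / (X n - x0)
     = (\<integral>y. (f (X n) y - f x0 y) / (X n - x0) \<partial>M)" for n
    by (simp add: i)
  have "\<forall>\<^sub>F n in sequentially. \<bar>X n - x0\<bar> < 1"
    using tendstoD[OF X(2), of 1] by (simp add: dist_real_def)
  then obtain N where N: "\<And>n. n \<ge> N \<Longrightarrow> \<bar>X n - x0\<bar> < 1"
    by (auto simp: eventually_sequentially)
  have "(\<lambda>n. \<integral>y. (f (X (n + N)) y - f x0 y) / (X (n + N) - x0) \<partial>M) \<longlonglongrightarrow> (\<integral>y. f' x0 y \<partial>M)"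
  proof (rule integral_dominated_convergence[where w=w])
    show "AE y in M. (\<lambda>n. (f (X (n + N)) y - f x0 y) / (X (n + N) - x0)) \<longlonglongrightarrow> f' x0 y"
    proof (rule AE_I2)
      fix y
      have "((\<lambda>x. (f x y - f x0 y) / (x - x0)) \<longlongrightarrow> f' x0 y) (at x0)"
        using d[of y x0] by (simp add: has_field_derivative_iff)
      with X have "(\<lambda>n. (f (X n) y - f x0 y) / (X n - x0)) \<longlonglongrightarrow> f' x0 y"
        unfolding tendsto_at_iff_sequentially comp_def by blast
      then show "(\<lambda>n. (f (X (n + N)) y - f x0 y) / (X (n + N) - x0)) \<longlonglongrightarrow> f' x0 y"
        by (rule LIMSEQ_ignore_initial_segment)
    qed
    show "AE y in M. norm ((f (X (n + N)) y - f x0 y) / (X (n + N) - x0)) \<le> w y" for n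
    proof (rule AE_I2)
      fix y
      have "X (n + N) \<noteq> x0" using X by auto
      have "norm (f (X (n + N)) y - f x0 y) \<le> w y * norm (X (n + N) - x0)"
      proof (rule field_differentiable_bound[of "ball x0 1" "\<lambda>x. f x y" "\<lambda>x. f' x y"])
        show "norm (f' z y) \<le> w y" if "z \<in> ball x0 1" for z
          using that b by (simp add: dist_real_def abs_minus_commute)
        show "X (n + N) \<in> ball x0 1" using N[of "n + N"] by (simp add: dist_real_def abs_minus_commute)
      qed (auto intro: d has_field_derivative_at_within)
      with \<open>X (n + N) \<noteq> x0\<close> show "norm ((f (X (n + N)) y - f x0 y) / (X (n + N) - x0)) \<le> w y"
        by (simp add: abs_divide pos_divide_le_eq)
    qed
  qed (use m w i in \<open>auto intro: borel_measurable_integrable\<close>)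
  then show "(\<lambda>n. ((\<integral>y. f (X n) y \<partial>M) - (\<integral>y. f x0 y \<partial>M)) / (X n - x0)) \<longlonglongrightarrow> (\<integral>y. f' x0 y \<partial>M)"
    unfolding eq by (rule LIMSEQ_offset)
qed

lemma has_tderiv_integral:
  assumes d: "\<And>q y. has_tderiv (\<lambda>q. f q y) (f' q y) q"
    and b: "\<And>q y. \<bar>f' q y\<bar> \<le> w y" and w: "integrable M w"
    and i: "\<And>q. integrable M (f q)" and m: "f' q0 \<in> borel_measurable M"
  shows "has_tderiv (\<lambda>q. \<integral>y. f q y \<partial>M) (\<integral>y. f' q0 y \<partial>M) q0"
proof -
  obtain x where x: "q0 = to_torus x" by (rule torus_cases_unit)
  have "((\<lambda>h. \<integral>y. f (q0 + to_torus h) y \<partial>M) has_real_derivative (\<integral>y. f' (q0 + to_torus 0) y \<partial>M)) (at 0)"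
  proof (rule has_real_derivative_integral[where w=w and f'="\<lambda>h. f' (q0 + to_torus h)"])
    fix h y
    have "((\<lambda>t. f (to_torus t) y) has_real_derivative f' (q0 + to_torus h) y) (at (x + h))"
      by (rule has_tderiv_lift) (use d[of y "q0 + to_torus h"] in \<open>simp add: x to_torus_add\<close>)
    then show "((\<lambda>h. f (q0 + to_torus h) y) has_real_derivative f' (q0 + to_torus h) y) (at h)"
      using DERIV_shift[of "\<lambda>t. f (to_torus t) y" _ h x] by (simp add: x to_torus_add add.commute)
  qed (use assms in auto)
  then show ?thesis by (simp add: has_tderiv_def)
qed

lemma has_tderiv_const [intro]: "has_tderiv (\<lambda>q. k) 0 q"
  by (simp add: has_tderiv_def)

lemma has_tderiv_add: "has_tderiv f f' q \<Longrightarrow> has_tderiv g g' q \<Longrightarrow> has_tderiv (\<lambda>q. f q + g q) (f' + g') q"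
  by (auto simp: has_tderiv_def intro!: derivative_eq_intros)

lemma has_tderiv_diff: "has_tderiv f f' q \<Longrightarrow> has_tderiv g g' q \<Longrightarrow> has_tderiv (\<lambda>q. f q - g q) (f' - g') q"
  by (auto simp: has_tderiv_def intro!: derivative_eq_intros)

lemma has_tderiv_mult: "has_tderiv f f' q \<Longrightarrow> has_tderiv g g' q
    \<Longrightarrow> has_tderiv (\<lambda>q. f q * g q) (f' * g q + f q * g') q"
  by (auto simp: has_tderiv_def intro!: derivative_eq_intros)

lemma has_tderiv_cmult: "has_tderiv f f' q \<Longrightarrow> has_tderiv (\<lambda>q. k * f q) (k * f') q"
  by (auto simp: has_tderiv_def intro!: derivative_eq_intros)

lemma has_tderiv_exp: "has_tderiv f f' q \<Longrightarrow> has_tderiv (\<lambda>q. exp (f q)) (f' * exp (f q)) q"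
  by (auto simp: has_tderiv_def intro!: derivative_eq_intros)

lemma has_tderiv_ln: "has_tderiv f f' q \<Longrightarrow> f q > 0 \<Longrightarrow> has_tderiv (\<lambda>q. ln (f q)) (f' / f q) q"
  by (auto simp: has_tderiv_def intro!: derivative_eq_intros)

lemma has_tderiv_cos_2pi: "has_tderiv cos_2pi (- 2 * pi * sin_2pi q) q"
  and has_tderiv_sin_2pi: "has_tderiv sin_2pi (2 * pi * cos_2pi q) q"
  unfolding has_tderiv_def cos_2pi_add sin_2pi_add cos_2pi_to_torus sin_2pi_to_torus
  by (auto intro!: derivative_eq_intros)

lemma has_tderiv_shift: "has_tderiv f f' (q + a) \<Longrightarrow> has_tderiv (\<lambda>q. f (q + a)) f' q"
  by (simp add: has_tderiv_def algebra_simps)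

lemma torus_deriv_eq: "has_tderiv f f' q \<Longrightarrow> torus_deriv f q = f'"
  by (simp add: has_tderiv_def torus_deriv_def DERIV_imp_deriv)

section \<open>The Bessel functions \<open>Z\<close> and \<open>Z'\<close>\<close>

text \<open>\<open>Zn n\<close> is the n-th derivative of \<open>Z\<close>. In classical notation
  \<open>Zn 0\<close> and \<open>Zn 1\<close> are the modified Bessel functions I_0 and I_1.\<close>

definition Zn :: "nat \<Rightarrow> real \<Rightarrow> real" where
  "Zn n a = (\<integral>q. cos_2pi q ^ n * exp (a * cos_2pi q) \<partial>torus_lebesgue)"

text \<open>The mean of \<open>cos_2pi\<close> under the Gibbs measure with parameter
  \<open>a\<close>, that is I_1 / I_0; \<open>R'\<close> below is the corresponding
  variance.\<close>

definition R :: "real \<Rightarrow> real" where "R a = Zn 1 a / Zn 0 a"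
definition R' :: "real \<Rightarrow> real" where "R' a = Zn 2 a / Zn 0 a - (R a)\<^sup>2"

lemma Z_eq: "Z a = Zn 0 a" by (simp add: Z_def Zn_def)

lemma exp_cos_le: "exp (a * cos_2pi q) \<le> exp \<bar>a\<bar>" and exp_cos_ge: "exp (- \<bar>a\<bar>) \<le> exp (a * cos_2pi q)"
proof -
  have "\<bar>a * cos_2pi q\<bar> \<le> \<bar>a\<bar>" by (simp add: abs_mult mult_left_le)
  then show "exp (a * cos_2pi q) \<le> exp \<bar>a\<bar>" "exp (- \<bar>a\<bar>) \<le> exp (a * cos_2pi q)" by (auto simp: abs_le_iff)
qed

lemma integrable_torus_continuous:
  fixes f :: "torus \<Rightarrow> real"
  assumes "continuous_on UNIV f" shows "integrable torus_lebesgue f"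
proof -
  obtain C where "\<And>q. \<bar>f q\<bar> \<le> C" using continuous_imp_bounded_torus[OF assms] by blast
  moreover have "f \<in> borel_measurable torus_lebesgue"
    using borel_measurable_continuous_onI[OF assms] by (simp cong: measurable_cong_sets)
  ultimately show ?thesis
    by (intro integrable_bounded[of _ _ C] torus.finite_measure_axioms) auto
qed

lemma Zn_integrable: "integrable torus_lebesgue (\<lambda>q. cos_2pi q ^ n * exp (a * cos_2pi q))"
  by (intro integrable_torus_continuous continuous_intros)

lemma DERIV_Zn: "(Zn n has_real_derivative Zn (Suc n) a) (at a)"
  unfolding Zn_def
proof (rule has_real_derivative_integral[where w="\<lambda>_. exp (\<bar>a\<bar> + 1)"])
  fix x q assume x: "\<bar>x - a\<bar> < 1"
  have "\<bar>cos_2pi q ^ Suc n * exp (x * cos_2pi q)\<bar> \<le> 1 * exp (\<bar>x\<bar>)"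
    unfolding abs_mult power_abs abs_exp_cancel by (intro mult_mono power_le_one exp_cos_le) auto
  also have "\<dots> \<le> exp (\<bar>a\<bar> + 1)" using x by simp
  finally show "\<bar>cos_2pi q ^ Suc n * exp (x * cos_2pi q)\<bar> \<le> exp (\<bar>a\<bar> + 1)" .
qed (auto intro!: derivative_eq_intros Zn_integrable)

lemma Zn_continuous: "continuous_on S (Zn n)"
  by (rule DERIV_continuous_on[OF has_field_derivative_at_within[OF DERIV_Zn]])

lemma Zn_0_pos: "Zn 0 a > 0"
proof -
  have "exp (- \<bar>a\<bar>) = (\<integral>q. exp (- \<bar>a\<bar>) \<partial>torus_lebesgue)" by simp
  also have "\<dots> \<le> Zn 0 a"
    unfolding Zn_def using Zn_integrable[of 0 a] exp_cos_ge[of a]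
    by (intro integral_mono) (simp_all del: exp_le_cancel_iff)
  finally show ?thesis by (smt (verit) exp_gt_zero)
qed

lemma Zn_0_nonzero: "Zn 0 a \<noteq> 0"
  using Zn_0_pos[of a] by simp

lemma Z_pos: "Z a > 0" by (simp add: Z_eq Zn_0_pos)

lemma DERIV_Z: "(Z has_real_derivative Zn 1 a) (at a)"
  using DERIV_Zn[of 0 a] by (simp add: Z_eq[abs_def])

text \<open>Translation by half a period changes the sign of \<open>cos_2pi\<close>.\<close>

lemma Zn_minus: "Zn n (- a) = (- 1) ^ n * Zn n a"
proof -
  have c: "cos_2pi (q + to_torus (1/2)) = - cos_2pi q" for q
    by (simp add: cos_2pi_add)
  have "Zn n (- a) = (\<integral>q. cos_2pi (q + to_torus (1/2)) ^ n * exp (- a * cos_2pi (q + to_torus (1/2))) \<partial>torus_lebesgue)"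
    unfolding Zn_def by (rule integral_torus_shift[symmetric]) measurable
  also have "\<dots> = (\<integral>q. (- 1) ^ n * (cos_2pi q ^ n * exp (a * cos_2pi q)) \<partial>torus_lebesgue)"
    unfolding c by (intro Bochner_Integration.integral_cong) (auto simp: power_minus[of "cos_2pi _"])
  finally show ?thesis by (simp add: Zn_def)
qed

lemma sin_2pi_squared: "(sin_2pi q)\<^sup>2 = 1 - (cos_2pi q)\<^sup>2"
  using sin_cos_2pi_squared[of q] by simp

text \<open>The derivative of \<open>sin_2pi q * exp (a * cos_2pi q)\<close> integrates to 0. This
  recurrence is the source of the Riccati equation \<open>R'_eq\<close>.\<close>

lemma Zn_2_eq: "a * (Zn 0 a - Zn 2 a) = Zn 1 a"
proof -
  define g where "g q = cos_2pi q * exp (a * cos_2pi q) - a * (exp (a * cos_2pi q) - (cos_2pi q)\<^sup>2 * exp (a * cos_2pi q))" for q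
  have "(\<integral>q. 2 * pi * g q \<partial>torus_lebesgue) = 0"
  proof (rule integral_tderiv_zero)
    fix q
    have "has_tderiv (\<lambda>q. sin_2pi q * exp (a * cos_2pi q))
        (2 * pi * cos_2pi q * exp (a * cos_2pi q) + sin_2pi q * (a * (- 2 * pi * sin_2pi q) * exp (a * cos_2pi q))) q"
      by (intro has_tderiv_mult has_tderiv_exp has_tderiv_cmult has_tderiv_sin_2pi has_tderiv_cos_2pi)
    moreover have "sin_2pi q * sin_2pi q = 1 - cos_2pi q * cos_2pi q"
      using sin_2pi_squared[of q] by (simp add: power2_eq_square)
    then have "2 * pi * cos_2pi q * exp (a * cos_2pi q) + sin_2pi q * (a * (- 2 * pi * sin_2pi q) * exp (a * cos_2pi q)) = 2 * pi * g q"
      unfolding g_def power2_eq_square by algebra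
    ultimately show "has_tderiv (\<lambda>q. sin_2pi q * exp (a * cos_2pi q)) (2 * pi * g q) q" by simp
  qed (unfold g_def, intro integrable_torus_continuous continuous_intros)
  then have "(\<integral>q. g q \<partial>torus_lebesgue) = 0"
    by (subst (asm) integral_mult_right_zero) simp
  moreover have "(\<integral>q. g q \<partial>torus_lebesgue) = Zn 1 a - a * (Zn 0 a - Zn 2 a)"
    using Zn_integrable[of 0 a] Zn_integrable[of 1 a] Zn_integrable[of 2 a] by (simp add: Zn_def g_def)
  ultimately show ?thesis by simp
qed

lemma Zn_at_0: "Zn 0 0 = 1" "Zn 1 0 = 0" "Zn 2 0 = 1 / 2"
proof -
  show "Zn 0 0 = 1" by (simp add: Zn_def)
  show "Zn 1 0 = 0" using Zn_2_eq[of 0] by simp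
  have i: "integrable torus_lebesgue (\<lambda>q. (cos_2pi q)\<^sup>2)" "integrable torus_lebesgue (\<lambda>q. (sin_2pi q)\<^sup>2)"
    by (intro integrable_torus_continuous continuous_intros)+
  \<comment> \<open>A quarter period exchanges the squares of sine and cosine, and these add up to
    1.\<close>
  have "(\<integral>q. (sin_2pi q)\<^sup>2 \<partial>torus_lebesgue) = (\<integral>q. (cos_2pi (q + (- to_torus (1/4))))\<^sup>2 \<partial>torus_lebesgue)"
    by (simp add: sin_2pi_eq_cos_2pi)
  also have "\<dots> = (\<integral>q. (cos_2pi q)\<^sup>2 \<partial>torus_lebesgue)"
    by (rule integral_torus_shift) measurable
  finally have "2 * (\<integral>q. (cos_2pi q)\<^sup>2 \<partial>torus_lebesgue) = (\<integral>q. (sin_2pi q)\<^sup>2 + (cos_2pi q)\<^sup>2 \<partial>torus_lebesgue)"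
    using i by simp
  then show "Zn 2 0 = 1 / 2" by (simp add: sin_cos_2pi_squared Zn_def)
qed

text \<open>Strictness comes from replacing the weight by its lower bound
  \<open>exp (- \<bar>a\<bar>)\<close>: this leaves a positive multiple of the integral of
  \<open>1 - cos_2pi\<close> at parameter 0, which is 1.\<close>

lemma R_less_1: "R a < 1"
proof -
  have "exp (- \<bar>a\<bar>) * (Zn 0 0 - Zn 1 0)
      = (\<integral>q. exp (- \<bar>a\<bar>) * (cos_2pi q ^ 0 * exp (0 * cos_2pi q) - cos_2pi q ^ 1 * exp (0 * cos_2pi q)) \<partial>torus_lebesgue)"
    using Zn_integrable[of 0 0] Zn_integrable[of 1 0] by (simp add: Zn_def)
  also have "\<dots> \<le> (\<integral>q. cos_2pi q ^ 0 * exp (a * cos_2pi q) - cos_2pi q ^ 1 * exp (a * cos_2pi q) \<partial>torus_lebesgue)"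
  proof (intro integral_mono Bochner_Integration.integrable_diff integrable_mult_right Zn_integrable)
    fix q
    have "exp (- \<bar>a\<bar>) * (1 - cos_2pi q) \<le> exp (a * cos_2pi q) * (1 - cos_2pi q)"
      by (intro mult_right_mono exp_cos_ge) simp
    then show "exp (- \<bar>a\<bar>) * (cos_2pi q ^ 0 * exp (0 * cos_2pi q) - cos_2pi q ^ 1 * exp (0 * cos_2pi q))
       \<le> cos_2pi q ^ 0 * exp (a * cos_2pi q) - cos_2pi q ^ 1 * exp (a * cos_2pi q)"
      by (simp add: algebra_simps)
  qed
  also have "\<dots> = Zn 0 a - Zn 1 a"
    using Zn_integrable[of 0 a] Zn_integrable[of 1 a] by (simp add: Zn_def)
  finally have "exp (- \<bar>a\<bar>) \<le> Zn 0 a - Zn 1 a" using Zn_at_0 by simp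
  then have "Zn 0 a - Zn 1 a > 0" by (rule less_le_trans[OF exp_gt_zero])
  then show ?thesis using Zn_0_pos[of a] by (simp add: R_def)
qed

lemma R_minus: "R (- a) = - R a"
  using Zn_minus[of 0 a] Zn_minus[of 1 a] by (simp add: R_def)

lemma R_0 [simp]: "R 0 = 0" using R_minus[of 0] by simp

lemma DERIV_R: "(R has_real_derivative R' a) (at a)"
proof -
  have "((\<lambda>a. Zn 1 a / Zn 0 a) has_real_derivative (Zn 2 a * Zn 0 a - Zn 1 a * Zn 1 a) / (Zn 0 a * Zn 0 a)) (at a)"
    using DERIV_divide[OF DERIV_Zn[of 1 a] DERIV_Zn[of 0 a]] Zn_0_pos[of a] by (simp add: numeral_2_eq_2)
  also have "(Zn 2 a * Zn 0 a - Zn 1 a * Zn 1 a) / (Zn 0 a * Zn 0 a) = R' a"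
    using Zn_0_pos[of a] by (simp add: R'_def R_def field_simps power2_eq_square)
  finally show ?thesis unfolding R_def[abs_def] .
qed

lemma R'_eq: "a \<noteq> 0 \<Longrightarrow> R' a = 1 - R a / a - (R a)\<^sup>2"
proof -
  assume a: "a \<noteq> 0"
  have "Zn 2 a = Zn 0 a - Zn 1 a / a" using Zn_2_eq[of a] a by (simp add: field_simps)
  then have "Zn 2 a / Zn 0 a = 1 - R a / a"
    using Zn_0_pos[of a] by (simp add: R_def diff_divide_distrib)
  then show ?thesis by (simp add: R'_def)
qed

text \<open>\<open>Zn 0 a * R' a\<close> is the weighted integral of the squared deviation of
  \<open>cos_2pi\<close> from \<open>R a\<close>. Bounding the weight below by
  \<open>exp (- \<bar>a\<bar>)\<close> leaves second moments at parameter 0, which are at least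
  1/2.\<close>

lemma R'_pos: "R' a > 0"
proof -
  let ?r = "R a"
  have eq: "Zn 2 b - 2 * ?r * Zn 1 b + ?r\<^sup>2 * Zn 0 b = (\<integral>q. (cos_2pi q - ?r)\<^sup>2 * exp (b * cos_2pi q) \<partial>torus_lebesgue)" for b
  proof -
    have "(\<integral>q. (cos_2pi q - ?r)\<^sup>2 * exp (b * cos_2pi q) \<partial>torus_lebesgue)
      = (\<integral>q. cos_2pi q ^ 2 * exp (b * cos_2pi q) - 2 * ?r * (cos_2pi q ^ 1 * exp (b * cos_2pi q)) + ?r\<^sup>2 * (cos_2pi q ^ 0 * exp (b * cos_2pi q)) \<partial>torus_lebesgue)"
      by (simp add: algebra_simps power2_diff)
    then show ?thesis
      using Zn_integrable[of 0 b] Zn_integrable[of 1 b] Zn_integrable[of 2 b] by (simp add: Zn_def)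
  qed
  have "exp (- \<bar>a\<bar>) * (Zn 2 0 - 2 * ?r * Zn 1 0 + ?r\<^sup>2 * Zn 0 0)
     = (\<integral>q. exp (- \<bar>a\<bar>) * ((cos_2pi q - ?r)\<^sup>2 * exp (0 * cos_2pi q)) \<partial>torus_lebesgue)"
    unfolding eq by simp
  also have "\<dots> \<le> (\<integral>q. (cos_2pi q - ?r)\<^sup>2 * exp (a * cos_2pi q) \<partial>torus_lebesgue)"
  proof (rule integral_mono)
    fix q
    show "exp (- \<bar>a\<bar>) * ((cos_2pi q - ?r)\<^sup>2 * exp (0 * cos_2pi q)) \<le> (cos_2pi q - ?r)\<^sup>2 * exp (a * cos_2pi q)"
      using mult_left_mono[OF exp_cos_ge[of a q], of "(cos_2pi q - ?r)\<^sup>2"] by (simp add: mult.commute)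
  qed (intro integrable_torus_continuous continuous_intros)+
  also have "\<dots> = Zn 2 a - 2 * ?r * Zn 1 a + ?r\<^sup>2 * Zn 0 a" by (rule eq[symmetric])
  also have "\<dots> = Zn 0 a * R' a" using Zn_0_pos[of a] by (simp add: R'_def R_def field_simps power2_eq_square)
  finally have "exp (- \<bar>a\<bar>) * (1/2 + ?r\<^sup>2) \<le> Zn 0 a * R' a" using Zn_at_0 by simp
  moreover have "exp (- \<bar>a\<bar>) * (1/2 + ?r\<^sup>2) > 0" by (intro mult_pos_pos add_pos_nonneg) auto
  ultimately show ?thesis using Zn_0_pos[of a] by (smt (verit) zero_less_mult_pos)
qed

lemma R_strict_mono: "a < b \<Longrightarrow> R a < R b"
  by (rule DERIV_pos_imp_increasing[of a b R]) (use DERIV_R R'_pos in blast)+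

lemma R_pos: "a > 0 \<Longrightarrow> R a > 0" using R_strict_mono[of 0 a] by simp

lemma R_continuous: "continuous_on S R"
  by (rule DERIV_continuous_on[OF has_field_derivative_at_within[OF DERIV_R]])

text \<open>\<open>R'' < 0\<close> on \<open>(0, \<infinity>)\<close>: differentiating the Riccati equation \<open>R' = 1 - R / a - R\<^sup>2\<close> twice shows
  that \<open>(a\<^sup>3 Z\<^sup>2 R'')' = - a\<^sup>2 Z\<^sup>2 (4 R R' + 2 a R'\<^sup>2)\<close>.\<close>

lemma DERIV_R':
  assumes "a > 0"
  shows "(R' has_real_derivative (1 - 2 * R' a - (R a)\<^sup>2 - 2 * a * R a * R' a) / a) (at a)"
proof -
  have "((\<lambda>a. 1 - R a / a - (R a)\<^sup>2) has_real_derivative (1 - 2 * R' a - (R a)\<^sup>2 - 2 * a * R a * R' a) / a) (at a)"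
    using assms by (auto intro!: derivative_eq_intros DERIV_R simp: R'_eq field_simps power2_eq_square)
  then show ?thesis
    by (rule has_field_derivative_transform_within_open[of _ _ _ "{0<..}"]) (use assms R'_eq in auto)
qed

lemma R''_neg:
  assumes a: "a > 0"
  shows "1 - 2 * R' a - (R a)\<^sup>2 - 2 * a * R a * R' a < 0"
proof -
  define k where "k a = 1 - 2 * R' a - (R a)\<^sup>2 - 2 * a * R a * R' a" for a
  \<comment> \<open>By \<open>DERIV_R'\<close>, \<open>k a\<close> equals \<open>a\<close> times the
    second derivative of \<open>R\<close> for \<open>a > 0\<close>. The product form avoids the
    division by \<open>a\<close>, so that \<open>K\<close> is continuous up to 0, where it
    vanishes.\<close>
  define K where "K a = a\<^sup>2 * (Z a)\<^sup>2 * k a" for a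
  have "K a < K 0"
  proof (rule DERIV_neg_imp_decreasing_open[OF a])
    fix x :: real assume x: "0 < x" "x < a"
    have Z1: "Zn 1 x = R x * Z x" using Z_pos[of x] by (simp add: R_def Z_eq)
    define r r1 k1 where "r = R x" and "r1 = R' x" and "k1 = k x / x"
    have "(R' has_real_derivative k1) (at x)"
      using DERIV_R'[OF x(1)] by (simp add: k1_def k_def)
    then have "(k has_real_derivative (0 - 2 * k1 - 2 * r * r1 - ((2 * r + 2 * x * r1) * r1 + k1 * (2 * x * r)))) (at x)"
      unfolding k_def[abs_def] r_def r1_def
      by (auto intro!: derivative_eq_intros DERIV_R simp: algebra_simps)
    moreover have "((\<lambda>a. a\<^sup>2 * (Z a)\<^sup>2) has_real_derivative (2 * x * (Z x)\<^sup>2 + x\<^sup>2 * (2 * Z x * (r * Z x)))) (at x)"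
      using Z1 by (auto intro!: derivative_eq_intros DERIV_Z simp: r_def)
    ultimately have "(K has_real_derivative (2 * x * (Z x)\<^sup>2 + x\<^sup>2 * (2 * Z x * (r * Z x))) * k x
       + (0 - 2 * k1 - 2 * r * r1 - ((2 * r + 2 * x * r1) * r1 + k1 * (2 * x * r))) * (x\<^sup>2 * (Z x)\<^sup>2)) (at x)"
      unfolding K_def[abs_def] by (rule DERIV_mult[rotated])
    also have "k x = x * k1" using x by (simp add: k1_def)
    also have "(2 * x * (Z x)\<^sup>2 + x\<^sup>2 * (2 * Z x * (r * Z x))) * (x * k1)
       + (0 - 2 * k1 - 2 * r * r1 - ((2 * r + 2 * x * r1) * r1 + k1 * (2 * x * r))) * (x\<^sup>2 * (Z x)\<^sup>2)
      = - (x\<^sup>2 * (Z x)\<^sup>2 * (4 * R x * R' x + 2 * x * (R' x)\<^sup>2))"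
      unfolding r_def[symmetric] r1_def[symmetric] by (simp add: algebra_simps power2_eq_square)
    finally have "(K has_real_derivative - (x\<^sup>2 * (Z x)\<^sup>2 * (4 * R x * R' x + 2 * x * (R' x)\<^sup>2))) (at x)" .
    moreover have "x\<^sup>2 * (Z x)\<^sup>2 * (4 * R x * R' x + 2 * x * (R' x)\<^sup>2) > 0"
      using x R'_pos[of x] R_pos[of x] Z_pos[of x] by (intro mult_pos_pos add_pos_pos) auto
    ultimately show "\<exists>y. DERIV K x :> y \<and> y < 0" by (intro exI conjI) auto
  next
    show "continuous_on {0..a} K"
      unfolding K_def k_def R'_def Z_eq
      by (intro continuous_intros Zn_continuous R_continuous) (simp_all add: Zn_0_nonzero)
  qed
  then have "a\<^sup>2 * (Z a)\<^sup>2 * k a < 0" by (simp add: K_def)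
  then show ?thesis unfolding k_def[symmetric]
    by (metis mult_less_0_iff not_less zero_le_mult_iff zero_le_power2)
qed

lemma R'_strict_antimono:
  assumes "0 < a" "a < b" shows "R' b < R' a"
proof (rule DERIV_neg_imp_decreasing[OF assms(2)])
  fix x assume "a \<le> x" "x \<le> b"
  then have x: "x > 0" using assms by simp
  show "\<exists>y. DERIV R' x :> y \<and> y < 0"
    using DERIV_R'[OF x] divide_neg_pos[OF R''_neg[OF x] x] by blast
qed

text \<open>If \<open>R\<close> stayed below \<open>\<eta>\<close>, the Riccati equation would force
  \<open>R'\<close> to be at least \<open>d\<close>, half of 1 - \<eta>^2, from 1 / d on; the other
  half absorbs \<open>R b / b\<close>. Over the next interval of length 1 / d the function
  \<open>R\<close> would then gain 1, impossible between 0 and 1.\<close>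

lemma R_tendsto_1:
  assumes "\<eta> < 1" shows "\<exists>b0>0. \<forall>b\<ge>b0. R b > \<eta>"
proof (rule ccontr)
  assume "\<not> ?thesis"
  then have le: "R b \<le> \<eta>" if "b > 0" for b
    using that R_strict_mono by (metis dual_order.strict_trans2 linorder_not_le not_less_iff_gr_or_eq)
  have \<eta>: "\<eta> > 0" using le[of 1] R_pos[of 1] by simp
  define d where "d = (1 - \<eta>\<^sup>2) / 2"
  have d: "d > 0" using assms \<eta> by (simp add: d_def power_less_one_iff)
  have R'_ge: "R' b \<ge> d" if b: "b \<ge> 1 / d" for b
  proof -
    have b0: "b > 0" using b d by (smt (verit) divide_pos_pos zero_less_one)
    have "(R b)\<^sup>2 \<le> \<eta>\<^sup>2" using le[OF b0] R_pos[OF b0] by (intro power_mono) auto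
    moreover have "R b / b \<le> 1 / b" using R_less_1[of b] b0 by (intro divide_right_mono) auto
    moreover have "1 / b \<le> d" using b b0 d by (simp add: field_simps)
    moreover have "2 * d = 1 - \<eta>\<^sup>2" by (simp add: d_def)
    moreover have "R' b = 1 - R b / b - (R b)\<^sup>2" using R'_eq[of b] b0 by simp
    ultimately show ?thesis by linarith
  qed
  have "R (1 / d + 1 / d) - R (1 / d) \<ge> 1"
  proof -
    obtain z where "z > 1 / d" "R (1 / d + 1 / d) - R (1 / d) = (1 / d + 1 / d - 1 / d) * R' z"
      using MVT2[of "1/d" "1/d + 1/d" R R'] DERIV_R d by (metis add_less_cancel_left add.right_neutral divide_pos_pos zero_less_one)
    moreover from this(1) R'_ge[of z] d have "1 / d * d \<le> 1 / d * R' z" by (intro mult_left_mono) auto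
    ultimately show ?thesis using d by simp
  qed
  then show False using R_less_1[of "1/d + 1/d"] R_pos[of "1/d"] d by simp
qed

section \<open>Roots of the scalar self-consistency equation\<close>

definition root :: "real \<Rightarrow> real \<Rightarrow> real \<Rightarrow> bool" where
  "root \<beta> \<eta> a \<longleftrightarrow> a = \<beta> * (\<eta> + R a)"

text \<open>As \<open>R\<close> is odd, the positive zeros \<open>b\<close> correspond to the
  negative roots \<open>- b\<close>. The form is concave on the half line, which limits the number
  of zeros.\<close>

definition gap :: "real \<Rightarrow> real \<Rightarrow> real \<Rightarrow> real" where
  "gap \<beta> \<eta> b = R b - \<eta> - b / \<beta>"

lemma root_minus_iff: "\<beta> > 0 \<Longrightarrow> root \<beta> \<eta> (- b) \<longleftrightarrow> gap \<beta> \<eta> b = 0"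
  by (cases "\<beta> = 0") (auto simp: root_def gap_def R_minus field_simps)

lemma DERIV_gap: "(gap \<beta> \<eta> has_real_derivative R' b - 1 / \<beta>) (at b)"
  unfolding gap_def[abs_def]
  using DERIV_diff[OF DERIV_diff[OF DERIV_R DERIV_const[of \<eta>]] DERIV_cdivide[OF DERIV_ident, of \<beta>]] by simp

lemma root_not_0: "\<beta> > 0 \<Longrightarrow> \<eta> > 0 \<Longrightarrow> root \<beta> \<eta> a \<Longrightarrow> a \<noteq> 0"
  by (auto simp: root_def)

lemma gap_rolle:
  assumes "x < y" "gap \<beta> \<eta> x = gap \<beta> \<eta> y"
  shows "\<exists>z. x < z \<and> z < y \<and> R' z = 1 / \<beta>"
proof -
  obtain z where "z > x" "z < y" "gap \<beta> \<eta> y - gap \<beta> \<eta> x = (y - x) * (R' z - 1 / \<beta>)"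
    using MVT2[OF assms(1), of "gap \<beta> \<eta>" "\<lambda>b. R' b - 1 / \<beta>"] DERIV_gap by blast
  with assms show ?thesis by (intro exI[of _ z]) auto
qed

lemma gap_neg_at_0: "\<eta> > 0 \<Longrightarrow> gap \<beta> \<eta> 0 < 0"
  by (simp add: gap_def)

lemma gap_neg_large:
  assumes "\<beta> > 0" "\<eta> > 0" "b \<ge> \<beta>" shows "gap \<beta> \<eta> b < 0"
proof -
  have "b / \<beta> \<ge> 1" using assms by simp
  then show ?thesis using R_less_1[of b] assms(2) by (simp add: gap_def)
qed

text \<open>The function \<open>f\<close> is negative at 0 and nonnegative at
  \<open>\<beta> * (\<eta> + 1)\<close> because \<open>R < 1\<close>. It is convex on the positive
  half line: with two zeros, \<open>f\<close> would first increase, so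
  \<open>R' < 1 / \<beta>\<close> somewhere, and later satisfy \<open>R' = 1 / \<beta>\<close> by
  Rolle, against the strict decrease of \<open>R'\<close>.\<close>

lemma ex1_positive_root:
  assumes "\<beta> > 0" "\<eta> > 0"
  shows "\<exists>!a. a > 0 \<and> root \<beta> \<eta> a"
proof -
  define f where "f a = a / \<beta> - \<eta> - R a" for a
  have df: "(f has_real_derivative 1 / \<beta> - R' a) (at a)" for a
    unfolding f_def
    using DERIV_diff[OF DERIV_diff[OF DERIV_cdivide[OF DERIV_ident, of \<beta>] DERIV_const[of \<eta>]] DERIV_R] by simp
  have rf: "root \<beta> \<eta> a \<longleftrightarrow> f a = 0" for a
    using assms by (cases "\<beta> = 0") (auto simp: root_def f_def field_simps)
  have "\<beta> * (\<eta> + 1) / \<beta> = \<eta> + 1" using assms by simp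
  then have "f (\<beta> * (\<eta> + 1)) \<ge> 0"
    using R_less_1[of "\<beta> * (\<eta> + 1)"] by (simp add: f_def)
  then have "\<exists>a\<ge>0. a \<le> \<beta> * (\<eta> + 1) \<and> f a = 0"
    using assms by (intro IVT) (auto simp: f_def intro!: DERIV_isCont[OF df, unfolded f_def])
  then obtain a where a: "a \<ge> 0" "f a = 0" by blast
  then have "a > 0" using root_not_0[OF assms] rf by force
  moreover have False if xy: "0 < x" "x < y" "f x = 0" "f y = 0" for x y
  proof -
    obtain z where z: "z > 0" "z < x" "f x - f 0 = (x - 0) * (1 / \<beta> - R' z)"
      using MVT2[OF xy(1), of f "\<lambda>b. 1 / \<beta> - R' b"] df by blast
    moreover have "f 0 < 0" using assms by (simp add: f_def)
    ultimately have "(x - 0) * (1 / \<beta> - R' z) > 0" using xy by simp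
    then have 1: "R' z < 1 / \<beta>" using xy(1) by (simp add: zero_less_mult_iff)
    obtain w where w: "w > x" "w < y" "f y - f x = (y - x) * (1 / \<beta> - R' w)"
      using MVT2[OF xy(2), of f "\<lambda>b. 1 / \<beta> - R' b"] df by blast
    then have "R' w = 1 / \<beta>" using xy by simp
    with 1 R'_strict_antimono[of z w] z w show False by simp
  qed
  ultimately show ?thesis using a rf by (metis linorder_neqE_linordered_idom)
qed

text \<open>Rolle would give two points with \<open>R' = 1 / \<beta>\<close>, but \<open>R'\<close>
  is strictly decreasing.\<close>

lemma gap_three_zeros:
  assumes "0 < x" "x < y" "y < z" "gap \<beta> \<eta> x = 0" "gap \<beta> \<eta> y = 0" "gap \<beta> \<eta> z = 0"
  shows False
proof -
  obtain v where v: "x < v" "v < y" "R' v = 1 / \<beta>" using gap_rolle[of x y \<beta> \<eta>] assms by auto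
  obtain w where w: "y < w" "w < z" "R' w = 1 / \<beta>" using gap_rolle[of y z \<beta> \<eta>] assms by auto
  show False using R'_strict_antimono[of v w] v w assms by simp
qed

text \<open>For \<open>b > 0\<close>, \<open>gap\<close> vanishes exactly where
  \<open>G b = 1 / \<beta>\<close> with \<open>G b = (R b - \<eta>) / b\<close>, so the threshold is
  the reciprocal of the maximum of \<open>G\<close>. Since \<open>\<eta> < 1\<close>,
  \<open>G\<close> is positive somewhere; it is negative before the point \<open>\<delta>\<close>
  with \<open>R \<delta> = \<eta>\<close> and decays like 1 / b, so the maximum is attained.\<close>

lemma ex_critical_value:
  assumes "0 < \<eta>" "\<eta> < 1"
  shows "\<exists>\<beta>c>0. (\<forall>\<beta>. 0 < \<beta> \<and> \<beta> < \<beta>c \<longrightarrow> {b. b > 0 \<and> gap \<beta> \<eta> b = 0} = {}) \<and>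
    (\<exists>b>0. {b. b > 0 \<and> gap \<beta>c \<eta> b = 0} = {b}) \<and>
    (\<forall>\<beta>>\<beta>c. \<exists>b1 b2. 0 < b1 \<and> b1 < b2 \<and> {b. b > 0 \<and> gap \<beta> \<eta> b = 0} = {b1, b2})"
proof -
  define G where "G b = (R b - \<eta>) / b" for b
  obtain b' where b': "b' > 0" "R b' > \<eta>" using R_tendsto_1[OF assms(2)] by blast
  have "\<exists>x\<ge>0. x \<le> b' \<and> R x = \<eta>"
    using b' assms by (intro IVT) (auto intro: DERIV_isCont DERIV_R)
  then obtain \<delta> where d: "\<delta> \<ge> 0" "R \<delta> = \<eta>" by blast
  then have d0: "\<delta> > 0" using assms by (cases "\<delta> = 0") auto
  have db: "\<delta> < b'" using b' d R_strict_mono by (metis linorder_neqE_linordered_idom order_less_asym)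
  \<comment> \<open>From here on the bound \<open>G b < 1 / b\<close> lies below
    \<open>G b'\<close>, so a maximum over [\<delta>, N] is global.\<close>
  define N where "N = 1 / G b'"
  have Gb: "G b' > 0" using b' by (simp add: G_def)
  have Gl: "G b < 1 / b" if "b > 0" for b
    unfolding G_def using that R_less_1[of b] assms by (intro divide_strict_right_mono) auto
  have bN: "b' \<le> N" using Gl[OF b'(1)] Gb b'(1) by (simp add: N_def field_simps)
  have "\<exists>x\<in>{\<delta>..N}. \<forall>y\<in>{\<delta>..N}. G y \<le> G x"
    unfolding G_def using d0 db bN
    by (intro continuous_attains_sup continuous_intros R_continuous) auto
  then obtain m where m: "m \<in> {\<delta>..N}" "\<And>y. y \<in> {\<delta>..N} \<Longrightarrow> G y \<le> G m" by blast
  have m0: "m > 0" using m(1) d0 by simp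
  have Gm: "G m > 0" using m(2)[of b'] Gb db bN by simp
  have max: "G b \<le> G m" if "b > 0" for b
  proof -
    consider "b < \<delta>" | "b \<in> {\<delta>..N}" | "b > N" by force
    then show ?thesis
    proof cases
      case 1
      then have "R b < \<eta>" using R_strict_mono d by blast
      then have "G b < 0" using that by (simp add: G_def divide_neg_pos)
      then show ?thesis using Gm by simp
    next
      case 3
      have "N > 0" using Gb by (simp add: N_def)
      then have "1 / b < 1 / N" using 3 by (simp add: frac_less2)
      then have "G b < G b'" using Gl[OF that] by (simp add: N_def)
      then show ?thesis using m(2)[of b'] db bN by simp
    qed (rule m(2))
  qed
  define \<beta>c where "\<beta>c = 1 / G m"
  have bc: "\<beta>c > 0" using Gm by (simp add: \<beta>c_def)
  have gap_G: "gap \<beta> \<eta> b = b * (G b - 1 / \<beta>)" if "b > 0" for b \<beta>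
    using that by (simp add: gap_def G_def field_simps)
  have gm: "gap \<beta>c \<eta> m = 0" using gap_G[OF m0] Gm by (simp add: \<beta>c_def)
  have le: "gap \<beta>c \<eta> b \<le> 0" if "b > 0" for b
    using gap_G[OF that, of \<beta>c] max[OF that] that by (simp add: \<beta>c_def mult_nonneg_nonpos)
  \<comment> \<open>At the threshold \<open>gap\<close> is nonpositive, so each zero is a maximum
    and the line is tangent there; injectivity of \<open>R'\<close> then singles out
    \<open>m\<close>.\<close>
  have stat: "R' b = 1 / \<beta>c" if b: "b > 0" "gap \<beta>c \<eta> b = 0" for b
  proof -
    have "R' b - 1 / \<beta>c = 0"
    proof (rule DERIV_local_max[OF DERIV_gap])
      show "0 < b" by (rule b)
      show "\<forall>y. \<bar>b - y\<bar> < b \<longrightarrow> gap \<beta>c \<eta> y \<le> gap \<beta>c \<eta> b" using b le by auto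
    qed
    then show ?thesis by simp
  qed
  show ?thesis
  proof (rule exI[of _ \<beta>c], intro conjI allI impI bc)
    fix \<beta> assume \<beta>: "0 < \<beta> \<and> \<beta> < \<beta>c"
    have "gap \<beta> \<eta> b < 0" if "b > 0" for b
    proof -
      have "1 / \<beta> > 1 / \<beta>c" using \<beta> by (simp add: frac_less2)
      then have "G b - 1 / \<beta> < 0" using max[OF that] by (simp add: \<beta>c_def)
      then show ?thesis using that by (simp add: gap_G mult_pos_neg)
    qed
    then show "{b. b > 0 \<and> gap \<beta> \<eta> b = 0} = {}" by force
  next
    show "\<exists>b>0. {b. b > 0 \<and> gap \<beta>c \<eta> b = 0} = {b}"
    proof (rule exI[of _ m], intro conjI m0 set_eqI iffI)
      fix b assume "b \<in> {b. b > 0 \<and> gap \<beta>c \<eta> b = 0}"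
      then have "R' b = R' m" "b > 0" using stat gm m0 by auto
      then show "b \<in> {m}" using R'_strict_antimono m0 by (metis linorder_neqE_linordered_idom order_less_irrefl singletonI)
    qed (use gm m0 in auto)
  next
    fix \<beta> assume \<beta>: "\<beta> > \<beta>c"
    have b0: "\<beta> > 0" using \<beta> bc by simp
    have "1 / \<beta> < 1 / \<beta>c" using \<beta> bc by (simp add: frac_less2)
    \<comment> \<open>Above the threshold \<open>gap\<close> is positive at \<open>m\<close> but
      negative at 0 and from \<open>\<beta>\<close> on, which gives one zero on either side of
      \<open>m\<close>.\<close>
    then have pos: "gap \<beta> \<eta> m > 0" using gap_G[OF m0, of \<beta>] m0 by (simp add: \<beta>c_def)
    have "\<exists>x\<ge>0. x \<le> m \<and> gap \<beta> \<eta> x = 0"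
      using pos m0 gap_neg_at_0[OF assms(1), of \<beta>] by (intro IVT) (auto intro: DERIV_isCont DERIV_gap)
    then obtain b1 where b1: "0 \<le> b1" "b1 \<le> m" "gap \<beta> \<eta> b1 = 0" by blast
    have neq: "b1 \<noteq> 0" "b1 \<noteq> m" using b1(3) pos gap_neg_at_0[OF assms(1), of \<beta>] by auto
    have "\<not> m \<ge> \<beta>" using gap_neg_large[OF b0 assms(1), of m] pos by auto
    then have "\<exists>x\<ge>m. x \<le> \<beta> \<and> gap \<beta> \<eta> x = 0"
      using pos gap_neg_large[OF b0 assms(1), of \<beta>]
      by (intro IVT2) (auto intro: DERIV_isCont DERIV_gap)
    then obtain b2 where b2: "m \<le> b2" "gap \<beta> \<eta> b2 = 0" by blast
    have "b2 \<noteq> m" using b2(2) pos by auto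
    then have o: "0 < b1" "b1 < b2" using b1 b2 neq by auto
    have "b \<in> {b1, b2}" if "b > 0" "gap \<beta> \<eta> b = 0" for b
      using gap_three_zeros[of b b1 b2 \<beta> \<eta>] gap_three_zeros[of b1 b b2 \<beta> \<eta>] gap_three_zeros[of b1 b2 b \<beta> \<eta>]
        that b1 b2 o by fastforce
    then show "\<exists>b1 b2. 0 < b1 \<and> b1 < b2 \<and> {b. b > 0 \<and> gap \<beta> \<eta> b = 0} = {b1, b2}"
      using o b1 b2 by (intro exI[of _ b1] exI[of _ b2]) auto
  qed
qed

section \<open>Phase space\<close>

text \<open>Balls around rational points with radii 1 / (n + 1) form a countable basis. Second
  countability identifies the product sigma-algebra of \<open>phase_prob\<close> with the Borel sets
  (\<open>borel_prod\<close>), so continuous functions on phase space become measurable.\<close>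

instance torus :: second_countable_topology
proof
  define B where "B = (\<lambda>(r, n). ball (to_torus (of_rat r)) (1 / real (Suc n))) ` (UNIV :: (rat \<times> nat) set)"
  have "countable B" unfolding B_def by (intro countable_image) auto
  moreover have "topological_basis B"
  proof (rule topological_basisI)
    show "open b" if "b \<in> B" for b using that by (auto simp: B_def)
    fix U :: "torus set" and x assume U: "open U" "x \<in> U"
    then obtain e where e: "e > 0" "ball x e \<subseteq> U" using open_contains_ball by blast
    obtain n where n: "inverse (real (Suc n)) < e / 2" using reals_Archimedean[of "e / 2"] e by auto
    obtain t where t: "x = to_torus t" by (rule torus_cases_unit)
    obtain r where r: "t < of_rat r" "of_rat r < t + 1 / real (Suc n)"
      using of_rat_dense[of t "t + 1 / real (Suc n)"] by auto
    have d: "dist (to_torus (of_rat r)) x < 1 / real (Suc n)"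
      unfolding t by (rule le_less_trans[OF dist_torus_le]) (use r in auto)
    show "\<exists>b\<in>B. x \<in> b \<and> b \<subseteq> U"
    proof (intro bexI conjI)
      show "x \<in> ball (to_torus (of_rat r)) (1 / real (Suc n))" using d by simp
      show "ball (to_torus (of_rat r)) (1 / real (Suc n)) \<subseteq> U"
      proof
        fix y assume "y \<in> ball (to_torus (of_rat r)) (1 / real (Suc n))"
        then have "dist x y < 1 / real (Suc n) + 1 / real (Suc n)"
          using dist_triangle[of x y "to_torus (of_rat r)"] d by (simp add: dist_commute)
        then have "dist x y < e" using n by (simp add: inverse_eq_divide)
        then show "y \<in> U" using e by auto
      qed
      show "ball (to_torus (of_rat r)) (1 / real (Suc n)) \<in> B" unfolding B_def by (rule image_eqI[of _ _ "(r, n)"]) auto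
    qed
  qed
  ultimately show "\<exists>B :: torus set set. countable B \<and> open = generate_topology B"
    using topological_basis_imp_subbasis by blast
qed

lemma sets_phase_lebesgue [simp, measurable_cong]: "sets phase_lebesgue = sets (borel \<Otimes>\<^sub>M borel)"
  unfolding phase_lebesgue_def by (intro sets_pair_measure_cong) auto

lemma space_phase_lebesgue [simp]: "space phase_lebesgue = UNIV"
  unfolding phase_lebesgue_def by (simp add: space_pair_measure)

interpretation phase: pair_sigma_finite torus_lebesgue "lborel :: real measure"
  by (intro pair_sigma_finite.intro lborel.sigma_finite_measure_axioms torus.sigma_finite_measure_axioms)

interpretation phase_sf: sigma_finite_measure phase_lebesgue
  unfolding phase_lebesgue_def by (rule phase.P.sigma_finite_measure_axioms)

lemma integrable_phase_prod:
  fixes f :: "torus \<Rightarrow> real" and g :: "real \<Rightarrow> real"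
  assumes "integrable torus_lebesgue f" "integrable lborel g"
  shows "integrable phase_lebesgue (\<lambda>(q, p). f q * g p)"
    and "(\<integral>(q, p). f q * g p \<partial>phase_lebesgue) = (\<integral>q. f q \<partial>torus_lebesgue) * (\<integral>p. g p \<partial>lborel)"
proof -
  have [measurable]: "f \<in> borel_measurable borel" "g \<in> borel_measurable borel" using assms by auto
  show i: "integrable phase_lebesgue (\<lambda>(q, p). f q * g p)"
    unfolding phase_lebesgue_def
    by (rule phase.Fubini_integrable) (use assms in \<open>auto simp: abs_mult\<close>)
  then show "(\<integral>(q, p). f q * g p \<partial>phase_lebesgue) = (\<integral>q. f q \<partial>torus_lebesgue) * (\<integral>p. g p \<partial>lborel)"
    unfolding phase_lebesgue_def by (subst phase.integral_fst'[symmetric]) auto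
qed

lemma integrable_phase_bound:
  fixes h :: "torus \<times> real \<Rightarrow> real" and g :: "real \<Rightarrow> real"
  assumes [measurable]: "h \<in> borel_measurable (borel \<Otimes>\<^sub>M borel)"
    and "integrable lborel g" "\<And>q p. \<bar>h (q, p)\<bar> \<le> g p"
  shows "integrable phase_lebesgue h"
proof (rule Bochner_Integration.integrable_bound)
  show "integrable phase_lebesgue (\<lambda>(q, p). 1 * g p)"
    by (rule integrable_phase_prod) (use assms in auto)
  show "AE x in phase_lebesgue. norm (h x) \<le> norm (case x of (q, p) \<Rightarrow> 1 * g p)"
    using assms(3) by (auto intro!: AE_I2 order_trans[OF assms(3) abs_ge_self])
qed measurable

lemma integral_dq_zero:
  assumes d: "\<And>q p. has_tderiv (\<lambda>q. f (q, p)) (f' (q, p)) q" and i: "integrable phase_lebesgue f'"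
  shows "(\<integral>x. f' x \<partial>phase_lebesgue) = 0"
proof -
  have i': "integrable (torus_lebesgue \<Otimes>\<^sub>M lborel) (\<lambda>(q, p). f' (q, p))"
    using i by (simp add: phase_lebesgue_def)
  have "AE p in lborel. integrable torus_lebesgue (\<lambda>q. f' (q, p))"
    using phase.AE_integrable_snd[OF i'] by simp
  then have "AE p in lborel. (\<integral>q. f' (q, p) \<partial>torus_lebesgue) = 0"
    by eventually_elim (rule integral_tderiv_zero[OF d])
  then have "(\<integral>p. (\<integral>q. f' (q, p) \<partial>torus_lebesgue) \<partial>lborel) = 0"
    by (rule integral_eq_zero_AE)
  then show ?thesis using phase.integral_snd[OF i'] by (simp add: phase_lebesgue_def)
qed

lemma integral_dp_zero:
  assumes d: "\<And>q p. ((\<lambda>p. f (q, p)) has_real_derivative f' (q, p)) (at p)"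
    and i: "integrable phase_lebesgue f" "integrable phase_lebesgue f'"
  shows "(\<integral>x. f' x \<partial>phase_lebesgue) = 0"
proof -
  have i': "integrable (torus_lebesgue \<Otimes>\<^sub>M lborel) f" "integrable (torus_lebesgue \<Otimes>\<^sub>M lborel) f'"
    using i by (simp_all add: phase_lebesgue_def)
  have "AE q in torus_lebesgue. (\<integral>p. f' (q, p) \<partial>lborel) = 0"
    using phase.AE_integrable_fst'[OF i'(1)] phase.AE_integrable_fst'[OF i'(2)]
    by eventually_elim (rule integral_deriv_zero[OF d])
  then have "(\<integral>q. (\<integral>p. f' (q, p) \<partial>lborel) \<partial>torus_lebesgue) = 0"
    by (rule integral_eq_zero_AE)
  then show ?thesis using phase.integral_fst'[OF i'(2)] by (simp add: phase_lebesgue_def)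
qed

lemma kappa_normal: "\<beta> > 0 \<Longrightarrow> kappa \<beta> = normal_density 0 (1 / sqrt \<beta>)"
  by (auto simp: kappa_def normal_density_def fun_eq_iff power_divide real_sqrt_divide real_sqrt_mult field_simps)

lemma kappa_pos: "\<beta> > 0 \<Longrightarrow> kappa \<beta> p > 0"
  by (simp add: kappa_def)

lemma kappa_measurable [measurable]: "kappa \<beta> \<in> borel_measurable borel"
  unfolding kappa_def[abs_def] by measurable

lemma DERIV_kappa: "(kappa \<beta> has_real_derivative - \<beta> * p * kappa \<beta> p) (at p)"
  unfolding kappa_def[abs_def] by (auto intro!: derivative_eq_intros)

lemma kappa_integrals:
  assumes "\<beta> > 0"
  shows "integrable lborel (kappa \<beta>)" "(\<integral>p. kappa \<beta> p \<partial>lborel) = 1"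
    "integrable lborel (\<lambda>p. kappa \<beta> p * p)" "(\<integral>p. kappa \<beta> p * p \<partial>lborel) = 0"
    "integrable lborel (\<lambda>p. kappa \<beta> p * p\<^sup>2)" "(\<integral>p. kappa \<beta> p * p\<^sup>2 \<partial>lborel) = 1 / \<beta>"
  using assms integrable_normal_moment[of "1 / sqrt \<beta>" 0 2] integral_normal_moment_even[of "1 / sqrt \<beta>" 0 1]
    integrable_normal_moment[of "1 / sqrt \<beta>" 0 1] integral_normal_moment_odd[of "1 / sqrt \<beta>" 0 0]
  by (simp_all add: kappa_normal power_divide)

section \<open>Gibbs measures with a general field\<close>

definition Zf :: "real \<Rightarrow> real \<Rightarrow> real" where
  "Zf X Y = (\<integral>q. exp (X * cos_2pi q + Y * sin_2pi q) \<partial>torus_lebesgue)"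

text \<open>Both Fourier components are kept: a steady state is identified before its sine mean is
  known to vanish, and a rotated Gibbs measure has a sine component as well.\<close>

definition wf :: "real \<Rightarrow> real \<Rightarrow> real \<Rightarrow> torus \<times> real \<Rightarrow> real" where
  "wf \<beta> X Y = (\<lambda>(q, p). exp (X * cos_2pi q + Y * sin_2pi q) / Zf X Y * kappa \<beta> p)"

text \<open>Amplitude and phase: every field is a translate of a pure cosine with nonnegative
  coefficient, which reduces its integrals to \<open>Z\<close> and \<open>Zn\<close>.\<close>

lemma polar_coordinates_torus:
  obtains h where "\<And>q. X * cos_2pi q + Y * sin_2pi q = sqrt (X\<^sup>2 + Y\<^sup>2) * cos_2pi (q - h)"
    "X = sqrt (X\<^sup>2 + Y\<^sup>2) * cos_2pi h" "Y = sqrt (X\<^sup>2 + Y\<^sup>2) * sin_2pi h"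
proof -
  define r where "r = sqrt (X\<^sup>2 + Y\<^sup>2)"
  have "\<exists>h. X = r * cos_2pi h \<and> Y = r * sin_2pi h"
  proof (cases "r = 0")
    case True
    then have "X\<^sup>2 + Y\<^sup>2 = 0" by (simp add: r_def)
    then have "X = 0 \<and> Y = 0" by (simp add: sum_power2_eq_zero_iff)
    then show ?thesis using True by simp
  next
    case False
    have "r\<^sup>2 = X\<^sup>2 + Y\<^sup>2" by (simp add: r_def)
    then have "(X / r)\<^sup>2 + (Y / r)\<^sup>2 = r\<^sup>2 / r\<^sup>2"
      by (simp add: power_divide add_divide_distrib[symmetric])
    then have "(X / r)\<^sup>2 + (Y / r)\<^sup>2 = 1" using False by simp
    then obtain t where "X / r = cos t" "Y / r = sin t" using sincos_total_2pi by metis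
    then show ?thesis using False by (intro exI[of _ "to_torus (t / (2 * pi))"]) (simp add: field_simps)
  qed
  then obtain h where h: "X = r * cos_2pi h" "Y = r * sin_2pi h" by blast
  have "X * cos_2pi q + Y * sin_2pi q = r * cos_2pi (q - h)" for q
    by (subst (1) h(1), subst (1) h(2)) (simp add: cos_2pi_diff algebra_simps)
  with h that show ?thesis by (metis r_def)
qed

text \<open>The integrand is, up to the factor \<open>- 2 * pi * a\<close>, the derivative of
  \<open>exp (a * cos_2pi q)\<close>; the factor degenerates at \<open>a = 0\<close>, where the sine
  itself is a derivative.\<close>

lemma integral_sin_exp_cos: "(\<integral>q. sin_2pi q * exp (a * cos_2pi q) \<partial>torus_lebesgue) = 0"
proof (cases "a = 0")
  case True
  have "(\<integral>q. - 2 * pi * sin_2pi q \<partial>torus_lebesgue) = 0"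
    by (rule integral_tderiv_zero[OF has_tderiv_cos_2pi]) (intro integrable_torus_continuous continuous_intros)
  then show ?thesis using True by simp
next
  case False
  have "(\<integral>q. (- 2 * pi * a) * (sin_2pi q * exp (a * cos_2pi q)) \<partial>torus_lebesgue) = 0"
  proof (rule integral_tderiv_zero)
    show "has_tderiv (\<lambda>q. exp (a * cos_2pi q)) ((- 2 * pi * a) * (sin_2pi q * exp (a * cos_2pi q))) q" for q
    proof -
      have "has_tderiv (\<lambda>q. exp (a * cos_2pi q)) (a * (- 2 * pi * sin_2pi q) * exp (a * cos_2pi q)) q"
        by (intro has_tderiv_exp has_tderiv_cmult has_tderiv_cos_2pi)
      then show ?thesis by (simp add: algebra_simps)
    qed
  qed (intro integrable_torus_continuous continuous_intros)
  then show ?thesis using False by simp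
qed

text \<open>The moments are multiplied by the modulus of the field because the phase is undetermined
  at zero field; in this form no division by the modulus occurs. Translating by the phase reduces
  them to \<open>integral_sin_exp_cos\<close> and \<open>Zn 1\<close>.\<close>

lemma Zf_eq: "Zf X Y = Z (sqrt (X\<^sup>2 + Y\<^sup>2))"
  and field_moments:
    "sqrt (X\<^sup>2 + Y\<^sup>2) * (\<integral>q. cos_2pi q * exp (X * cos_2pi q + Y * sin_2pi q) \<partial>torus_lebesgue) = X * Zn 1 (sqrt (X\<^sup>2 + Y\<^sup>2))"
    "sqrt (X\<^sup>2 + Y\<^sup>2) * (\<integral>q. sin_2pi q * exp (X * cos_2pi q + Y * sin_2pi q) \<partial>torus_lebesgue) = Y * Zn 1 (sqrt (X\<^sup>2 + Y\<^sup>2))"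
proof -
  define r where "r = sqrt (X\<^sup>2 + Y\<^sup>2)"
  obtain h where h: "\<And>q. X * cos_2pi q + Y * sin_2pi q = r * cos_2pi (q - h)"
     "X = r * cos_2pi h" "Y = r * sin_2pi h"
    using polar_coordinates_torus unfolding r_def by blast
  have *: "(\<integral>q. g q * exp (X * cos_2pi q + Y * sin_2pi q) \<partial>torus_lebesgue)
       = (\<integral>q. g (q + h) * exp (r * cos_2pi q) \<partial>torus_lebesgue)" if [measurable]: "g \<in> borel_measurable borel" for g
    unfolding h(1)
    by (subst integral_torus_shift[of "\<lambda>q. g q * exp (r * cos_2pi (q - h))" h, symmetric])
       (simp_all add: cos_2pi_diff)
  show "Zf X Y = Z (sqrt (X\<^sup>2 + Y\<^sup>2))"
    using *[of "\<lambda>_. 1"] by (simp add: Zf_def Z_def r_def)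
  have i: "integrable torus_lebesgue (\<lambda>q. sin_2pi q * exp (r * cos_2pi q))"
    "integrable torus_lebesgue (\<lambda>q. cos_2pi q * exp (r * cos_2pi q))"
    by (intro integrable_torus_continuous continuous_intros)+
  have Zn: "(\<integral>q. cos_2pi q * exp (r * cos_2pi q) \<partial>torus_lebesgue) = Zn 1 r" by (simp add: Zn_def)
  have "(\<integral>q. cos_2pi q * exp (X * cos_2pi q + Y * sin_2pi q) \<partial>torus_lebesgue) = cos_2pi h * Zn 1 r"
    unfolding *[OF measurable_cos_2pi] Zn[symmetric] cos_2pi_add
    using i integral_sin_exp_cos[of r] by (simp add: left_diff_distrib mult.assoc mult.left_commute[of _ "cos_2pi h"] mult.left_commute[of _ "sin_2pi h"])
  then have "r * (\<integral>q. cos_2pi q * exp (X * cos_2pi q + Y * sin_2pi q) \<partial>torus_lebesgue) = (r * cos_2pi h) * Zn 1 r"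
    by simp
  then show "sqrt (X\<^sup>2 + Y\<^sup>2) * (\<integral>q. cos_2pi q * exp (X * cos_2pi q + Y * sin_2pi q) \<partial>torus_lebesgue) = X * Zn 1 (sqrt (X\<^sup>2 + Y\<^sup>2))"
    unfolding r_def[symmetric] h(2)[symmetric] .
  have "(\<integral>q. sin_2pi q * exp (X * cos_2pi q + Y * sin_2pi q) \<partial>torus_lebesgue) = sin_2pi h * Zn 1 r"
    unfolding *[OF measurable_sin_2pi] Zn[symmetric] sin_2pi_add
    using i integral_sin_exp_cos[of r] by (simp add: distrib_right mult.assoc mult.left_commute[of _ "cos_2pi h"] mult.left_commute[of _ "sin_2pi h"])
  then have "r * (\<integral>q. sin_2pi q * exp (X * cos_2pi q + Y * sin_2pi q) \<partial>torus_lebesgue) = (r * sin_2pi h) * Zn 1 r"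
    by simp
  then show "sqrt (X\<^sup>2 + Y\<^sup>2) * (\<integral>q. sin_2pi q * exp (X * cos_2pi q + Y * sin_2pi q) \<partial>torus_lebesgue) = Y * Zn 1 (sqrt (X\<^sup>2 + Y\<^sup>2))"
    unfolding r_def[symmetric] h(3)[symmetric] .
qed

lemma Zf_pos: "Zf X Y > 0" by (simp add: Zf_eq Z_pos)

lemma wf_measurable [measurable]: "wf \<beta> X Y \<in> borel_measurable (borel \<Otimes>\<^sub>M borel)"
  unfolding wf_def by measurable

lemma wf_pos: "\<beta> > 0 \<Longrightarrow> wf \<beta> X Y x > 0"
  by (cases x) (simp add: wf_def Zf_pos kappa_pos)

lemma wf_integral:
  assumes "\<beta> > 0" "continuous_on UNIV f" "integrable lborel (\<lambda>p. kappa \<beta> p * g p)"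
  shows "integrable phase_lebesgue (\<lambda>(q, p). wf \<beta> X Y (q, p) * (f q * g p))"
    "(\<integral>(q, p). wf \<beta> X Y (q, p) * (f q * g p) \<partial>phase_lebesgue)
      = (\<integral>q. f q * exp (X * cos_2pi q + Y * sin_2pi q) \<partial>torus_lebesgue) / Zf X Y * (\<integral>p. kappa \<beta> p * g p \<partial>lborel)"
proof -
  have i: "integrable torus_lebesgue (\<lambda>q. f q * exp (X * cos_2pi q + Y * sin_2pi q) / Zf X Y)"
    using Zf_pos[of X Y] by (intro integrable_torus_continuous continuous_intros assms) auto
  have eq: "(\<lambda>(q, p). wf \<beta> X Y (q, p) * (f q * g p))
     = (\<lambda>(q, p). (f q * exp (X * cos_2pi q + Y * sin_2pi q) / Zf X Y) * (kappa \<beta> p * g p))"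
    by (auto simp: wf_def fun_eq_iff)
  show "integrable phase_lebesgue (\<lambda>(q, p). wf \<beta> X Y (q, p) * (f q * g p))"
    unfolding eq by (rule integrable_phase_prod[OF i assms(3)])
  show "(\<integral>(q, p). wf \<beta> X Y (q, p) * (f q * g p) \<partial>phase_lebesgue)
      = (\<integral>q. f q * exp (X * cos_2pi q + Y * sin_2pi q) \<partial>torus_lebesgue) / Zf X Y * (\<integral>p. kappa \<beta> p * g p \<partial>lborel)"
    unfolding eq integrable_phase_prod(2)[OF i assms(3)] by simp
qed

lemma wf_integral_1:
  assumes "\<beta> > 0"
  shows "integrable phase_lebesgue (wf \<beta> X Y)" "(\<integral>x. wf \<beta> X Y x \<partial>phase_lebesgue) = 1"
  using wf_integral[OF assms, of "\<lambda>_. 1" "\<lambda>_. 1" X Y] kappa_integrals[OF assms] Zf_pos[of X Y]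
  by (simp_all add: Zf_def split_beta')

lemma gibbs_eq: "gibbs \<beta> a = density phase_lebesgue (\<lambda>x. ennreal (wf \<beta> a 0 x))"
proof -
  have "Zf a 0 = Z a" by (simp add: Zf_def Z_def)
  then show ?thesis unfolding gibbs_def wf_def by (simp add: split_beta')
qed

section \<open>Test functions\<close>

text \<open>A class closed under differentiation, so that all the derivatives demanded by
  \<open>smooth_phase\<close> exist at once. The exponential brings in the von Mises kernel and the
  Gibbs weight, and the ring operations are those of the Stone-Weierstrass theorem.\<close>

inductive_set torus_elem :: "(torus \<Rightarrow> real) set" where
  const: "(\<lambda>q. k) \<in> torus_elem"
| cos: "cos_2pi \<in> torus_elem"
| sin: "sin_2pi \<in> torus_elem"
| add: "f \<in> torus_elem \<Longrightarrow> g \<in> torus_elem \<Longrightarrow> (\<lambda>q. f q + g q) \<in> torus_elem"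
| mult: "f \<in> torus_elem \<Longrightarrow> g \<in> torus_elem \<Longrightarrow> (\<lambda>q. f q * g q) \<in> torus_elem"
| exp: "f \<in> torus_elem \<Longrightarrow> (\<lambda>q. exp (f q)) \<in> torus_elem"

lemma torus_elem_continuous: "f \<in> torus_elem \<Longrightarrow> continuous_on S f"
  by (induction rule: torus_elem.induct) (auto intro!: continuous_intros)

lemma torus_elem_deriv: "f \<in> torus_elem \<Longrightarrow> \<exists>f'\<in>torus_elem. \<forall>q. has_tderiv f (f' q) q"
proof (induction rule: torus_elem.induct)
  case (const k)
  show ?case by (rule bexI[of _ "\<lambda>q. 0"]) (auto intro: torus_elem.const)
next
  case cos
  show ?case by (rule bexI[of _ "\<lambda>q. - 2 * pi * sin_2pi q"])
      (auto intro: has_tderiv_cos_2pi[simplified] torus_elem.intros torus_elem.mult[OF torus_elem.const torus_elem.sin, of "- 2 * pi", simplified])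
next
  case sin
  show ?case by (rule bexI[of _ "\<lambda>q. 2 * pi * cos_2pi q"])
      (auto intro: has_tderiv_sin_2pi torus_elem.intros)
next
  case (add f g)
  then obtain f' g' where "f' \<in> torus_elem" "g' \<in> torus_elem" "\<And>q. has_tderiv f (f' q) q" "\<And>q. has_tderiv g (g' q) q"
    by blast
  then show ?case by (intro bexI[of _ "\<lambda>q. f' q + g' q"]) (auto intro: has_tderiv_add torus_elem.add)
next
  case (mult f g)
  then obtain f' g' where "f' \<in> torus_elem" "g' \<in> torus_elem" "\<And>q. has_tderiv f (f' q) q" "\<And>q. has_tderiv g (g' q) q"
    by blast
  with mult.hyps show ?case by (intro bexI[of _ "\<lambda>q. f' q * g q + f q * g' q"])
     (auto intro: has_tderiv_mult torus_elem.add torus_elem.mult)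
next
  case (exp f)
  then obtain f' where "f' \<in> torus_elem" "\<And>q. has_tderiv f (f' q) q"
    by blast
  with exp.hyps show ?case by (intro bexI[of _ "\<lambda>q. f' q * exp (f q)"])
     (auto intro: has_tderiv_exp torus_elem.exp torus_elem.mult)
qed

text \<open>\<open>bump 0\<close> is the standard flat function exp (- 1 / x). The powers of x are
  included because derivatives then remain linear combinations of members of the family.\<close>

definition bump :: "nat \<Rightarrow> real \<Rightarrow> real" where
  "bump n x = (if x > 0 then exp (- 1 / x) / x ^ n else 0)"

lemma bump_pos: "x > 0 \<Longrightarrow> bump n x > 0" and bump_nonneg: "bump n x \<ge> 0"
  by (auto simp: bump_def)

lemma bump_tendsto_0: "(bump n \<longlongrightarrow> 0) (at_right 0)"
proof -
  have "((\<lambda>x. (inverse x) ^ n / exp (inverse x)) \<longlongrightarrow> (0::real)) (at_right 0)"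
    by (rule filterlim_compose[OF tendsto_power_div_exp_0 filterlim_inverse_at_top_right])
  then show ?thesis
    by (rule Lim_transform_eventually)
       (auto simp: eventually_at_right_field bump_def exp_minus field_simps inverse_eq_divide intro!: exI[of _ 1])
qed

lemma DERIV_bump: "(bump n has_real_derivative bump (n + 2) x - real n * bump (n + 1) x) (at x)"
proof -
  consider "x > 0" | "x < 0" | "x = 0" by linarith
  then show ?thesis
  proof cases
    case 1
    have "((\<lambda>x. exp (- 1 / x) / x ^ n) has_real_derivative bump (n + 2) x - real n * bump (n + 1) x) (at x)"
    proof -
      have "((\<lambda>x. exp (- 1 / x)) has_real_derivative exp (- 1 / x) / x\<^sup>2) (at x)"
        using 1 by (auto intro!: derivative_eq_intros simp: power2_eq_square)
      from DERIV_divide[OF this DERIV_pow[of n x UNIV]] 1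
      have "((\<lambda>x. exp (- 1 / x) / x ^ n) has_real_derivative
        (exp (- 1 / x) / x\<^sup>2 * x ^ n - exp (- 1 / x) * (real n * x ^ (n - Suc 0))) / (x ^ n * x ^ n)) (at x)"
        by simp
      also have "(exp (- 1 / x) / x\<^sup>2 * x ^ n - exp (- 1 / x) * (real n * x ^ (n - Suc 0))) / (x ^ n * x ^ n)
        = bump (n + 2) x - real n * bump (n + 1) x"
        using 1 by (cases n) (simp_all add: bump_def field_simps power2_eq_square)
      finally show ?thesis .
    qed
    then show ?thesis
      by (rule has_field_derivative_transform_within_open[of _ _ _ "{0<..}"]) (use 1 in \<open>auto simp: bump_def\<close>)
  next
    case 2
    have "((\<lambda>x. 0) has_real_derivative bump (n + 2) x - real n * bump (n + 1) x) (at x)"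
      using 2 by (simp add: bump_def)
    then show ?thesis
      by (rule has_field_derivative_transform_within_open[of _ _ _ "{..<0}"]) (use 2 in \<open>auto simp: bump_def\<close>)
  next
    case 3
    \<comment> \<open>At 0 the right difference quotient of \<open>bump n\<close> is
      \<open>bump (n + 1)\<close>.\<close>
    have "((\<lambda>h. bump n h / h) \<longlongrightarrow> 0) (at_right 0)"
      by (rule Lim_transform_eventually[OF bump_tendsto_0[of "n + 1"]])
         (auto simp: eventually_at_right_field bump_def intro!: exI[of _ 1])
    moreover have "((\<lambda>h. bump n h / h) \<longlongrightarrow> 0) (at_left 0)"
      by (rule tendsto_eventually) (auto simp: eventually_at_left_field bump_def intro!: exI[of _ "-1"])
    ultimately show ?thesis
      using 3 by (simp add: has_field_derivative_iff filterlim_split_at bump_def)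
  qed
qed

text \<open>The counterpart in \<open>p\<close>: \<open>bump\<close> yields compactly supported
  functions, \<open>inverse\<close> the rational kernel \<open>zeta\<close>.\<close>

inductive_set smooth_elem :: "(real \<Rightarrow> real) set" where
  const: "(\<lambda>q. k) \<in> smooth_elem"
| ident: "(\<lambda>x. x) \<in> smooth_elem"
| add: "f \<in> smooth_elem \<Longrightarrow> g \<in> smooth_elem \<Longrightarrow> (\<lambda>q. f q + g q) \<in> smooth_elem"
| mult: "f \<in> smooth_elem \<Longrightarrow> g \<in> smooth_elem \<Longrightarrow> (\<lambda>q. f q * g q) \<in> smooth_elem"
| inverse: "f \<in> smooth_elem \<Longrightarrow> (\<forall>x. f x \<noteq> 0) \<Longrightarrow> (\<lambda>q. inverse (f q)) \<in> smooth_elem"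
| bump: "f \<in> smooth_elem \<Longrightarrow> (\<lambda>q. bump n (f q)) \<in> smooth_elem"

lemma smooth_elem_deriv: "f \<in> smooth_elem \<Longrightarrow> \<exists>f'\<in>smooth_elem. \<forall>x. (f has_real_derivative f' x) (at x)"
proof (induction rule: smooth_elem.induct)
  case (const k)
  show ?case by (rule bexI[of _ "\<lambda>q. 0"]) (auto intro: smooth_elem.const)
next
  case ident
  show ?case by (rule bexI[of _ "\<lambda>q. 1"]) (auto intro: smooth_elem.const)
next
  case (add f g)
  then obtain f' g' where "f' \<in> smooth_elem" "g' \<in> smooth_elem" "\<And>q. DERIV f q :> f' q" "\<And>q. DERIV g q :> g' q"
    by blast
  then show ?case by (intro bexI[of _ "\<lambda>q. f' q + g' q"]) (auto intro: DERIV_add smooth_elem.add)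
next
  case (mult f g)
  then obtain f' g' where "f' \<in> smooth_elem" "g' \<in> smooth_elem" "\<And>q. DERIV f q :> f' q" "\<And>q. DERIV g q :> g' q"
    by blast
  with mult.hyps show ?case by (intro bexI[of _ "\<lambda>q. f' q * g q + g' q * f q"])
     (auto intro: DERIV_mult smooth_elem.add smooth_elem.mult)
next
  case (inverse f)
  then obtain f' where f': "f' \<in> smooth_elem" "\<And>q. DERIV f q :> f' q"
    by blast
  show ?case
  proof (rule bexI[of _ "\<lambda>q. (- 1) * (f' q * (inverse (f q) * inverse (f q)))"], intro allI)
    fix x
    show "DERIV (\<lambda>q. inverse (f q)) x :> (- 1) * (f' x * (inverse (f x) * inverse (f x)))"
      using DERIV_inverse_fun[OF f'(2), of x] inverse.hyps by (simp add: power2_eq_square divide_inverse mult_ac)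
  qed (intro smooth_elem.mult smooth_elem.const smooth_elem.inverse f' inverse.hyps)
next
  case (bump f n)
  then obtain f' where f': "f' \<in> smooth_elem" "\<And>q. DERIV f q :> f' q"
    by blast
  show ?case
  proof (rule bexI[of _ "\<lambda>q. (bump (n + 2) (f q) + (- real n) * bump (n + 1) (f q)) * f' q"], intro allI)
    fix x
    show "DERIV (\<lambda>q. bump n (f q)) x :> (bump (n + 2) (f x) + (- real n) * bump (n + 1) (f x)) * f' x"
      using DERIV_chain2[OF DERIV_bump f'(2)] by simp
  qed (intro smooth_elem.mult smooth_elem.add smooth_elem.const smooth_elem.bump f' bump.hyps)
qed

lemma smooth_elem_continuous: "f \<in> smooth_elem \<Longrightarrow> continuous_on S f"
  using smooth_elem_deriv[of f] by (metis DERIV_continuous_on has_field_derivative_at_within)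

lemma smooth_phase_product:
  assumes "A \<in> torus_elem" "B \<in> smooth_elem"
  shows "smooth_phase (\<lambda>(q, p). A q * B p)"
proof -
  \<comment> \<open>A derivative inside the class is chosen once for each function; iterating the
    choice produces the whole array of mixed derivatives of the product.\<close>
  define nA where "nA f = (SOME f'. f' \<in> torus_elem \<and> (\<forall>q. has_tderiv f (f' q) q))" for f
  define nB where "nB f = (SOME f'. f' \<in> smooth_elem \<and> (\<forall>x. (f has_real_derivative f' x) (at x)))" for f
  have nA: "nA f \<in> torus_elem \<and> (\<forall>q. has_tderiv f (nA f q) q)" if "f \<in> torus_elem" for f
  proof -
    have "\<exists>f'. f' \<in> torus_elem \<and> (\<forall>q. has_tderiv f (f' q) q)" using torus_elem_deriv[OF that] by blast
    from someI_ex[OF this] show ?thesis unfolding nA_def .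
  qed
  have nB: "nB f \<in> smooth_elem \<and> (\<forall>x. (f has_real_derivative nB f x) (at x))" if "f \<in> smooth_elem" for f
  proof -
    have "\<exists>f'. f' \<in> smooth_elem \<and> (\<forall>x. (f has_real_derivative f' x) (at x))"
      using smooth_elem_deriv[OF that] by blast
    from someI_ex[OF this] show ?thesis unfolding nB_def .
  qed
  define DA DB where "DA i = (nA ^^ i) A" and "DB j = (nB ^^ j) B" for i j
  have DA: "DA i \<in> torus_elem" for i using assms nA by (induction i) (auto simp: DA_def)
  have DB: "DB j \<in> smooth_elem" for j using assms nB by (induction j) (auto simp: DB_def)
  have DA': "has_tderiv (DA i) (DA (Suc i) q) q" for i q using nA[OF DA[of i]] by (simp add: DA_def)
  have DB': "(DB j has_real_derivative DB (Suc j) x) (at x)" for j x using nB[OF DB[of j]] by (simp add: DB_def)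
  show ?thesis
    unfolding smooth_phase_def
  proof (intro exI[of _ "\<lambda>i j (q, p). DA i q * DB j p"] conjI allI)
    show "(\<lambda>(q, p). DA 0 q * DB 0 p) = (\<lambda>(q, p). A q * B p)" by (simp add: DA_def DB_def)
    fix i j
    show "continuous_on UNIV (\<lambda>(q, p). DA i q * DB j p)"
      unfolding split_beta'
      by (intro continuous_on_mult continuous_on_compose2[OF torus_elem_continuous[OF DA[of i]], of UNIV]
          continuous_on_compose2[OF smooth_elem_continuous[OF DB[of j]], of UNIV] continuous_intros) auto
    fix q p
    show "((\<lambda>h. case (q + to_torus h, p) of (q, p) \<Rightarrow> DA i q * DB j p) has_real_derivative
            (case (q, p) of (q, p) \<Rightarrow> DA (Suc i) q * DB j p)) (at 0)"
      using DERIV_cmult_right[OF DA'[of i q, unfolded has_tderiv_def], of "DB j p"] by simp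
    show "((\<lambda>y. case (q, y) of (q, p) \<Rightarrow> DA i q * DB j p) has_real_derivative
            (case (q, p) of (q, p) \<Rightarrow> DA i q * DB (Suc j) p)) (at p)"
      using DERIV_cmult[OF DB'[of j p], of "DA i q"] by simp
  qed
qed

lemma test_function_product:
  assumes "A \<in> torus_elem" "B \<in> smooth_elem" "\<And>p. \<bar>p\<bar> > K \<Longrightarrow> B p = 0"
  shows "test_function (\<lambda>(q, p). A q * B p)"
  using smooth_phase_product[OF assms(1,2)] assms(3) by (auto simp: test_function_def)

section \<open>Steady states\<close>

definition mean_cos :: "(torus \<times> real) measure \<Rightarrow> real" where
  "mean_cos \<mu> = (\<integral>x. cos_2pi (fst x) \<partial>\<mu>)"

definition mean_sin :: "(torus \<times> real) measure \<Rightarrow> real" where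
  "mean_sin \<mu> = (\<integral>x. sin_2pi (fst x) \<partial>\<mu>)"

text \<open>By the addition formula the force of the cosine interaction sees only the first Fourier
  mode of the measure, so the drift has just two parameters.\<close>

definition drift :: "real \<Rightarrow> (torus \<times> real) measure \<Rightarrow> torus \<Rightarrow> real" where
  "drift \<eta> \<mu> q = 2 * pi * ((\<eta> + mean_cos \<mu>) * sin_2pi q - mean_sin \<mu> * cos_2pi q)"

lemma phase_prob_measurable:
  assumes "phase_prob \<mu>" shows "measurable \<mu> N = measurable (borel \<Otimes>\<^sub>M borel) N"
  using assms by (intro measurable_cong_sets) (auto simp: phase_prob_def)

lemma phase_prob_integrable_bounded:
  fixes f :: "torus \<times> real \<Rightarrow> real"
  assumes "phase_prob \<mu>" "f \<in> borel_measurable (borel \<Otimes>\<^sub>M borel)" "\<And>x. \<bar>f x\<bar> \<le> C"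
  shows "integrable \<mu> f"
  using assms by (intro integrable_bounded[of _ _ C])
     (auto simp: phase_prob_measurable phase_prob_def prob_space_def)

lemma position_marginal_integral:
  fixes f :: "torus \<Rightarrow> real"
  assumes "phase_prob \<mu>" and [measurable]: "f \<in> borel_measurable borel"
  shows "(\<integral>q. f q \<partial>position_marginal \<mu>) = (\<integral>x. f (fst x) \<partial>\<mu>)"
  unfolding position_marginal_def
  by (rule integral_distr) (simp_all add: phase_prob_measurable[OF assms(1)])

lemma torus_deriv_V: "torus_deriv (V \<eta>) q = 2 * pi * \<eta> * sin_2pi q"
  unfolding V_def[abs_def] using has_tderiv_cmult[OF has_tderiv_cos_2pi, of "- \<eta>" q] by (intro torus_deriv_eq) (simp add: mult_ac)

lemma torus_deriv_W: "torus_deriv W q = 2 * pi * sin_2pi q"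
  unfolding W_def[abs_def] using has_tderiv_cmult[OF has_tderiv_cos_2pi, of "- 1" q] by (intro torus_deriv_eq) simp

lemma integrable_cos_sin:
  assumes "phase_prob \<mu>"
  shows "integrable \<mu> (\<lambda>x. cos_2pi (fst x))" "integrable \<mu> (\<lambda>x. sin_2pi (fst x))"
  by (rule phase_prob_integrable_bounded[OF assms, of _ 1]; simp)+

lemma drift_eq:
  assumes "phase_prob \<mu>"
  shows "torus_deriv (V \<eta>) q + (torus_deriv W \<star> position_marginal \<mu>) q = drift \<eta> \<mu> q"
proof -
  have "(torus_deriv W \<star> position_marginal \<mu>) q = (\<integral>x. 2 * pi * sin_2pi (q - fst x) \<partial>\<mu>)"
    unfolding torus_conv_def torus_deriv_W
    by (rule position_marginal_integral[OF assms]) (simp add: sin_2pi_diff)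
  also have "\<dots> = 2 * pi * (sin_2pi q * mean_cos \<mu> - cos_2pi q * mean_sin \<mu>)"
    using integrable_cos_sin[OF assms] by (simp add: sin_2pi_diff mean_cos_def mean_sin_def)
  finally show ?thesis by (simp add: torus_deriv_V drift_def algebra_simps)
qed

lemma W_conv_eq:
  assumes "phase_prob \<mu>"
  shows "(W \<star> position_marginal \<mu>) q = - (mean_cos \<mu> * cos_2pi q + mean_sin \<mu> * sin_2pi q)"
proof -
  have "(W \<star> position_marginal \<mu>) q = (\<integral>x. - cos_2pi (q - fst x) \<partial>\<mu>)"
    unfolding torus_conv_def W_def
    by (rule position_marginal_integral[OF assms]) (simp add: cos_2pi_diff)
  also have "\<dots> = - (cos_2pi q * mean_cos \<mu> + sin_2pi q * mean_sin \<mu>)"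
    using integrable_cos_sin[OF assms] by (simp add: cos_2pi_diff mean_cos_def mean_sin_def)
  finally show ?thesis by (simp add: mult.commute)
qed

text \<open>A constant curve has derivative 0, and derivatives within \<open>{0..}\<close> are
  unique, also at the endpoint 0, as restriction to \<open>{t..t+1}\<close> shows.\<close>

lemma steady_state_iff:
  "steady_state \<gamma> \<beta> \<eta> \<mu> \<longleftrightarrow> phase_prob \<mu> \<and>
    (\<forall>\<phi>. test_function \<phi> \<longrightarrow> (\<integral>x. vfp_generator \<gamma> \<beta> \<eta> \<mu> \<phi> x \<partial>\<mu>) = 0)"
proof -
  have "(((\<lambda>s. c) has_real_derivative d) (at t within {0..})) \<longleftrightarrow> d = 0" if "t \<ge> 0" for c d t :: real
  proof
    assume d: "((\<lambda>s. c) has_real_derivative d) (at t within {0..})"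
    have "((\<lambda>s. c) has_real_derivative d) (at t within {t..t+1})"
      by (rule DERIV_subset[OF d]) (use that in auto)
    moreover have "((\<lambda>s. c) has_real_derivative 0) (at t within {t..t+1})" by simp
    ultimately show "d = 0"
      using vector_derivative_unique_within_closed_interval[of t "t+1" t "\<lambda>s. c" d 0]
      by (simp add: has_real_derivative_iff_has_vector_derivative cbox_interval)
  qed simp
  then show ?thesis unfolding steady_state_def vfp_solution_def
    by (metis order_refl)
qed

lemma integral_gibbs:
  assumes "\<beta> > 0" and [measurable]: "f \<in> borel_measurable (borel \<Otimes>\<^sub>M borel)"
  shows "(\<integral>x. f x \<partial>gibbs \<beta> a) = (\<integral>x. wf \<beta> a 0 x * f x \<partial>phase_lebesgue)"
  unfolding gibbs_eq using wf_pos[OF assms(1)]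
  by (subst integral_real_density) (auto simp: less_imp_le)

lemma phase_prob_density:
  fixes f :: "torus \<times> real \<Rightarrow> real"
  assumes "\<And>x. f x \<ge> 0" "integrable phase_lebesgue f" "(\<integral>x. f x \<partial>phase_lebesgue) = 1"
  shows "phase_prob (density phase_lebesgue (\<lambda>x. ennreal (f x)))"
proof -
  have "prob_space (density phase_lebesgue (\<lambda>x. ennreal (f x)))"
  proof (rule prob_spaceI)
    have [measurable]: "f \<in> borel_measurable (borel \<Otimes>\<^sub>M borel)"
      using borel_measurable_integrable[OF assms(2)] by simp
    have "emeasure (density phase_lebesgue (\<lambda>x. ennreal (f x))) UNIV = (\<integral>\<^sup>+x. ennreal (f x) * indicator UNIV x \<partial>phase_lebesgue)"
      by (rule emeasure_density) (use sets.top[of phase_lebesgue] in simp_all)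
    also have "\<dots> = 1"
      using assms by (simp add: nn_integral_eq_integral)
    finally show "emeasure (density phase_lebesgue (\<lambda>x. ennreal (f x))) (space (density phase_lebesgue (\<lambda>x. ennreal (f x)))) = 1"
      by simp
  qed
  then show ?thesis by (simp add: phase_prob_def)
qed

lemma phase_prob_wf: "\<beta> > 0 \<Longrightarrow> phase_prob (density phase_lebesgue (\<lambda>x. ennreal (wf \<beta> X Y x)))"
  by (rule phase_prob_density) (simp_all add: wf_integral_1 less_imp_le[OF wf_pos])

lemma phase_prob_gibbs: "\<beta> > 0 \<Longrightarrow> phase_prob (gibbs \<beta> a)"
  unfolding gibbs_eq by (rule phase_prob_wf)

lemma mean_density_wf:
  assumes "\<beta> > 0"
  shows "sqrt (X\<^sup>2 + Y\<^sup>2) * mean_cos (density phase_lebesgue (\<lambda>x. ennreal (wf \<beta> X Y x))) = X * R (sqrt (X\<^sup>2 + Y\<^sup>2))"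
    "sqrt (X\<^sup>2 + Y\<^sup>2) * mean_sin (density phase_lebesgue (\<lambda>x. ennreal (wf \<beta> X Y x))) = Y * R (sqrt (X\<^sup>2 + Y\<^sup>2))"
proof -
  have *: "(\<integral>x. f (fst x) \<partial>density phase_lebesgue (\<lambda>x. ennreal (wf \<beta> X Y x)))
      = (\<integral>q. f q * exp (X * cos_2pi q + Y * sin_2pi q) \<partial>torus_lebesgue) / Zf X Y"
    if f: "continuous_on UNIV f" for f :: "torus \<Rightarrow> real"
  proof -
    have [measurable]: "f \<in> borel_measurable borel" using f by (rule borel_measurable_continuous_onI)
    have "(\<integral>x. f (fst x) \<partial>density phase_lebesgue (\<lambda>x. ennreal (wf \<beta> X Y x)))
       = (\<integral>x. wf \<beta> X Y x * f (fst x) \<partial>phase_lebesgue)"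
      by (subst integral_real_density) (auto simp: less_imp_le[OF wf_pos[OF assms]])
    then show ?thesis
      using wf_integral(2)[OF assms f, of "\<lambda>_. 1" X Y] kappa_integrals[OF assms] by (simp add: split_beta')
  qed
  have "continuous_on UNIV cos_2pi" "continuous_on UNIV sin_2pi" by (intro continuous_intros)+
  with field_moments[of X Y] show
    "sqrt (X\<^sup>2 + Y\<^sup>2) * mean_cos (density phase_lebesgue (\<lambda>x. ennreal (wf \<beta> X Y x))) = X * R (sqrt (X\<^sup>2 + Y\<^sup>2))"
    "sqrt (X\<^sup>2 + Y\<^sup>2) * mean_sin (density phase_lebesgue (\<lambda>x. ennreal (wf \<beta> X Y x))) = Y * R (sqrt (X\<^sup>2 + Y\<^sup>2))"
    unfolding mean_cos_def mean_sin_def by (simp_all add: * Zf_eq Z_eq R_def)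
qed

lemma mean_wf_0:
  assumes "\<beta> > 0"
  shows "mean_cos (gibbs \<beta> a) = R a" "mean_sin (gibbs \<beta> a) = 0"
proof -
  have c: "continuous_on UNIV cos_2pi" "continuous_on UNIV sin_2pi" by (intro continuous_intros)+
  have Z: "Zf a 0 = Zn 0 a" by (simp add: Zf_def Zn_def)
  have "mean_cos (gibbs \<beta> a) = (\<integral>x. wf \<beta> a 0 x * cos_2pi (fst x) \<partial>phase_lebesgue)"
    unfolding mean_cos_def by (rule integral_gibbs[OF assms]) measurable
  also have "\<dots> = (\<integral>q. cos_2pi q * exp (a * cos_2pi q) \<partial>torus_lebesgue) / Zn 0 a"
    using wf_integral(2)[OF assms c(1), of "\<lambda>_. 1" a 0] kappa_integrals[OF assms] by (simp add: split_beta' Z)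
  finally show "mean_cos (gibbs \<beta> a) = R a" by (simp add: R_def Zn_def)
  have "mean_sin (gibbs \<beta> a) = (\<integral>x. wf \<beta> a 0 x * sin_2pi (fst x) \<partial>phase_lebesgue)"
    unfolding mean_sin_def by (rule integral_gibbs[OF assms]) measurable
  also have "\<dots> = (\<integral>q. sin_2pi q * exp (a * cos_2pi q) \<partial>torus_lebesgue) / Zn 0 a"
    using wf_integral(2)[OF assms c(2), of "\<lambda>_. 1" a 0] kappa_integrals[OF assms] by (simp add: split_beta' Z)
  finally show "mean_sin (gibbs \<beta> a) = 0" by (simp add: integral_sin_exp_cos)
qed

lemma continuous_on_case_prod_I: "continuous_on UNIV (\<lambda>x. f (fst x) (snd x)) \<Longrightarrow> continuous_on UNIV (\<lambda>(q, p). f q p)"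
  by (simp add: split_beta')

lemma compact_support_bounded:
  fixes f :: "torus \<times> real \<Rightarrow> real"
  assumes c: "continuous_on UNIV f" and K: "\<And>q p. \<bar>p\<bar> > K \<Longrightarrow> f (q, p) = 0"
  shows "\<exists>C. \<forall>q p. \<bar>f (q, p)\<bar> \<le> C * indicator {- K..K} p"
proof -
  have "compact ((UNIV :: torus set) \<times> {- K..K})" by (intro compact_Times compact_torus compact_Icc)
  then have "bounded (f ` (UNIV \<times> {- K..K}))"
    by (intro compact_imp_bounded compact_continuous_image continuous_on_subset[OF c]) auto
  then obtain C where C: "\<And>x. x \<in> UNIV \<times> {- K..K} \<Longrightarrow> \<bar>f x\<bar> \<le> C" by (auto simp: bounded_iff)
  have "\<bar>f (q, p)\<bar> \<le> C * indicator {- K..K} p" for q p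
    using C[of "(q, p)"] K[of p q] by (cases "p \<in> {- K..K}") (auto simp: indicator_def abs_le_iff)
  then show ?thesis by blast
qed

lemma compact_support_integrable:
  fixes f :: "torus \<times> real \<Rightarrow> real"
  assumes c: "continuous_on UNIV f" and K: "\<And>q p. \<bar>p\<bar> > K \<Longrightarrow> f (q, p) = 0"
  shows "integrable phase_lebesgue f"
proof -
  obtain C where "\<And>q p. \<bar>f (q, p)\<bar> \<le> C * indicator {- K..K} p"
    using compact_support_bounded[OF c K] by blast
  then show ?thesis
  proof (rule integrable_phase_bound[rotated 2])
    show "f \<in> borel_measurable (borel \<Otimes>\<^sub>M borel)"
      unfolding borel_prod by (rule borel_measurable_continuous_onI[OF c])
    show "integrable lborel (\<lambda>p. C * indicator {- K..K} p)"
      by (intro integrable_mult_right integrable_real_indicator) (auto simp: emeasure_lborel_Icc_eq)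
  qed
qed

text \<open>For a root the drift equals \<open>2 * pi * a / \<beta> * sin_2pi q\<close>, so the
  Gibbs density \<open>w\<close> has logarithmic derivatives \<open>- \<beta> * dr q\<close> and
  \<open>- \<beta> * p\<close>. The density times the generator is then a combination of exact
  derivatives.\<close>

lemma gibbs_steady:
  assumes b: "\<beta> > 0" and r: "root \<beta> \<eta> a"
  shows "steady_state \<gamma> \<beta> \<eta> (gibbs \<beta> a)"
  unfolding steady_state_iff
proof (intro conjI allI impI)
  show pp: "phase_prob (gibbs \<beta> a)" by (rule phase_prob_gibbs[OF b])
  define w where "w = (\<lambda>q p. exp (a * cos_2pi q) / Zf a 0 * kappa \<beta> p)"
  define dr where "dr = drift \<eta> (gibbs \<beta> a)"
  have dr: "dr q = 2 * pi * a / \<beta> * sin_2pi q" for q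
  proof -
    have "a / \<beta> = \<eta> + R a" using r b by (simp add: root_def field_simps)
    then show ?thesis by (simp add: dr_def drift_def mean_wf_0[OF b] times_divide_eq_right[symmetric] mult.assoc del: times_divide_eq_right)
  qed
  have wq: "has_tderiv (\<lambda>q. w q p) (- \<beta> * dr q * w q p) q" for q p
    unfolding w_def divide_inverse using b
    by (auto simp: has_tderiv_def dr intro!: derivative_eq_intros has_tderiv_cos_2pi[unfolded has_tderiv_def])
  have wp: "((\<lambda>p. w q p) has_real_derivative - \<beta> * p * w q p) (at p)" for q p
    unfolding w_def using DERIV_cmult[OF DERIV_kappa, of "exp (a * cos_2pi q) / Zf a 0" \<beta> p] by (simp add: mult_ac)
  have wc: "continuous_on UNIV (\<lambda>x. w (fst x) (snd x))"
    unfolding w_def kappa_def by (intro continuous_intros) (simp_all add: Zf_pos less_imp_neq[symmetric])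
  have drc: "continuous_on UNIV (\<lambda>x. dr (fst x))"
    unfolding dr by (intro continuous_intros)
  fix \<phi> assume "test_function \<phi>"
  then obtain D K where D0: "D 0 0 = \<phi>" and D: "\<forall>i j. continuous_on UNIV (D i j) \<and>
       (\<forall>q p. ((\<lambda>h. D i j (q + to_torus h, p)) has_real_derivative D (Suc i) j (q, p)) (at 0) \<and>
              ((\<lambda>y. D i j (q, y)) has_real_derivative D i (Suc j) (q, p)) (at p))"
    and K: "\<And>q p. \<bar>p\<bar> > K \<Longrightarrow> \<phi> (q, p) = 0"
    unfolding test_function_def smooth_phase_def by blast
  have c: "continuous_on UNIV (D i j)" for i j using D by simp
  have dq: "((\<lambda>h. D i j (q + to_torus h, p)) has_real_derivative D (Suc i) j (q, p)) (at 0)" for i j q p using D by simp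
  have dp: "((\<lambda>y. D i j (q, y)) has_real_derivative D i (Suc j) (q, p)) (at p)" for i j q p using D by simp
  define u where "u q p = D 0 0 (q, p)" for q p
  define uq where "uq q p = D 1 0 (q, p)" for q p
  define up where "up q p = D 0 1 (q, p)" for q p
  define upp where "upp q p = D 0 2 (q, p)" for q p
  have uq: "has_tderiv (\<lambda>q. u q p) (uq q p) q" for q p
    using dq[of 0 0 q p] by (simp add: has_tderiv_def u_def uq_def)
  have up: "((\<lambda>p. u q p) has_real_derivative up q p) (at p)" for q p
    using dp[of 0 0 q p] by (simp add: u_def up_def)
  have upp: "((\<lambda>p. up q p) has_real_derivative upp q p) (at p)" for q p
    using dp[of 0 1 q p] by (simp add: up_def upp_def numeral_2_eq_2)
  have cont: "continuous_on UNIV (\<lambda>x. u (fst x) (snd x))" "continuous_on UNIV (\<lambda>x. uq (fst x) (snd x))"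
     "continuous_on UNIV (\<lambda>x. up (fst x) (snd x))" "continuous_on UNIV (\<lambda>x. upp (fst x) (snd x))"
    by (simp_all add: u_def uq_def up_def upp_def c)
  have u0: "u q p = 0" if "\<bar>p\<bar> > K" for q p using K[OF that] by (simp add: u_def D0)
  have uq0: "uq q p = 0" if "\<bar>p\<bar> > K" for q p
  proof -
    have "((\<lambda>h. 0) has_real_derivative uq q p) (at 0)"
      using uq[of p q] u0[OF that] by (simp add: has_tderiv_def)
    then show ?thesis using DERIV_unique[OF _ DERIV_const] by blast
  qed
  \<comment> \<open>The functions \<open>D i j\<close> are known only as derivatives; their support
    in \<open>p\<close> is inherited because \<open>\<phi>\<close> vanishes on the open set beyond
    \<open>K\<close>.\<close>
  have deriv0: "f' p = 0" if p: "\<bar>p\<bar> > K" and d: "(f has_real_derivative f' p) (at p)" and z: "\<And>p. \<bar>p\<bar> > K \<Longrightarrow> f p = 0"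
    for f f' :: "real \<Rightarrow> real" and p
  proof -
    have "open {p :: real. \<bar>p\<bar> > K}" by (intro open_Collect_less continuous_intros)
    then have "((\<lambda>p. 0) has_real_derivative f' p) (at p)"
      using has_field_derivative_transform_within_open[OF d, of "{p. \<bar>p\<bar> > K}" "\<lambda>_. 0"] p z by auto
    then show ?thesis using DERIV_unique[OF _ DERIV_const] by blast
  qed
  have up0: "up q p = 0" if "\<bar>p\<bar> > K" for q p using deriv0[of p "u q" "up q"] that up u0 by blast
  have upp0: "upp q p = 0" if "\<bar>p\<bar> > K" for q p using deriv0[of p "up q" "upp q"] that upp up0 by blast
  have gen: "vfp_generator \<gamma> \<beta> \<eta> (gibbs \<beta> a) \<phi> (q, p)
      = p * uq q p - dr q * up q p + \<gamma> * (- p * up q p + 1 / \<beta> * upp q p)" for q p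
  proof -
    have 1: "d_q \<phi> (q, p) = uq q p" for q p
      unfolding d_q_def using torus_deriv_eq[OF uq[of p q]] by (simp add: u_def D0)
    have 2: "d_p \<phi> = (\<lambda>(q, p). up q p)"
      unfolding d_p_def using DERIV_imp_deriv[OF up] by (auto simp: u_def D0 fun_eq_iff)
    have 3: "d_p (d_p \<phi>) (q, p) = upp q p" for q p
      unfolding 2 unfolding d_p_def using DERIV_imp_deriv[OF upp] by simp
    show ?thesis
      unfolding vfp_generator_def by (simp add: 1 3 fun_cong[OF 2] drift_eq[OF pp] dr_def)
  qed
  \<comment> \<open>The derivatives of \<open>p u w\<close> in q, and of \<open>dr u w\<close> and
    \<open>up w\<close> in p. In \<open>f1 - f2\<close> the contributions of the derivatives of
    \<open>w\<close> cancel.\<close>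
  define f1 where "f1 = (\<lambda>(q, p). p * (uq q p * w q p + u q p * (- \<beta> * dr q * w q p)))"
  define f2 where "f2 = (\<lambda>(q, p). dr q * (up q p * w q p + u q p * (- \<beta> * p * w q p)))"
  define f3 where "f3 = (\<lambda>(q, p). upp q p * w q p + up q p * (- \<beta> * p * w q p))"
  have i1: "integrable phase_lebesgue f1"
    unfolding f1_def
    by (rule compact_support_integrable[where K=K], rule continuous_on_case_prod_I)
       (intro continuous_intros cont wc drc, simp add: uq0 u0)
  have i2: "integrable phase_lebesgue f2"
    unfolding f2_def
    by (rule compact_support_integrable[where K=K], rule continuous_on_case_prod_I)
       (intro continuous_intros cont wc drc, simp add: up0 u0)
  have i3: "integrable phase_lebesgue f3"
    unfolding f3_def
    by (rule compact_support_integrable[where K=K], rule continuous_on_case_prod_I)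
       (intro continuous_intros cont wc drc, simp add: upp0 up0)
  have I1: "(\<integral>x. f1 x \<partial>phase_lebesgue) = 0"
  proof (rule integral_dq_zero[OF _ i1])
    show "has_tderiv (\<lambda>q. (case (q, p) of (q, p) \<Rightarrow> p * (u q p * w q p))) (f1 (q, p)) q" for q p
      using has_tderiv_cmult[OF has_tderiv_mult[OF uq[of p q] wq[of p q]], of p] by (simp add: f1_def)
  qed
  have I2: "(\<integral>x. f2 x \<partial>phase_lebesgue) = 0"
  proof (rule integral_dp_zero[OF _ _ i2])
    show "((\<lambda>p. (case (q, p) of (q, p) \<Rightarrow> dr q * (u q p * w q p))) has_real_derivative (f2 (q, p))) (at p)" for q p
      using DERIV_cmult[OF DERIV_mult[OF up[of q p] wp[of q p]], of "dr q"] by (simp add: f2_def algebra_simps)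
    show "integrable phase_lebesgue (\<lambda>(q, p). dr q * (u q p * w q p))"
      by (rule compact_support_integrable[where K=K], rule continuous_on_case_prod_I)
         (intro continuous_intros cont wc drc, simp add: u0)
  qed
  have I3: "(\<integral>x. f3 x \<partial>phase_lebesgue) = 0"
  proof (rule integral_dp_zero[OF _ _ i3])
    show "((\<lambda>p. (case (q, p) of (q, p) \<Rightarrow> up q p * w q p)) has_real_derivative (f3 (q, p))) (at p)" for q p
      using DERIV_mult[OF upp[of q p] wp[of q p]] by (simp add: f3_def algebra_simps)
    show "integrable phase_lebesgue (\<lambda>(q, p). up q p * w q p)"
      by (rule compact_support_integrable[where K=K], rule continuous_on_case_prod_I)
         (intro continuous_intros cont wc drc, simp add: up0)
  qed
  have m: "vfp_generator \<gamma> \<beta> \<eta> (gibbs \<beta> a) \<phi> \<in> borel_measurable (borel \<Otimes>\<^sub>M borel)"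
  proof -
    have "vfp_generator \<gamma> \<beta> \<eta> (gibbs \<beta> a) \<phi> = (\<lambda>(q, p). p * uq q p - dr q * up q p + \<gamma> * (- p * up q p + 1 / \<beta> * upp q p))"
      using gen by auto
    moreover have "continuous_on UNIV (\<lambda>(q, p). p * uq q p - dr q * up q p + \<gamma> * (- p * up q p + 1 / \<beta> * upp q p))"
      by (rule continuous_on_case_prod_I) (intro continuous_intros cont drc)
    ultimately show ?thesis unfolding borel_prod by (simp add: borel_measurable_continuous_onI)
  qed
  have "(\<integral>x. vfp_generator \<gamma> \<beta> \<eta> (gibbs \<beta> a) \<phi> x \<partial>gibbs \<beta> a)
     = (\<integral>x. wf \<beta> a 0 x * vfp_generator \<gamma> \<beta> \<eta> (gibbs \<beta> a) \<phi> x \<partial>phase_lebesgue)"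
    by (rule integral_gibbs[OF b m])
  also have "\<dots> = (\<integral>x. f1 x - f2 x + \<gamma> / \<beta> * f3 x \<partial>phase_lebesgue)"
  proof (rule Bochner_Integration.integral_cong[OF refl])
    fix x :: "torus \<times> real"
    obtain q p where x: "x = (q, p)" by (cases x)
    have w: "wf \<beta> a 0 x = w q p" by (simp add: x wf_def w_def)
    show "wf \<beta> a 0 x * vfp_generator \<gamma> \<beta> \<eta> (gibbs \<beta> a) \<phi> x = f1 x - f2 x + \<gamma> / \<beta> * f3 x"
      unfolding w using b by (simp add: x gen f1_def f2_def f3_def field_simps)
  qed
  also have "\<dots> = 0" using i1 i2 i3 by (simp add: I1 I2 I3)
  finally show "(\<integral>x. vfp_generator \<gamma> \<beta> \<eta> (gibbs \<beta> a) \<phi> x \<partial>gibbs \<beta> a) = 0" .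
qed

section \<open>Uniqueness for the stationary linear equation\<close>

text \<open>With t = 1 / x this is t^n / n! \<le> exp t, a single term of the exponential
  series.\<close>

lemma bump_le_fact: "bump n x \<le> fact n"
proof (cases "x > 0")
  case True
  define t where "t = 1 / x"
  have t: "t > 0" using True by (simp add: t_def)
  have "t ^ n / fact n \<le> exp t"
  proof -
    have "(\<lambda>k. t ^ k /\<^sub>R fact k) sums exp t" by (rule exp_converges)
    then have s: "summable (\<lambda>k. t ^ k /\<^sub>R fact k)" "exp t = (\<Sum>k. t ^ k /\<^sub>R fact k)"
      by (auto simp: sums_iff)
    have "sum (\<lambda>k. t ^ k /\<^sub>R fact k) {n} \<le> (\<Sum>k. t ^ k /\<^sub>R fact k)"
      by (rule sum_le_suminf[OF s(1)]) (use t in auto)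
    then show ?thesis using s by (simp add: divide_inverse mult.commute)
  qed
  then have "t ^ n * exp (- t) \<le> fact n"
    by (simp add: exp_minus field_simps)
  then show ?thesis using True by (simp add: bump_def t_def power_divide)
qed (simp add: bump_def)

lemma continuous_on_bump [continuous_intros]:
  assumes "continuous_on S f" shows "continuous_on S (\<lambda>x. bump n (f x))"
proof -
  have "continuous_on UNIV (bump n)"
    by (rule DERIV_continuous_on[OF has_field_derivative_at_within[OF DERIV_bump]])
  then show ?thesis using continuous_on_compose2[OF _ assms] by blast
qed

lemma bump_tendsto: "(f \<longlongrightarrow> l) F \<Longrightarrow> ((\<lambda>x. bump n (f x)) \<longlongrightarrow> bump n l) F"
  using isCont_tendsto_compose[OF DERIV_isCont[OF DERIV_bump]] by blast

text \<open>The offset \<open>1/2\<close> keeps the argument of \<open>bump\<close> in \<open>(-\<infinity>, 1/2]\<close>, where \<open>bump 2\<close>, the derivative of \<open>bump 0\<close>,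
  is increasing.\<close>

definition cutoff :: "nat \<Rightarrow> real \<Rightarrow> real \<Rightarrow> real" where
  "cutoff n K y = bump n (1 / 2 - (y / K)\<^sup>2)"

lemma cutoff_smooth: "cutoff n K \<in> smooth_elem"
proof -
  have "(\<lambda>y. 1 / 2 + (- 1 / K\<^sup>2) * (y * y)) \<in> smooth_elem"
    by (intro smooth_elem.add smooth_elem.mult smooth_elem.const smooth_elem.ident)
  from smooth_elem.bump[OF this, of n] show ?thesis
    unfolding cutoff_def[abs_def] by (simp add: power_divide power2_eq_square)
qed

lemma cutoff_bounds: "0 \<le> cutoff n K y" "cutoff n K y \<le> fact n"
  by (simp_all add: cutoff_def bump_nonneg bump_le_fact)

lemma cutoff_0: "K > 0 \<Longrightarrow> \<bar>y\<bar> \<ge> K \<Longrightarrow> cutoff n K y = 0"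
proof -
  assume "K > 0" "\<bar>y\<bar> \<ge> K"
  then have "1 \<le> \<bar>y / K\<bar>" by simp
  then have "1 \<le> (y / K)\<^sup>2" using abs_le_square_iff[of 1 "y / K"] by simp
  then show ?thesis by (simp add: cutoff_def bump_def)
qed

lemma DERIV_cutoff: "(cutoff n K has_real_derivative
    - 2 * y / K\<^sup>2 * (cutoff (n + 2) K y - real n * cutoff (n + 1) K y)) (at y)"
proof -
  have "((\<lambda>y. 1 / 2 - (y / K)\<^sup>2) has_real_derivative - 2 * y / K\<^sup>2) (at y)"
    by (cases "K = 0") (auto intro!: derivative_eq_intros simp: power2_eq_square)
  from DERIV_chain2[OF DERIV_bump this] show ?thesis
    unfolding cutoff_def[abs_def] by (simp add: mult.commute)
qed

lemma cutoff_tendsto: "(\<lambda>k. cutoff n (real (Suc k)) y) \<longlonglongrightarrow> bump n (1 / 2)"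
proof -
  have "(\<lambda>k. 1 / 2 - (y / real (Suc k))\<^sup>2) \<longlonglongrightarrow> 1 / 2 - 0\<^sup>2"
    by (intro tendsto_intros real_tendsto_divide_at_top[OF tendsto_const] filterlim_compose[OF filterlim_real_sequentially filterlim_Suc])
  then show ?thesis unfolding cutoff_def by (intro bump_tendsto) simp
qed

text \<open>For positive \<open>x\<close> up to 1/2, \<open>x ^ 4\<close> is at most half of
  \<open>x ^ 3\<close>. In \<open>moment2\<close> this gives the truncation term of the second
  derivative a favourable sign.\<close>

lemma cutoff_4_3: "cutoff 4 K y - 2 * cutoff 3 K y \<ge> 0"
proof -
  define x where "x = 1 / 2 - (y / K)\<^sup>2"
  show ?thesis
  proof (cases "x > 0")
    case True
    have "x \<le> 1 / 2" by (simp add: x_def)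
    then have "2 * x ^ 3 \<ge> 0 \<and> 2 * x ^ 4 \<le> x ^ 3" using True by (simp add: power_Suc[of x 3, simplified] numeral_eq_Suc)
    then have "2 / x ^ 3 \<le> 1 / x ^ 4" using True by (simp add: field_simps)
    then have "exp (- 1 / x) * (2 / x ^ 3) \<le> exp (- 1 / x) * (1 / x ^ 4)" by (intro mult_left_mono) auto
    then show ?thesis using True by (simp add: cutoff_def bump_def x_def[symmetric] mult.commute)
  qed (simp add: cutoff_def bump_def x_def[symmetric])
qed

text \<open>With the drift frozen the equation is linear in the measure. Test functions are
  restricted to products A(q) B(p) with compactly supported B.\<close>

locale kinetic =
  fixes M :: "(torus \<times> real) measure" and \<beta> \<gamma> s1 s2 :: real and D :: "torus \<Rightarrow> real"
  assumes \<beta>: "\<beta> > 0" and \<gamma>: "\<gamma> > 0" and pp: "phase_prob M"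
    and D_def: "D = (\<lambda>q. s1 * sin_2pi q + s2 * cos_2pi q)"
    and weak0: "\<And>A A' B B' B'' K. A \<in> torus_elem \<Longrightarrow> (\<And>q. has_tderiv A (A' q) q) \<Longrightarrow> B \<in> smooth_elem \<Longrightarrow>
      (\<And>y. (B has_real_derivative B' y) (at y)) \<Longrightarrow> (\<And>y. (B' has_real_derivative B'' y) (at y)) \<Longrightarrow>
      (\<And>y. \<bar>y\<bar> > K \<Longrightarrow> B y = 0) \<Longrightarrow>
      (\<integral>(x, y). A' x * (y * B y) - D x * A x * B' y + \<gamma> * (A x * (- y * B' y + B'' y / \<beta>)) \<partial>M) = 0"
begin

interpretation M: prob_space M using pp by (simp add: phase_prob_def)

lemma sets_M [simp, measurable_cong]: "sets M = sets (borel \<Otimes>\<^sub>M borel)"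
  using pp by (simp add: phase_prob_def)

lemma space_M [simp]: "space M = UNIV"
  using sets_eq_imp_space_eq[OF sets_M] by (simp add: space_pair_measure)

lemma measurable_D [measurable]: "D \<in> borel_measurable borel"
  unfolding D_def by measurable

definition CD :: real where "CD = \<bar>s1\<bar> + \<bar>s2\<bar>"

lemma CD_nonneg: "CD \<ge> 0" by (simp add: CD_def)

lemma abs_D_le: "\<bar>D q\<bar> \<le> CD"
proof -
  have "\<bar>D q\<bar> \<le> \<bar>s1\<bar> * \<bar>sin_2pi q\<bar> + \<bar>s2\<bar> * \<bar>cos_2pi q\<bar>"
    unfolding D_def by (metis abs_mult abs_triangle_ineq)
  also have "\<dots> \<le> \<bar>s1\<bar> * 1 + \<bar>s2\<bar> * 1" by (intro add_mono mult_left_mono) auto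
  finally show ?thesis by (simp add: CD_def)
qed

lemma integrable_M_bounded:
  fixes f :: "torus \<times> real \<Rightarrow> real"
  assumes "f \<in> borel_measurable (borel \<Otimes>\<^sub>M borel)" "\<And>x y. \<bar>f (x, y)\<bar> \<le> C"
  shows "integrable M f"
  by (rule phase_prob_integrable_bounded[OF pp, of _ C]) (use assms in auto)

text \<open>Nothing about the tails in \<open>p\<close> is known at first, so this precedes every
  unbounded test function. With A = 1 the transport term disappears, and a truncated y^2 makes
  friction produce - 2 \<gamma> y^2: half of it absorbs the drift by Young's inequality, and the
  rest is bounded uniformly in the truncation.\<close>

lemma moment2: "integrable M (\<lambda>(x, y). y\<^sup>2)"
proof -
  define w where "w k y = cutoff 2 (real (Suc k)) y" for k y
  have [measurable]: "cutoff n K \<in> borel_measurable borel" for n K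
    by (intro borel_measurable_continuous_onI smooth_elem_continuous cutoff_smooth)
  have [measurable]: "w k \<in> borel_measurable borel" for k unfolding w_def by measurable
  \<comment> \<open>The constant left by Young's inequality and diffusion, times the bound 2 of
    \<open>w k\<close>, divided by \<open>\<gamma>\<close>.\<close>
  define c where "c = 2 * (CD\<^sup>2 / \<gamma> + 2 * \<gamma> / \<beta>) / \<gamma>"
  have w: "0 \<le> w k y" "w k y \<le> 2" for k y using cutoff_bounds[of 2] by (simp_all add: w_def)
  have le: "(\<integral>\<^sup>+(x, y). ennreal (y\<^sup>2 * w k y) \<partial>M) \<le> ennreal c" for k
  proof -
    define K where "K = real (Suc k)"
    have K: "K > 0" by (simp add: K_def)
    have w0: "w k y = 0" if "\<bar>y\<bar> \<ge> K" for y using cutoff_0[OF K that] by (simp add: w_def K_def)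
    \<comment> \<open>Up to an additive constant this is a smooth truncation of a multiple of y^2:
      the factor K^2 makes its derivative exactly \<open>2 * y * w k y\<close>.\<close>
    define B where "B y = - K\<^sup>2 * cutoff 0 K y" for y
    define B' where "B' y = 2 * y * w k y" for y
    define B'' where "B'' y = 2 * w k y + 2 * y * (- 2 * y / K\<^sup>2 * (cutoff 4 K y - 2 * cutoff 3 K y))" for y
    have [measurable]: "B' \<in> borel_measurable borel" "B'' \<in> borel_measurable borel"
      unfolding B'_def B''_def by measurable
    have 1: "(B has_real_derivative B' y) (at y)" for y
      unfolding B_def B'_def w_def K_def[symmetric] using DERIV_cmult[OF DERIV_cutoff, of "- K\<^sup>2" 0 K y] K
      by (simp add: numeral_2_eq_2)
    have "(w k has_real_derivative (- 2 * y / K\<^sup>2 * (cutoff 4 K y - 2 * cutoff 3 K y))) (at y)" for y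
    proof -
      have "w k = cutoff 2 K" by (auto simp: w_def K_def)
      then show ?thesis using DERIV_cutoff[of 2 K y] by simp
    qed
    then have 2: "(B' has_real_derivative B'' y) (at y)" for y
      unfolding B'_def B''_def by (auto intro!: derivative_eq_intros)
    \<comment> \<open>The term in which the derivative falls on the cutoff has a sign and is
      dropped, so no estimate on the region near \<open>K\<close> is needed here.\<close>
    have B''_le: "B'' y \<le> 2 * w k y" for y
    proof -
      define t where "t = y * y / K\<^sup>2 * (cutoff 4 K y - 2 * cutoff 3 K y)"
      have "t \<ge> 0" unfolding t_def by (intro mult_nonneg_nonneg cutoff_4_3) simp
      moreover have "B'' y = 2 * w k y - 4 * t" by (simp add: B''_def t_def)
      ultimately show ?thesis by simp
    qed
    have "(\<integral>(x, y). 0 * (y * B y) - D x * 1 * B' y + \<gamma> * (1 * (- y * B' y + B'' y / \<beta>)) \<partial>M) = 0"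
    proof (rule weak0[where K=K])
      show "B \<in> smooth_elem" unfolding B_def by (intro smooth_elem.mult smooth_elem.const cutoff_smooth)
      show "B y = 0" if "\<bar>y\<bar> > K" for y using cutoff_0[OF K, of y 0] that by (simp add: B_def)
    qed (use 1 2 in \<open>auto intro: torus_elem.const\<close>)
    then have eq: "(\<integral>(x, y). - D x * B' y + \<gamma> * (- y * B' y + B'' y / \<beta>) \<partial>M) = 0"
      by simp
    define h where "h = (\<lambda>(x :: torus, y). w k y * (CD\<^sup>2 / \<gamma> + 2 * \<gamma> / \<beta>) - \<gamma> * (y\<^sup>2 * w k y))"
    define g where "g = (\<lambda>(x, y). - D x * B' y + \<gamma> * (- y * B' y + B'' y / \<beta>))"
    have gh: "g (x, y) \<le> h (x, y)" for x y
    proof -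
      have "- D x * (2 * y) \<le> CD\<^sup>2 / \<gamma> + \<gamma> * y\<^sup>2"
      proof -
        have "0 \<le> (D x + \<gamma> * y)\<^sup>2 / \<gamma>" using \<gamma> by simp
        also have "\<dots> = (D x)\<^sup>2 / \<gamma> + 2 * D x * y + \<gamma> * y\<^sup>2" using \<gamma> by (simp add: field_simps power2_eq_square)
        finally have "- D x * (2 * y) \<le> (D x)\<^sup>2 / \<gamma> + \<gamma> * y\<^sup>2" by simp
        moreover have "(D x)\<^sup>2 \<le> CD\<^sup>2" using abs_D_le[of x] CD_nonneg by (metis abs_le_square_iff abs_of_nonneg)
        then have "(D x)\<^sup>2 / \<gamma> \<le> CD\<^sup>2 / \<gamma>" using \<gamma> by (simp add: divide_right_mono)
        ultimately show ?thesis by linarith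
      qed
      from mult_right_mono[OF this w(1)[of k y]]
      have "- D x * B' y \<le> w k y * (CD\<^sup>2 / \<gamma>) + \<gamma> * (y\<^sup>2 * w k y)" by (simp add: B'_def algebra_simps)
      moreover have "\<gamma> * (B'' y / \<beta>) \<le> \<gamma> * (2 * w k y / \<beta>)"
        using \<gamma> \<beta> B''_le[of y] by (intro mult_left_mono divide_right_mono) auto
      ultimately show ?thesis by (simp add: g_def h_def B'_def algebra_simps power2_eq_square)
    qed
    have y2w: "y\<^sup>2 * w k y \<le> K\<^sup>2 * 2" for y
    proof (cases "\<bar>y\<bar> \<ge> K")
      case False
      then have "\<bar>y\<bar> \<le> \<bar>K\<bar>" using K by simp
      then have "y\<^sup>2 \<le> K\<^sup>2" by (simp only: abs_le_square_iff)
      then show ?thesis using w[of k y] by (intro mult_mono) auto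
    qed (simp add: w0)
    have i1: "integrable M (\<lambda>(x, y). y\<^sup>2 * w k y)"
      by (rule integrable_M_bounded[where C="K\<^sup>2 * 2"]) (use w[of k] y2w in \<open>auto simp: abs_mult\<close>)
    have i2: "integrable M (\<lambda>(x, y). w k y)"
      by (rule integrable_M_bounded[where C=2]) (use w[of k] in auto)
    have ih: "integrable M h" using i1 i2 unfolding h_def by (simp add: split_beta')
    have ig: "integrable M g"
    proof -
      have c1: "continuous_on UNIV B'" "continuous_on UNIV B''"
        unfolding B'_def B''_def w_def
        by (intro continuous_intros smooth_elem_continuous[OF cutoff_smooth]; use K in simp)+
      have c2: "continuous_on UNIV (\<lambda>x. g x)"
        unfolding g_def D_def
        by (rule continuous_on_case_prod_I)
           (intro continuous_intros continuous_on_compose2[OF c1(1)] continuous_on_compose2[OF c1(2)]; use \<beta> in simp)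
      have z: "g (x, y) = 0" if "\<bar>y\<bar> > K" for x y
        using w0[of y] cutoff_0[OF K, of y] that by (simp add: g_def B'_def B''_def)
      obtain C where C: "\<And>q p. \<bar>g (q, p)\<bar> \<le> C * indicator {- K..K} p"
        using compact_support_bounded[OF c2 z] by blast
      have "C \<ge> 0" using C[of 0 0] K by simp
      show ?thesis
      proof (rule integrable_M_bounded)
        show "g \<in> borel_measurable (borel \<Otimes>\<^sub>M borel)" unfolding g_def by measurable
        show "\<bar>g (x, y)\<bar> \<le> C" for x y
          using C[of x y] \<open>C \<ge> 0\<close> by (cases "y \<in> {- K..K}") auto
      qed
    qed
    have "0 = (\<integral>z. g z \<partial>M)" using eq by (simp add: g_def split_beta')
    also have "\<dots> \<le> (\<integral>z. h z \<partial>M)" using gh by (intro integral_mono ig ih) auto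
    also have "\<dots> = (\<integral>(x, y). w k y \<partial>M) * (CD\<^sup>2 / \<gamma> + 2 * \<gamma> / \<beta>) - \<gamma> * (\<integral>(x, y). y\<^sup>2 * w k y \<partial>M)"
      using i1 i2 by (simp add: h_def split_beta')
    finally have "\<gamma> * (\<integral>(x, y). y\<^sup>2 * w k y \<partial>M) \<le> (\<integral>(x, y). w k y \<partial>M) * (CD\<^sup>2 / \<gamma> + 2 * \<gamma> / \<beta>)" by simp
    also have "(\<integral>(x, y). w k y \<partial>M) \<le> (\<integral>(x, y). 2 \<partial>M)"
      using i2 w by (intro integral_mono) (auto simp: split_beta')
    then have "(\<integral>(x, y). w k y \<partial>M) * (CD\<^sup>2 / \<gamma> + 2 * \<gamma> / \<beta>) \<le> 2 * (CD\<^sup>2 / \<gamma> + 2 * \<gamma> / \<beta>)"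
      using \<gamma> \<beta> M.prob_space by (intro mult_right_mono) (auto simp: split_beta')
    finally have "(\<integral>(x, y). y\<^sup>2 * w k y \<partial>M) \<le> c" using \<gamma> by (simp add: c_def field_simps)
    then show ?thesis
      using i1 w[of k] by (simp add: nn_integral_eq_integral split_beta' ennreal_leI)
  qed
  \<comment> \<open>The pointwise limit of the weights \<open>w k\<close>. As it is positive,
    Fatou's lemma carries the uniform bound over to y^2 itself.\<close>
  define b where "b = bump 2 (1 / 2)"
  have b: "b > 0" by (simp add: b_def bump_pos)
  have "(\<integral>\<^sup>+(x, y). ennreal (y\<^sup>2 * b) \<partial>M) = (\<integral>\<^sup>+z. liminf (\<lambda>k. case z of (x, y) \<Rightarrow> ennreal (y\<^sup>2 * w k y)) \<partial>M)"
  proof (rule nn_integral_cong)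
    fix z :: "torus \<times> real"
    obtain x y where z: "z = (x, y)" by (cases z)
    have "(\<lambda>k. ennreal (y\<^sup>2 * w k y)) \<longlonglongrightarrow> ennreal (y\<^sup>2 * b)"
      unfolding w_def b_def by (intro tendsto_ennrealI tendsto_intros cutoff_tendsto)
    then show "(case z of (x, y) \<Rightarrow> ennreal (y\<^sup>2 * b)) = liminf (\<lambda>k. case z of (x, y) \<Rightarrow> ennreal (y\<^sup>2 * w k y))"
      by (simp add: lim_imp_Liminf z)
  qed
  also have "\<dots> \<le> liminf (\<lambda>k. \<integral>\<^sup>+(x, y). ennreal (y\<^sup>2 * w k y) \<partial>M)"
    by (rule nn_integral_liminf) measurable
  also have "\<dots> \<le> ennreal c"
    using Liminf_mono[of "\<lambda>k. \<integral>\<^sup>+(x, y). ennreal (y\<^sup>2 * w k y) \<partial>M" "\<lambda>_. ennreal c" sequentially] le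
    by (simp add: Liminf_const)
  finally have "integrable M (\<lambda>(x, y). y\<^sup>2 * b)"
    using b by (intro integrableI_bounded) (auto simp: split_beta' abs_mult less_top[symmetric] top_unique)
  then have "integrable M (\<lambda>z. (case z of (x, y) \<Rightarrow> y\<^sup>2 * b) * (1 / b))" by (rule integrable_mult_left)
  then show ?thesis using b by (simp add: split_beta')
qed

lemma integrable_M_quadratic:
  fixes f :: "torus \<times> real \<Rightarrow> real"
  assumes "f \<in> borel_measurable (borel \<Otimes>\<^sub>M borel)" "\<And>x y. \<bar>f (x, y)\<bar> \<le> C * (1 + y\<^sup>2)"
  shows "integrable M f"
proof (rule Bochner_Integration.integrable_bound)
  have "integrable M (\<lambda>x. C * (1 + (case x of (x, y) \<Rightarrow> y\<^sup>2)))"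
    using moment2 by (intro integrable_mult_right Bochner_Integration.integrable_add) auto
  then show "integrable M (\<lambda>(x, y). C * (1 + y\<^sup>2))" by (simp add: split_beta')
  show "f \<in> borel_measurable M" using assms(1) by simp
  show "AE x in M. norm (f x) \<le> norm (case x of (x, y) \<Rightarrow> C * (1 + y\<^sup>2))"
    using assms(2) by (auto intro!: AE_I2 order_trans[OF assms(2) abs_ge_self])
qed

lemma abs_le_1_plus_square: "\<bar>y\<bar> \<le> 1 + (y :: real)\<^sup>2"
proof -
  have "0 \<le> (\<bar>y\<bar> - 1)\<^sup>2" by simp
  then have "2 * \<bar>y\<bar> \<le> 1 + y\<^sup>2" by (simp add: power2_diff)
  then show ?thesis by (smt (verit) abs_ge_zero)
qed

text \<open>Truncate \<open>B\<close> by \<open>X k\<close>, whose first two derivatives are of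
  order 1 / (k + 1), and let k tend to infinity. The terms grow at most quadratically in
  \<open>y\<close>, so \<open>moment2\<close> supplies the dominating function.\<close>

lemma weak:
  assumes A: "A \<in> torus_elem" "\<And>q. has_tderiv A (A' q) q" and A': "A' \<in> torus_elem"
    and B: "B \<in> smooth_elem" "\<And>y. (B has_real_derivative B' y) (at y)" "\<And>y. (B' has_real_derivative B'' y) (at y)"
    and B'' [measurable]: "B'' \<in> borel_measurable borel"
    and b: "\<And>y. \<bar>B y\<bar> \<le> C * (1 + \<bar>y\<bar>)" "\<And>y. \<bar>B' y\<bar> \<le> C" "\<And>y. \<bar>B'' y\<bar> \<le> C"
  shows "(\<integral>(x, y). A' x * (y * B y) - D x * A x * B' y + \<gamma> * (A x * (- y * B' y + B'' y / \<beta>)) \<partial>M) = 0"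
proof -
  \<comment> \<open>The limit of \<open>cutoff 0\<close> at fixed \<open>y\<close>; dividing by it
    makes the truncations converge to 1.\<close>
  define b0 where "b0 = bump 0 (1 / 2)"
  have b0: "b0 > 0" by (simp add: b0_def bump_pos)
  define X where "X k y = cutoff 0 (real (Suc k)) y / b0" for k y
  define X1 where "X1 k y = (- 2 * y / (real (Suc k))\<^sup>2) * (cutoff 2 (real (Suc k)) y / b0)" for k y
  define X2 where "X2 k y = (- 2 / (real (Suc k))\<^sup>2) * (cutoff 2 (real (Suc k)) y / b0)
     + (- 2 * y / (real (Suc k))\<^sup>2) * ((- 2 * y / (real (Suc k))\<^sup>2) * ((cutoff 4 (real (Suc k)) y - 2 * cutoff 3 (real (Suc k)) y) / b0))" for k y
  have [measurable]: "cutoff n K \<in> borel_measurable borel" for n K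
    by (intro borel_measurable_continuous_onI smooth_elem_continuous cutoff_smooth)
  have [measurable]: "A \<in> borel_measurable borel" "A' \<in> borel_measurable borel" "B \<in> borel_measurable borel"
    using A A' B by (auto intro!: borel_measurable_continuous_onI torus_elem_continuous smooth_elem_continuous)
  have [measurable]: "B' \<in> borel_measurable borel"
    by (intro borel_measurable_continuous_onI DERIV_continuous_on[OF has_field_derivative_at_within[OF B(3)]])
  have [measurable]: "X k \<in> borel_measurable borel" "X1 k \<in> borel_measurable borel" "X2 k \<in> borel_measurable borel" for k
    unfolding X_def X1_def X2_def by measurable
  have dX: "(X k has_real_derivative X1 k y) (at y)" for k y
    unfolding X_def[abs_def] X1_def using DERIV_cdivide[OF DERIV_cutoff[of 0 "real (Suc k)" y], of b0] by (simp add: numeral_2_eq_2)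
  have d2: "((\<lambda>y. cutoff 2 (real (Suc k)) y / b0) has_real_derivative
      (- 2 * y / (real (Suc k))\<^sup>2) * ((cutoff 4 (real (Suc k)) y - 2 * cutoff 3 (real (Suc k)) y) / b0)) (at y)" for k y
    using DERIV_cdivide[OF DERIV_cutoff[of 2 "real (Suc k)" y], of b0] by simp
  have d3: "((\<lambda>y. - 2 * y / (real (Suc k))\<^sup>2) has_real_derivative - 2 / (real (Suc k))\<^sup>2) (at y)" for k y
    by (rule DERIV_cdivide) (auto intro!: derivative_eq_intros)
  have dX1: "(X1 k has_real_derivative X2 k y) (at y)" for k y
    unfolding X1_def[abs_def] X2_def by (rule DERIV_cong[OF DERIV_mult'[OF d3 d2]]) (simp only: add.commute)
  \<comment> \<open>One constant for \<open>X\<close>, \<open>X1\<close> and \<open>X2\<close>,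
    assembled from the bounds \<open>fact n\<close> on the cutoffs.\<close>
  define c where "c = 2 * fact 2 / b0 + 4 * (fact 4 + 2 * fact 3) / b0 + 1 / b0"
  have cp: "0 \<le> 2 * fact 2 / b0" "0 \<le> 4 * (fact 4 + 2 * fact 3) / b0" "0 \<le> 1 / b0"
    using b0 by (intro divide_nonneg_pos mult_nonneg_nonneg add_nonneg_nonneg; simp)+
  have c0: "c \<ge> 0" using cp unfolding c_def by linarith
  have c2: "2 * fact 2 / b0 \<le> c" using cp unfolding c_def by linarith
  have c3: "2 * fact 2 / b0 + 4 * (fact 4 + 2 * fact 3) / b0 \<le> c" using cp unfolding c_def by linarith
  have c4: "1 / b0 \<le> c" using cp unfolding c_def by linarith
  note cl = c2 c3 c4
  have X_le: "\<bar>X k y\<bar> \<le> c" for k y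
  proof -
    have "\<bar>X k y\<bar> \<le> 1 / b0" using cutoff_bounds[of 0 "real (Suc k)" y] b0 by (simp add: X_def divide_right_mono)
    also have "\<dots> \<le> c" by (rule cl)
    finally show ?thesis .
  qed
  have y_le: "\<bar>y\<bar> / (real (Suc k))\<^sup>2 \<le> 1 / real (Suc k)" if "\<bar>y\<bar> < real (Suc k)" for y k
  proof -
    have "\<bar>y\<bar> / (real (Suc k))\<^sup>2 \<le> real (Suc k) / (real (Suc k))\<^sup>2"
      using that by (intro divide_right_mono) auto
    then show ?thesis by (simp add: power2_eq_square)
  qed
  have X1_le: "\<bar>X1 k y\<bar> \<le> c / real (Suc k)" and X2_le: "\<bar>X2 k y\<bar> \<le> c / real (Suc k)" for k y
  proof -
    define K where "K = real (Suc k)"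
    have K: "K \<ge> 1" by (simp add: K_def)
    have *: "\<bar>X1 k y\<bar> \<le> c / K \<and> \<bar>X2 k y\<bar> \<le> c / K"
    proof (cases "\<bar>y\<bar> \<ge> K")
      case True
      then have "cutoff n K y = 0" for n using cutoff_0[of K y n] K by simp
      then show ?thesis using c0 K by (simp add: X1_def X2_def K_def[symmetric] del: of_nat_Suc)
    next
      case False
      have y: "\<bar>y\<bar> / K\<^sup>2 \<le> 1 / K" using y_le[of y k] False by (simp add: K_def)
      have y1: "1 / K \<le> 1" using K by simp
      have c2: "\<bar>cutoff 2 K y / b0\<bar> \<le> fact 2 / b0" using cutoff_bounds[of 2 K y] b0 by (simp add: divide_right_mono)
      have "\<bar>cutoff 4 K y - 2 * cutoff 3 K y\<bar> \<le> fact 4 + 2 * fact 3"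
        using cutoff_bounds[of 4 K y] cutoff_bounds[of 3 K y] unfolding abs_le_iff by (smt (verit))
      then have c4: "\<bar>(cutoff 4 K y - 2 * cutoff 3 K y) / b0\<bar> \<le> (fact 4 + 2 * fact 3) / b0"
        using b0 by (simp add: divide_right_mono)
      have k2: "2 / K\<^sup>2 \<le> 2 * (1 / K)" using K by (simp add: power2_eq_square field_simps)
      have e1: "\<bar>X1 k y\<bar> = 2 * (\<bar>y\<bar> / K\<^sup>2) * \<bar>cutoff 2 K y / b0\<bar>"
        unfolding X1_def K_def[symmetric] by (simp add: abs_mult)
      also have "\<dots> \<le> 2 * (1 / K) * (fact 2 / b0)" using K by (intro mult_mono y c2) auto
      also have "\<dots> = (2 * fact 2 / b0) / K" by simp
      also have "\<dots> \<le> c / K" using K by (intro divide_right_mono cl) auto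
      finally have a1: "\<bar>X1 k y\<bar> \<le> c / K" .
      have "\<bar>X2 k y\<bar> \<le> 2 / K\<^sup>2 * \<bar>cutoff 2 K y / b0\<bar> + 2 * (\<bar>y\<bar> / K\<^sup>2) * (2 * (\<bar>y\<bar> / K\<^sup>2) * \<bar>(cutoff 4 K y - 2 * cutoff 3 K y) / b0\<bar>)"
        unfolding X2_def K_def[symmetric] by (rule order_trans[OF abs_triangle_ineq]) (simp add: abs_mult)
      also have "\<dots> \<le> 2 * (1 / K) * (fact 2 / b0) + 2 * (1 / K) * (2 * 1 * ((fact 4 + 2 * fact 3) / b0))"
        using K b0 by (intro add_mono mult_mono k2 y c2 c4 order_trans[OF y y1]) auto
      also have "\<dots> = (2 * fact 2 / b0 + 4 * (fact 4 + 2 * fact 3) / b0) / K" by (simp add: add_divide_distrib)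
      also have "\<dots> \<le> c / K" using K by (intro divide_right_mono cl) auto
      finally show ?thesis using a1 by simp
    qed
    then show "\<bar>X1 k y\<bar> \<le> c / real (Suc k)" "\<bar>X2 k y\<bar> \<le> c / real (Suc k)" by (auto simp: K_def)
  qed
  have X_lim: "(\<lambda>k. X k y) \<longlonglongrightarrow> 1" for y
    unfolding X_def using tendsto_divide[OF cutoff_tendsto[of 0 y] tendsto_const[of b0]] b0 by (simp add: b0_def)
  have c_lim: "(\<lambda>k. c / real (Suc k)) \<longlonglongrightarrow> 0"
    by (intro real_tendsto_divide_at_top[OF tendsto_const] filterlim_compose[OF filterlim_real_sequentially filterlim_Suc])
  have X1_lim: "(\<lambda>k. X1 k y) \<longlonglongrightarrow> 0" for y
    by (rule Lim_null_comparison[OF _ c_lim]) (use X1_le in auto)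
  have X2_lim: "(\<lambda>k. X2 k y) \<longlonglongrightarrow> 0" for y
    by (rule Lim_null_comparison[OF _ c_lim]) (use X2_le in auto)
  define f where "f k = (\<lambda>(x, y). A' x * (y * (B y * X k y)) - D x * A x * (B' y * X k y + X1 k y * B y)
     + \<gamma> * (A x * (- y * (B' y * X k y + X1 k y * B y) + (B'' y * X k y + X1 k y * B' y + (X2 k y * B y + B' y * X1 k y)) / \<beta>)))" for k
  define g where "g = (\<lambda>(x, y). A' x * (y * B y) - D x * A x * B' y + \<gamma> * (A x * (- y * B' y + B'' y / \<beta>)))"
  have f0: "(\<integral>z. f k z \<partial>M) = 0" for k
    unfolding f_def
  proof (rule weak0[where K="real (Suc k)"])
    have "(\<lambda>y. cutoff 0 (real (Suc k)) y * (1 / b0)) \<in> smooth_elem"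
      by (intro smooth_elem.mult smooth_elem.const cutoff_smooth)
    then have "X k \<in> smooth_elem" by (simp add: X_def[abs_def])
    then show "(\<lambda>y. B y * X k y) \<in> smooth_elem" by (intro smooth_elem.mult B)
    show "((\<lambda>y. B y * X k y) has_real_derivative B' y * X k y + X1 k y * B y) (at y)" for y
      by (rule DERIV_mult[OF B(2) dX])
    show "((\<lambda>y. B' y * X k y + X1 k y * B y) has_real_derivative
       (B'' y * X k y + X1 k y * B' y + (X2 k y * B y + B' y * X1 k y))) (at y)" for y
      by (rule DERIV_add[OF DERIV_mult[OF B(3) dX] DERIV_mult[OF dX1 B(2)]])
    show "B y * X k y = 0" if "\<bar>y\<bar> > real (Suc k)" for y
      using cutoff_0[of "real (Suc k)" y 0] that by (simp add: X_def)
  qed (use A in auto)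
  obtain CA where CA: "\<And>q. \<bar>A q\<bar> \<le> CA" using continuous_imp_bounded_torus torus_elem_continuous[OF A(1)] by metis
  obtain CA' where CA': "\<And>q. \<bar>A' q\<bar> \<le> CA'" using continuous_imp_bounded_torus torus_elem_continuous[OF A'] by metis
  have C0: "C \<ge> 0" using b(2)[of 0] by simp
  have CA0: "CA \<ge> 0" "CA' \<ge> 0" using CA[of 0] CA'[of 0] by simp_all
  \<comment> \<open>The summands belong, in this order, to transport, drift, and friction with
    diffusion.\<close>
  define bound where "bound = 2 * CA' * C * c + CD * CA * (3 * C * c) + \<gamma> * (CA * (4 * C * c + (5 * C * c) / \<beta>))"
  have bound: "\<bar>f k (x, y)\<bar> \<le> bound * (1 + y\<^sup>2)" for k x y
  proof -
    define Y where "Y = 1 + y\<^sup>2"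
    have y1: "\<bar>y\<bar> * (1 + \<bar>y\<bar>) = \<bar>y\<bar> + y\<^sup>2" by (simp add: power2_eq_square distrib_left)
    have y2: "y\<^sup>2 \<ge> 0" by simp
    have Y1: "Y \<ge> 1" using y2 unfolding Y_def by linarith
    have Y2: "\<bar>y\<bar> \<le> Y" using abs_le_1_plus_square[of y] unfolding Y_def by linarith
    have Y3: "1 + \<bar>y\<bar> \<le> 2 * Y" using Y1 Y2 by linarith
    have Y4: "\<bar>y\<bar> * (1 + \<bar>y\<bar>) \<le> 2 * Y"
    proof -
      have "y\<^sup>2 \<le> Y" by (simp add: Y_def)
      from add_mono[OF Y2 this] show ?thesis unfolding y1 by simp
    qed
    note Y = Y1 Y2 Y3 Y4
    have Yle: "a \<le> a * Y" if "0 \<le> a" for a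
      using mult_left_mono[OF Y1 that] by simp
    have BX: "\<bar>B y * X k y\<bar> \<le> C * (1 + \<bar>y\<bar>) * c" unfolding abs_mult using C0 by (intro mult_mono b X_le) auto
    have sm: "c / real (Suc k) \<le> c" using c0 divide_left_mono[of 1 "real (Suc k)" c] by simp
    \<comment> \<open>\<open>B\<close> grows linearly, but \<open>X1\<close> is of size 1 / (k + 1)
      and vanishes once \<open>\<bar>y\<bar>\<close> reaches k + 1, so the product stays bounded in
      both k and y.\<close>
    have X1B: "\<bar>X1 k y * B y\<bar> \<le> 2 * C * c"
    proof (cases "\<bar>y\<bar> \<ge> real (Suc k)")
      case True
      then show ?thesis using cutoff_0[of "real (Suc k)" y 2] C0 c0 by (simp add: X1_def)
    next
      case False
      have "\<bar>X1 k y * B y\<bar> \<le> c / real (Suc k) * (C * (1 + real (Suc k)))"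
        unfolding abs_mult using False C0 c0
        by (intro mult_mono X1_le order_trans[OF b(1)] mult_left_mono) auto
      also have "\<dots> = C * c * (1 / real (Suc k) + 1)" by (simp add: field_simps)
      also have "\<dots> \<le> C * c * 2" using C0 c0 by (intro mult_left_mono) auto
      finally show ?thesis by simp
    qed
    have X2B: "\<bar>X2 k y * B y\<bar> \<le> 2 * C * c"
    proof (cases "\<bar>y\<bar> \<ge> real (Suc k)")
      case True
      then show ?thesis using cutoff_0[of "real (Suc k)" y] C0 c0 by (simp add: X2_def)
    next
      case False
      have "\<bar>X2 k y * B y\<bar> \<le> c / real (Suc k) * (C * (1 + real (Suc k)))"
        unfolding abs_mult using False C0 c0
        by (intro mult_mono X2_le order_trans[OF b(1)] mult_left_mono) auto
      also have "\<dots> = C * c * (1 / real (Suc k) + 1)" by (simp add: field_simps)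
      also have "\<dots> \<le> C * c * 2" using C0 c0 by (intro mult_left_mono) auto
      finally show ?thesis by simp
    qed
    have B'X: "\<bar>B' y * X k y\<bar> \<le> C * c" unfolding abs_mult using C0 by (intro mult_mono b X_le) auto
    have B''X: "\<bar>B'' y * X k y\<bar> \<le> C * c" unfolding abs_mult using C0 by (intro mult_mono b X_le) auto
    have X1B': "\<bar>X1 k y * B' y\<bar> \<le> c * C" unfolding abs_mult using c0 by (intro mult_mono b order_trans[OF X1_le sm]) auto
    have S1: "\<bar>B' y * X k y + X1 k y * B y\<bar> \<le> 3 * C * c" using B'X X1B by linarith
    have "\<bar>B'' y * X k y + X1 k y * B' y + (X2 k y * B y + B' y * X1 k y)\<bar> \<le> 5 * C * c"
      using B''X X1B' X2B by (simp add: mult.commute[of "B' y"] mult.commute[of c C])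
    then have S2: "\<bar>(B'' y * X k y + X1 k y * B' y + (X2 k y * B y + B' y * X1 k y)) / \<beta>\<bar> \<le> (5 * C * c) / \<beta>"
      using \<beta> by (simp add: divide_right_mono)
    have Cc: "C * c \<ge> 0" using C0 c0 by simp
    have T1: "\<bar>A' x * (y * (B y * X k y))\<bar> \<le> (2 * CA' * C * c) * Y"
    proof -
      have "\<bar>A' x * (y * (B y * X k y))\<bar> \<le> CA' * (\<bar>y\<bar> * (C * (1 + \<bar>y\<bar>) * c))"
        unfolding abs_mult[of "A' x"] abs_mult[of y] using CA0 by (intro mult_mono CA' BX) auto
      also have "\<dots> = CA' * (C * c) * (\<bar>y\<bar> * (1 + \<bar>y\<bar>))" by (simp add: mult_ac)
      also have "\<dots> \<le> CA' * (C * c) * (2 * Y)" using CA0 Cc by (intro mult_left_mono Y) auto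
      finally show ?thesis by (simp add: mult_ac)
    qed
    have T2: "\<bar>D x * A x * (B' y * X k y + X1 k y * B y)\<bar> \<le> (CD * CA * (3 * C * c)) * Y"
    proof -
      have "\<bar>D x * A x * (B' y * X k y + X1 k y * B y)\<bar> \<le> CD * CA * (3 * C * c)"
        unfolding abs_mult[of "D x * A x"] abs_mult[of "D x"]
        using CD_nonneg CA0 by (intro mult_mono abs_D_le CA S1) auto
      also have "\<dots> \<le> CD * CA * (3 * C * c) * Y" using CD_nonneg CA0 C0 c0 by (intro Yle mult_nonneg_nonneg) auto
      finally show ?thesis .
    qed
    have T3: "\<bar>- y * (B' y * X k y + X1 k y * B y)\<bar> \<le> 4 * C * c * Y"
    proof -
      have "\<bar>- y * (B' y * X k y + X1 k y * B y)\<bar> \<le> Y * (3 * C * c)"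
        unfolding abs_mult abs_minus_cancel using Y by (intro mult_mono S1) auto
      also have "\<dots> \<le> Y * (4 * C * c)" using Cc Y by (intro mult_left_mono) auto
      finally show ?thesis by (simp add: mult_ac)
    qed
    have T4: "(5 * C * c) / \<beta> \<le> (5 * C * c) / \<beta> * Y" using C0 c0 \<beta> by (intro Yle divide_nonneg_pos mult_nonneg_nonneg) auto
    have T5: "\<bar>\<gamma> * (A x * (- y * (B' y * X k y + X1 k y * B y) + (B'' y * X k y + X1 k y * B' y + (X2 k y * B y + B' y * X1 k y)) / \<beta>))\<bar>
       \<le> \<gamma> * (CA * (4 * C * c * Y + (5 * C * c) / \<beta> * Y))"
      unfolding abs_mult[of \<gamma>] abs_mult[of "A x"] using \<gamma> CA0
      by (intro mult_mono CA order_trans[OF abs_triangle_ineq add_mono[OF T3 order_trans[OF S2 T4]]]) auto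
    have "\<bar>f k (x, y)\<bar> \<le> (2 * CA' * C * c) * Y + (CD * CA * (3 * C * c)) * Y + \<gamma> * (CA * (4 * C * c * Y + (5 * C * c) / \<beta> * Y))"
      using T1 T2 T5 unfolding f_def prod.case by linarith
    also have "\<dots> = bound * Y" by (simp add: bound_def algebra_simps)
    finally show ?thesis by (simp add: Y_def)
  qed
  have "(\<lambda>k. \<integral>z. f k z \<partial>M) \<longlonglongrightarrow> (\<integral>z. g z \<partial>M)"
  proof (rule integral_dominated_convergence[where w="\<lambda>(x, y). bound * (1 + y\<^sup>2)"])
    show "g \<in> borel_measurable M" unfolding g_def by measurable
    show "f k \<in> borel_measurable M" for k unfolding f_def by measurable
    have "integrable M (\<lambda>x. bound * (1 + (case x of (x, y) \<Rightarrow> y\<^sup>2)))"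
      using moment2 by (intro integrable_mult_right Bochner_Integration.integrable_add) auto
    then show "integrable M (\<lambda>(x, y). bound * (1 + y\<^sup>2))" by (simp add: split_beta')
    show "AE z in M. norm (f k z) \<le> (case z of (x, y) \<Rightarrow> bound * (1 + y\<^sup>2))" for k
      using bound by (auto intro!: AE_I2)
    show "AE z in M. (\<lambda>k. f k z) \<longlonglongrightarrow> g z"
    proof (rule AE_I2)
      fix z :: "torus \<times> real"
      obtain x y where z: "z = (x, y)" by (cases z)
      have "(\<lambda>k. f k z) \<longlonglongrightarrow> A' x * (y * (B y * 1)) - D x * A x * (B' y * 1 + 0 * B y)
         + \<gamma> * (A x * (- y * (B' y * 1 + 0 * B y) + (B'' y * 1 + 0 * B' y + (0 * B y + B' y * 0)) / \<beta>))"
        unfolding f_def z prod.case using \<beta>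
        by (intro tendsto_intros X_lim X1_lim X2_lim) auto
      then show "(\<lambda>k. f k z) \<longlonglongrightarrow> g z" by (simp add: g_def z)
    qed
  qed
  then have "(\<integral>z. g z \<partial>M) = 0" unfolding f0 using LIMSEQ_unique tendsto_const by blast
  then show ?thesis by (simp add: g_def)
qed

end

section \<open>Mollification\<close>

text \<open>This kernel is chosen because its derivatives are bounded multiples of itself: \<open>dz1 = \<zeta>' / \<zeta>\<close> and \<open>dz2 = \<zeta>'' / \<zeta>\<close>.\<close>

definition zeta :: "real \<Rightarrow> real \<Rightarrow> real" where
  "zeta e t = 2 / pi * (e ^ 3 * (inverse (e\<^sup>2 + t\<^sup>2) * inverse (e\<^sup>2 + t\<^sup>2)))"

definition dz1 :: "real \<Rightarrow> real \<Rightarrow> real" where "dz1 e t = - 4 * t / (e\<^sup>2 + t\<^sup>2)"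
definition dz2 :: "real \<Rightarrow> real \<Rightarrow> real" where "dz2 e t = (20 * t\<^sup>2 - 4 * e\<^sup>2) / (e\<^sup>2 + t\<^sup>2)\<^sup>2"

text \<open>The von Mises density with centre \<open>x\<close>. As the exponential of a
  trigonometric polynomial it is an admissible test function in either variable, with logarithmic
  derivative bounded by 2 pi times the modulus of \<open>a\<close>.\<close>

definition eta :: "real \<Rightarrow> torus \<Rightarrow> torus \<Rightarrow> real" where
  "eta a q x = exp (a * cos_2pi (q - x)) / Zn 0 a"

lemma measurable_zeta [measurable]: "zeta e \<in> borel_measurable borel" "dz1 e \<in> borel_measurable borel" "dz2 e \<in> borel_measurable borel"
  unfolding zeta_def[abs_def] dz1_def[abs_def] dz2_def[abs_def] by measurable

lemma measurable_cos_diff [measurable]: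
  assumes [measurable]: "f \<in> borel_measurable N" "g \<in> borel_measurable N"
  shows "(\<lambda>z. cos_2pi (f z - g z)) \<in> borel_measurable N" "(\<lambda>z. sin_2pi (f z - g z)) \<in> borel_measurable N"
  unfolding cos_2pi_diff sin_2pi_diff by measurable

lemma measurable_eta [measurable]:
  assumes [measurable]: "f \<in> borel_measurable N" "g \<in> borel_measurable N"
  shows "(\<lambda>z. eta a (f z) (g z)) \<in> borel_measurable N"
  unfolding eta_def by measurable

lemma eta_pos: "eta a q x > 0"
  by (simp add: eta_def Zn_0_pos)

lemma eta_tderiv: "has_tderiv (\<lambda>q. eta a q x) (- 2 * pi * a * sin_2pi (q - x) * eta a q x) q"
proof -
  have "has_tderiv (\<lambda>q. exp (a * cos_2pi (q + - x)) * (1 / Zn 0 a)) ((a * (- 2 * pi * sin_2pi (q + - x)) * exp (a * cos_2pi (q + - x))) * (1 / Zn 0 a) + exp (a * cos_2pi (q + - x)) * 0) q"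
    by (intro has_tderiv_mult has_tderiv_exp has_tderiv_cmult has_tderiv_shift[of cos_2pi] has_tderiv_cos_2pi has_tderiv_const)
  then show ?thesis by (simp add: eta_def[abs_def] mult_ac)
qed

lemma eta_swap: "eta a q x = eta a x q"
  by (simp add: eta_def cos_2pi_diff mult.commute)

lemma eta_elem: "(\<lambda>x. eta a q x) \<in> torus_elem"
proof -
  have "(\<lambda>x. exp (a * (cos_2pi q * cos_2pi x + sin_2pi q * sin_2pi x)) * (1 / Zn 0 a)) \<in> torus_elem"
    by (intro torus_elem.intros)
  then show ?thesis by (simp add: eta_def cos_2pi_diff)
qed

lemma sin_eta_elem: "(\<lambda>x. 2 * pi * a * sin_2pi (q - x) * eta a q x) \<in> torus_elem"
proof -
  have "(\<lambda>x. (2 * pi * a * (sin_2pi q * cos_2pi x + (- cos_2pi q) * sin_2pi x)) * eta a q x) \<in> torus_elem"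
    by (intro torus_elem.intros eta_elem)
  then show ?thesis by (simp add: sin_2pi_diff)
qed

lemma eta_tderiv2: "has_tderiv (\<lambda>x. eta a q x) (2 * pi * a * sin_2pi (q - x) * eta a q x) x"
  using eta_tderiv[of a q x] by (simp add: eta_swap[of a q] sin_2pi_diff algebra_simps)

text \<open>The second integral measures the width of the kernel: together with chord bounds such as
  \<open>lipschitz_chord\<close> it quantifies the error made by mollifying in
  \<open>q\<close>.\<close>

lemma eta_integral: "(\<integral>q. eta a q x \<partial>torus_lebesgue) = 1"
  and eta_integral_cos: "(\<integral>q. eta a q x * (1 - cos_2pi (q - x)) \<partial>torus_lebesgue) = 1 - R a"
proof -
  have "(\<integral>q. eta a q x \<partial>torus_lebesgue) = (\<integral>q. exp (a * cos_2pi q) / Zn 0 a \<partial>torus_lebesgue)"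
    using integral_torus_shift[of "\<lambda>q. exp (a * cos_2pi q) / Zn 0 a" "- x"] by (simp add: eta_def)
  then show "(\<integral>q. eta a q x \<partial>torus_lebesgue) = 1" using Zn_0_pos[of a] by (simp add: Zn_def)
  have "(\<integral>q. eta a q x * (1 - cos_2pi (q - x)) \<partial>torus_lebesgue)
      = (\<integral>q. exp (a * cos_2pi q) / Zn 0 a * (1 - cos_2pi q) \<partial>torus_lebesgue)"
    using integral_torus_shift[of "\<lambda>q. exp (a * cos_2pi q) / Zn 0 a * (1 - cos_2pi q)" "- x"] by (simp add: eta_def)
  also have "\<dots> = (\<integral>q. exp (a * cos_2pi q) / Zn 0 a - cos_2pi q * exp (a * cos_2pi q) / Zn 0 a \<partial>torus_lebesgue)"
    by (intro Bochner_Integration.integral_cong refl) (simp add: algebra_simps diff_divide_distrib)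
  also have "\<dots> = Zn 0 a / Zn 0 a - Zn 1 a / Zn 0 a"
    using Zn_integrable[of 0 a] Zn_integrable[of 1 a] by (simp add: Zn_def)
  finally show "(\<integral>q. eta a q x * (1 - cos_2pi (q - x)) \<partial>torus_lebesgue) = 1 - R a"
    using Zn_0_pos[of a] by (simp add: R_def)
qed

lemma continuous_on_eta: "continuous_on S (\<lambda>q. eta a q x)"
  unfolding eta_swap[of a _ x] by (rule torus_elem_continuous[OF eta_elem])

lemma eta_bound: "\<exists>C. \<forall>q x. eta a q x \<le> C"
  using exp_cos_le[of a] Zn_0_pos[of a] by (intro exI[of _ "exp \<bar>a\<bar> / Zn 0 a"]) (simp add: eta_def divide_right_mono)

context
  fixes e :: real assumes e: "e > 0"
begin

lemma e2t2: "e\<^sup>2 + t\<^sup>2 > 0" using e by (simp add: add_pos_nonneg)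

lemma zeta_pos: "zeta e t > 0"
  unfolding zeta_def using e e2t2[of t] by simp

lemma DERIV_zeta: "(zeta e has_real_derivative dz1 e t * zeta e t) (at t)"
proof -
  have "((\<lambda>t. inverse (e\<^sup>2 + t\<^sup>2)) has_real_derivative - (2 * t) * (inverse (e\<^sup>2 + t\<^sup>2) * inverse (e\<^sup>2 + t\<^sup>2))) (at t)"
    using e2t2[of t] by (auto intro!: derivative_eq_intros simp: power2_eq_square)
  from DERIV_cmult[OF DERIV_cmult[OF DERIV_mult[OF this this]], of "2 / pi" "e ^ 3"]
  show ?thesis unfolding zeta_def[abs_def] dz1_def divide_inverse[of "- 4 * t"] by (simp add: mult_ac)
qed

lemma DERIV_dz1: "(dz1 e has_real_derivative dz2 e t - dz1 e t * dz1 e t) (at t)"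
proof -
  have "(dz1 e has_real_derivative ((- 4) * (e\<^sup>2 + t\<^sup>2) - (- 4 * t) * (2 * t)) / ((e\<^sup>2 + t\<^sup>2) * (e\<^sup>2 + t\<^sup>2))) (at t)"
  proof -
    have "((\<lambda>t. - 4 * t) has_real_derivative - 4) (at t)" by (auto intro!: derivative_eq_intros)
    moreover have "((\<lambda>t. e\<^sup>2 + t\<^sup>2) has_real_derivative 2 * t) (at t)" by (auto intro!: derivative_eq_intros)
    ultimately show ?thesis
      unfolding dz1_def[abs_def] by (rule DERIV_divide) (rule less_imp_neq[OF e2t2, symmetric])
  qed
  also have "((- 4) * (e\<^sup>2 + t\<^sup>2) - (- 4 * t) * (2 * t)) / ((e\<^sup>2 + t\<^sup>2) * (e\<^sup>2 + t\<^sup>2)) = dz2 e t - dz1 e t * dz1 e t"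
  proof -
    have "dz1 e t * dz1 e t = (16 * (t * t)) / ((e\<^sup>2 + t\<^sup>2) * (e\<^sup>2 + t\<^sup>2))" by (simp add: dz1_def)
    moreover have "dz2 e t = (20 * (t * t) - 4 * e\<^sup>2) / ((e\<^sup>2 + t\<^sup>2) * (e\<^sup>2 + t\<^sup>2))"
      by (simp add: dz2_def power2_eq_square)
    ultimately have "dz2 e t - dz1 e t * dz1 e t = (20 * (t * t) - 4 * e\<^sup>2 - 16 * (t * t)) / ((e\<^sup>2 + t\<^sup>2) * (e\<^sup>2 + t\<^sup>2))"
      by (simp add: diff_divide_distrib[symmetric])
    also have "20 * (t * t) - 4 * e\<^sup>2 - 16 * (t * t) = (- 4) * (e\<^sup>2 + t\<^sup>2) - (- 4 * t) * (2 * t)"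
      by (simp add: power2_eq_square)
    finally show ?thesis ..
  qed
  finally show ?thesis .
qed

lemma DERIV_dz1_zeta: "((\<lambda>t. dz1 e t * zeta e t) has_real_derivative dz2 e t * zeta e t) (at t)"
  using DERIV_mult[OF DERIV_dz1 DERIV_zeta, of t] by (simp add: algebra_simps)

lemma abs_dz1_le: "\<bar>dz1 e t\<bar> \<le> 2 / e"
proof -
  have "0 \<le> (e - \<bar>t\<bar>)\<^sup>2" by simp
  then have "2 * (\<bar>t\<bar> * e) \<le> e\<^sup>2 + t\<^sup>2" by (simp add: power2_diff algebra_simps)
  then show ?thesis using e e2t2[of t] by (simp add: dz1_def abs_mult field_simps)
qed

lemma abs_dz2_le: "\<bar>dz2 e t\<bar> \<le> 20 / e\<^sup>2"
proof -
  have "\<bar>dz2 e t\<bar> = \<bar>20 * t\<^sup>2 - 4 * e\<^sup>2\<bar> / (e\<^sup>2 + t\<^sup>2)\<^sup>2"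
    unfolding dz2_def by simp
  also have "\<dots> \<le> (20 * (e\<^sup>2 + t\<^sup>2)) / (e\<^sup>2 + t\<^sup>2)\<^sup>2"
  proof (intro divide_right_mono)
    have "0 \<le> t\<^sup>2" "0 \<le> e\<^sup>2" by simp_all
    then show "\<bar>20 * t\<^sup>2 - 4 * e\<^sup>2\<bar> \<le> 20 * (e\<^sup>2 + t\<^sup>2)" unfolding distrib_left by (intro abs_leI; linarith)
  qed simp
  also have "\<dots> = 20 / (e\<^sup>2 + t\<^sup>2)"
  proof -
    have "20 * s / s\<^sup>2 = 20 / s" if "s > 0" for s :: real using that by (simp add: power2_eq_square)
    from this[OF e2t2[of t]] show ?thesis .
  qed
  also have "\<dots> \<le> 20 / e\<^sup>2" using e e2t2[of t] by (intro divide_left_mono mult_pos_pos) auto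
  finally show ?thesis .
qed

lemma zeta_le: "zeta e t \<le> 1 / e"
proof -
  have "zeta e t = 2 / pi * (e ^ 3 / (e\<^sup>2 + t\<^sup>2)\<^sup>2)"
    by (simp add: zeta_def divide_inverse power2_eq_square)
  also have "\<dots> \<le> 1 * (e ^ 3 / (e\<^sup>2)\<^sup>2)"
    using e pi_ge_two by (intro mult_mono divide_left_mono power_mono) auto
  also have "\<dots> = 1 / e" using e by (simp add: eval_nat_numeral)
  finally show ?thesis .
qed

lemma zeta_smooth: "(\<lambda>y. zeta e (p - y)) \<in> smooth_elem"
proof -
  have i: "(\<lambda>y. inverse (e\<^sup>2 + (p + (- 1) * y) * (p + (- 1) * y))) \<in> smooth_elem"
  proof (intro smooth_elem.inverse smooth_elem.add smooth_elem.mult smooth_elem.const smooth_elem.ident allI)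
    fix y show "e\<^sup>2 + (p + (- 1) * y) * (p + (- 1) * y) \<noteq> 0"
      using e2t2[of "p + (- 1) * y"] unfolding power2_eq_square by (rule less_imp_neq[symmetric])
  qed
  have "(\<lambda>y. 2 / pi * (e ^ 3 * (inverse (e\<^sup>2 + (p + (- 1) * y) * (p + (- 1) * y)) * inverse (e\<^sup>2 + (p + (- 1) * y) * (p + (- 1) * y))))) \<in> smooth_elem"
    by (intro smooth_elem.mult smooth_elem.const i)
  then show ?thesis unfolding zeta_def by (simp add: power2_eq_square)
qed

text \<open>Up to scale this is the Student density with three degrees of freedom, which still has a
  variance, namely e^2. Partial fractions give primitives built from \<open>arctan (t / e)\<close>
  and \<open>e * t / (e\<^sup>2 + t\<^sup>2)\<close>; the limits of the arctangent account for the
  factor 2 / pi.\<close>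

lemma zeta_integrals:
  "integrable lborel (zeta e)" "(\<integral>t. zeta e t \<partial>lborel) = 1"
  "integrable lborel (\<lambda>t. zeta e t * t\<^sup>2)" "(\<integral>t. zeta e t * t\<^sup>2 \<partial>lborel) = e\<^sup>2"
proof -
  have c: "isCont (zeta e) t" for t using DERIV_isCont[OF DERIV_zeta] .
  have lim1: "((\<lambda>t. e * t / (e\<^sup>2 + t\<^sup>2)) \<longlongrightarrow> 0) at_top" "((\<lambda>t. e * t / (e\<^sup>2 + t\<^sup>2)) \<longlongrightarrow> 0) at_bot"
    using e by real_asymp+
  have te: "filterlim (\<lambda>t. t / e) at_top at_top" "filterlim (\<lambda>t. t / e) at_bot at_bot" using e by real_asymp+
  have lim2: "((\<lambda>t. arctan (t / e)) \<longlongrightarrow> pi / 2) at_top" "((\<lambda>t. arctan (t / e)) \<longlongrightarrow> - (pi / 2)) at_bot"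
    using filterlim_compose[OF tendsto_arctan_at_top te(1)] filterlim_compose[OF tendsto_arctan_at_bot te(2)] by auto
  have d1: "((\<lambda>t. e * t / (e\<^sup>2 + t\<^sup>2)) has_real_derivative (e * (e\<^sup>2 - t\<^sup>2)) / (e\<^sup>2 + t\<^sup>2)\<^sup>2) (at t)" for t
    using e2t2[of t] by (auto intro!: derivative_eq_intros simp: power2_eq_square algebra_simps)
  have d2: "((\<lambda>t. arctan (t / e)) has_real_derivative e / (e\<^sup>2 + t\<^sup>2)) (at t)" for t
    using e e2t2[of t] by (auto intro!: derivative_eq_intros simp: power2_eq_square field_simps)
  have zz: "zeta e t = 1 / pi * ((e * (e\<^sup>2 - t\<^sup>2)) / (e\<^sup>2 + t\<^sup>2)\<^sup>2 + e / (e\<^sup>2 + t\<^sup>2))" for t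
  proof -
    define s where "s = e\<^sup>2 + t\<^sup>2"
    have s: "s \<noteq> 0" "t\<^sup>2 = s - e\<^sup>2" using e2t2[of t] by (auto simp: s_def)
    have "e * (e\<^sup>2 - t\<^sup>2) / s\<^sup>2 + e / s = 2 * e ^ 3 / s\<^sup>2"
      unfolding s(2) using s(1) by (simp add: field_simps eval_nat_numeral)
    then have "1 / pi * (e * (e\<^sup>2 - t\<^sup>2) / s\<^sup>2 + e / s) = 1 / pi * (2 * e ^ 3 / s\<^sup>2)" by simp
    also have "\<dots> = zeta e t"
      unfolding zeta_def s_def[symmetric] by (simp add: divide_inverse power2_eq_square)
    finally show ?thesis by (simp add: s_def)
  qed
  have zt: "zeta e t * t\<^sup>2 = e\<^sup>2 / pi * (e / (e\<^sup>2 + t\<^sup>2) - (e * (e\<^sup>2 - t\<^sup>2)) / (e\<^sup>2 + t\<^sup>2)\<^sup>2)" for t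
  proof -
    define s where "s = e\<^sup>2 + t\<^sup>2"
    have s: "s \<noteq> 0" "t\<^sup>2 = s - e\<^sup>2" using e2t2[of t] by (auto simp: s_def)
    have "e / s - e * (e\<^sup>2 - t\<^sup>2) / s\<^sup>2 = 2 * e * t\<^sup>2 / s\<^sup>2"
      unfolding s(2) using s(1) by (simp add: field_simps eval_nat_numeral)
    then have "e\<^sup>2 / pi * (e / s - e * (e\<^sup>2 - t\<^sup>2) / s\<^sup>2) = e\<^sup>2 / pi * (2 * e * t\<^sup>2 / s\<^sup>2)" by simp
    also have "\<dots> = zeta e t * t\<^sup>2"
      unfolding zeta_def s_def[symmetric] by (simp add: divide_inverse power2_eq_square power3_eq_cube)
    finally show ?thesis by (simp add: s_def)
  qed
  define F1 where "F1 t = 1 / pi * (e * t / (e\<^sup>2 + t\<^sup>2) + arctan (t / e))" for t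
  define F2 where "F2 t = e\<^sup>2 / pi * (arctan (t / e) - e * t / (e\<^sup>2 + t\<^sup>2))" for t
  have "(F1 \<longlongrightarrow> 1 / 2) at_top" "(F1 \<longlongrightarrow> - 1 / 2) at_bot"
    unfolding F1_def
    using tendsto_mult_left[OF tendsto_add[OF lim1(1) lim2(1)], of "1 / pi"] tendsto_mult_left[OF tendsto_add[OF lim1(2) lim2(2)], of "1 / pi"]
    by simp_all
  then have l1: "((F1 \<circ> real_of_ereal) \<longlongrightarrow> 1 / 2) (at_left \<infinity>)" "((F1 \<circ> real_of_ereal) \<longlongrightarrow> - 1 / 2) (at_right (-\<infinity>))"
    unfolding ereal_tendsto_simps .
  have "(F2 \<longlongrightarrow> e\<^sup>2 / 2) at_top" "(F2 \<longlongrightarrow> - e\<^sup>2 / 2) at_bot"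
    unfolding F2_def
    using tendsto_mult_left[OF tendsto_diff[OF lim2(1) lim1(1)], of "e\<^sup>2 / pi"] tendsto_mult_left[OF tendsto_diff[OF lim2(2) lim1(2)], of "e\<^sup>2 / pi"]
    by simp_all
  then have l2: "((F2 \<circ> real_of_ereal) \<longlongrightarrow> e\<^sup>2 / 2) (at_left \<infinity>)" "((F2 \<circ> real_of_ereal) \<longlongrightarrow> - e\<^sup>2 / 2) (at_right (-\<infinity>))"
    unfolding ereal_tendsto_simps .
  have D1: "(F1 has_real_derivative zeta e t) (at t)" for t
    unfolding F1_def zz by (intro DERIV_cmult DERIV_add d1 d2)
  have D2: "(F2 has_real_derivative zeta e t * t\<^sup>2) (at t)" for t
    unfolding F2_def zt by (intro DERIV_cmult DERIV_diff d1 d2)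
  note I1 = interval_integral_FTC_nonneg[of "-\<infinity>" "\<infinity>" F1 "zeta e" "- 1 / 2" "1 / 2"]
  show "integrable lborel (zeta e)" "(\<integral>t. zeta e t \<partial>lborel) = 1"
    using I1 D1 c l1 zeta_pos by (auto simp: less_imp_le set_integrable_def interval_lebesgue_integral_def set_lebesgue_integral_def)
  note I2 = interval_integral_FTC_nonneg[of "-\<infinity>" "\<infinity>" F2 "\<lambda>t. zeta e t * t\<^sup>2" "- e\<^sup>2 / 2" "e\<^sup>2 / 2"]
  have c2: "isCont (\<lambda>t. zeta e t * t\<^sup>2) t" for t using c by (intro continuous_intros)
  show "integrable lborel (\<lambda>t. zeta e t * t\<^sup>2)" "(\<integral>t. zeta e t * t\<^sup>2 \<partial>lborel) = e\<^sup>2"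
    using I2 D2 c2 l2 zeta_pos by (auto simp: less_imp_le set_integrable_def interval_lebesgue_integral_def set_lebesgue_integral_def)
qed

lemma zeta_shift:
  assumes "integrable lborel (\<lambda>t. zeta e t * g t)"
  shows "integrable lborel (\<lambda>p. zeta e (p - y) * g (p - y))"
    "(\<integral>p. zeta e (p - y) * g (p - y) \<partial>lborel) = (\<integral>t. zeta e t * g t \<partial>lborel)"
  using lborel_integrable_real_affine[OF assms, of 1 "- y"] lborel_integral_real_affine[of 1 "\<lambda>t. zeta e t * g t" "- y"]
  by simp_all

end

section \<open>The entropy estimate\<close>

context kinetic
begin

interpretation M: prob_space M using pp by (simp add: phase_prob_def)

interpretation PM: pair_sigma_finite M phase_lebesgue
  by (intro pair_sigma_finite.intro M.sigma_finite_measure_axioms phase_sf.sigma_finite_measure_axioms)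

lemma sets_M2 [measurable_cong]: "sets M = sets (borel \<Otimes>\<^sub>M borel)" by simp

definition ker :: "real \<Rightarrow> real \<Rightarrow> torus \<times> real \<Rightarrow> torus \<times> real \<Rightarrow> real" where
  "ker a e w z = eta a (fst z) (fst w) * zeta e (snd z - snd w)"

text \<open>Throughout, \<open>w\<close> is integrated over the measure and \<open>z\<close> is the point where the mollification is evaluated.\<close>

definition T :: "real \<Rightarrow> real \<Rightarrow> (torus \<times> real \<Rightarrow> torus \<times> real \<Rightarrow> real) \<Rightarrow> torus \<times> real \<Rightarrow> real" where
  "T a e H z = (\<integral>w. ker a e w z * H w z \<partial>M)"

text \<open>A common majorant of the integrands below: one factor is integrable against the kernel,
  the other against the measure, and only second moments are available on either side.\<close>

definition dom :: "torus \<times> real \<Rightarrow> torus \<times> real \<Rightarrow> real" where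
  "dom w z = (1 + (snd z - snd w)\<^sup>2) * (1 + (snd w)\<^sup>2)"

abbreviation "BB \<equiv> (borel \<Otimes>\<^sub>M borel) :: (torus \<times> real) measure"

abbreviation meas2 :: "(torus \<times> real \<Rightarrow> torus \<times> real \<Rightarrow> real) \<Rightarrow> bool" where
  "meas2 H \<equiv> (\<lambda>(w, z). H w z) \<in> borel_measurable (BB \<Otimes>\<^sub>M BB)"

lemma dom_ge_1: "dom w z \<ge> 1"
proof -
  have "1 * 1 \<le> dom w z" unfolding dom_def by (intro mult_mono) auto
  then show ?thesis by simp
qed

lemma ker_measurable [measurable]: "(\<lambda>x. ker a e (fst x) (snd x)) \<in> borel_measurable (BB \<Otimes>\<^sub>M BB)"
  unfolding ker_def by measurable

context
  fixes a e :: real assumes e: "e > 0"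
begin

lemma ker_pos: "ker a e w z > 0"
  unfolding ker_def by (intro mult_pos_pos eta_pos zeta_pos[OF e])

lemma ker_fibre:
  assumes "continuous_on UNIV f" "integrable lborel (\<lambda>t. zeta e t * g t)"
  shows "integrable phase_lebesgue (\<lambda>z. ker a e w z * (f (fst z) * g (snd z - snd w)))"
    "(\<integral>z. ker a e w z * (f (fst z) * g (snd z - snd w)) \<partial>phase_lebesgue)
       = (\<integral>q. eta a q (fst w) * f q \<partial>torus_lebesgue) * (\<integral>t. zeta e t * g t \<partial>lborel)"
proof -
  have i: "integrable torus_lebesgue (\<lambda>q. eta a q (fst w) * f q)"
    by (intro integrable_torus_continuous continuous_intros continuous_on_eta assms)
  note z = zeta_shift[OF e assms(2), of "snd w"]
  have eq: "(\<lambda>z. ker a e w z * (f (fst z) * g (snd z - snd w)))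
     = (\<lambda>(q, p). (eta a q (fst w) * f q) * (zeta e (p - snd w) * g (p - snd w)))"
    by (auto simp: ker_def fun_eq_iff)
  show "integrable phase_lebesgue (\<lambda>z. ker a e w z * (f (fst z) * g (snd z - snd w)))"
    unfolding eq by (rule integrable_phase_prod(1)[OF i z(1)])
  show "(\<integral>z. ker a e w z * (f (fst z) * g (snd z - snd w)) \<partial>phase_lebesgue)
       = (\<integral>q. eta a q (fst w) * f q \<partial>torus_lebesgue) * (\<integral>t. zeta e t * g t \<partial>lborel)"
    unfolding eq by (simp add: integrable_phase_prod(2)[OF i z(1)] z(2))
qed

lemma ker_dom:
  "integrable phase_lebesgue (\<lambda>z. ker a e w z * dom w z)"
  "(\<integral>z. ker a e w z * dom w z \<partial>phase_lebesgue) = (1 + e\<^sup>2) * (1 + (snd w)\<^sup>2)"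
proof -
  have i: "integrable lborel (\<lambda>t. zeta e t * (1 + t\<^sup>2))"
    using zeta_integrals[OF e] by (simp add: distrib_left)
  have v: "(\<integral>t. zeta e t * (1 + t\<^sup>2) \<partial>lborel) = 1 + e\<^sup>2"
    using zeta_integrals[OF e] by (simp add: distrib_left)
  have eq: "(\<lambda>z. ker a e w z * dom w z) = (\<lambda>z. (ker a e w z * (1 * (1 + (snd z - snd w)\<^sup>2))) * (1 + (snd w)\<^sup>2))"
    by (simp add: dom_def mult_ac)
  note k = ker_fibre[OF continuous_on_const[of UNIV 1] i, of w]
  show "integrable phase_lebesgue (\<lambda>z. ker a e w z * dom w z)"
    unfolding eq by (intro integrable_mult_left k)
  show "(\<integral>z. ker a e w z * dom w z \<partial>phase_lebesgue) = (1 + e\<^sup>2) * (1 + (snd w)\<^sup>2)"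
    unfolding eq using k by (simp add: v eta_integral)
qed

text \<open>Joint integrability of this one majorant is what makes Fubini available for every
  \<open>T a e H\<close> used later.\<close>

lemma ker_dom_joint: "integrable (M \<Otimes>\<^sub>M phase_lebesgue) (\<lambda>(w, z). ker a e w z * dom w z)"
proof (rule PM.Fubini_integrable)
  show "(\<lambda>(w, z). ker a e w z * dom w z) \<in> borel_measurable (M \<Otimes>\<^sub>M phase_lebesgue)"
    unfolding split_beta' dom_def by measurable
  have "norm (ker a e w z * dom w z) = ker a e w z * dom w z" for w z
    using ker_pos[of w z] dom_ge_1[of w z] by (simp add: abs_mult)
  moreover have "integrable M (\<lambda>w. (1 + e\<^sup>2) * (1 + (snd w)\<^sup>2))"
    using moment2 by (intro integrable_mult_right Bochner_Integration.integrable_add) (auto simp: split_beta')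
  ultimately show "integrable M (\<lambda>w. \<integral>z. norm (case (w, z) of (w, z) \<Rightarrow> ker a e w z * dom w z) \<partial>phase_lebesgue)"
    by (simp add: ker_dom)
qed (simp add: ker_dom)

lemma ker_joint:
  assumes m: "meas2 H" and b: "\<And>w z. \<bar>H w z\<bar> \<le> C * dom w z"
  shows "integrable (M \<Otimes>\<^sub>M phase_lebesgue) (\<lambda>(w, z). ker a e w z * H w z)"
proof (rule Bochner_Integration.integrable_bound)
  show "integrable (M \<Otimes>\<^sub>M phase_lebesgue) (\<lambda>x. C * (case x of (w, z) \<Rightarrow> ker a e w z * dom w z))"
    by (intro integrable_mult_right ker_dom_joint)
  have [measurable]: "(\<lambda>x. H (fst x) (snd x)) \<in> borel_measurable (BB \<Otimes>\<^sub>M BB)" using m by (simp add: split_beta')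
  show "(\<lambda>(w, z). ker a e w z * H w z) \<in> borel_measurable (M \<Otimes>\<^sub>M phase_lebesgue)"
    unfolding split_beta' by measurable
  have "norm (ker a e w z * H w z) \<le> norm (C * (ker a e w z * dom w z))" for w z
  proof -
    have "norm (ker a e w z * H w z) = ker a e w z * \<bar>H w z\<bar>" using ker_pos[of w z] by (simp add: abs_mult)
    also have "\<dots> \<le> ker a e w z * (C * dom w z)" using ker_pos[of w z] by (intro mult_left_mono b) auto
    finally show ?thesis using abs_ge_self[of "C * (ker a e w z * dom w z)"] by (simp add: mult_ac)
  qed
  then show "AE x in M \<Otimes>\<^sub>M phase_lebesgue. norm (case x of (w, z) \<Rightarrow> ker a e w z * H w z)
      \<le> norm (C * (case x of (w, z) \<Rightarrow> ker a e w z * dom w z))"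
    by (auto simp: split_beta')
qed

lemma T_integrable:
  assumes "meas2 H" "\<And>w z. \<bar>H w z\<bar> \<le> C * dom w z"
  shows "integrable phase_lebesgue (T a e H)"
    and "(\<integral>z. T a e H z \<partial>phase_lebesgue) = (\<integral>w. \<integral>z. ker a e w z * H w z \<partial>phase_lebesgue \<partial>M)"
    and "integrable M (\<lambda>w. \<integral>z. ker a e w z * H w z \<partial>phase_lebesgue)"
  using PM.integrable_snd[OF ker_joint[OF assms]] PM.Fubini_integral[OF ker_joint[OF assms]]
    PM.integrable_fst[OF ker_joint[OF assms]]
  unfolding T_def[abs_def] by auto

lemma T_measurable [measurable]:
  assumes "meas2 H" shows "T a e H \<in> borel_measurable BB"
proof -
  have [measurable]: "(\<lambda>x. H (fst x) (snd x)) \<in> borel_measurable (BB \<Otimes>\<^sub>M BB)" using assms by (simp add: split_beta')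
  have sw: "(\<lambda>x. (snd x, fst x)) \<in> measurable (BB \<Otimes>\<^sub>M M) (BB \<Otimes>\<^sub>M BB)" by measurable
  have "(\<lambda>x. ker a e (fst x) (snd x) * H (fst x) (snd x)) \<in> borel_measurable (BB \<Otimes>\<^sub>M BB)" by measurable
  from measurable_compose[OF sw this]
  have "(\<lambda>z. \<integral>w. ker a e w z * H w z \<partial>M) \<in> borel_measurable BB"
    by (intro M.borel_measurable_lebesgue_integral) (simp add: split_beta')
  then show ?thesis unfolding T_def[abs_def] .
qed

text \<open>At fixed \<open>z\<close> the kernel is bounded, so only the growth in the velocity of
  \<open>w\<close> has to be matched by \<open>moment2\<close>.\<close>

lemma fibre_integrable:
  assumes m: "meas2 H" and b: "\<And>w. \<bar>H w z\<bar> \<le> C * (1 + (snd w)\<^sup>2)"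
  shows "integrable M (\<lambda>w. ker a e w z * H w z)"
proof -
  obtain E where E: "\<And>q x. eta a q x \<le> E" using eta_bound by blast
  have "E \<ge> 0" using E[of 0 0] eta_pos[of a 0 0] by linarith
  have [measurable]: "(\<lambda>x. H (fst x) (snd x)) \<in> borel_measurable (BB \<Otimes>\<^sub>M BB)" using m by (simp add: split_beta')
  have k: "ker a e w z \<le> E * (1 / e)" for w
    unfolding ker_def using less_imp_le[OF zeta_pos[OF e]] \<open>E \<ge> 0\<close> by (intro mult_mono E zeta_le[OF e]) auto
  show ?thesis
  proof (rule integrable_M_quadratic)
    have p: "(\<lambda>w. (w, z)) \<in> measurable BB (BB \<Otimes>\<^sub>M BB)"
      by (rule measurable_Pair) (auto simp: space_pair_measure)
    have "(\<lambda>x. ker a e (fst x) (snd x) * H (fst x) (snd x)) \<in> borel_measurable (BB \<Otimes>\<^sub>M BB)" by measurable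
    from measurable_compose[OF p this] show "(\<lambda>w. ker a e w z * H w z) \<in> borel_measurable BB" by simp
    show "\<bar>ker a e (x, y) z * H (x, y) z\<bar> \<le> (E * (1 / e) * C) * (1 + y\<^sup>2)" for x y
    proof -
      have "\<bar>ker a e (x, y) z * H (x, y) z\<bar> = ker a e (x, y) z * \<bar>H (x, y) z\<bar>"
        using ker_pos[of "(x, y)" z] by (simp add: abs_mult)
      also have "\<dots> \<le> (E * (1 / e)) * (C * (1 + y\<^sup>2))"
        using ker_pos[of "(x, y)" z] b[of "(x, y)"] e \<open>E \<ge> 0\<close> by (intro mult_mono k) auto
      finally show ?thesis by (simp add: mult_ac)
    qed
  qed
qed

end

end

section \<open>The mollified density, its fluxes, and the equation they satisfy\<close>

context kinetic
begin

interpretation M: prob_space M using pp by (simp add: phase_prob_def)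

lemma dom_bounds:
  "1 + (snd z)\<^sup>2 \<le> 2 * dom w z" "1 + (snd w)\<^sup>2 \<le> dom w z" "1 + (snd z - snd w)\<^sup>2 \<le> dom w z"
  "(1 + \<bar>snd z\<bar>) * (1 + \<bar>snd w\<bar>) \<le> 3 * dom w z" "(1 + \<bar>snd z - snd w\<bar>) * (1 + \<bar>snd z\<bar>) \<le> 3 * dom w z"
proof -
  define p y where "p = snd z" and "y = snd w"
  have d: "dom w z = (1 + (p - y)\<^sup>2) * (1 + y\<^sup>2)" by (simp add: dom_def p_def y_def)
  have d': "dom w z = 1 + (p - y)\<^sup>2 + y\<^sup>2 + (p - y)\<^sup>2 * y\<^sup>2" unfolding d by (simp add: algebra_simps)
  have n: "0 \<le> (p - y)\<^sup>2 * y\<^sup>2" "0 \<le> y\<^sup>2" "0 \<le> (p - y)\<^sup>2" "0 \<le> (p - y - y)\<^sup>2" by simp_all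
  \<comment> \<open>The parallelogram identity for p = (p - y) + y, whose companion difference is p
    - 2 y.\<close>
  have p2: "p\<^sup>2 = 2 * (p - y)\<^sup>2 + 2 * y\<^sup>2 - (p - y - y)\<^sup>2" by (simp add: power2_eq_square algebra_simps)
  have 1: "1 + p\<^sup>2 \<le> 2 * dom w z" using n unfolding d' p2 by argo
  have 2: "1 + y\<^sup>2 \<le> dom w z" using n unfolding d' by argo
  have 3: "1 + (p - y)\<^sup>2 \<le> dom w z" using n unfolding d' by argo
  have amgm: "(1 + \<bar>r\<bar>) * (1 + \<bar>s\<bar>) \<le> (1 + r\<^sup>2) + (1 + s\<^sup>2)" for r s :: real
  proof -
    have "0 \<le> (\<bar>r\<bar> - \<bar>s\<bar>)\<^sup>2 + (\<bar>r\<bar> - 1)\<^sup>2 + (\<bar>s\<bar> - 1)\<^sup>2" by simp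
    then show ?thesis by (simp add: power2_diff algebra_simps)
  qed
  have "(1 + \<bar>p - y\<bar>) * (1 + \<bar>p\<bar>) \<le> (1 + (p - y)\<^sup>2) + (1 + p\<^sup>2)" by (rule amgm)
  then have 5: "(1 + \<bar>p - y\<bar>) * (1 + \<bar>p\<bar>) \<le> 3 * dom w z" using 1 3 by linarith
  have "(1 + \<bar>p\<bar>) * (1 + \<bar>y\<bar>) \<le> (1 + p\<^sup>2) + (1 + y\<^sup>2)" by (rule amgm)
  then have 4: "(1 + \<bar>p\<bar>) * (1 + \<bar>y\<bar>) \<le> 3 * dom w z" using 1 2 by linarith
  show "1 + (snd z)\<^sup>2 \<le> 2 * dom w z" "1 + (snd w)\<^sup>2 \<le> dom w z" "1 + (snd z - snd w)\<^sup>2 \<le> dom w z"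
     "(1 + \<bar>snd z\<bar>) * (1 + \<bar>snd w\<bar>) \<le> 3 * dom w z" "(1 + \<bar>snd z - snd w\<bar>) * (1 + \<bar>snd z\<bar>) \<le> 3 * dom w z"
    using 1 2 3 4 5 by (simp_all add: p_def y_def)
qed

lemma T_mult: "T a e (\<lambda>w z. H w z * \<Phi> z) = (\<lambda>z. T a e H z * \<Phi> z)"
  unfolding T_def by (simp add: mult.assoc[symmetric])

context
  fixes a e :: real assumes e: "e > 0"
begin

lemma TI:
  assumes "meas2 H" and [measurable]: "\<Phi> \<in> borel_measurable BB" and "\<And>w z. \<bar>H w z\<bar> * \<bar>\<Phi> z\<bar> \<le> C * dom w z"
  shows "integrable phase_lebesgue (\<lambda>z. T a e H z * \<Phi> z)"
proof -
  have [measurable]: "(\<lambda>x. H (fst x) (snd x)) \<in> borel_measurable (BB \<Otimes>\<^sub>M BB)" using assms(1) by (simp add: split_beta')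
  have "meas2 (\<lambda>w z. H w z * \<Phi> z)" unfolding split_beta' by measurable
  from T_integrable(1)[OF e this, of C] assms(3) have "integrable phase_lebesgue (T a e (\<lambda>w z. H w z * \<Phi> z))"
    by (simp add: abs_mult)
  then show ?thesis by (simp add: T_mult)
qed

lemma T_tderiv:
  assumes [measurable]: "g \<in> borel_measurable BB" and b: "\<And>w. \<bar>g w\<bar> \<le> C * (1 + (snd w)\<^sup>2)"
  shows "has_tderiv (\<lambda>q. T a e (\<lambda>w z. g w) (q, p)) (T a e (\<lambda>w z. - 2 * pi * a * sin_2pi (fst z - fst w) * g w) (q, p)) q"
proof -
  obtain E where E: "\<And>q x. eta a q x \<le> E" using eta_bound by blast
  have "E \<ge> 0" using E[of 0 0] eta_pos[of a 0 0] by linarith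
  have kb: "0 \<le> ker a e w z" "ker a e w z \<le> E * (1 / e)" for w z
    using less_imp_le[OF ker_pos[OF e, of a w z]] apply simp
    unfolding ker_def using less_imp_le[OF zeta_pos[OF e]] \<open>E \<ge> 0\<close> by (intro mult_mono E zeta_le[OF e]) auto
  show ?thesis
    unfolding T_def
  proof (rule has_tderiv_integral[where w="\<lambda>w. E * (1 / e) * (2 * pi * \<bar>a\<bar>) * (C * (1 + (snd w)\<^sup>2))"])
    fix q w
    show "has_tderiv (\<lambda>q. ker a e w (q, p) * g w) (ker a e w (q, p) * (- 2 * pi * a * sin_2pi (fst (q, p) - fst w) * g w)) q"
      using has_tderiv_mult[OF eta_tderiv[of a "fst w" q] has_tderiv_const[of "zeta e (p - snd w) * g w"]]
      by (simp add: ker_def mult_ac)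
    have "\<bar>sin_2pi (q - fst w)\<bar> \<le> 1" by simp
    have "\<bar>ker a e w (q, p) * (- 2 * pi * a * sin_2pi (fst (q, p) - fst w) * g w)\<bar>
      = ker a e w (q, p) * (2 * pi * \<bar>a\<bar> * \<bar>sin_2pi (q - fst w)\<bar>) * \<bar>g w\<bar>"
      using kb(1)[of w "(q, p)"] by (simp add: abs_mult)
    also have "\<dots> \<le> E * (1 / e) * (2 * pi * \<bar>a\<bar> * 1) * (C * (1 + (snd w)\<^sup>2))"
      using kb b \<open>E \<ge> 0\<close> e by (intro mult_mono mult_nonneg_nonneg order_refl) auto
    finally show "\<bar>ker a e w (q, p) * (- 2 * pi * a * sin_2pi (fst (q, p) - fst w) * g w)\<bar>
      \<le> E * (1 / e) * (2 * pi * \<bar>a\<bar>) * (C * (1 + (snd w)\<^sup>2))" by simp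
  next
    show "integrable M (\<lambda>w. E * (1 / e) * (2 * pi * \<bar>a\<bar>) * (C * (1 + (snd w)\<^sup>2)))"
      using moment2 by (intro integrable_mult_right Bochner_Integration.integrable_add) (auto simp: split_beta')
    show "integrable M (\<lambda>w. ker a e w (q, p) * g w)" for q
      by (rule fibre_integrable[OF e _ b]) measurable
    show "(\<lambda>w. ker a e w (q, p) * (- 2 * pi * a * sin_2pi (fst (q, p) - fst w) * g w)) \<in> borel_measurable M"
      unfolding ker_def by measurable
  qed
qed

lemma T_pderiv:
  assumes [measurable]: "g \<in> borel_measurable BB" and b: "\<And>w. \<bar>g w\<bar> \<le> C * (1 + (snd w)\<^sup>2)"
  shows "((\<lambda>p. T a e (\<lambda>w z. g w) (q, p)) has_real_derivative (T a e (\<lambda>w z. dz1 e (snd z - snd w) * g w) (q, p))) (at p)"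
    "((\<lambda>p. T a e (\<lambda>w z. dz1 e (snd z - snd w)) (q, p)) has_real_derivative (T a e (\<lambda>w z. dz2 e (snd z - snd w)) (q, p))) (at p)"
proof -
  obtain E where E: "\<And>q x. eta a q x \<le> E" using eta_bound by blast
  have "E \<ge> 0" using E[of 0 0] eta_pos[of a 0 0] by linarith
  have kb: "0 \<le> ker a e w z" "ker a e w z \<le> E * (1 / e)" for w z
    using less_imp_le[OF ker_pos[OF e, of a w z]] apply simp
    unfolding ker_def using less_imp_le[OF zeta_pos[OF e]] \<open>E \<ge> 0\<close> by (intro mult_mono E zeta_le[OF e]) auto
  have mi: "integrable M (\<lambda>w. c * (C * (1 + (snd w)\<^sup>2)))" for c C
    using moment2 by (intro integrable_mult_right Bochner_Integration.integrable_add) (auto simp: split_beta')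
  have d1: "((\<lambda>p. zeta e (p - y)) has_real_derivative dz1 e (p - y) * zeta e (p - y)) (at p)" for y p
    using DERIV_shift[of "zeta e" _ p "- y"] DERIV_zeta[OF e, of "p - y"] by simp
  have d2: "((\<lambda>p. dz1 e (p - y) * zeta e (p - y)) has_real_derivative dz2 e (p - y) * zeta e (p - y)) (at p)" for y p
    using DERIV_shift[of "\<lambda>t. dz1 e t * zeta e t" _ p "- y"] DERIV_dz1_zeta[OF e, of "p - y"] by simp
  show "((\<lambda>p. T a e (\<lambda>w z. g w) (q, p)) has_real_derivative (T a e (\<lambda>w z. dz1 e (snd z - snd w) * g w) (q, p))) (at p)"
    unfolding T_def
  proof (rule has_real_derivative_integral[where w="\<lambda>w. (E * (1 / e) * (2 / e)) * (C * (1 + (snd w)\<^sup>2))"])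
    fix p w
    show "((\<lambda>p. ker a e w (q, p) * g w) has_real_derivative ker a e w (q, p) * (dz1 e (snd (q, p) - snd w) * g w)) (at p)"
      using DERIV_cmult[OF d1[of "snd w" p], of "eta a q (fst w) * g w"] by (simp add: ker_def mult_ac)
    have "\<bar>ker a e w (q, p) * (dz1 e (snd (q, p) - snd w) * g w)\<bar>
      = ker a e w (q, p) * \<bar>dz1 e (p - snd w)\<bar> * \<bar>g w\<bar>"
      using kb(1)[of w "(q, p)"] by (simp add: abs_mult)
    also have "\<dots> \<le> E * (1 / e) * (2 / e) * (C * (1 + (snd w)\<^sup>2))"
      using kb b \<open>E \<ge> 0\<close> e by (intro mult_mono mult_nonneg_nonneg abs_dz1_le[OF e]) auto
    finally show "\<bar>ker a e w (q, p) * (dz1 e (snd (q, p) - snd w) * g w)\<bar> \<le> (E * (1 / e) * (2 / e)) * (C * (1 + (snd w)\<^sup>2))" .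
  next
    show "integrable M (\<lambda>w. ker a e w (q, p) * g w)" for p
      by (rule fibre_integrable[OF e _ b]) measurable
    show "(\<lambda>w. ker a e w (q, p) * (dz1 e (snd (q, p) - snd w) * g w)) \<in> borel_measurable M"
      unfolding ker_def by measurable
  qed (rule mi)
  show "((\<lambda>p. T a e (\<lambda>w z. dz1 e (snd z - snd w)) (q, p)) has_real_derivative (T a e (\<lambda>w z. dz2 e (snd z - snd w)) (q, p))) (at p)"
    unfolding T_def
  proof (rule has_real_derivative_integral[where w="\<lambda>w. (E * (1 / e) * (20 / e\<^sup>2)) * (1 * (1 + (snd w)\<^sup>2))"])
    fix p w
    show "((\<lambda>p. ker a e w (q, p) * dz1 e (snd (q, p) - snd w)) has_real_derivative ker a e w (q, p) * dz2 e (snd (q, p) - snd w)) (at p)"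
      using DERIV_cmult[OF d2[of "snd w" p], of "eta a q (fst w)"] by (simp add: ker_def mult_ac)
    have "\<bar>ker a e w (q, p) * dz2 e (snd (q, p) - snd w)\<bar>
      = ker a e w (q, p) * \<bar>dz2 e (p - snd w)\<bar> * 1"
      using kb(1)[of w "(q, p)"] by (simp add: abs_mult)
    also have "\<dots> \<le> E * (1 / e) * (20 / e\<^sup>2) * (1 * (1 + (snd w)\<^sup>2))"
      using kb \<open>E \<ge> 0\<close> e by (intro mult_mono mult_nonneg_nonneg abs_dz2_le[OF e]) auto
    finally show "\<bar>ker a e w (q, p) * dz2 e (snd (q, p) - snd w)\<bar> \<le> (E * (1 / e) * (20 / e\<^sup>2)) * (1 * (1 + (snd w)\<^sup>2))" .
  next
    show "integrable M (\<lambda>w. ker a e w (q, p) * dz1 e (snd (q, p) - snd w))" for p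
    proof (rule fibre_integrable[OF e, where C="2 / e"])
      show "meas2 (\<lambda>w z. dz1 e (snd z - snd w))" unfolding split_beta' by measurable
      fix w show "\<bar>dz1 e (snd (q, p) - snd w)\<bar> \<le> 2 / e * (1 + (snd w)\<^sup>2)"
        using order_trans[OF abs_dz1_le[OF e], of "2 / e * (1 + (snd w)\<^sup>2)"] e mult_left_mono[of 1 "1 + (snd w)\<^sup>2" "2 / e"] by simp
    qed
    show "(\<lambda>w. ker a e w (q, p) * dz2 e (snd (q, p) - snd w)) \<in> borel_measurable M"
      unfolding ker_def by measurable
  qed (rule mi)
qed

text \<open>The mollified density \<open>uu\<close>, its flux \<open>mm\<close> in \<open>q\<close> and its flux \<open>- ff\<close> in \<open>p\<close>; a final \<open>q\<close> or \<open>p\<close> in a name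
  denotes the derivative.\<close>

definition uu :: "torus \<times> real \<Rightarrow> real" where "uu = T a e (\<lambda>w z. 1)"
definition uq :: "torus \<times> real \<Rightarrow> real" where "uq = T a e (\<lambda>w z. - 2 * pi * a * sin_2pi (fst z - fst w))"
definition up :: "torus \<times> real \<Rightarrow> real" where "up = T a e (\<lambda>w z. dz1 e (snd z - snd w))"
definition mm :: "torus \<times> real \<Rightarrow> real" where "mm = T a e (\<lambda>w z. snd w)"
definition mq :: "torus \<times> real \<Rightarrow> real" where "mq = T a e (\<lambda>w z. - 2 * pi * a * sin_2pi (fst z - fst w) * snd w)"
definition ff :: "torus \<times> real \<Rightarrow> real" where
  "ff z = T a e (\<lambda>w z. D (fst w) + \<gamma> * snd w) z + \<gamma> / \<beta> * up z"
definition fp :: "torus \<times> real \<Rightarrow> real" where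
  "fp z = T a e (\<lambda>w z. dz1 e (snd z - snd w) * (D (fst w) + \<gamma> * snd w)) z + \<gamma> / \<beta> * T a e (\<lambda>w z. dz2 e (snd z - snd w)) z"

lemma meas2_rules:
  "meas2 (\<lambda>w z. 1)" "meas2 (\<lambda>w z. - 2 * pi * a * sin_2pi (fst z - fst w))" "meas2 (\<lambda>w z. dz1 e (snd z - snd w))"
  "meas2 (\<lambda>w z. snd w)" "meas2 (\<lambda>w z. - 2 * pi * a * sin_2pi (fst z - fst w) * snd w)"
  "meas2 (\<lambda>w z. D (fst w) + \<gamma> * snd w)" "meas2 (\<lambda>w z. dz1 e (snd z - snd w) * (D (fst w) + \<gamma> * snd w))"
  "meas2 (\<lambda>w z. dz2 e (snd z - snd w))"
  unfolding split_beta' by measurable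

lemma D_gamma_le: "\<bar>D q + \<gamma> * y\<bar> \<le> (CD + \<gamma>) * (1 + y\<^sup>2)"
proof -
  have "\<bar>D q + \<gamma> * y\<bar> \<le> CD + \<gamma> * \<bar>y\<bar>" using abs_D_le[of q] \<gamma> abs_triangle_ineq[of "D q" "\<gamma> * y"] by (simp add: abs_mult)
  also have "\<dots> \<le> CD * (1 + y\<^sup>2) + \<gamma> * (1 + y\<^sup>2)"
    using CD_nonneg \<gamma> abs_le_1_plus_square[of y] mult_left_mono[of 1 "1 + y\<^sup>2" CD] by (intro add_mono mult_left_mono) auto
  finally show ?thesis by (simp add: distrib_right)
qed

lemma measurable_parts [measurable]:
  "uu \<in> borel_measurable BB" "uq \<in> borel_measurable BB" "up \<in> borel_measurable BB" "mm \<in> borel_measurable BB"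
  "mq \<in> borel_measurable BB" "ff \<in> borel_measurable BB" "fp \<in> borel_measurable BB"
proof -
  note m = T_measurable[OF e meas2_rules(1)] T_measurable[OF e meas2_rules(2)] T_measurable[OF e meas2_rules(3)]
    T_measurable[OF e meas2_rules(4)] T_measurable[OF e meas2_rules(5)] T_measurable[OF e meas2_rules(6)]
    T_measurable[OF e meas2_rules(7)] T_measurable[OF e meas2_rules(8)]
  show u: "uu \<in> borel_measurable BB" "uq \<in> borel_measurable BB" "up \<in> borel_measurable BB" "mm \<in> borel_measurable BB"
    "mq \<in> borel_measurable BB"
    unfolding uu_def uq_def up_def mm_def mq_def by (rule m)+
  show "ff \<in> borel_measurable BB" "fp \<in> borel_measurable BB"
    unfolding ff_def[abs_def] fp_def[abs_def]
    by (intro borel_measurable_add borel_measurable_times borel_measurable_const m u)+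
qed

lemma derivs:
  "has_tderiv (\<lambda>q. uu (q, p)) (uq (q, p)) q" "((\<lambda>p. uu (q, p)) has_real_derivative up (q, p)) (at p)"
  "has_tderiv (\<lambda>q. mm (q, p)) (mq (q, p)) q" "((\<lambda>p. ff (q, p)) has_real_derivative fp (q, p)) (at p)"
proof -
  have 1: "\<bar>1 :: real\<bar> \<le> 1 * (1 + (snd w)\<^sup>2)" for w :: "torus \<times> real" by simp
  have y: "\<bar>snd w\<bar> \<le> 1 * (1 + (snd w)\<^sup>2)" for w :: "torus \<times> real" using abs_le_1_plus_square by simp
  show "has_tderiv (\<lambda>q. uu (q, p)) (uq (q, p)) q"
    using T_tderiv[OF _ 1, of p q] by (simp add: uu_def uq_def)
  show "((\<lambda>p. uu (q, p)) has_real_derivative up (q, p)) (at p)"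
    using T_pderiv(1)[OF _ 1, of q p] by (simp add: uu_def up_def)
  show "has_tderiv (\<lambda>q. mm (q, p)) (mq (q, p)) q"
    using T_tderiv[OF _ y, of p q] by (simp add: mm_def mq_def)
  show "((\<lambda>p. ff (q, p)) has_real_derivative fp (q, p)) (at p)"
    unfolding ff_def fp_def up_def
  proof (intro DERIV_add DERIV_cmult T_pderiv(2)[OF _ 1] T_pderiv(1)[OF _ D_gamma_le])
  qed measurable
qed

text \<open>The stationary equation tested with the mollification kernel.\<close>

lemma pde: "mq z = fp z"
proof -
  define q p where "q = fst z" and "p = snd z"
  \<comment> \<open>\<open>weak\<close> takes a single constant for the kernel and its first two
    derivatives, so the three bounds are added.\<close>
  define C where "C = 1 / e + 2 / e * (1 / e) + 20 / e\<^sup>2 * (1 / e)"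
  have le: "0 \<le> 1 / e" "0 \<le> 2 / e * (1 / e)" "0 \<le> 20 / e\<^sup>2 * (1 / e)" using e by simp_all
  have d: "((\<lambda>y. p - y) has_real_derivative - 1) (at y)" for y by (auto intro!: derivative_eq_intros)
  have zz: "0 \<le> zeta e t" for t using zeta_pos[OF e] less_imp_le by blast
  have b1: "\<bar>zeta e t\<bar> \<le> C * (1 + \<bar>y\<bar>)" for t y :: real
  proof -
    have "\<bar>zeta e t\<bar> \<le> C" using zeta_le[OF e, of t] zz[of t] le unfolding C_def by linarith
    moreover have "C \<ge> 0" using le unfolding C_def by linarith
    then have "C \<le> C * (1 + \<bar>y\<bar>)" using mult_left_mono[of 1 "1 + \<bar>y\<bar>" C] by simp
    ultimately show ?thesis by linarith
  qed
  have b2: "\<bar>- (dz1 e t * zeta e t)\<bar> \<le> C" for t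
  proof -
    have "\<bar>- (dz1 e t * zeta e t)\<bar> \<le> 2 / e * (1 / e)"
      unfolding abs_minus_cancel abs_mult using zz[of t] e by (intro mult_mono abs_dz1_le[OF e]) (auto simp: zeta_le[OF e])
    then show ?thesis using le unfolding C_def by linarith
  qed
  have b3: "\<bar>dz2 e t * zeta e t\<bar> \<le> C" for t
  proof -
    have "\<bar>dz2 e t * zeta e t\<bar> \<le> 20 / e\<^sup>2 * (1 / e)"
      unfolding abs_mult using zz[of t] e by (intro mult_mono abs_dz2_le[OF e]) (auto simp: zeta_le[OF e])
    then show ?thesis using le unfolding C_def by linarith
  qed
  have "(\<integral>(x, y). 2 * pi * a * sin_2pi (q - x) * eta a q x * (y * zeta e (p - y)) - D x * eta a q x * (- (dz1 e (p - y) * zeta e (p - y)))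
     + \<gamma> * (eta a q x * (- y * (- (dz1 e (p - y) * zeta e (p - y))) + (dz2 e (p - y) * zeta e (p - y)) / \<beta>)) \<partial>M) = 0"
  proof (rule weak)
    show "((\<lambda>y. zeta e (p - y)) has_real_derivative - (dz1 e (p - y) * zeta e (p - y))) (at y)" for y
      using DERIV_chain2[OF DERIV_zeta[OF e] d] by simp
    show "((\<lambda>y. - (dz1 e (p - y) * zeta e (p - y))) has_real_derivative (dz2 e (p - y) * zeta e (p - y))) (at y)" for y
      using DERIV_minus[OF DERIV_chain2[OF DERIV_dz1_zeta[OF e] d]] by simp
    show "\<bar>zeta e (p - y)\<bar> \<le> C * (1 + \<bar>y\<bar>)" for y by (rule b1)
    show "\<bar>- (dz1 e (p - y) * zeta e (p - y))\<bar> \<le> C" for y by (rule b2)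
    show "\<bar>dz2 e (p - y) * zeta e (p - y)\<bar> \<le> C" for y by (rule b3)
  qed (auto intro: eta_elem sin_eta_elem eta_tderiv2 zeta_smooth[OF e])
  \<comment> \<open>The test function was differentiated in the integration variable; in terms of
    derivatives in \<open>z\<close> the odd-order ones change sign.\<close>
  then have 0: "(\<integral>w. - (ker a e w z * (- 2 * pi * a * sin_2pi (fst z - fst w) * snd w)) + (ker a e w z * (dz1 e (snd z - snd w) * (D (fst w) + \<gamma> * snd w))
     + \<gamma> / \<beta> * (ker a e w z * dz2 e (snd z - snd w))) \<partial>M) = 0"
    by (simp add: ker_def split_beta' q_def p_def algebra_simps)
  have c1: "1 \<le> 1 + y\<^sup>2" for y :: real by simp
  have i1: "integrable M (\<lambda>w. ker a e w z * (- 2 * pi * a * sin_2pi (fst z - fst w) * snd w))"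
  proof (rule fibre_integrable[OF e meas2_rules(5), where C="2 * pi * \<bar>a\<bar>"])
    fix w
    have "\<bar>- 2 * pi * a * sin_2pi (fst z - fst w) * snd w\<bar> = 2 * pi * \<bar>a\<bar> * \<bar>sin_2pi (fst z - fst w)\<bar> * \<bar>snd w\<bar>"
      by (simp add: abs_mult)
    also have "\<dots> \<le> 2 * pi * \<bar>a\<bar> * 1 * (1 + (snd w)\<^sup>2)" by (intro mult_mono abs_le_1_plus_square) auto
    finally show "\<bar>- 2 * pi * a * sin_2pi (fst z - fst w) * snd w\<bar> \<le> 2 * pi * \<bar>a\<bar> * (1 + (snd w)\<^sup>2)" by simp
  qed
  have i2: "integrable M (\<lambda>w. ker a e w z * (dz1 e (snd z - snd w) * (D (fst w) + \<gamma> * snd w)))"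
  proof (rule fibre_integrable[OF e meas2_rules(7), where C="2 / e * (CD + \<gamma>)"])
    fix w
    have "\<bar>dz1 e (snd z - snd w) * (D (fst w) + \<gamma> * snd w)\<bar> \<le> 2 / e * ((CD + \<gamma>) * (1 + (snd w)\<^sup>2))"
      unfolding abs_mult using e by (intro mult_mono abs_dz1_le[OF e] D_gamma_le) auto
    then show "\<bar>dz1 e (snd z - snd w) * (D (fst w) + \<gamma> * snd w)\<bar> \<le> 2 / e * (CD + \<gamma>) * (1 + (snd w)\<^sup>2)" by (simp only: mult.assoc)
  qed
  have i3: "integrable M (\<lambda>w. ker a e w z * dz2 e (snd z - snd w))"
  proof (rule fibre_integrable[OF e meas2_rules(8), where C="20 / e\<^sup>2"])
    fix w
    have "\<bar>dz2 e (snd z - snd w)\<bar> * 1 \<le> 20 / e\<^sup>2 * (1 + (snd w)\<^sup>2)"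
      using e by (intro mult_mono abs_dz2_le[OF e]) auto
    then show "\<bar>dz2 e (snd z - snd w)\<bar> \<le> 20 / e\<^sup>2 * (1 + (snd w)\<^sup>2)" by simp
  qed
  have "- mq z + fp z = 0"
    using 0 i1 i2 i3 unfolding mq_def fp_def T_def
    by (subst (asm) Bochner_Integration.integral_add) auto
  then show ?thesis by simp
qed

lemma T_prod_integrable:
  assumes m: "meas2 H" "\<Psi> \<in> borel_measurable BB"
    and h: "\<And>w z. \<bar>H w z\<bar> \<le> K * (1 + \<bar>snd w\<bar>)" "\<And>z. \<bar>\<Psi> z\<bar> \<le> C * (1 + \<bar>snd z\<bar>)"
  shows "integrable phase_lebesgue (\<lambda>z. T a e H z * \<Psi> z)"
proof (rule TI[OF m, where C="3 * (K * C)"])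
  fix w z
  have K: "K \<ge> 0" using h(1)[of "(0, 0)" "(0, 0)"] abs_ge_zero order_trans by fastforce
  have C: "C \<ge> 0" using h(2)[of "(0, 0)"] abs_ge_zero order_trans by fastforce
  have "\<bar>H w z\<bar> * \<bar>\<Psi> z\<bar> \<le> (K * (1 + \<bar>snd w\<bar>)) * (C * (1 + \<bar>snd z\<bar>))"
    using h K by (intro mult_mono) auto
  also have "\<dots> = K * C * ((1 + \<bar>snd z\<bar>) * (1 + \<bar>snd w\<bar>))" by (simp only: mult_ac)
  also have "\<dots> \<le> K * C * (3 * dom w z)" using K C by (intro mult_left_mono dom_bounds) auto
  finally show "\<bar>H w z\<bar> * \<bar>\<Psi> z\<bar> \<le> 3 * (K * C) * dom w z" by (simp add: mult_ac)
qed

lemma le_times_linear: "K \<ge> 0 \<Longrightarrow> K \<le> K * (1 + \<bar>y :: real\<bar>)"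
  using mult_left_mono[of 1 "1 + \<bar>y\<bar>" K] by simp

lemma parts_integrable:
  assumes [measurable]: "\<Psi> \<in> borel_measurable BB" and \<Psi>: "\<And>z. \<bar>\<Psi> z\<bar> \<le> C * (1 + \<bar>snd z\<bar>)"
  shows "integrable phase_lebesgue (\<lambda>z. mm z * \<Psi> z)" "integrable phase_lebesgue (\<lambda>z. mq z * \<Psi> z)"
    "integrable phase_lebesgue (\<lambda>z. ff z * \<Psi> z)" "integrable phase_lebesgue (\<lambda>z. fp z * \<Psi> z)"
    "integrable phase_lebesgue (\<lambda>z. uu z * \<Psi> z)" "integrable phase_lebesgue (\<lambda>z. uq z * \<Psi> z)"
    "integrable phase_lebesgue (\<lambda>z. up z * \<Psi> z)"
proof -
  have Dg: "\<bar>D (fst w) + \<gamma> * snd w\<bar> \<le> (CD + \<gamma>) * (1 + \<bar>snd w\<bar>)" for w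
  proof -
    have "\<bar>D (fst w) + \<gamma> * snd w\<bar> \<le> CD + \<gamma> * \<bar>snd w\<bar>"
      using abs_triangle_ineq[of "D (fst w)" "\<gamma> * snd w"] abs_D_le[of "fst w"] \<gamma> by (simp add: abs_mult)
    also have "\<dots> \<le> (CD + \<gamma>) * (1 + \<bar>snd w\<bar>)"
      using CD_nonneg \<gamma> mult_nonneg_nonneg[OF CD_nonneg abs_ge_zero[of "snd w"]] by (simp add: distrib_left distrib_right)
    finally show ?thesis .
  qed
  have h1: "\<bar>snd w\<bar> \<le> 1 * (1 + \<bar>snd w\<bar>)" for w :: "torus \<times> real" by simp
  have s: "\<bar>- 2 * pi * a * sin_2pi (fst z - fst w)\<bar> \<le> (2 * pi * \<bar>a\<bar>)" for w z :: "torus \<times> real"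
  proof -
    have "\<bar>- 2 * pi * a * sin_2pi (fst z - fst w)\<bar> = 2 * pi * \<bar>a\<bar> * \<bar>sin_2pi (fst z - fst w)\<bar>"
      by (simp add: abs_mult)
    also have "\<dots> \<le> 2 * pi * \<bar>a\<bar> * 1" by (intro mult_left_mono) auto
    finally show ?thesis by simp
  qed
  have h2: "\<bar>- 2 * pi * a * sin_2pi (fst z - fst w) * snd w\<bar> \<le> (2 * pi * \<bar>a\<bar>) * (1 + \<bar>snd w\<bar>)" for w z :: "torus \<times> real"
    unfolding abs_mult[of _ "snd w"] by (intro mult_mono s) auto
  have h3: "\<bar>dz1 e (snd z - snd w)\<bar> \<le> (2 / e) * (1 + \<bar>snd w\<bar>)" for w z :: "torus \<times> real"
    by (rule order_trans[OF abs_dz1_le[OF e] le_times_linear]) (use e in simp)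
  have h4: "\<bar>dz2 e (snd z - snd w)\<bar> \<le> (20 / e\<^sup>2) * (1 + \<bar>snd w\<bar>)" for w z :: "torus \<times> real"
    by (rule order_trans[OF abs_dz2_le[OF e] le_times_linear]) (use e in simp)
  have h5: "\<bar>dz1 e (snd z - snd w) * (D (fst w) + \<gamma> * snd w)\<bar> \<le> (2 / e * (CD + \<gamma>)) * (1 + \<bar>snd w\<bar>)" for w z :: "torus \<times> real"
    unfolding abs_mult mult.assoc using e by (intro mult_mono abs_dz1_le[OF e] Dg) auto
  have h6: "\<bar>1 :: real\<bar> \<le> 1 * (1 + \<bar>snd w\<bar>)" for w :: "torus \<times> real" by simp
  have h7: "\<bar>- 2 * pi * a * sin_2pi (fst z - fst w)\<bar> \<le> (2 * pi * \<bar>a\<bar>) * (1 + \<bar>snd w\<bar>)" for w z :: "torus \<times> real"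
    by (rule order_trans[OF s le_times_linear]) simp
  note i = T_prod_integrable[OF _ assms(1) _ \<Psi>]
  note j = i[OF meas2_rules(1) h6] i[OF meas2_rules(2) h7] i[OF meas2_rules(3) h3] i[OF meas2_rules(4) h1]
    i[OF meas2_rules(5) h2] i[OF meas2_rules(6) Dg] i[OF meas2_rules(7) h5] i[OF meas2_rules(8) h4]
  show "integrable phase_lebesgue (\<lambda>z. mm z * \<Psi> z)" "integrable phase_lebesgue (\<lambda>z. mq z * \<Psi> z)"
    "integrable phase_lebesgue (\<lambda>z. uu z * \<Psi> z)" "integrable phase_lebesgue (\<lambda>z. uq z * \<Psi> z)"
    "integrable phase_lebesgue (\<lambda>z. up z * \<Psi> z)"
    unfolding mm_def mq_def uu_def uq_def up_def by (rule j)+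
  show "integrable phase_lebesgue (\<lambda>z. ff z * \<Psi> z)" "integrable phase_lebesgue (\<lambda>z. fp z * \<Psi> z)"
    unfolding ff_def fp_def up_def distrib_right mult.assoc[of "\<gamma> / \<beta>"]
    by (intro Bochner_Integration.integrable_add integrable_mult_right j)+
qed

text \<open>Integration by parts of \<open>pde\<close> against \<Phi>. The derivative in
  \<open>p\<close> may grow linearly, as that of a truncated entropy does.\<close>

lemma entropy_test:
  assumes d: "\<And>q p. has_tderiv (\<lambda>q. \<Phi> (q, p)) (\<Phi>q (q, p)) q" "\<And>q p. ((\<lambda>p. \<Phi> (q, p)) has_real_derivative \<Phi>p (q, p)) (at p)"
    and m: "\<Phi> \<in> borel_measurable BB" "\<Phi>q \<in> borel_measurable BB" "\<Phi>p \<in> borel_measurable BB"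
    and b: "\<And>z. \<bar>\<Phi> z\<bar> \<le> C" "\<And>z. \<bar>\<Phi>q z\<bar> \<le> C" "\<And>z. \<bar>\<Phi>p z\<bar> \<le> C * (1 + \<bar>snd z\<bar>)"
  shows "(\<integral>z. mm z * \<Phi>q z - ff z * \<Phi>p z \<partial>phase_lebesgue) = 0"
proof -
  have C: "C \<ge> 0" using b(1)[of "(0, 0)"] by simp
  have b1: "\<bar>\<Phi> z\<bar> \<le> C * (1 + \<bar>snd z\<bar>)" for z by (rule order_trans[OF b(1) le_times_linear[OF C]])
  have b2: "\<bar>\<Phi>q z\<bar> \<le> C * (1 + \<bar>snd z\<bar>)" for z by (rule order_trans[OF b(2) le_times_linear[OF C]])
  note i = parts_integrable[OF m(1) b1] parts_integrable[OF m(2) b2] parts_integrable[OF m(3) b(3)]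
  have I1: "(\<integral>z. mm z * \<Phi>q z + mq z * \<Phi> z \<partial>phase_lebesgue) = 0"
  proof (rule integral_dq_zero)
    show "has_tderiv (\<lambda>q. (mm (q, p)) * \<Phi> (q, p)) (mm (q, p) * \<Phi>q (q, p) + mq (q, p) * \<Phi> (q, p)) q" for q p
      using has_tderiv_mult[OF derivs(3)[of p q] d(1)[of p q]] by (simp add: add.commute)
  qed (intro Bochner_Integration.integrable_add i)
  have I2: "(\<integral>z. ff z * \<Phi>p z + fp z * \<Phi> z \<partial>phase_lebesgue) = 0"
  proof (rule integral_dp_zero)
    show "((\<lambda>p. (ff (q, p)) * \<Phi> (q, p)) has_real_derivative (ff (q, p) * \<Phi>p (q, p) + fp (q, p) * \<Phi> (q, p))) (at p)" for q p
      using DERIV_mult'[OF derivs(4)[of q p] d(2)[of q p]] by simp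
  qed (intro Bochner_Integration.integrable_add i)+
  have "(\<integral>z. mm z * \<Phi>q z - ff z * \<Phi>p z \<partial>phase_lebesgue)
     = (\<integral>z. (mm z * \<Phi>q z + mq z * \<Phi> z) - (ff z * \<Phi>p z + fp z * \<Phi> z) \<partial>phase_lebesgue)"
    by (simp add: pde)
  also have "\<dots> = (\<integral>z. mm z * \<Phi>q z + mq z * \<Phi> z \<partial>phase_lebesgue) - (\<integral>z. ff z * \<Phi>p z + fp z * \<Phi> z \<partial>phase_lebesgue)"
    by (intro Bochner_Integration.integral_diff Bochner_Integration.integrable_add i)
  finally show ?thesis using I1 I2 by simp
qed

text \<open>The logarithm to be tested contains the kinetic energy and hence grows quadratically,
  beyond what integrates against the fluxes. It is truncated, and the truncation disappears in the
  limit by dominated convergence.\<close>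

lemma entropy_test_growth:
  assumes d: "\<And>q p. has_tderiv (\<lambda>q. \<Phi> (q, p)) (\<Phi>q (q, p)) q" "\<And>q p. ((\<lambda>p. \<Phi> (q, p)) has_real_derivative \<Phi>p (q, p)) (at p)"
    and m [measurable]: "\<Phi> \<in> borel_measurable BB" "\<Phi>q \<in> borel_measurable BB" "\<Phi>p \<in> borel_measurable BB"
    and b: "\<And>z. \<bar>\<Phi> z\<bar> \<le> C * (1 + (snd z)\<^sup>2)" "\<And>z. \<bar>\<Phi>q z\<bar> \<le> C" "\<And>z. \<bar>\<Phi>p z\<bar> \<le> C * (1 + \<bar>snd z\<bar>)"
  shows "(\<integral>z. mm z * \<Phi>q z - ff z * \<Phi>p z \<partial>phase_lebesgue) = 0"
proof -
  have C: "C \<ge> 0" using b(2)[of "(0, 0)"] by simp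
  \<comment> \<open>Quadratic decay makes \<open>X k * \<Phi>\<close> bounded for each k.\<close>
  define X where "X k p = 1 / (1 + (p / real (Suc k))\<^sup>2)" for k p
  define X1 where "X1 k p = - (2 * p / (real (Suc k))\<^sup>2) * (X k p * X k p)" for k p
  have X: "0 < X k p" "X k p \<le> 1" for k p
    unfolding X_def by (auto simp: add_pos_nonneg)
  have [measurable]: "X k \<in> borel_measurable borel" "X1 k \<in> borel_measurable borel" for k
    unfolding X_def[abs_def] X1_def[abs_def] by measurable
  have dX: "(X k has_real_derivative X1 k p) (at p)" for k p
  proof -
    have "1 + (p / real (Suc k))\<^sup>2 \<noteq> 0" using zero_le_power2[of "p / real (Suc k)"] by linarith
    then show ?thesis unfolding X_def[abs_def] X1_def
      by (auto intro!: derivative_eq_intros simp: power2_eq_square)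
  qed
  have q1: "X k p * (1 + p\<^sup>2) \<le> (real (Suc k))\<^sup>2" for k p
  proof -
    define K where "K = real (Suc k)"
    have K: "K \<ge> 1" by (simp add: K_def)
    have "1 \<le> K\<^sup>2" using K by (simp add: power2_eq_square mult_ge1_I)
    then have "1 + p\<^sup>2 \<le> K\<^sup>2 * (1 + (p / K)\<^sup>2)" using K by (simp add: distrib_left power_divide)
    moreover have "1 + (p / K)\<^sup>2 > 0" by (simp add: add_pos_nonneg)
    ultimately show ?thesis by (simp add: X_def K_def[symmetric] divide_le_eq del: of_nat_Suc)
  qed
  \<comment> \<open>Uniformly in k, the truncation term \<open>X1 * \<Phi>\<close> has the same
    linear growth as \<open>\<Phi>p\<close>, which yields the dominating function.\<close>
  have q2: "\<bar>X1 k p\<bar> * (1 + p\<^sup>2) \<le> 2 * \<bar>p\<bar>" for k p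
  proof -
    have "\<bar>X1 k p\<bar> * (1 + p\<^sup>2) = (2 * \<bar>p\<bar> * X k p) * ((X k p * (1 + p\<^sup>2)) / (real (Suc k))\<^sup>2)"
      unfolding X1_def using X[of k p] by (simp add: abs_mult)
    also have "\<dots> \<le> (2 * \<bar>p\<bar> * 1) * 1"
      using X[of k p] q1[of k p] by (intro mult_mono) (auto simp: divide_le_eq_1)
    finally show ?thesis by simp
  qed
  have X_lim: "(\<lambda>k. X k p) \<longlonglongrightarrow> 1" for p
  proof -
    have "(\<lambda>k. 1 / (1 + (p / real (Suc k))\<^sup>2)) \<longlonglongrightarrow> 1 / (1 + 0\<^sup>2)"
      by (intro tendsto_intros real_tendsto_divide_at_top[OF tendsto_const] filterlim_compose[OF filterlim_real_sequentially filterlim_Suc]) auto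
    then show ?thesis by (simp add: X_def)
  qed
  have X1_lim: "(\<lambda>k. X1 k p) \<longlonglongrightarrow> 0" for p
  proof -
    have i: "(\<lambda>k. 1 / real (Suc k)) \<longlonglongrightarrow> 0"
      by (intro real_tendsto_divide_at_top[OF tendsto_const] filterlim_compose[OF filterlim_real_sequentially filterlim_Suc])
    have "(\<lambda>k. - (2 * p * (1 / real (Suc k) * (1 / real (Suc k)))) * (X k p * X k p)) \<longlonglongrightarrow> - (2 * p * (0 * 0)) * (1 * 1)"
      by (intro tendsto_intros i X_lim)
    then show ?thesis by (simp add: X1_def power2_eq_square)
  qed
  define f where "f k z = mm z * (X k (snd z) * \<Phi>q z) - ff z * (X k (snd z) * \<Phi>p z + X1 k (snd z) * \<Phi> z)" for k z
  have f0: "(\<integral>z. f k z \<partial>phase_lebesgue) = 0" for k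
    unfolding f_def
  proof (rule entropy_test[where \<Phi>="\<lambda>z. X k (snd z) * \<Phi> z" and C="C * ((real (Suc k))\<^sup>2 + 2)"])
    show "has_tderiv (\<lambda>q. X k (snd (q, p)) * \<Phi> (q, p)) (X k (snd (q, p)) * \<Phi>q (q, p)) q" for q p
      using has_tderiv_cmult[OF d(1)[of p q]] by simp
    show "((\<lambda>p. X k (snd (q, p)) * \<Phi> (q, p)) has_real_derivative X k (snd (q, p)) * \<Phi>p (q, p) + X1 k (snd (q, p)) * \<Phi> (q, p)) (at p)" for q p
      using DERIV_mult'[OF dX d(2)[of q p]] by simp
    fix z :: "torus \<times> real"
    have n: "0 \<le> (real (Suc k))\<^sup>2" by simp
    have "\<bar>X k (snd z) * \<Phi> z\<bar> \<le> X k (snd z) * (C * (1 + (snd z)\<^sup>2))"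
      using X(1)[of k "snd z"] b(1)[of z] by (simp add: abs_mult)
    also have "\<dots> = C * (X k (snd z) * (1 + (snd z)\<^sup>2))" by simp
    also have "\<dots> \<le> C * (real (Suc k))\<^sup>2" using C q1 by (intro mult_left_mono) auto
    also have "\<dots> \<le> C * ((real (Suc k))\<^sup>2 + 2)" using C by (intro mult_left_mono) auto
    finally show "\<bar>X k (snd z) * \<Phi> z\<bar> \<le> C * ((real (Suc k))\<^sup>2 + 2)" .
    have "\<bar>X k (snd z) * \<Phi>q z\<bar> \<le> 1 * C"
      unfolding abs_mult using X[of k "snd z"] by (intro mult_mono b) auto
    also have "\<dots> \<le> C * ((real (Suc k))\<^sup>2 + 2)" using C n mult_left_mono[of 1 "(real (Suc k))\<^sup>2 + 2" C] by linarith
    finally show "\<bar>X k (snd z) * \<Phi>q z\<bar> \<le> C * ((real (Suc k))\<^sup>2 + 2)" .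
    have 1: "\<bar>X k (snd z) * \<Phi>p z\<bar> \<le> 1 * (C * (1 + \<bar>snd z\<bar>))"
      unfolding abs_mult using X[of k "snd z"] by (intro mult_mono b) auto
    have "\<bar>X1 k (snd z) * \<Phi> z\<bar> \<le> \<bar>X1 k (snd z)\<bar> * (C * (1 + (snd z)\<^sup>2))"
      unfolding abs_mult by (intro mult_left_mono b) auto
    also have "\<dots> = C * (\<bar>X1 k (snd z)\<bar> * (1 + (snd z)\<^sup>2))" by simp
    also have "\<dots> \<le> C * (2 * \<bar>snd z\<bar>)" using C q2 by (intro mult_left_mono) auto
    finally have "\<bar>X k (snd z) * \<Phi>p z + X1 k (snd z) * \<Phi> z\<bar> \<le> C * (1 + \<bar>snd z\<bar>) + C * (2 * \<bar>snd z\<bar>)"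
      using 1 by linarith
    also have "\<dots> \<le> 3 * C * (1 + \<bar>snd z\<bar>)" using C by (simp add: algebra_simps)
    also have "\<dots> \<le> C * ((real (Suc k))\<^sup>2 + 2) * (1 + \<bar>snd z\<bar>)"
    proof (rule mult_right_mono)
      have "1 \<le> (real (Suc k))\<^sup>2" by simp
      then show "3 * C \<le> C * ((real (Suc k))\<^sup>2 + 2)" using C mult_left_mono[of 3 "(real (Suc k))\<^sup>2 + 2" C] by linarith
    qed simp
    finally show "\<bar>X k (snd z) * \<Phi>p z + X1 k (snd z) * \<Phi> z\<bar> \<le> C * ((real (Suc k))\<^sup>2 + 2) * (1 + \<bar>snd z\<bar>)" .
  qed measurable
  have c: "\<bar>C\<bar> \<le> C * (1 + \<bar>snd z\<bar>)" "\<bar>3 * (C * (1 + \<bar>snd z\<bar>))\<bar> \<le> 3 * C * (1 + \<bar>snd z\<bar>)" for z :: "torus \<times> real"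
    using le_times_linear[OF C, of "snd z"] C by simp_all
  have iw: "integrable phase_lebesgue (\<lambda>z. \<bar>mm z * C\<bar> + \<bar>ff z * (3 * (C * (1 + \<bar>snd z\<bar>)))\<bar>)"
    by (intro Bochner_Integration.integrable_add integrable_abs parts_integrable(1)[OF _ c(1)] parts_integrable(3)[OF _ c(2)]) measurable
  have "(\<lambda>k. \<integral>z. f k z \<partial>phase_lebesgue) \<longlonglongrightarrow> (\<integral>z. mm z * \<Phi>q z - ff z * \<Phi>p z \<partial>phase_lebesgue)"
  proof (rule integral_dominated_convergence[OF _ _ iw])
    show "f k \<in> borel_measurable phase_lebesgue" for k unfolding f_def[abs_def] by measurable
    show "AE z in phase_lebesgue. norm (f k z) \<le> \<bar>mm z * C\<bar> + \<bar>ff z * (3 * (C * (1 + \<bar>snd z\<bar>)))\<bar>" for k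
    proof (rule AE_I2)
      fix z :: "torus \<times> real"
      have 0: "\<bar>X k (snd z) * \<Phi>q z\<bar> \<le> 1 * C"
        unfolding abs_mult using X[of k "snd z"] by (intro mult_mono b) auto
      have 1: "\<bar>X k (snd z) * \<Phi>p z\<bar> \<le> 1 * (C * (1 + \<bar>snd z\<bar>))"
        unfolding abs_mult using X[of k "snd z"] by (intro mult_mono b) auto
      have "\<bar>X1 k (snd z) * \<Phi> z\<bar> \<le> \<bar>X1 k (snd z)\<bar> * (C * (1 + (snd z)\<^sup>2))"
        unfolding abs_mult by (intro mult_left_mono b) auto
      also have "\<dots> = C * (\<bar>X1 k (snd z)\<bar> * (1 + (snd z)\<^sup>2))" by simp
      also have "\<dots> \<le> C * (2 * \<bar>snd z\<bar>)" using C q2 by (intro mult_left_mono) auto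
      finally have "\<bar>X k (snd z) * \<Phi>p z + X1 k (snd z) * \<Phi> z\<bar> \<le> C * (1 + \<bar>snd z\<bar>) + C * (2 * \<bar>snd z\<bar>)"
        using 1 by linarith
      also have "\<dots> \<le> 3 * (C * (1 + \<bar>snd z\<bar>))" using C by (simp add: algebra_simps)
      finally have 2: "\<bar>X k (snd z) * \<Phi>p z + X1 k (snd z) * \<Phi> z\<bar> \<le> 3 * (C * (1 + \<bar>snd z\<bar>))" .
      have "norm (f k z) \<le> \<bar>mm z\<bar> * \<bar>X k (snd z) * \<Phi>q z\<bar> + \<bar>ff z\<bar> * \<bar>X k (snd z) * \<Phi>p z + X1 k (snd z) * \<Phi> z\<bar>"
        unfolding f_def real_norm_def by (rule order_trans[OF abs_triangle_ineq4]) (simp add: abs_mult)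
      also have "\<dots> \<le> \<bar>mm z\<bar> * C + \<bar>ff z\<bar> * (3 * (C * (1 + \<bar>snd z\<bar>)))"
        using 0 2 by (intro add_mono mult_left_mono) auto
      also have "\<dots> = \<bar>mm z * C\<bar> + \<bar>ff z * (3 * (C * (1 + \<bar>snd z\<bar>)))\<bar>" using C by (simp add: abs_mult)
      finally show "norm (f k z) \<le> \<bar>mm z * C\<bar> + \<bar>ff z * (3 * (C * (1 + \<bar>snd z\<bar>)))\<bar>" .
    qed
    show "AE z in phase_lebesgue. (\<lambda>k. f k z) \<longlonglongrightarrow> mm z * \<Phi>q z - ff z * \<Phi>p z"
    proof (rule AE_I2)
      fix z :: "torus \<times> real"
      have "(\<lambda>k. f k z) \<longlonglongrightarrow> mm z * (1 * \<Phi>q z) - ff z * (1 * \<Phi>p z + 0 * \<Phi> z)"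
        unfolding f_def by (intro tendsto_intros X_lim X1_lim)
      then show "(\<lambda>k. f k z) \<longlonglongrightarrow> mm z * \<Phi>q z - ff z * \<Phi>p z" by simp
    qed
  qed measurable
  then show ?thesis unfolding f0 using LIMSEQ_unique tendsto_const by blast
qed

end

end

section \<open>Dissipation of relative entropy and the Stein identity with error terms\<close>

context kinetic
begin

interpretation M: prob_space M using pp by (simp add: phase_prob_def)

interpretation PM: pair_sigma_finite M phase_lebesgue
  by (intro pair_sigma_finite.intro M.sigma_finite_measure_axioms phase_sf.sigma_finite_measure_axioms)

text \<open>A primitive of \<open>D\<close>; it is single-valued on the torus because
  \<open>D\<close> has mean zero.\<close>

definition pot :: "torus \<Rightarrow> real" where
  "pot q = (s2 * sin_2pi q - s1 * cos_2pi q) / (2 * pi)"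

lemma pot_tderiv: "has_tderiv pot (D q) q"
proof -
  have "has_tderiv (\<lambda>q. (1 / (2 * pi)) * (s2 * sin_2pi q - s1 * cos_2pi q)) ((1 / (2 * pi)) * (s2 * (2 * pi * cos_2pi q) - s1 * (- 2 * pi * sin_2pi q))) q"
    by (intro has_tderiv_cmult has_tderiv_diff has_tderiv_sin_2pi has_tderiv_cos_2pi)
  moreover have "(1 / (2 * pi)) * (s2 * (2 * pi * cos_2pi q) - s1 * (- 2 * pi * sin_2pi q)) = D q"
    by (simp add: D_def field_simps)
  ultimately show ?thesis by (simp add: pot_def[abs_def])
qed

lemma pot_continuous: "continuous_on S pot"
  unfolding pot_def[abs_def] by (intro continuous_intros) simp

lemma pot_measurable [measurable]: "pot \<in> borel_measurable borel"
  by (intro borel_measurable_continuous_onI pot_continuous)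

text \<open>Cauchy-Schwarz, and the squared chord \<open>2 * (1 - cos_2pi (q - x))\<close> between
  two points of the unit circle.\<close>

lemma D_diff_le: "(D q - D x)\<^sup>2 \<le> 4 * (s1\<^sup>2 + s2\<^sup>2) * (1 - cos_2pi (q - x))"
proof -
  define A B where "A = sin_2pi q - sin_2pi x" and "B = cos_2pi q - cos_2pi x"
  have "(D q - D x)\<^sup>2 = (s1 * A + s2 * B)\<^sup>2" by (simp add: D_def A_def B_def algebra_simps)
  also have "\<dots> \<le> (s1\<^sup>2 + s2\<^sup>2) * (A\<^sup>2 + B\<^sup>2)"
  proof -
    have "(s1\<^sup>2 + s2\<^sup>2) * (A\<^sup>2 + B\<^sup>2) - (s1 * A + s2 * B)\<^sup>2 = (s1 * B - s2 * A)\<^sup>2"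
      by (simp add: power2_eq_square algebra_simps)
    moreover have "0 \<le> (s1 * B - s2 * A)\<^sup>2" by simp
    ultimately show ?thesis by linarith
  qed
  also have "A\<^sup>2 + B\<^sup>2 = 2 * (1 - cos_2pi (q - x))"
    using sin_cos_2pi_squared[of q] sin_cos_2pi_squared[of x]
    by (simp add: A_def B_def cos_2pi_diff power2_diff algebra_simps)
  also have "(s1\<^sup>2 + s2\<^sup>2) * (2 * (1 - cos_2pi (q - x))) \<le> 4 * (s1\<^sup>2 + s2\<^sup>2) * (1 - cos_2pi (q - x))"
  proof -
    define t where "t = (s1\<^sup>2 + s2\<^sup>2) * (1 - cos_2pi (q - x))"
    have "0 \<le> t" unfolding t_def by (intro mult_nonneg_nonneg) auto
    moreover have "(s1\<^sup>2 + s2\<^sup>2) * (2 * (1 - cos_2pi (q - x))) = 2 * t" "4 * (s1\<^sup>2 + s2\<^sup>2) * (1 - cos_2pi (q - x)) = 4 * t"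
      by (simp_all add: t_def)
    ultimately show ?thesis by simp
  qed
  finally show ?thesis .
qed

context
  fixes a e :: real assumes e: "e > 0"
begin

abbreviation "Uu \<equiv> uu a e"
abbreviation "Uq \<equiv> uq a e"
abbreviation "Up \<equiv> up a e"

lemma uu_pos: "Uu z > 0"
proof -
  have m: "meas2 (\<lambda>w z. 1)" by (rule meas2_rules(1)[OF e])
  have i: "integrable M (\<lambda>w. ker a e w z * 1)"
    by (rule fibre_integrable[OF e m, where C=1]) simp
  have n: "0 \<le> Uu z"
    unfolding uu_def[OF e] T_def by (intro Bochner_Integration.integral_nonneg) (simp add: less_imp_le[OF ker_pos[OF e]])
  have "Uu z \<noteq> 0"
  proof
    assume "Uu z = 0"
    then have "AE w in M. ker a e w z * 1 = 0"
      unfolding uu_def[OF e] T_def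
      by (subst (asm) integral_nonneg_eq_0_iff_AE[OF i]) (simp_all add: less_imp_le[OF ker_pos[OF e]])
    then have "AE w in M. False"
    proof eventually_elim
      fix w assume "ker a e w z * 1 = 0"
      then show False using ker_pos[OF e, of a w z] by simp
    qed
    then show False by simp
  qed
  with n show ?thesis by simp
qed

lemma T_joint:
  assumes "meas2 H" "\<And>w z. \<bar>H w z\<bar> \<le> C * dom w z"
  shows "(\<integral>z. T a e H z \<partial>phase_lebesgue) = (\<integral>(w, z). ker a e w z * H w z \<partial>(M \<Otimes>\<^sub>M phase_lebesgue))"
  unfolding T_def using PM.integral_snd[OF ker_joint[OF e assms]] by simp

lemma T_int_mono:
  assumes "meas2 H" "\<And>w z. \<bar>H w z\<bar> \<le> C * dom w z" "meas2 G" "\<And>w z. \<bar>G w z\<bar> \<le> C' * dom w z" "\<And>w z. H w z \<le> G w z"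
  shows "(\<integral>z. T a e H z \<partial>phase_lebesgue) \<le> (\<integral>z. T a e G z \<partial>phase_lebesgue)"
  unfolding T_joint[OF assms(1,2)] T_joint[OF assms(3,4)]
  by (rule integral_mono[OF ker_joint[OF e assms(1,2)] ker_joint[OF e assms(3,4)]])
     (auto simp: less_imp_le[OF ker_pos[OF e]] assms(5) mult_left_mono)

lemma T_int_add:
  assumes "meas2 H" "\<And>w z. \<bar>H w z\<bar> \<le> C * dom w z" "meas2 G" "\<And>w z. \<bar>G w z\<bar> \<le> C' * dom w z"
  shows "(\<integral>z. T a e (\<lambda>w z. H w z + G w z) z \<partial>phase_lebesgue) = (\<integral>z. T a e H z \<partial>phase_lebesgue) + (\<integral>z. T a e G z \<partial>phase_lebesgue)"
proof -
  have [measurable]: "(\<lambda>x. H (fst x) (snd x)) \<in> borel_measurable (BB \<Otimes>\<^sub>M BB)" "(\<lambda>x. G (fst x) (snd x)) \<in> borel_measurable (BB \<Otimes>\<^sub>M BB)"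
    using assms by (simp_all add: split_beta')
  have m: "meas2 (\<lambda>w z. H w z + G w z)" unfolding split_beta' by measurable
  have b: "\<bar>H w z + G w z\<bar> \<le> (C + C') * dom w z" for w z
    unfolding distrib_right by (rule order_trans[OF abs_triangle_ineq add_mono[OF assms(2,4)]])
  show ?thesis
    unfolding T_joint[OF assms(1,2)] T_joint[OF assms(3,4)] T_joint[OF m b]
    using ker_joint[OF e assms(1,2)] ker_joint[OF e assms(3,4)]
    by (simp add: split_beta' distrib_left)
qed

lemma T_mono:
  assumes "meas2 H" "meas2 G" "\<And>w. \<bar>H w z\<bar> \<le> C * (1 + (snd w)\<^sup>2)" "\<And>w. \<bar>G w z\<bar> \<le> C * (1 + (snd w)\<^sup>2)" "\<And>w. H w z \<le> G w z"
  shows "T a e H z \<le> T a e G z"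
  unfolding T_def
  by (intro integral_mono fibre_integrable[OF e assms(1,3)] fibre_integrable[OF e assms(2,4)] assms mult_left_mono)
     (simp_all add: less_imp_le[OF ker_pos[OF e]])

text \<open>The operator averages \<open>H\<close> with weights of total mass \<open>Uu z\<close>.
  For the logarithmic derivatives of the kernel this bounds those of the mollified density,
  uniformly in \<open>z\<close>.\<close>

lemma T_bound:
  assumes "meas2 H" "\<And>w. \<bar>H w z\<bar> \<le> C"
  shows "\<bar>T a e H z\<bar> \<le> C * Uu z"
proof -
  have C: "C \<ge> 0" using assms(2)[of "(0, 0)"] by simp
  have C1: "C \<le> C * (1 + (snd w)\<^sup>2)" for w :: "torus \<times> real"
    using mult_left_mono[of 1 "1 + (snd w)\<^sup>2" C] C by simp
  have m: "meas2 (\<lambda>w z. C)" "meas2 (\<lambda>w z. - C)" by simp_all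
  have HC: "\<bar>H w z\<bar> \<le> C * (1 + (snd w)\<^sup>2)" for w by (rule order_trans[OF assms(2) C1])
  have CC: "\<bar>C\<bar> \<le> C * (1 + (snd w)\<^sup>2)" "\<bar>- C\<bar> \<le> C * (1 + (snd w)\<^sup>2)" for w :: "torus \<times> real"
    using C1[of w] C by simp_all
  have "T a e H z \<le> T a e (\<lambda>w z. C) z"
    by (rule T_mono[OF assms(1) m(1) HC CC(1) abs_le_D1[OF assms(2)]])
  moreover have "- C \<le> H w z" for w using assms(2)[of w] by (simp add: abs_le_iff)
  then have "T a e (\<lambda>w z. - C) z \<le> T a e H z"
    by (rule T_mono[OF m(2) assms(1) CC(2) HC])
  ultimately show ?thesis by (simp add: uu_def[OF e] T_def mult.commute abs_le_iff)
qed

lemma uq_le: "\<bar>Uq z\<bar> \<le> 2 * pi * \<bar>a\<bar> * Uu z"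
  unfolding uq_def[OF e]
proof (rule T_bound)
  fix w
  have "\<bar>- 2 * pi * a * sin_2pi (fst z - fst w)\<bar> = 2 * pi * \<bar>a\<bar> * \<bar>sin_2pi (fst z - fst w)\<bar>"
    by (simp add: abs_mult)
  also have "\<dots> \<le> 2 * pi * \<bar>a\<bar> * 1" by (intro mult_left_mono) auto
  finally show "\<bar>- 2 * pi * a * sin_2pi (fst z - fst w)\<bar> \<le> 2 * pi * \<bar>a\<bar>" by simp
qed (rule meas2_rules[OF e])

lemma up_le: "\<bar>Up z\<bar> \<le> 2 / e * Uu z"
  unfolding up_def[OF e] by (rule T_bound[OF meas2_rules(3)[OF e] abs_dz1_le[OF e]])

definition lam :: "torus \<times> real \<Rightarrow> real" where
  "lam z = ln (Uu z) + \<beta> * ((snd z)\<^sup>2 / 2 + pot (fst z))"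
definition lq :: "torus \<times> real \<Rightarrow> real" where "lq z = Uq z / Uu z + \<beta> * D (fst z)"
definition lp :: "torus \<times> real \<Rightarrow> real" where "lp z = Up z / Uu z + \<beta> * snd z"

lemma lam_measurable [measurable]:
  "lam \<in> borel_measurable BB" "lq \<in> borel_measurable BB" "lp \<in> borel_measurable BB"
  using measurable_parts[OF e, of a] unfolding lam_def[abs_def] lq_def[abs_def] lp_def[abs_def] by measurable

lemma lam_derivs:
  "has_tderiv (\<lambda>q. lam (q, p)) (lq (q, p)) q" "((\<lambda>p. lam (q, p)) has_real_derivative lp (q, p)) (at p)"
proof -
  have "has_tderiv (\<lambda>q. ln (Uu (q, p)) + \<beta> * (p\<^sup>2 / 2 + pot q)) (Uq (q, p) / Uu (q, p) + \<beta> * (0 + D q)) q"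
    by (intro has_tderiv_add has_tderiv_ln derivs[OF e] uu_pos has_tderiv_cmult has_tderiv_const pot_tderiv)
  then show "has_tderiv (\<lambda>q. lam (q, p)) (lq (q, p)) q" by (simp add: lam_def lq_def)
  have "((\<lambda>p. ln (Uu (q, p)) + \<beta> * (p\<^sup>2 / 2 + pot q)) has_real_derivative (1 / Uu (q, p) * Up (q, p) + \<beta> * (p + 0))) (at p)"
    by (intro DERIV_add DERIV_chain2[OF DERIV_ln_divide[OF uu_pos] derivs(2)[OF e]] DERIV_cmult DERIV_const)
       (auto intro!: derivative_eq_intros)
  then show "((\<lambda>p. lam (q, p)) has_real_derivative lp (q, p)) (at p)" by (simp add: lam_def lp_def)
qed

lemma lq_le: "\<bar>lq z\<bar> \<le> 2 * pi * \<bar>a\<bar> + \<beta> * CD"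
proof -
  have "\<bar>Uq z / Uu z\<bar> \<le> 2 * pi * \<bar>a\<bar>" using uq_le[of z] uu_pos[of z] by (simp add: abs_divide divide_le_eq)
  moreover have "\<bar>\<beta> * D (fst z)\<bar> \<le> \<beta> * CD" using \<beta> abs_D_le by (simp add: abs_mult)
  ultimately show ?thesis unfolding lq_def by linarith
qed

lemma up_quot_le: "\<bar>Up z / Uu z\<bar> \<le> 2 / e"
proof -
  have "\<bar>Up z\<bar> / Uu z \<le> 2 / e * Uu z / Uu z" using up_le[of z] uu_pos[of z] by (intro divide_right_mono) auto
  then show ?thesis using uu_pos[of z] by (simp add: abs_divide)
qed

lemma lp_le: "\<bar>lp z\<bar> \<le> (2 / e + \<beta>) * (1 + \<bar>snd z\<bar>)"
proof -
  have "\<bar>lp z\<bar> \<le> 2 / e + \<beta> * \<bar>snd z\<bar>" using up_quot_le[of z] \<beta> abs_triangle_ineq[of "Up z / Uu z" "\<beta> * snd z"]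
    by (simp add: lp_def abs_mult)
  also have "\<dots> \<le> (2 / e + \<beta>) * (1 + \<bar>snd z\<bar>)"
  proof -
    have "0 \<le> 2 / e * \<bar>snd z\<bar>" using e by simp
    moreover have "(2 / e + \<beta>) * (1 + \<bar>snd z\<bar>) = 2 / e + \<beta> * \<bar>snd z\<bar> + (\<beta> + 2 / e * \<bar>snd z\<bar>)" by (simp add: distrib_left distrib_right)
    ultimately show ?thesis using \<beta> by linarith
  qed
  finally show ?thesis .
qed

lemma lp_square_le: "\<bar>(lp z)\<^sup>2\<bar> \<le> 4 * (2 / e + \<beta>)\<^sup>2 * dom w z"
proof -
  have p2: "(1 + \<bar>snd z\<bar>)\<^sup>2 \<le> 2 * (1 + (snd z)\<^sup>2)"
    using zero_le_power2[of "\<bar>snd z\<bar> - 1"] by (simp add: power2_sum power2_diff)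
  have "\<bar>(lp z)\<^sup>2\<bar> = \<bar>lp z\<bar>\<^sup>2" by simp
  also have "\<dots> \<le> ((2 / e + \<beta>) * (1 + \<bar>snd z\<bar>))\<^sup>2" by (intro power_mono lp_le) auto
  also have "\<dots> = (2 / e + \<beta>)\<^sup>2 * (1 + \<bar>snd z\<bar>)\<^sup>2" by (simp add: power_mult_distrib)
  also have "\<dots> \<le> (2 / e + \<beta>)\<^sup>2 * (4 * dom w z)"
    using p2 dom_bounds(1)[of z w] by (intro mult_left_mono) auto
  finally show ?thesis by (simp only: mult_ac)
qed

text \<open>Moving from the origin first in \<open>q\<close> and then in \<open>p\<close>, the
  bounds on the logarithmic derivatives give linear growth of \<open>ln (Uu z)\<close>; the
  quadratic growth stems from the kinetic energy.\<close>

lemma lam_growth: "\<exists>C. \<forall>z. \<bar>lam z\<bar> \<le> C * (1 + (snd z)\<^sup>2)"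
proof -
  define L where "L z = ln (Uu z)" for z
  have Lp: "((\<lambda>p. L (q, p)) has_real_derivative Up (q, p) / Uu (q, p)) (at p)" for q p
    using DERIV_chain2[OF DERIV_ln_divide[OF uu_pos] derivs(2)[OF e]] by (simp add: L_def)
  have Lq: "has_tderiv (\<lambda>q. L (q, 0)) (Uq (q, 0) / Uu (q, 0)) q" for q
    unfolding L_def by (intro has_tderiv_ln derivs[OF e] uu_pos)
  have 1: "\<bar>L (q, p) - L (q, 0)\<bar> \<le> 2 / e * \<bar>p\<bar>" for q p
    using field_differentiable_bound[of UNIV "\<lambda>p. L (q, p)" "\<lambda>p. Up (q, p) / Uu (q, p)" "2 / e" p 0]
      up_quot_le Lp by (auto intro: has_field_derivative_at_within)
  have 2: "\<bar>L (q, 0) - L (0, 0)\<bar> \<le> 2 * pi * \<bar>a\<bar>" for q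
  proof -
    obtain t where t: "0 \<le> t" "t < 1" "q = to_torus t" by (rule torus_cases_unit)
    have "norm (L (to_torus t, 0) - L (to_torus 0, 0)) \<le> 2 * pi * \<bar>a\<bar> * norm (t - 0)"
    proof (rule field_differentiable_bound[of UNIV "\<lambda>t. L (to_torus t, 0)" "\<lambda>t. Uq (to_torus t, 0) / Uu (to_torus t, 0)"])
      show "((\<lambda>t. L (to_torus t, 0)) has_field_derivative Uq (to_torus z, 0) / Uu (to_torus z, 0)) (at z within UNIV)" for z
        using has_tderiv_lift[OF Lq] by (auto intro: has_field_derivative_at_within)
      show "norm (Uq (to_torus z, 0) / Uu (to_torus z, 0)) \<le> 2 * pi * \<bar>a\<bar>" for z
        using uq_le[of "(to_torus z, 0)"] uu_pos[of "(to_torus z, 0)"] by (simp add: abs_divide divide_le_eq)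
    qed auto
    also have "\<dots> \<le> 2 * pi * \<bar>a\<bar> * 1" using t by (intro mult_left_mono) auto
    finally show ?thesis by (simp add: t(3))
  qed
  obtain P where P: "\<And>q. \<bar>pot q\<bar> \<le> P" using continuous_imp_bounded_torus[OF pot_continuous] by blast
  define C where "C = \<bar>L (0, 0)\<bar> + 2 * pi * \<bar>a\<bar> + 2 / e + \<beta> * (1 + P)"
  have "\<bar>lam (q, p)\<bar> \<le> C * (1 + p\<^sup>2)" for q p
  proof -
    have P0: "P \<ge> 0" using P[of 0] by simp
    define Y where "Y = 1 + p\<^sup>2"
    have Y: "1 \<le> Y" "\<bar>p\<bar> \<le> Y" "p\<^sup>2 / 2 \<le> Y" using abs_le_1_plus_square[of p] zero_le_power2[of p] by (auto simp: Y_def)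
    have le: "c \<le> c * Y" if "0 \<le> c" for c using mult_left_mono[OF Y(1) that] by simp
    have "\<bar>L (q, p)\<bar> \<le> \<bar>L (0, 0)\<bar> + 2 * pi * \<bar>a\<bar> + 2 / e * \<bar>p\<bar>" using 1[of q p] 2[of q] by linarith
    also have "\<dots> \<le> \<bar>L (0, 0)\<bar> * Y + 2 * pi * \<bar>a\<bar> * Y + 2 / e * Y"
      using e Y by (intro add_mono le mult_left_mono) auto
    finally have a1: "\<bar>L (q, p)\<bar> \<le> \<bar>L (0, 0)\<bar> * Y + 2 * pi * \<bar>a\<bar> * Y + 2 / e * Y" .
    have "\<bar>p\<^sup>2 / 2 + pot q\<bar> \<le> Y + P * Y"
      using P[of q] Y(3) le[OF P0] by (intro order_trans[OF abs_triangle_ineq] add_mono) auto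
    then have "\<bar>\<beta> * (p\<^sup>2 / 2 + pot q)\<bar> \<le> \<beta> * (Y + P * Y)" using \<beta> by (simp add: abs_mult)
    then have "\<bar>lam (q, p)\<bar> \<le> \<bar>L (0, 0)\<bar> * Y + 2 * pi * \<bar>a\<bar> * Y + 2 / e * Y + \<beta> * (Y + P * Y)"
      using a1 unfolding lam_def L_def[symmetric] by simp
    also have "\<dots> = C * Y" by (simp add: C_def algebra_simps)
    finally show ?thesis by (simp add: Y_def)
  qed
  then show ?thesis by (metis prod.collapse)
qed

text \<open>The bound of \<open>lq_le\<close>. It grows linearly with the concentration
  \<open>a\<close>, which later dictates the order of the limits.\<close>

definition Ca :: real where "Ca = 2 * pi * \<bar>a\<bar> + \<beta> * CD"

text \<open>The entropy dissipation \<open>\<integral> u (\<partial>\<^sub>p \<Lambda>)\<^sup>2\<close> of the mollified measure is controlled by the commutators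
  \<open>p - y\<close> and \<open>D q - D x\<close> alone: the transport term drops out because the Gibbs weight is invariant.\<close>

lemma entropy_identity:
  "(\<integral>z. \<gamma> / \<beta> * (Uu z * (lp z)\<^sup>2) \<partial>phase_lebesgue)
   = (\<integral>z. T a e (\<lambda>w z. - (snd z - snd w) * lq z + (D (fst z) - D (fst w) + \<gamma> * (snd z - snd w)) * lp z) z \<partial>phase_lebesgue)"
  "integrable phase_lebesgue (\<lambda>z. Uu z * (lp z)\<^sup>2)"
  "\<exists>K. \<forall>w z. \<bar>- (snd z - snd w) * lq z + (D (fst z) - D (fst w) + \<gamma> * (snd z - snd w)) * lp z\<bar> \<le> K * dom w z"
proof -
  obtain C0 where C0: "\<And>z. \<bar>lam z\<bar> \<le> C0 * (1 + (snd z)\<^sup>2)" using lam_growth by blast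
  define C where "C = \<bar>C0\<bar> + Ca + (2 / e + \<beta>)"
  have Ca0: "Ca \<ge> 0" unfolding Ca_def using \<beta> CD_nonneg by (intro add_nonneg_nonneg mult_nonneg_nonneg) auto
  have le: "C0 \<le> C" "Ca \<le> C" "2 / e + \<beta> \<le> C"
  proof -
    have "0 < 2 / e" using e by simp
    then show "C0 \<le> C" "Ca \<le> C" "2 / e + \<beta> \<le> C" using Ca0 \<beta> unfolding C_def by linarith+
  qed
  have zero: "(\<integral>z. mm a e z * lq z - ff a e z * lp z \<partial>phase_lebesgue) = 0"
  proof (rule entropy_test_growth[OF e lam_derivs lam_measurable, where C=C])
    fix z
    show "\<bar>lam z\<bar> \<le> C * (1 + (snd z)\<^sup>2)"
      by (rule order_trans[OF C0 mult_right_mono[OF le(1)]]) simp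
    show "\<bar>lq z\<bar> \<le> C" using lq_le[of z] le(2) by (simp add: Ca_def)
    show "\<bar>lp z\<bar> \<le> C * (1 + \<bar>snd z\<bar>)"
      by (rule order_trans[OF lp_le mult_right_mono[OF le(3)]]) simp
  qed
  note pi1 = parts_integrable[OF e, of _ _ a]
  have i1: "integrable phase_lebesgue (\<lambda>z. Uq z * snd z)" by (rule pi1(6)[where C=1]) auto
  have i2: "integrable phase_lebesgue (\<lambda>z. Up z * D (fst z))"
    by (rule pi1(7)[where C=CD]) (auto intro: order_trans[OF abs_D_le le_times_linear[OF e CD_nonneg]])
  have i3: "integrable phase_lebesgue (\<lambda>z. Uu z * D (fst z))"
    by (rule pi1(5)[where C=CD]) (auto intro: order_trans[OF abs_D_le le_times_linear[OF e CD_nonneg]])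
  have z1: "(\<integral>z. Uq z * snd z \<partial>phase_lebesgue) = 0"
  proof (rule integral_dq_zero[OF _ i1])
    show "has_tderiv (\<lambda>q. Uu (q, p) * snd (q, p)) (Uq (q, p) * snd (q, p)) q" for q p
      using has_tderiv_cmult[OF derivs(1)[OF e, of a p q], of p] by (simp add: mult.commute)
  qed
  have z2: "(\<integral>z. Up z * D (fst z) \<partial>phase_lebesgue) = 0"
  proof (rule integral_dp_zero[OF _ i3 i2])
    show "((\<lambda>p. Uu (q, p) * D (fst (q, p))) has_real_derivative Up (q, p) * D (fst (q, p))) (at p)" for q p
      using DERIV_cmult[OF derivs(2)[OF e, of a q p], of "D q"] by (simp add: mult.commute)
  qed
  have mT: "meas2 (\<lambda>w z. (snd z - snd w) * lq z)" "meas2 (\<lambda>w z. (D (fst z) - D (fst w) + \<gamma> * (snd z - snd w)) * lp z)"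
     "meas2 (\<lambda>w z. - (snd z - snd w) * lq z + (D (fst z) - D (fst w) + \<gamma> * (snd z - snd w)) * lp z)"
    unfolding split_beta' by measurable
  have fi1: "integrable M (\<lambda>w. ker a e w z)" for z
    using fibre_integrable[OF e meas2_rules(1)[OF e], where z=z and C=1] by simp
  have fi2: "integrable M (\<lambda>w. ker a e w z * snd w)" for z
    using fibre_integrable[OF e meas2_rules(4)[OF e], where z=z and C=1] abs_le_1_plus_square by simp
  have fi3: "integrable M (\<lambda>w. ker a e w z * D (fst w))" for z
  proof (rule fibre_integrable[OF e, where C=CD])
    show "meas2 (\<lambda>w z. D (fst w))" unfolding split_beta' by measurable
    show "\<bar>D (fst w)\<bar> \<le> CD * (1 + (snd w)\<^sup>2)" for w
      using order_trans[OF abs_D_le[of "fst w"], of "CD * (1 + (snd w)\<^sup>2)"] CD_nonneg mult_left_mono[of 1 "1 + (snd w)\<^sup>2" CD] by simp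
  qed
  \<comment> \<open>Pointwise algebra: the commutator term is the dissipation, plus the tested
    equation, minus \<open>Uq z * snd z - Up z * D (fst z)\<close>. The second part integrates to 0
    by \<open>zero\<close>, the third by \<open>z1\<close> and \<open>z2\<close>.\<close>
  have key: "T a e (\<lambda>w z. - (snd z - snd w) * lq z + (D (fst z) - D (fst w) + \<gamma> * (snd z - snd w)) * lp z) z
     = \<gamma> / \<beta> * (Uu z * (lp z)\<^sup>2) + (mm a e z * lq z - ff a e z * lp z) - (Uq z * snd z - Up z * D (fst z))" for z
  proof -
    define I1 I2 I3 where "I1 = (\<integral>w. ker a e w z \<partial>M)" and "I2 = (\<integral>w. ker a e w z * snd w \<partial>M)" and "I3 = (\<integral>w. ker a e w z * D (fst w) \<partial>M)"
    have u: "Uu z = I1" "mm a e z = I2" by (simp_all add: uu_def[OF e] mm_def[OF e] T_def I1_def I2_def)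
    have "T a e (\<lambda>w z. D (fst w) + \<gamma> * snd w) z = (\<integral>w. ker a e w z * D (fst w) + \<gamma> * (ker a e w z * snd w) \<partial>M)"
      by (simp add: T_def algebra_simps)
    also have "\<dots> = I3 + \<gamma> * I2" using fi2 fi3 by (simp add: I2_def I3_def)
    finally have f: "ff a e z = I3 + \<gamma> * I2 + \<gamma> / \<beta> * Up z" by (simp add: ff_def[OF e])
    have "T a e (\<lambda>w z. - (snd z - snd w) * lq z + (D (fst z) - D (fst w) + \<gamma> * (snd z - snd w)) * lp z) z
      = (\<integral>w. (- snd z * lq z + D (fst z) * lp z + \<gamma> * snd z * lp z) * ker a e w z + ((lq z - \<gamma> * lp z) * (ker a e w z * snd w) - lp z * (ker a e w z * D (fst w))) \<partial>M)"
      by (simp add: T_def algebra_simps)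
    also have "\<dots> = (- snd z * lq z + D (fst z) * lp z + \<gamma> * snd z * lp z) * I1 + ((lq z - \<gamma> * lp z) * I2 - lp z * I3)"
      using fi1 fi2 fi3 by (simp add: I1_def I2_def I3_def)
    finally have 1: "T a e (\<lambda>w z. - (snd z - snd w) * lq z + (D (fst z) - D (fst w) + \<gamma> * (snd z - snd w)) * lp z) z
      = (- snd z * lq z + D (fst z) * lp z + \<gamma> * snd z * lp z) * I1 + ((lq z - \<gamma> * lp z) * I2 - lp z * I3)" .
    have I1: "I1 > 0" using uu_pos[of z] u by simp
    have qq: "Uq z = I1 * lq z - \<beta> * D (fst z) * I1" using I1 by (simp add: lq_def u field_simps)
    have pq: "Up z = I1 * lp z - \<beta> * snd z * I1" using I1 by (simp add: lp_def u field_simps)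
    have gb: "\<gamma> / \<beta> * Up z = \<gamma> / \<beta> * (I1 * lp z) - \<gamma> * snd z * I1" unfolding pq using \<beta> by (simp add: field_simps)
    show ?thesis unfolding 1 f u gb qq unfolding pq by (simp add: algebra_simps power2_eq_square)
  qed
  have bd: "\<bar>- (snd z - snd w) * lq z + (D (fst z) - D (fst w) + \<gamma> * (snd z - snd w)) * lp z\<bar> \<le> 3 * (C + (2 * CD + \<gamma>) * C) * dom w z" for w z
  proof -
    define P Y where "P = 1 + \<bar>snd z\<bar>" and "Y = 1 + \<bar>snd z - snd w\<bar>"
    have PY: "1 \<le> P" "1 \<le> Y" "Y * P \<le> 3 * dom w z" using dom_bounds(5)[of z w] by (simp_all add: P_def Y_def)
    have C1: "C \<ge> 0" "C \<ge> Ca" using le Ca0 by auto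
    have "\<bar>(snd z - snd w) * lq z\<bar> \<le> Y * C"
      unfolding abs_mult using lq_le[of z] C1 by (intro mult_mono) (auto simp: Y_def Ca_def)
    also have "\<dots> \<le> Y * (C * P)" using PY C1 mult_left_mono[of 1 P C] by (intro mult_left_mono) auto
    finally have 1: "\<bar>(snd z - snd w) * lq z\<bar> \<le> C * (Y * P)" by (simp add: mult_ac)
    have "\<bar>D (fst z) - D (fst w) + \<gamma> * (snd z - snd w)\<bar> \<le> \<bar>D (fst z)\<bar> + \<bar>D (fst w)\<bar> + \<bar>\<gamma> * (snd z - snd w)\<bar>" by linarith
    also have "\<dots> \<le> CD + CD + \<gamma> * \<bar>snd z - snd w\<bar>"
      using \<gamma> by (intro add_mono abs_D_le) (simp add: abs_mult)
    also have "\<dots> \<le> (2 * CD + \<gamma>) * Y"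
      using CD_nonneg \<gamma> mult_nonneg_nonneg[OF CD_nonneg abs_ge_zero[of "snd z - snd w"]] by (simp add: Y_def algebra_simps)
    finally have 2: "\<bar>D (fst z) - D (fst w) + \<gamma> * (snd z - snd w)\<bar> \<le> (2 * CD + \<gamma>) * Y" .
    have 3: "\<bar>lp z\<bar> \<le> C * P" using order_trans[OF lp_le mult_right_mono[OF le(3)]] by (simp add: P_def)
    have "\<bar>(D (fst z) - D (fst w) + \<gamma> * (snd z - snd w)) * lp z\<bar> \<le> ((2 * CD + \<gamma>) * Y) * (C * P)"
      unfolding abs_mult using CD_nonneg \<gamma> PY by (intro mult_mono 2 3) auto
    then have 4: "\<bar>(D (fst z) - D (fst w) + \<gamma> * (snd z - snd w)) * lp z\<bar> \<le> ((2 * CD + \<gamma>) * C) * (Y * P)" by (simp only: mult_ac)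
    have "\<bar>- (snd z - snd w) * lq z + (D (fst z) - D (fst w) + \<gamma> * (snd z - snd w)) * lp z\<bar>
      \<le> \<bar>(snd z - snd w) * lq z\<bar> + \<bar>(D (fst z) - D (fst w) + \<gamma> * (snd z - snd w)) * lp z\<bar>"
      by (rule order_trans[OF abs_triangle_ineq]) (simp add: abs_mult abs_minus_commute)
    also have "\<dots> \<le> C * (Y * P) + ((2 * CD + \<gamma>) * C) * (Y * P)" by (rule add_mono[OF 1 4])
    also have "\<dots> = (C + (2 * CD + \<gamma>) * C) * (Y * P)" by (simp add: distrib_right)
    also have "\<dots> \<le> (C + (2 * CD + \<gamma>) * C) * (3 * dom w z)"
      using CD_nonneg \<gamma> C1 PY by (intro mult_left_mono) auto
    finally show ?thesis
      by (simp only: mult_ac)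
  qed
  then show "\<exists>K. \<forall>w z. \<bar>- (snd z - snd w) * lq z + (D (fst z) - D (fst w) + \<gamma> * (snd z - snd w)) * lp z\<bar> \<le> K * dom w z" by blast
  have iJ': "integrable phase_lebesgue (\<lambda>z. T a e (\<lambda>w z. 1) z * (lp z)\<^sup>2)"
  proof (rule TI[OF e meas2_rules(1)[OF e], where C="4 * (2 / e + \<beta>)\<^sup>2"])
    fix w z :: "torus \<times> real"
    show "\<bar>1 :: real\<bar> * \<bar>(lp z)\<^sup>2\<bar> \<le> 4 * (2 / e + \<beta>)\<^sup>2 * dom w z" using lp_square_le[where z=z and w=w] by simp
  qed measurable
  then show iJ: "integrable phase_lebesgue (\<lambda>z. Uu z * (lp z)\<^sup>2)" by (simp add: uu_def[OF e])
  have lqC: "\<bar>lq z\<bar> \<le> C * (1 + \<bar>snd z\<bar>)" for z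
    using order_trans[OF _ le_times_linear[OF e, of C "snd z"]] lq_le[of z] le Ca0 by (simp add: Ca_def)
  have lpC: "\<bar>lp z\<bar> \<le> C * (1 + \<bar>snd z\<bar>)" for z
    using order_trans[OF lp_le mult_right_mono[OF le(3)]] by simp
  have i4: "integrable phase_lebesgue (\<lambda>z. mm a e z * lq z)" by (rule pi1(1)[OF _ lqC]) simp
  have i5: "integrable phase_lebesgue (\<lambda>z. ff a e z * lp z)" by (rule pi1(3)[OF _ lpC]) simp
  have "(\<integral>z. T a e (\<lambda>w z. - (snd z - snd w) * lq z + (D (fst z) - D (fst w) + \<gamma> * (snd z - snd w)) * lp z) z \<partial>phase_lebesgue)
    = (\<integral>z. \<gamma> / \<beta> * (Uu z * (lp z)\<^sup>2) \<partial>phase_lebesgue) + (\<integral>z. mm a e z * lq z - ff a e z * lp z \<partial>phase_lebesgue)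
     - ((\<integral>z. Uq z * snd z \<partial>phase_lebesgue) - (\<integral>z. Up z * D (fst z) \<partial>phase_lebesgue))"
    unfolding key using iJ i1 i2 i4 i5 by simp
  then show "(\<integral>z. \<gamma> / \<beta> * (Uu z * (lp z)\<^sup>2) \<partial>phase_lebesgue)
   = (\<integral>z. T a e (\<lambda>w z. - (snd z - snd w) * lq z + (D (fst z) - D (fst w) + \<gamma> * (snd z - snd w)) * lp z) z \<partial>phase_lebesgue)"
    unfolding zero z1 z2 by simp
qed

definition m2 :: real where "m2 = (\<integral>w. (snd w)\<^sup>2 \<partial>M)"

text \<open>All commutators are majorised by such combinations, whose integrals are exact: e^2 is
  the variance of \<open>zeta\<close> and \<open>1 - R a\<close> the width of \<open>eta\<close>.
  Error bounds thus become explicit in \<open>e\<close> and \<open>a\<close>.\<close>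

lemma T_quad:
  defines "H \<equiv> \<lambda>\<alpha> \<delta> \<epsilon> \<kappa> w z. \<alpha> + \<delta> * (snd z - snd w)\<^sup>2 + \<epsilon> * (1 - cos_2pi (fst z - fst w)) + \<kappa> * (snd w)\<^sup>2"
  shows "(\<integral>z. T a e (H \<alpha> \<delta> \<epsilon> \<kappa>) z \<partial>phase_lebesgue) = \<alpha> + \<delta> * e\<^sup>2 + \<epsilon> * (1 - R a) + \<kappa> * m2"
    "integrable phase_lebesgue (T a e (H \<alpha> \<delta> \<epsilon> \<kappa>))" "meas2 (H \<alpha> \<delta> \<epsilon> \<kappa>)"
    "\<bar>H \<alpha> \<delta> \<epsilon> \<kappa> w z\<bar> \<le> (\<bar>\<alpha>\<bar> + \<bar>\<delta>\<bar> + 2 * \<bar>\<epsilon>\<bar> + \<bar>\<kappa>\<bar>) * dom w z"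
proof -
  show m: "meas2 (H \<alpha> \<delta> \<epsilon> \<kappa>)" unfolding H_def split_beta' by measurable
  show b: "\<bar>H \<alpha> \<delta> \<epsilon> \<kappa> w z\<bar> \<le> (\<bar>\<alpha>\<bar> + \<bar>\<delta>\<bar> + 2 * \<bar>\<epsilon>\<bar> + \<bar>\<kappa>\<bar>) * dom w z" for w z
  proof -
    have d: "1 \<le> dom w z" "(snd z - snd w)\<^sup>2 \<le> dom w z" "(snd w)\<^sup>2 \<le> dom w z"
      using dom_ge_1[of w z] dom_bounds(2)[of w z] dom_bounds(3)[of z w] by auto
    have c: "\<bar>1 - cos_2pi (fst z - fst w)\<bar> \<le> 2"
      using abs_cos_2pi_le[of "fst z - fst w"] unfolding abs_le_iff by linarith
    have "\<bar>H \<alpha> \<delta> \<epsilon> \<kappa> w z\<bar> \<le> \<bar>\<alpha>\<bar> * 1 + \<bar>\<delta>\<bar> * (snd z - snd w)\<^sup>2 + \<bar>\<epsilon>\<bar> * \<bar>1 - cos_2pi (fst z - fst w)\<bar> + \<bar>\<kappa>\<bar> * (snd w)\<^sup>2"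
      unfolding H_def by (intro order_trans[OF abs_triangle_ineq] add_mono) (auto simp: abs_mult)
    also have "\<dots> \<le> \<bar>\<alpha>\<bar> * dom w z + \<bar>\<delta>\<bar> * dom w z + \<bar>\<epsilon>\<bar> * (2 * dom w z) + \<bar>\<kappa>\<bar> * dom w z"
      using d by (intro add_mono mult_left_mono order_trans[OF c]) auto
    finally show ?thesis by (simp add: algebra_simps)
  qed
  have f0: "integrable phase_lebesgue (\<lambda>z. ker a e w z * (1 * 1))" "(\<integral>z. ker a e w z * (1 * 1) \<partial>phase_lebesgue) = 1" for w
    using ker_fibre[OF e continuous_on_const[of UNIV 1], of "\<lambda>t. 1" a w] zeta_integrals[OF e] eta_integral[of a "fst w"] by simp_all
  have f1: "integrable phase_lebesgue (\<lambda>z. ker a e w z * (1 * (snd z - snd w)\<^sup>2))" "(\<integral>z. ker a e w z * (1 * (snd z - snd w)\<^sup>2) \<partial>phase_lebesgue) = e\<^sup>2" for w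
    using ker_fibre[OF e continuous_on_const[of UNIV 1], of "\<lambda>t. t\<^sup>2" a w] zeta_integrals[OF e] eta_integral[of a "fst w"] by simp_all
  have f2: "integrable phase_lebesgue (\<lambda>z. ker a e w z * ((1 - cos_2pi (fst z - fst w)) * 1))" "(\<integral>z. ker a e w z * ((1 - cos_2pi (fst z - fst w)) * 1) \<partial>phase_lebesgue) = 1 - R a" for w
  proof -
    have c: "continuous_on UNIV (\<lambda>q. 1 - cos_2pi (q - fst w))" unfolding cos_2pi_diff by (intro continuous_intros)
    show "integrable phase_lebesgue (\<lambda>z. ker a e w z * ((1 - cos_2pi (fst z - fst w)) * 1))" "(\<integral>z. ker a e w z * ((1 - cos_2pi (fst z - fst w)) * 1) \<partial>phase_lebesgue) = 1 - R a"
      using ker_fibre[OF e c, of "\<lambda>t. 1" a w] zeta_integrals[OF e] eta_integral_cos[of a "fst w"] by simp_all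
  qed
  have eq: "ker a e w z * H \<alpha> \<delta> \<epsilon> \<kappa> w z = (\<alpha> + \<kappa> * (snd w)\<^sup>2) * (ker a e w z * (1 * 1)) + \<delta> * (ker a e w z * (1 * (snd z - snd w)\<^sup>2)) + \<epsilon> * (ker a e w z * ((1 - cos_2pi (fst z - fst w)) * 1))" for w z
    by (simp add: H_def algebra_simps)
  have "(\<integral>z. ker a e w z * H \<alpha> \<delta> \<epsilon> \<kappa> w z \<partial>phase_lebesgue) = (\<alpha> + \<kappa> * (snd w)\<^sup>2) * 1 + \<delta> * e\<^sup>2 + \<epsilon> * (1 - R a)" for w
    unfolding eq
    by (simp only: Bochner_Integration.integral_add Bochner_Integration.integrable_add integrable_mult_right integral_mult_right_zero f0 f1 f2)
  moreover have "integrable M (\<lambda>w. (snd w)\<^sup>2)" using moment2 by (simp add: split_beta')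
  ultimately have v: "(\<integral>w. \<integral>z. ker a e w z * H \<alpha> \<delta> \<epsilon> \<kappa> w z \<partial>phase_lebesgue \<partial>M) = \<alpha> + \<delta> * e\<^sup>2 + \<epsilon> * (1 - R a) + \<kappa> * m2"
    using M.prob_space by (simp add: m2_def)
  show "(\<integral>z. T a e (H \<alpha> \<delta> \<epsilon> \<kappa>) z \<partial>phase_lebesgue) = \<alpha> + \<delta> * e\<^sup>2 + \<epsilon> * (1 - R a) + \<kappa> * m2"
    unfolding T_integrable(2)[OF e m b] v ..
  show "integrable phase_lebesgue (T a e (H \<alpha> \<delta> \<epsilon> \<kappa>))" by (rule T_integrable(1)[OF e m b])
qed

text \<open>The velocity part of the Fisher information of the mollified density relative to the
  Gibbs weight.\<close>

definition fisher :: real where "fisher = (\<integral>z. Uu z * (lp z)\<^sup>2 \<partial>phase_lebesgue)"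

text \<open>Young's inequality, applied pointwise inside the entropy identity, returns half of the
  dissipation and leaves squares of the commutators, which \<open>T_quad\<close> integrates.\<close>

lemma fisher_le:
  "\<gamma> / (2 * \<beta>) * fisher \<le> Ca * e + \<beta> * \<gamma> * e\<^sup>2 + 4 * \<beta> * (s1\<^sup>2 + s2\<^sup>2) / \<gamma> * (1 - R a)"
proof -
  define S where "S = s1\<^sup>2 + s2\<^sup>2"
  define G where "G w z = Ca * e / 2 + (Ca / (2 * e) + \<beta> * \<gamma>) * (snd z - snd w)\<^sup>2 + (4 * \<beta> * S / \<gamma>) * (1 - cos_2pi (fst z - fst w)) + 0 * (snd w)\<^sup>2" for w z :: "torus \<times> real"
  note Q = T_quad[where \<alpha>="Ca * e / 2" and \<delta>="Ca / (2 * e) + \<beta> * \<gamma>" and \<epsilon>="4 * \<beta> * S / \<gamma>" and \<kappa>=0, folded G_def]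
  have Ca0: "Ca \<ge> 0" unfolding Ca_def using \<beta> CD_nonneg by (intro add_nonneg_nonneg mult_nonneg_nonneg) auto
  have pw: "- (snd z - snd w) * lq z + (D (fst z) - D (fst w) + \<gamma> * (snd z - snd w)) * lp z \<le> G w z + \<gamma> / (2 * \<beta>) * (lp z)\<^sup>2" for w z
  proof -
    define t h l where "t = snd z - snd w" and "h = D (fst z) - D (fst w) + \<gamma> * t" and "l = lp z"
    have "- t * lq z \<le> \<bar>t\<bar> * \<bar>lq z\<bar>" by (metis abs_ge_self abs_minus_cancel abs_mult)
    also have "\<dots> \<le> \<bar>t\<bar> * Ca" using lq_le[of z] by (intro mult_left_mono) (auto simp: Ca_def)
    \<comment> \<open>Young's inequality at the scale \<open>e\<close>, the standard deviation of
      \<open>t\<close> under the kernel: after integration the two halves add up to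
      \<open>Ca * e\<close>.\<close>
    also have "\<dots> \<le> (t\<^sup>2 / (2 * e) + e / 2) * Ca"
    proof (rule mult_right_mono[OF _ Ca0])
      have "0 \<le> (\<bar>t\<bar> - e)\<^sup>2 / (2 * e)" using e by simp
      also have "\<dots> = t\<^sup>2 / (2 * e) + e / 2 - \<bar>t\<bar>" using e by (simp add: power2_diff field_simps power2_eq_square)
      finally show "\<bar>t\<bar> \<le> t\<^sup>2 / (2 * e) + e / 2" by simp
    qed
    finally have 1: "- t * lq z \<le> Ca * e / 2 + Ca / (2 * e) * t\<^sup>2" by (simp add: algebra_simps)
    \<comment> \<open>The weights are chosen so that exactly half of the dissipation
      \<open>\<gamma> / \<beta> * l\<^sup>2\<close> reappears on the right.\<close>
    have "0 \<le> (\<gamma> * l - \<beta> * h)\<^sup>2 / (2 * \<beta> * \<gamma>)" using \<beta> \<gamma> by simp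
    also have "\<dots> = \<gamma> / (2 * \<beta>) * l\<^sup>2 + \<beta> / (2 * \<gamma>) * h\<^sup>2 - h * l" using \<beta> \<gamma> by (simp add: power2_eq_square field_simps)
    finally have 2: "h * l \<le> \<gamma> / (2 * \<beta>) * l\<^sup>2 + \<beta> / (2 * \<gamma>) * h\<^sup>2" by simp
    have "h\<^sup>2 \<le> 2 * (D (fst z) - D (fst w))\<^sup>2 + 2 * (\<gamma> * t)\<^sup>2"
    proof -
      have "(r + s)\<^sup>2 \<le> 2 * r\<^sup>2 + 2 * s\<^sup>2" for r s :: real
        using zero_le_power2[of "r - s"] by (simp add: power2_sum power2_diff)
      then show ?thesis by (simp add: h_def)
    qed
    also have "\<dots> \<le> 2 * (4 * S * (1 - cos_2pi (fst z - fst w))) + 2 * (\<gamma> * t)\<^sup>2"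
      using D_diff_le[of "fst z" "fst w"] by (simp add: S_def)
    finally have "\<beta> / (2 * \<gamma>) * h\<^sup>2 \<le> \<beta> / (2 * \<gamma>) * (2 * (4 * S * (1 - cos_2pi (fst z - fst w))) + 2 * (\<gamma> * t)\<^sup>2)"
      using \<beta> \<gamma> by (intro mult_left_mono) auto
    also have "\<dots> = 4 * \<beta> * S / \<gamma> * (1 - cos_2pi (fst z - fst w)) + \<beta> * \<gamma> * t\<^sup>2"
      using \<gamma> by (simp add: field_simps power2_eq_square)
    finally have 3: "h * l \<le> \<gamma> / (2 * \<beta>) * l\<^sup>2 + 4 * \<beta> * S / \<gamma> * (1 - cos_2pi (fst z - fst w)) + \<beta> * \<gamma> * t\<^sup>2" using 2 by linarith
    show ?thesis unfolding G_def t_def[symmetric] h_def[symmetric] l_def[symmetric] distrib_right using 1 3 by linarith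
  qed
  have mG: "meas2 G" by (rule Q(3))
  define H where "H w z = - (snd z - snd w) * lq z + (D (fst z) - D (fst w) + \<gamma> * (snd z - snd w)) * lp z" for w z
  have mH: "meas2 H" "meas2 (\<lambda>w z. 1 * (\<gamma> / (2 * \<beta>) * (lp z)\<^sup>2))" unfolding H_def split_beta' by measurable
  obtain K where K: "\<And>w z. \<bar>H w z\<bar> \<le> K * dom w z" using entropy_identity(3) unfolding H_def by blast
  have bl: "\<bar>1 * (\<gamma> / (2 * \<beta>) * (lp z)\<^sup>2)\<bar> \<le> (\<gamma> / (2 * \<beta>) * (4 * (2 / e + \<beta>)\<^sup>2)) * dom w z" for w z
    using mult_left_mono[OF lp_square_le[where z=z and w=w], of "\<gamma> / (2 * \<beta>)"] \<beta> \<gamma> by (simp add: abs_mult mult_ac)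
  have bG: "\<bar>G w z + 1 * (\<gamma> / (2 * \<beta>) * (lp z)\<^sup>2)\<bar> \<le> (\<bar>Ca * e / 2\<bar> + \<bar>Ca / (2 * e) + \<beta> * \<gamma>\<bar> + 2 * \<bar>4 * \<beta> * S / \<gamma>\<bar> + \<bar>0\<bar> + (\<gamma> / (2 * \<beta>) * (4 * (2 / e + \<beta>)\<^sup>2))) * dom w z" for w z
    unfolding distrib_right[of _ "\<gamma> / (2 * \<beta>) * (4 * (2 / e + \<beta>)\<^sup>2)"] by (rule order_trans[OF abs_triangle_ineq add_mono[OF Q(4) bl]])
  have mG': "meas2 (\<lambda>w z. G w z + 1 * (\<gamma> / (2 * \<beta>) * (lp z)\<^sup>2))" unfolding G_def split_beta' by measurable
  have "\<gamma> / \<beta> * fisher = (\<integral>z. T a e H z \<partial>phase_lebesgue)"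
    using entropy_identity(1) by (simp add: fisher_def H_def[abs_def])
  also have "\<dots> \<le> (\<integral>z. T a e (\<lambda>w z. G w z + 1 * (\<gamma> / (2 * \<beta>) * (lp z)\<^sup>2)) z \<partial>phase_lebesgue)"
    by (rule T_int_mono[OF mH(1) K mG' bG]) (use pw in \<open>simp add: H_def\<close>)
  also have "\<dots> = (\<integral>z. T a e G z \<partial>phase_lebesgue) + (\<integral>z. T a e (\<lambda>w z. 1 * (\<gamma> / (2 * \<beta>) * (lp z)\<^sup>2)) z \<partial>phase_lebesgue)"
    by (rule T_int_add[OF Q(3) Q(4) mH(2) bl])
  also have "(\<integral>z. T a e (\<lambda>w z. 1 * (\<gamma> / (2 * \<beta>) * (lp z)\<^sup>2)) z \<partial>phase_lebesgue) = (\<integral>z. \<gamma> / (2 * \<beta>) * (Uu z * (lp z)\<^sup>2) \<partial>phase_lebesgue)"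
    unfolding T_mult uu_def[OF e] by (simp add: mult_ac)
  also have "\<dots> = \<gamma> / (2 * \<beta>) * fisher" by (simp add: fisher_def)
  finally have "\<gamma> / \<beta> * fisher - \<gamma> / (2 * \<beta>) * fisher \<le> (\<integral>z. T a e G z \<partial>phase_lebesgue)" by simp
  moreover have "\<gamma> / \<beta> * fisher - \<gamma> / (2 * \<beta>) * fisher = \<gamma> / (2 * \<beta>) * fisher" using \<beta> by (simp add: field_simps)
  moreover have "(\<integral>z. T a e G z \<partial>phase_lebesgue) = Ca * e / 2 + (Ca / (2 * e) + \<beta> * \<gamma>) * e\<^sup>2 + 4 * \<beta> * S / \<gamma> * (1 - R a) + 0 * m2"
    by (rule Q(1))
  moreover have "Ca * e / 2 + (Ca / (2 * e) + \<beta> * \<gamma>) * e\<^sup>2 = Ca * e + \<beta> * \<gamma> * e\<^sup>2" using e by (simp add: field_simps power2_eq_square)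
  ultimately show ?thesis by (simp add: S_def)
qed

text \<open>For a Maxwellian velocity the integral of A(q) (B' - \<beta> p B) vanishes. Under the
  mollified density, integration by parts turns it into minus the integral of
  \<open>lp * A * B\<close>, which the Fisher information controls; the remaining terms are the cost
  of undoing the mollification. The parameter \<tau> balances the two.\<close>

lemma stein_le:
  fixes A :: "torus \<Rightarrow> real" and B B' F :: "real \<Rightarrow> real"
  assumes [measurable]: "A \<in> borel_measurable borel" "B' \<in> borel_measurable borel"
    and CA: "\<And>q. \<bar>A q\<bar> \<le> CA" and LA: "\<And>q x. (A q - A x)\<^sup>2 \<le> LA * (1 - cos_2pi (q - x))"
    and B': "\<And>p. (B has_real_derivative B' p) (at p)" and CB: "\<And>p. \<bar>B p\<bar> \<le> CB"
    and F_def: "\<And>p. F p = B' p - \<beta> * p * B p"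
    and CF: "\<And>p. \<bar>F p\<bar> \<le> CF * (1 + \<bar>p\<bar>)" and LF: "\<And>p y. \<bar>F p - F y\<bar> \<le> CF * (1 + \<bar>y\<bar>) * \<bar>p - y\<bar>"
    and \<tau>: "\<tau> > 0"
  shows "\<bar>\<integral>w. A (fst w) * F (snd w) \<partial>M\<bar> \<le> CA * CB * (\<tau> / 2 * fisher + 1 / (2 * \<tau>))
    + ((CA * CF + CF) / \<tau> + (CA * CF * \<tau> / 2 + 2 * CF / \<tau>) * e\<^sup>2 + (CF * \<tau> * LA / 2) * (1 - R a) + (CA * CF + 2 * CF) / \<tau> * m2)"
proof -
  have nn: "CA \<ge> 0" "CB \<ge> 0" "CF \<ge> 0" using CA[of 0] CB[of 0] CF[of 0] by auto
  have [measurable]: "B \<in> borel_measurable borel"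
    by (intro borel_measurable_continuous_onI DERIV_continuous_on[OF has_field_derivative_at_within[OF B']])
  have "F = (\<lambda>p. B' p - \<beta> * p * B p)" using F_def by auto
  then have [measurable]: "F \<in> borel_measurable borel" by simp
  note pi1 = parts_integrable[OF e, of _ _ a]
  have Uu1: "(\<integral>z. Uu z \<partial>phase_lebesgue) = 1"
    using T_quad(1)[where \<alpha>=1 and \<delta>=0 and \<epsilon>=0 and \<kappa>=0] by (simp add: uu_def[OF e])
  have iU: "integrable phase_lebesgue Uu"
    using T_quad(2)[where \<alpha>=1 and \<delta>=0 and \<epsilon>=0 and \<kappa>=0] by (simp add: uu_def[OF e])
  have bAB: "\<bar>A (fst z) * B (snd z)\<bar> \<le> CA * CB" for z unfolding abs_mult using nn by (intro mult_mono CA CB) auto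
  have iAB: "integrable phase_lebesgue (\<lambda>z. Up z * (A (fst z) * B (snd z)))" "integrable phase_lebesgue (\<lambda>z. Uu z * (A (fst z) * B (snd z)))"
    using nn by (intro pi1[where C="CA * CB"] order_trans[OF bAB le_times_linear[OF e]]; simp)+
  have B'_le: "\<bar>B' p\<bar> \<le> (CF + \<beta> * CB) * (1 + \<bar>p\<bar>)" for p
  proof -
    have "\<bar>B' p\<bar> = \<bar>F p + \<beta> * p * B p\<bar>" by (simp add: F_def)
    also have "\<dots> \<le> CF * (1 + \<bar>p\<bar>) + \<beta> * \<bar>p\<bar> * CB"
      using \<beta> by (intro order_trans[OF abs_triangle_ineq] add_mono CF) (auto simp: abs_mult intro!: mult_left_mono CB)
    also have "\<dots> \<le> (CF + \<beta> * CB) * (1 + \<bar>p\<bar>)" using nn \<beta> by (simp add: algebra_simps)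
    finally show ?thesis .
  qed
  have iAB': "integrable phase_lebesgue (\<lambda>z. Uu z * (A (fst z) * B' (snd z)))"
  proof (rule pi1(5)[where C="CA * (CF + \<beta> * CB)"])
    show "\<bar>A (fst z) * B' (snd z)\<bar> \<le> CA * (CF + \<beta> * CB) * (1 + \<bar>snd z\<bar>)" for z :: "torus \<times> real"
      unfolding abs_mult mult.assoc using nn by (intro mult_mono CA B'_le) auto
  qed measurable
  have z: "(\<integral>z. Up z * (A (fst z) * B (snd z)) + Uu z * (A (fst z) * B' (snd z)) \<partial>phase_lebesgue) = 0"
  proof (rule integral_dp_zero[OF _ iAB(2)])
    show "((\<lambda>p. Uu (q, p) * (A (fst (q, p)) * B (snd (q, p)))) has_real_derivative
       Up (q, p) * (A (fst (q, p)) * B (snd (q, p))) + Uu (q, p) * (A (fst (q, p)) * B' (snd (q, p)))) (at p)" for q p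
      using DERIV_mult'[OF derivs(2)[OF e, of a q p] DERIV_cmult[OF B'[of p], of "A q"]] by (simp add: add.commute)
  qed (intro Bochner_Integration.integrable_add iAB iAB')
  have ilp: "integrable phase_lebesgue (\<lambda>z. Uu z * (lp z * (A (fst z) * B (snd z))))"
  proof (rule pi1(5)[where C="(2 / e + \<beta>) * (CA * CB)"])
    show "\<bar>lp z * (A (fst z) * B (snd z))\<bar> \<le> (2 / e + \<beta>) * (CA * CB) * (1 + \<bar>snd z\<bar>)" for z
    proof -
      have "\<bar>lp z * (A (fst z) * B (snd z))\<bar> \<le> ((2 / e + \<beta>) * (1 + \<bar>snd z\<bar>)) * (CA * CB)"
        unfolding abs_mult[of "lp z"] using e \<beta> by (intro mult_mono lp_le bAB) auto
      then show ?thesis by (simp only: mult_ac)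
    qed
  qed measurable
  have "(\<integral>z. Uu z * (A (fst z) * F (snd z)) \<partial>phase_lebesgue)
     = (\<integral>z. (Up z * (A (fst z) * B (snd z)) + Uu z * (A (fst z) * B' (snd z))) - Uu z * (lp z * (A (fst z) * B (snd z))) \<partial>phase_lebesgue)"
  proof (intro Bochner_Integration.integral_cong refl)
    fix z
    have "Uu z * lp z = Up z + \<beta> * snd z * Uu z" using uu_pos[of z] by (simp add: lp_def field_simps)
    then have "Uu z * (lp z * (A (fst z) * B (snd z))) = (Up z + \<beta> * snd z * Uu z) * (A (fst z) * B (snd z))"
      by (simp only: mult.assoc[symmetric])
    then show "Uu z * (A (fst z) * F (snd z)) = (Up z * (A (fst z) * B (snd z)) + Uu z * (A (fst z) * B' (snd z))) - Uu z * (lp z * (A (fst z) * B (snd z)))"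
      by (simp add: F_def algebra_simps)
  qed
  also have "\<dots> = - (\<integral>z. Uu z * (lp z * (A (fst z) * B (snd z))) \<partial>phase_lebesgue)"
    using z iAB iAB' ilp by simp
  finally have X1: "(\<integral>z. Uu z * (A (fst z) * F (snd z)) \<partial>phase_lebesgue) = - (\<integral>z. Uu z * (lp z * (A (fst z) * B (snd z))) \<partial>phase_lebesgue)" .
  have "\<bar>\<integral>z. Uu z * (lp z * (A (fst z) * B (snd z))) \<partial>phase_lebesgue\<bar> \<le> (\<integral>z. \<bar>Uu z * (lp z * (A (fst z) * B (snd z)))\<bar> \<partial>phase_lebesgue)"
    by (rule integral_abs_bound)
  also have "\<dots> \<le> (\<integral>z. CA * CB * (\<tau> / 2 * (Uu z * (lp z)\<^sup>2) + 1 / (2 * \<tau>) * Uu z) \<partial>phase_lebesgue)"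
  proof (rule integral_mono)
    show "integrable phase_lebesgue (\<lambda>z. \<bar>Uu z * (lp z * (A (fst z) * B (snd z)))\<bar>)" using ilp by (rule integrable_abs)
    show "integrable phase_lebesgue (\<lambda>z. CA * CB * (\<tau> / 2 * (Uu z * (lp z)\<^sup>2) + 1 / (2 * \<tau>) * Uu z))"
      by (intro integrable_mult_right Bochner_Integration.integrable_add entropy_identity iU)
    fix z
    have "0 \<le> (\<tau> * \<bar>lp z\<bar> - 1)\<^sup>2 / (2 * \<tau>)" using \<tau> by simp
    also have "\<dots> = \<tau> / 2 * (lp z)\<^sup>2 + 1 / (2 * \<tau>) - \<bar>lp z\<bar>" using \<tau> by (simp add: power2_eq_square field_simps)
    finally have lpz: "\<bar>lp z\<bar> \<le> \<tau> / 2 * (lp z)\<^sup>2 + 1 / (2 * \<tau>)" by simp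
    have "\<bar>Uu z * (lp z * (A (fst z) * B (snd z)))\<bar> = Uu z * (\<bar>lp z\<bar> * \<bar>A (fst z) * B (snd z)\<bar>)"
      using uu_pos[of z] by (simp add: abs_mult)
    also have "\<dots> \<le> Uu z * ((\<tau> / 2 * (lp z)\<^sup>2 + 1 / (2 * \<tau>)) * (CA * CB))"
      using uu_pos[of z] \<tau> by (intro mult_left_mono mult_mono lpz bAB) auto
    finally show "\<bar>Uu z * (lp z * (A (fst z) * B (snd z)))\<bar> \<le> CA * CB * (\<tau> / 2 * (Uu z * (lp z)\<^sup>2) + 1 / (2 * \<tau>) * Uu z)"
      by (simp add: algebra_simps)
  qed
  also have "\<dots> = CA * CB * (\<tau> / 2 * fisher + 1 / (2 * \<tau>))"
    using entropy_identity(2) iU by (simp add: fisher_def Uu1)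
  finally have X1_le: "\<bar>\<integral>z. Uu z * (A (fst z) * F (snd z)) \<partial>phase_lebesgue\<bar> \<le> CA * CB * (\<tau> / 2 * fisher + 1 / (2 * \<tau>))"
    unfolding X1 by simp
  define H1 where "H1 w z = A (fst w) * F (snd w)" for w z :: "torus \<times> real"
  define H2 where "H2 w z = 1 * (A (fst z) * F (snd z))" for w z :: "torus \<times> real"
  \<comment> \<open>A majorant of the difference of \<open>H1\<close> (evaluated at
    \<open>w\<close>) and \<open>H2\<close> (evaluated at \<open>z\<close>): Young's inequality with
    parameter \<tau> for the increments of \<open>F\<close> in the velocity and of \<open>A\<close>
    in the position, the latter entering through \<open>LA\<close>.\<close>
  define G where "G w z = (CA * CF + CF) / \<tau> + (CA * CF * \<tau> / 2 + 2 * CF / \<tau>) * (snd z - snd w)\<^sup>2 + (CF * \<tau> * LA / 2) * (1 - cos_2pi (fst z - fst w)) + (CA * CF + 2 * CF) / \<tau> * (snd w)\<^sup>2" for w z :: "torus \<times> real"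
  note Q = T_quad[where \<alpha>="(CA * CF + CF) / \<tau>" and \<delta>="CA * CF * \<tau> / 2 + 2 * CF / \<tau>" and \<epsilon>="CF * \<tau> * LA / 2" and \<kappa>="(CA * CF + 2 * CF) / \<tau>", folded G_def]
  have mH: "meas2 H1" "meas2 H2" unfolding H1_def H2_def split_beta' by measurable
  have AFb: "\<bar>A q * F p\<bar> \<le> CA * CF * (1 + \<bar>p\<bar>)" for q p unfolding abs_mult mult.assoc using nn by (intro mult_mono CA CF) auto
  have d1: "1 + \<bar>snd w\<bar> \<le> 3 * dom w z" "1 + \<bar>snd z\<bar> \<le> 3 * dom w z" for w z :: "torus \<times> real"
    using dom_bounds(4)[of z w] mult_left_mono[of 1 "1 + \<bar>snd w\<bar>" "1 + \<bar>snd z\<bar>"] mult_right_mono[of 1 "1 + \<bar>snd z\<bar>" "1 + \<bar>snd w\<bar>"] by auto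
  have bH: "\<bar>H1 w z\<bar> \<le> CA * CF * 3 * dom w z" "\<bar>H2 w z\<bar> \<le> CA * CF * 3 * dom w z" for w z
    unfolding H1_def H2_def mult_1 mult.assoc[of _ 3] using nn
    by (intro order_trans[OF AFb] mult_left_mono d1; simp)+
  have HG: "\<bar>H1 w z - H2 w z\<bar> \<le> G w z" for w z
  proof -
    define p y c where "p = snd z" and "y = snd w" and "c = 1 - cos_2pi (fst z - fst w)"
    have am: "r * s \<le> \<tau> / 2 * r\<^sup>2 + 1 / (2 * \<tau>) * s\<^sup>2" for r s :: real
    proof -
      have "0 \<le> (\<tau> * r - s)\<^sup>2 / (2 * \<tau>)" using \<tau> by simp
      also have "\<dots> = \<tau> / 2 * r\<^sup>2 + 1 / (2 * \<tau>) * s\<^sup>2 - r * s" using \<tau> by (simp add: power2_eq_square field_simps)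
      finally show ?thesis by simp
    qed
    have s1: "(1 + \<bar>r\<bar>)\<^sup>2 \<le> 2 + 2 * r\<^sup>2" for r :: real
      using zero_le_power2[of "\<bar>r\<bar> - 1"] by (simp add: power2_sum power2_diff)
    have s2: "p\<^sup>2 \<le> 2 * (p - y)\<^sup>2 + 2 * y\<^sup>2"
      using zero_le_power2[of "p - 2 * y"] by (simp add: power2_sum power2_diff algebra_simps)
    have t0: "0 \<le> 1 / (2 * \<tau>)" using \<tau> by simp
    have e1: "\<bar>p - y\<bar> * (1 + \<bar>y\<bar>) \<le> \<tau> / 2 * (p - y)\<^sup>2 + 1 / (2 * \<tau>) * (2 + 2 * y\<^sup>2)"
      using am[of "\<bar>p - y\<bar>" "1 + \<bar>y\<bar>"] mult_left_mono[OF s1[of y] t0] by simp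
    have e2: "\<bar>A (fst z) - A (fst w)\<bar> * (1 + \<bar>p\<bar>) \<le> \<tau> / 2 * (LA * c) + 1 / (2 * \<tau>) * (2 + 2 * (2 * (p - y)\<^sup>2 + 2 * y\<^sup>2))"
    proof -
      have "\<tau> / 2 * \<bar>A (fst z) - A (fst w)\<bar>\<^sup>2 \<le> \<tau> / 2 * (LA * c)" using LA[of "fst z" "fst w"] \<tau> by (intro mult_left_mono) (auto simp: c_def)
      moreover have "1 / (2 * \<tau>) * (1 + \<bar>p\<bar>)\<^sup>2 \<le> 1 / (2 * \<tau>) * (2 + 2 * (2 * (p - y)\<^sup>2 + 2 * y\<^sup>2))"
      proof (rule mult_left_mono[OF _ t0])
        have "2 + 2 * p\<^sup>2 \<le> 2 + 2 * (2 * (p - y)\<^sup>2 + 2 * y\<^sup>2)" by (intro add_left_mono mult_left_mono s2) simp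
        then show "(1 + \<bar>p\<bar>)\<^sup>2 \<le> 2 + 2 * (2 * (p - y)\<^sup>2 + 2 * y\<^sup>2)" by (rule order_trans[OF s1])
      qed
      ultimately show ?thesis using am[of "\<bar>A (fst z) - A (fst w)\<bar>" "1 + \<bar>p\<bar>"] by linarith
    qed
    have "H1 w z - H2 w z = A (fst w) * (F y - F p) + (A (fst w) - A (fst z)) * F p"
      by (simp add: H1_def H2_def p_def y_def algebra_simps)
    also have "\<bar>\<dots>\<bar> \<le> CA * (CF * (1 + \<bar>y\<bar>) * \<bar>p - y\<bar>) + \<bar>A (fst z) - A (fst w)\<bar> * (CF * (1 + \<bar>p\<bar>))"
    proof (intro order_trans[OF abs_triangle_ineq] add_mono)
      show "\<bar>A (fst w) * (F y - F p)\<bar> \<le> CA * (CF * (1 + \<bar>y\<bar>) * \<bar>p - y\<bar>)"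
        unfolding abs_mult using nn LF[of p y] by (intro mult_mono CA) (auto simp: abs_minus_commute)
      show "\<bar>(A (fst w) - A (fst z)) * F p\<bar> \<le> \<bar>A (fst z) - A (fst w)\<bar> * (CF * (1 + \<bar>p\<bar>))"
        unfolding abs_mult abs_minus_commute[of "A (fst w)"] by (intro mult_left_mono CF) auto
    qed
    also have "\<dots> = CA * CF * (\<bar>p - y\<bar> * (1 + \<bar>y\<bar>)) + CF * (\<bar>A (fst z) - A (fst w)\<bar> * (1 + \<bar>p\<bar>))" by (simp add: mult_ac)
    also have "\<dots> \<le> CA * CF * (\<tau> / 2 * (p - y)\<^sup>2 + 1 / (2 * \<tau>) * (2 + 2 * y\<^sup>2)) + CF * (\<tau> / 2 * (LA * c) + 1 / (2 * \<tau>) * (2 + 2 * (2 * (p - y)\<^sup>2 + 2 * y\<^sup>2)))"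
      using nn by (intro add_mono mult_left_mono e1 e2) auto
    also have "\<dots> = G w z"
      unfolding G_def p_def[symmetric] y_def[symmetric] c_def[symmetric] using \<tau> by (simp add: field_simps)
    finally show ?thesis .
  qed
  have G1: "(\<integral>z. T a e H1 z \<partial>phase_lebesgue) \<le> (\<integral>z. T a e H2 z \<partial>phase_lebesgue) + (\<integral>z. T a e G z \<partial>phase_lebesgue)"
    and G2: "(\<integral>z. T a e H2 z \<partial>phase_lebesgue) \<le> (\<integral>z. T a e H1 z \<partial>phase_lebesgue) + (\<integral>z. T a e G z \<partial>phase_lebesgue)"
  proof -
    have le: "H1 w z \<le> H2 w z + G w z" "H2 w z \<le> H1 w z + G w z" for w z
      using HG[of w z] unfolding abs_le_iff by linarith+
    have m: "meas2 (\<lambda>w z. H2 w z + G w z)" "meas2 (\<lambda>w z. H1 w z + G w z)"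
      unfolding H1_def H2_def G_def split_beta' by measurable
    define K where "K = CA * CF * 3 + (\<bar>(CA * CF + CF) / \<tau>\<bar> + \<bar>CA * CF * \<tau> / 2 + 2 * CF / \<tau>\<bar> + 2 * \<bar>CF * \<tau> * LA / 2\<bar> + \<bar>(CA * CF + 2 * CF) / \<tau>\<bar>)"
    have b: "\<bar>H2 w z + G w z\<bar> \<le> K * dom w z" "\<bar>H1 w z + G w z\<bar> \<le> K * dom w z" for w z
      unfolding K_def distrib_right[of "CA * CF * 3"] by (rule order_trans[OF abs_triangle_ineq add_mono[OF bH(2) Q(4)]]) (rule order_trans[OF abs_triangle_ineq add_mono[OF bH(1) Q(4)]])
    show "(\<integral>z. T a e H1 z \<partial>phase_lebesgue) \<le> (\<integral>z. T a e H2 z \<partial>phase_lebesgue) + (\<integral>z. T a e G z \<partial>phase_lebesgue)"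
      using T_int_mono[OF mH(1) bH(1) m(1) b(1) le(1)] T_int_add[OF mH(2) bH(2) Q(3) Q(4)] by simp
    show "(\<integral>z. T a e H2 z \<partial>phase_lebesgue) \<le> (\<integral>z. T a e H1 z \<partial>phase_lebesgue) + (\<integral>z. T a e G z \<partial>phase_lebesgue)"
      using T_int_mono[OF mH(2) bH(2) m(2) b(2) le(2)] T_int_add[OF mH(1) bH(1) Q(3) Q(4)] by simp
  qed
  have f0: "(\<integral>z. ker a e w z \<partial>phase_lebesgue) = 1" for w
    using ker_fibre[OF e continuous_on_const[of UNIV 1], of "\<lambda>t. 1" a w] zeta_integrals[OF e] eta_integral[of a "fst w"] by simp
  have 1: "(\<integral>z. T a e H1 z \<partial>phase_lebesgue) = (\<integral>w. A (fst w) * F (snd w) \<partial>M)"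
    unfolding T_integrable(2)[OF e mH(1) bH(1)] H1_def by (simp add: f0)
  have 2: "(\<integral>z. T a e H2 z \<partial>phase_lebesgue) = (\<integral>z. Uu z * (A (fst z) * F (snd z)) \<partial>phase_lebesgue)"
    unfolding H2_def[abs_def] T_mult uu_def[OF e] ..
  have 3: "(\<integral>z. T a e G z \<partial>phase_lebesgue) = (CA * CF + CF) / \<tau> + (CA * CF * \<tau> / 2 + 2 * CF / \<tau>) * e\<^sup>2 + (CF * \<tau> * LA / 2) * (1 - R a) + (CA * CF + 2 * CF) / \<tau> * m2"
    by (rule Q(1))
  show ?thesis using G1 G2 X1_le unfolding 1 2 3 by linarith
qed

end

end

section \<open>Removing the mollification\<close>

lemma R_LIMSEQ: "(\<lambda>n. R (real n)) \<longlonglongrightarrow> 1"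
proof (rule order_tendstoI)
  fix y :: real assume "y < 1"
  then obtain b where b: "b > 0" "\<And>c. c \<ge> b \<Longrightarrow> R c > y" using R_tendsto_1 by blast
  obtain N where "real N \<ge> b" using real_arch_simple by blast
  then show "\<forall>\<^sub>F n in sequentially. R (real n) > y"
    using b by (intro eventually_sequentiallyI[of N]) (meson of_nat_mono order_trans)
next
  fix y :: real assume "1 < y"
  then show "\<forall>\<^sub>F n in sequentially. R (real n) < y"
    by (intro always_eventually allI) (meson R_less_1 less_trans)
qed

text \<open>Indicators of open sets are limits of truncated multiples of the distance to the
  complement. Lipschitz test functions are the natural class here, since
  \<open>lipschitz_chord\<close> makes them admissible in the Stein identity.\<close>

lemma measure_eqI_lipschitz:
  fixes \<mu>1 \<mu>2 :: "'a :: metric_space measure"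
  assumes f: "finite_measure \<mu>1" "finite_measure \<mu>2" and s: "sets \<mu>1 = sets borel" "sets \<mu>2 = sets borel"
    and eq: "\<And>f L. (\<And>x. 0 \<le> f x) \<Longrightarrow> (\<And>x. f x \<le> 1) \<Longrightarrow> (\<And>x y. \<bar>f x - f y\<bar> \<le> L * dist x y) \<Longrightarrow>
       (\<integral>x. f x \<partial>\<mu>1) = (\<integral>x. f x \<partial>\<mu>2 :: real)"
  shows "\<mu>1 = \<mu>2"
proof -
  interpret m1: finite_measure \<mu>1 by fact
  interpret m2: finite_measure \<mu>2 by fact
  have meas: "measure \<mu>1 U = measure \<mu>2 U" if U: "open U" for U
  proof -
    \<comment> \<open>The distance to the empty set is 0 by convention, so the whole space gets its
      value separately.\<close>
    define f where "f n x = (if U = UNIV then 1 else min 1 (real n * infdist x (- U)))" for n x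
    have f01: "0 \<le> f n x" "f n x \<le> 1" for n x by (auto simp: f_def infdist_nonneg)
    have lip: "\<bar>f n x - f n y\<bar> \<le> real n * dist x y" for n x y
    proof (cases "U = UNIV")
      case False
      have "\<bar>f n x - f n y\<bar> \<le> \<bar>real n * infdist x (- U) - real n * infdist y (- U)\<bar>"
        using False by (auto simp: f_def min_def)
      also have "\<dots> = real n * \<bar>infdist x (- U) - infdist y (- U)\<bar>"
        by (simp add: right_diff_distrib[symmetric] abs_mult)
      also have "\<dots> \<le> real n * dist x y" by (intro mult_left_mono infdist_triangle_abs) simp
      finally show ?thesis .
    qed (simp add: f_def)
    have c: "continuous_on UNIV (f n)" for n
      unfolding f_def by (cases "U = UNIV") (auto intro!: continuous_intros)
    have fm: "f n \<in> borel_measurable borel" for n using c by (rule borel_measurable_continuous_onI)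
    have lim: "(\<lambda>n. f n x) \<longlonglongrightarrow> indicator U x" for x
    proof (cases "x \<in> U \<and> U \<noteq> UNIV")
      case True
      then have d: "infdist x (- U) > 0" using U by (intro infdist_pos_not_in_closed) (auto simp: closed_Compl)
      then obtain N where N: "real N * infdist x (- U) > 1" using ex_less_of_nat_mult by blast
      have "\<forall>\<^sub>F n in sequentially. f n x = indicator U x"
      proof (rule eventually_sequentiallyI[of N])
        fix n assume "n \<ge> N"
        then have "real N * infdist x (- U) \<le> real n * infdist x (- U)" using d by (intro mult_right_mono) auto
        then show "f n x = indicator U x" using N True by (simp add: f_def)
      qed
      then show ?thesis by (rule tendsto_eventually)
    next
      case False
      then have "f n x = indicator U x" for n by (auto simp: f_def indicator_def)
      then show ?thesis by simp
    qed
    have l: "(\<lambda>n. \<integral>x. f n x \<partial>\<mu>) \<longlonglongrightarrow> measure \<mu> U" if "finite_measure \<mu>" "sets \<mu> = sets borel" for \<mu>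
    proof -
      interpret finite_measure \<mu> by fact
      have m: "g \<in> borel_measurable \<mu> \<longleftrightarrow> g \<in> borel_measurable borel" for g :: "'a \<Rightarrow> real"
        by (simp add: measurable_cong_sets[OF that(2)])
      have "(\<lambda>n. \<integral>x. f n x \<partial>\<mu>) \<longlonglongrightarrow> (\<integral>x. indicator U x \<partial>\<mu>)"
        by (rule integral_dominated_convergence[where w="\<lambda>_. 1"]) (use f01 fm lim U in \<open>auto simp: m\<close>)
      also have "(\<integral>x. indicator U x \<partial>\<mu>) = measure \<mu> U" using U that(2) sets_eq_imp_space_eq[OF that(2)] by simp
      finally show ?thesis .
    qed
    have "(\<integral>x. f n x \<partial>\<mu>1) = (\<integral>x. f n x \<partial>\<mu>2)" for n by (rule eq[OF f01 lip])
    then show ?thesis using l[OF f(1) s(1)] l[OF f(2) s(2)] LIMSEQ_unique by simp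
  qed
  show ?thesis
  proof (rule measure_eqI_generator_eq[where E="{S. open S}" and \<Omega>=UNIV and A="\<lambda>_. UNIV"])
    show "sets \<mu>1 = sigma_sets UNIV {S. open S}" "sets \<mu>2 = sigma_sets UNIV {S. open S}"
      using s by (simp_all add: borel_def)
    show "emeasure \<mu>1 X = emeasure \<mu>2 X" if "X \<in> {S. open S}" for X
      using meas that by (simp add: m1.emeasure_eq_measure m2.emeasure_eq_measure)
  qed (auto simp: Int_stable_def)
qed

lemma torus_elem_shift: "f \<in> torus_elem \<Longrightarrow> (\<lambda>q. f (q + h)) \<in> torus_elem"
proof (induction rule: torus_elem.induct)
  case cos
  have "(\<lambda>q. cos_2pi h * cos_2pi q + (- sin_2pi h) * sin_2pi q) \<in> torus_elem" by (intro torus_elem.intros)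
  then show ?case by (simp add: cos_2pi_add mult.commute)
next
  case sin
  have "(\<lambda>q. cos_2pi h * sin_2pi q + sin_2pi h * cos_2pi q) \<in> torus_elem" by (intro torus_elem.intros)
  then show ?case by (simp add: sin_2pi_add mult.commute)
qed (auto intro: torus_elem.intros)

text \<open>Sine and cosine separate points (\<open>torus_eqI\<close>), so Stone-Weierstrass applies
  to \<open>torus_elem\<close>.\<close>

interpretation torus_ring: function_ring_on torus_elem UNIV
proof
  show "compact (UNIV :: torus set)" by (rule compact_torus)
  show "\<exists>f\<in>torus_elem. f x \<noteq> f y" if "x \<noteq> y" for x y
    using torus_eqI that torus_elem.cos torus_elem.sin by blast
qed (auto intro: torus_elem_continuous torus_elem.intros)

lemma abs_sin_diff_le: "\<bar>sin x - sin y\<bar> \<le> \<bar>x - y :: real\<bar>" and abs_cos_diff_le: "\<bar>cos x - cos y\<bar> \<le> \<bar>x - y\<bar>"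
  using field_differentiable_bound[of UNIV sin cos 1 x y] field_differentiable_bound[of UNIV cos "\<lambda>x. - sin x" 1 x y]
  by (auto intro: DERIV_sin DERIV_cos)

context kinetic
begin

interpretation M: prob_space M using pp by (simp add: phase_prob_def)

text \<open>The order of the limits matters. First \<open>e\<close> tends to 0 at fixed
  \<open>a\<close>, so that \<open>Ca * e\<close> vanishes although \<open>Ca\<close> grows with
  \<open>a\<close>; then \<open>a\<close> tends to infinity, removing every multiple of
  \<open>1 - R a\<close>; what is left is \<open>K / \<tau>\<close>, and \<tau> tends to infinity
  last.\<close>

lemma stein_zero:
  fixes A :: "torus \<Rightarrow> real" and B B' F :: "real \<Rightarrow> real"
  assumes m: "A \<in> borel_measurable borel" "B' \<in> borel_measurable borel"
    and CA: "\<And>q. \<bar>A q\<bar> \<le> CA" and LA: "\<And>q x. (A q - A x)\<^sup>2 \<le> LA * (1 - cos_2pi (q - x))"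
    and B': "\<And>p. (B has_real_derivative B' p) (at p)" and CB: "\<And>p. \<bar>B p\<bar> \<le> CB"
    and F_def: "\<And>p. F p = B' p - \<beta> * p * B p"
    and CF: "\<And>p. \<bar>F p\<bar> \<le> CF * (1 + \<bar>p\<bar>)" and LF: "\<And>p y. \<bar>F p - F y\<bar> \<le> CF * (1 + \<bar>y\<bar>) * \<bar>p - y\<bar>"
  shows "(\<integral>w. A (fst w) * F (snd w) \<partial>M) = 0"
proof -
  define X where "X = \<bar>\<integral>w. A (fst w) * F (snd w) \<partial>M\<bar>"
  define S where "S = s1\<^sup>2 + s2\<^sup>2"
  have nn: "CA \<ge> 0" "CB \<ge> 0" "CF \<ge> 0" using CA[of 0] CB[of 0] CF[of 0] by auto
  define b where "b a e \<tau> = CA * CB * (\<tau> / 2 * (2 * \<beta> / \<gamma> * ((2 * pi * \<bar>a\<bar> + \<beta> * CD) * e + \<beta> * \<gamma> * e\<^sup>2 + 4 * \<beta> * S / \<gamma> * (1 - R a))) + 1 / (2 * \<tau>))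
    + ((CA * CF + CF) / \<tau> + (CA * CF * \<tau> / 2 + 2 * CF / \<tau>) * e\<^sup>2 + (CF * \<tau> * LA / 2) * (1 - R a) + (CA * CF + 2 * CF) / \<tau> * m2)" for a e \<tau>
  have le: "X \<le> b a e \<tau>" if "e > 0" "\<tau> > 0" for a e \<tau>
  proof -
    have "fisher a e \<le> 2 * \<beta> / \<gamma> * (Ca a * e + \<beta> * \<gamma> * e\<^sup>2 + 4 * \<beta> * S / \<gamma> * (1 - R a))"
    proof -
      have "2 * \<beta> / \<gamma> * (\<gamma> / (2 * \<beta>) * fisher a e) \<le> 2 * \<beta> / \<gamma> * (Ca a * e + \<beta> * \<gamma> * e\<^sup>2 + 4 * \<beta> * S / \<gamma> * (1 - R a))"
        using fisher_le[OF that(1), of a] \<beta> \<gamma> by (intro mult_left_mono) (auto simp: S_def)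
      then show ?thesis using \<beta> \<gamma> by simp
    qed
    then have "CA * CB * (\<tau> / 2 * fisher a e + 1 / (2 * \<tau>))
       \<le> CA * CB * (\<tau> / 2 * (2 * \<beta> / \<gamma> * (Ca a * e + \<beta> * \<gamma> * e\<^sup>2 + 4 * \<beta> * S / \<gamma> * (1 - R a))) + 1 / (2 * \<tau>))"
      using nn that by (intro mult_left_mono add_right_mono) auto
    then show ?thesis using stein_le[OF that(1) m CA LA B' CB F_def CF LF that(2), of a]
      unfolding X_def b_def Ca_def[OF that(1)] by linarith
  qed
  have b0: "X \<le> b a 0 \<tau>" if "\<tau> > 0" for a \<tau>
  proof (rule tendsto_lowerbound)
    have e0: "((\<lambda>e. e) \<longlongrightarrow> (0 :: real)) (at_right 0)" by (rule tendsto_ident_at)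
    show "((\<lambda>e. b a e \<tau>) \<longlongrightarrow> b a 0 \<tau>) (at_right 0)"
      unfolding b_def by (intro tendsto_intros e0)
    show "\<forall>\<^sub>F e in at_right 0. X \<le> b a e \<tau>"
      using eventually_at_right_less[of 0] by eventually_elim (rule le[OF _ that])
  qed simp
  define K where "K = CA * CB / 2 + (CA * CF + CF) + (CA * CF + 2 * CF) * m2"
  have b1: "X \<le> K / \<tau>" if "\<tau> > 0" for \<tau>
  proof (rule tendsto_lowerbound)
    have "(\<lambda>n. b (real n) 0 \<tau>) \<longlonglongrightarrow> CA * CB * (\<tau> / 2 * (2 * \<beta> / \<gamma> * (4 * \<beta> * S / \<gamma> * (1 - 1))) + 1 / (2 * \<tau>))
    + ((CA * CF + CF) / \<tau> + (CF * \<tau> * LA / 2) * (1 - 1) + (CA * CF + 2 * CF) / \<tau> * m2)"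
      unfolding b_def by (simp only: mult_zero_right power_zero_numeral add_0_left add_0_right) (intro tendsto_intros R_LIMSEQ)
    also have "CA * CB * (\<tau> / 2 * (2 * \<beta> / \<gamma> * (4 * \<beta> * S / \<gamma> * (1 - 1))) + 1 / (2 * \<tau>))
    + ((CA * CF + CF) / \<tau> + (CF * \<tau> * LA / 2) * (1 - 1) + (CA * CF + 2 * CF) / \<tau> * m2) = K / \<tau>"
      using that by (simp add: K_def field_simps)
    finally show "(\<lambda>n. b (real n) 0 \<tau>) \<longlonglongrightarrow> K / \<tau>" .
    show "\<forall>\<^sub>F n in sequentially. X \<le> b (real n) 0 \<tau>" using b0[OF that] by simp
  qed simp
  have "X \<le> 0"
  proof (rule tendsto_lowerbound)
    show "(\<lambda>n. K / real (Suc n)) \<longlonglongrightarrow> 0"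
      by (intro real_tendsto_divide_at_top[OF tendsto_const] filterlim_compose[OF filterlim_real_sequentially filterlim_Suc])
    show "\<forall>\<^sub>F n in sequentially. X \<le> K / real (Suc n)" using b1 by (intro always_eventually allI) simp
  qed simp
  then show ?thesis by (simp add: X_def)
qed

end

text \<open>The addition formulas express the generators at a sum through products in the two
  variables; measurability then propagates along the induction.\<close>

lemma torus_elem_add_measurable:
  "f \<in> torus_elem \<Longrightarrow> (\<lambda>z. f (fst z + snd z)) \<in> borel_measurable (borel \<Otimes>\<^sub>M borel)"
  by (induction rule: torus_elem.induct) (auto simp: cos_2pi_add sin_2pi_add)

lemma lipschitz_chord:
  assumes "\<And>x y. \<bar>f x - f y\<bar> \<le> L * dist x y"
  shows "(f q - f x)\<^sup>2 \<le> L\<^sup>2 * (1 - cos_2pi (q - x))"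
proof -
  have "\<bar>f q - f x\<bar>\<^sup>2 \<le> (L * dist q x)\<^sup>2" by (intro power_mono assms) auto
  also have "\<dots> \<le> L\<^sup>2 * (1 - cos_2pi (q - x))"
    unfolding power_mult_distrib by (intro mult_left_mono dist_torus_le_chord) auto
  finally show ?thesis by simp
qed

definition maxwell :: "real \<Rightarrow> real measure" where "maxwell \<beta> = density lborel (\<lambda>p. ennreal (kappa \<beta> p))"

lemma prob_space_maxwell: "\<beta> > 0 \<Longrightarrow> prob_space (maxwell \<beta>)"
  unfolding maxwell_def kappa_normal by (rule prob_space_normal_density) simp

lemma sets_maxwell [simp, measurable_cong]: "sets (maxwell \<beta>) = sets borel"
  and space_maxwell [simp]: "space (maxwell \<beta>) = UNIV"
  by (simp_all add: maxwell_def)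

lemma maxwell_eq_distr:
  assumes \<beta>: "\<beta> > 0"
  shows "maxwell \<beta> = distr std_normal_distribution borel (\<lambda>x. x / sqrt \<beta>)"
proof -
  interpret prob_space std_normal_distribution by (rule prob_space_normal_density) simp
  have "distributed std_normal_distribution lborel (\<lambda>x. x) (\<lambda>x. ennreal (normal_density 0 1 x))"
    unfolding distributed_def by (auto simp: distr_id2)
  from normal_density_affine[OF this, of "1 / sqrt \<beta>" 0] \<beta>
  have "distr std_normal_distribution lborel (\<lambda>x. x / sqrt \<beta>) = density lborel (\<lambda>x. ennreal (normal_density 0 (1 / sqrt \<beta>) x))"
    unfolding distributed_def by simp
  then show ?thesis unfolding maxwell_def kappa_normal[OF \<beta>] by (metis distr_cong sets_lborel)
qed

section \<open>The velocity is Maxwellian and independent of the position\<close>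

context kinetic
begin

interpretation M: prob_space M using pp by (simp add: phase_prob_def)

context
  fixes A :: "torus \<Rightarrow> real" and CA LA :: real
  assumes mA [measurable]: "A \<in> borel_measurable borel" and CA: "\<And>q. \<bar>A q\<bar> \<le> CA"
    and LA: "\<And>q x. (A q - A x)\<^sup>2 \<le> LA * (1 - cos_2pi (q - x))"
begin

lemma trig_integrable:
  "integrable M (\<lambda>w. A (fst w) * cos (s * snd w))" "integrable M (\<lambda>w. A (fst w) * sin (s * snd w))"
  "integrable M (\<lambda>w. A (fst w) * (snd w * cos (s * snd w)))" "integrable M (\<lambda>w. A (fst w) * (snd w * sin (s * snd w)))"
proof -
  have CA0: "CA \<ge> 0" using CA[of 0] by simp
  have 1: "\<bar>A x * t\<bar> \<le> CA" if "\<bar>t\<bar> \<le> 1" for x t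
    using mult_mono[OF CA[of x] that] CA0 by (simp add: abs_mult)
  show "integrable M (\<lambda>w. A (fst w) * cos (s * snd w))" "integrable M (\<lambda>w. A (fst w) * sin (s * snd w))"
    by (rule integrable_M_bounded[where C=CA]; auto intro: 1)+
  have 2: "\<bar>A x * (y * t)\<bar> \<le> CA * (1 + y\<^sup>2)" if "\<bar>t\<bar> \<le> 1" for x y t
  proof -
    have "\<bar>A x * (y * t)\<bar> = \<bar>A x\<bar> * (\<bar>y\<bar> * \<bar>t\<bar>)" by (simp add: abs_mult)
    also have "\<dots> \<le> CA * ((1 + y\<^sup>2) * 1)" using that CA0 by (intro mult_mono CA abs_le_1_plus_square) auto
    finally show ?thesis by simp
  qed
  show "integrable M (\<lambda>w. A (fst w) * (snd w * cos (s * snd w)))" "integrable M (\<lambda>w. A (fst w) * (snd w * sin (s * snd w)))"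
    by (rule integrable_M_quadratic[where C=CA]; auto intro: 2)+
qed

text \<open>The Stein identity with B = sin (s p) and B = cos (s p) says that both integrals satisfy
  the equation f' = - (s / \<beta>) f in s, whose solutions are multiples of a Gaussian.\<close>

lemma trig_moments:
  "(\<integral>w. A (fst w) * cos (s * snd w) \<partial>M) = (\<integral>w. A (fst w) \<partial>M) * exp (- s\<^sup>2 / (2 * \<beta>))"
  "(\<integral>w. A (fst w) * sin (s * snd w) \<partial>M) = 0"
proof -
  have CA0: "CA \<ge> 0" using CA[of 0] by simp
  define c sn where "c s = (\<integral>w. A (fst w) * cos (s * snd w) \<partial>M)" and "sn s = (\<integral>w. A (fst w) * sin (s * snd w) \<partial>M)" for s
  define yc ys where "yc s = (\<integral>w. A (fst w) * (snd w * cos (s * snd w)) \<partial>M)" and "ys s = (\<integral>w. A (fst w) * (snd w * sin (s * snd w)) \<partial>M)" for s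
  have iw: "integrable M (\<lambda>w. CA * (1 + (snd w)\<^sup>2))"
    using moment2 by (intro integrable_mult_right Bochner_Integration.integrable_add) (auto simp: split_beta')
  have yb: "\<bar>A (fst w) * (snd w * t)\<bar> \<le> CA * (1 + (snd w)\<^sup>2)" if "\<bar>t\<bar> \<le> 1" for w t
  proof -
    have "\<bar>A (fst w) * (snd w * t)\<bar> = \<bar>A (fst w)\<bar> * (\<bar>snd w\<bar> * \<bar>t\<bar>)" by (simp add: abs_mult)
    also have "\<dots> \<le> CA * ((1 + (snd w)\<^sup>2) * 1)" using that CA0 by (intro mult_mono CA abs_le_1_plus_square) auto
    finally show ?thesis by simp
  qed
  have dc: "(c has_real_derivative - ys s) (at s)" for s
  proof -
    have "((\<lambda>s. \<integral>w. A (fst w) * cos (s * snd w) \<partial>M) has_real_derivative (\<integral>w. A (fst w) * (snd w * (- sin (s * snd w))) \<partial>M)) (at s)"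
    proof (rule has_real_derivative_integral[OF _ _ iw])
      show "((\<lambda>x. A (fst y) * cos (x * snd y)) has_real_derivative A (fst y) * (snd y * - sin (x * snd y))) (at x)" for x y
        by (auto intro!: derivative_eq_intros)
      show "\<bar>A (fst y) * (snd y * - sin (x * snd y))\<bar> \<le> CA * (1 + (snd y)\<^sup>2)" for x y by (rule yb) simp
    qed (auto intro: trig_integrable)
    then show ?thesis by (simp add: c_def[abs_def] ys_def)
  qed
  have ds: "(sn has_real_derivative yc s) (at s)" for s
    unfolding sn_def[abs_def] yc_def
  proof (rule has_real_derivative_integral[OF _ _ iw])
    show "((\<lambda>x. A (fst y) * sin (x * snd y)) has_real_derivative A (fst y) * (snd y * cos (x * snd y))) (at x)" for x y
      by (auto intro!: derivative_eq_intros)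
    show "\<bar>A (fst y) * (snd y * cos (x * snd y))\<bar> \<le> CA * (1 + (snd y)\<^sup>2)" for x y by (rule yb) simp
  qed (auto intro: trig_integrable)
  \<comment> \<open>Growth here and Lipschitz bound in \<open>gl\<close>, with one constant serving
    as \<open>CF\<close>; the sign \<sigma> covers both choices of \<open>B\<close>.\<close>
  have gb: "\<bar>\<sigma> * s * t1 - \<beta> * p * t2\<bar> \<le> (s\<^sup>2 + \<bar>s\<bar> + \<beta> + \<beta> * \<bar>s\<bar>) * (1 + \<bar>p\<bar>)" if "\<bar>t1\<bar> \<le> 1" "\<bar>t2\<bar> \<le> 1" "\<bar>\<sigma>\<bar> = 1" for s t1 t2 p \<sigma> :: real
  proof -
    have "\<bar>\<sigma> * s * t1 - \<beta> * p * t2\<bar> \<le> \<bar>\<sigma> * s * t1\<bar> + \<bar>\<beta> * p * t2\<bar>" by (rule abs_triangle_ineq4)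
    also have "\<dots> \<le> \<bar>s\<bar> * 1 + \<beta> * \<bar>p\<bar> * 1"
      unfolding abs_mult that(3) using that \<beta> by (intro add_mono mult_mono) auto
    also have "\<dots> \<le> (s\<^sup>2 + \<bar>s\<bar> + \<beta> + \<beta> * \<bar>s\<bar>) * (1 + \<bar>p\<bar>)" using \<beta> by (simp add: algebra_simps)
    finally show ?thesis .
  qed
  have gl: "\<bar>(\<sigma> * s * f (s * p) - \<beta> * p * g (s * p)) - (\<sigma> * s * f (s * y) - \<beta> * y * g (s * y))\<bar> \<le> (s\<^sup>2 + \<bar>s\<bar> + \<beta> + \<beta> * \<bar>s\<bar>) * (1 + \<bar>y\<bar>) * \<bar>p - y\<bar>"
    if f: "\<And>x y. \<bar>f x - f y\<bar> \<le> \<bar>x - y\<bar>" and g: "\<And>x y. \<bar>g x - g y\<bar> \<le> \<bar>x - y\<bar>" and g1: "\<And>x. \<bar>g x\<bar> \<le> 1" and \<sigma>: "\<bar>\<sigma>\<bar> = 1"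
    for s p y \<sigma> :: real and f g :: "real \<Rightarrow> real"
  proof -
    have sp: "\<bar>s * p - s * y\<bar> = \<bar>s\<bar> * \<bar>p - y\<bar>" by (simp add: right_diff_distrib[symmetric] abs_mult)
    have "(\<sigma> * s * f (s * p) - \<beta> * p * g (s * p)) - (\<sigma> * s * f (s * y) - \<beta> * y * g (s * y))
       = \<sigma> * s * (f (s * p) - f (s * y)) - (\<beta> * (p - y) * g (s * p) + \<beta> * y * (g (s * p) - g (s * y)))" by (simp add: algebra_simps)
    also have "\<bar>\<dots>\<bar> \<le> \<bar>\<sigma> * s * (f (s * p) - f (s * y))\<bar> + (\<bar>\<beta> * (p - y) * g (s * p)\<bar> + \<bar>\<beta> * y * (g (s * p) - g (s * y))\<bar>)"
      by (intro order_trans[OF abs_triangle_ineq4] add_left_mono abs_triangle_ineq)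
    also have "\<dots> \<le> \<bar>s\<bar> * (\<bar>s\<bar> * \<bar>p - y\<bar>) + (\<beta> * \<bar>p - y\<bar> * 1 + \<beta> * \<bar>y\<bar> * (\<bar>s\<bar> * \<bar>p - y\<bar>))"
      unfolding abs_mult \<sigma> using \<beta> f[of "s * p" "s * y"] g[of "s * p" "s * y"] g1 unfolding sp
      by (intro add_mono mult_mono) auto
    also have "\<dots> = (s\<^sup>2 + \<beta> + \<beta> * \<bar>s\<bar> * \<bar>y\<bar>) * \<bar>p - y\<bar>" by (simp add: algebra_simps power2_eq_square)
    also have "\<dots> \<le> ((s\<^sup>2 + \<bar>s\<bar> + \<beta> + \<beta> * \<bar>s\<bar>) * (1 + \<bar>y\<bar>)) * \<bar>p - y\<bar>"
      using \<beta> by (intro mult_right_mono) (auto simp: algebra_simps)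
    finally show ?thesis by simp
  qed
  have s1: "s * c s - \<beta> * ys s = 0" for s
  proof -
    have "(\<integral>w. A (fst w) * (1 * s * cos (s * snd w) - \<beta> * snd w * sin (s * snd w)) \<partial>M) = 0"
    proof (rule stein_zero[OF mA _ CA LA, where B="\<lambda>p. sin (s * p)" and B'="\<lambda>p. 1 * s * cos (s * p)" and CB=1 and CF="s\<^sup>2 + \<bar>s\<bar> + \<beta> + \<beta> * \<bar>s\<bar>"
        and F="\<lambda>p. 1 * s * cos (s * p) - \<beta> * p * sin (s * p)"])
      show "((\<lambda>p. sin (s * p)) has_real_derivative 1 * s * cos (s * p)) (at p)" for p by (auto intro!: derivative_eq_intros)
      show "\<bar>1 * s * cos (s * p) - \<beta> * p * sin (s * p)\<bar> \<le> (s\<^sup>2 + \<bar>s\<bar> + \<beta> + \<beta> * \<bar>s\<bar>) * (1 + \<bar>p\<bar>)" for p by (rule gb) auto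
      show "\<bar>1 * s * cos (s * p) - \<beta> * p * sin (s * p) - (1 * s * cos (s * y) - \<beta> * y * sin (s * y))\<bar>
        \<le> (s\<^sup>2 + \<bar>s\<bar> + \<beta> + \<beta> * \<bar>s\<bar>) * (1 + \<bar>y\<bar>) * \<bar>p - y\<bar>" for p y
        by (rule gl) (auto simp: abs_cos_diff_le abs_sin_diff_le)
    qed auto
    then show ?thesis using trig_integrable(1)[of s] trig_integrable(4)[of s]
      by (simp add: c_def ys_def right_diff_distrib mult.left_commute[of _ \<beta>] mult.left_commute[of _ s] mult.assoc)
  qed
  have s2: "- s * sn s - \<beta> * yc s = 0" for s
  proof -
    have "(\<integral>w. A (fst w) * ((- 1) * s * sin (s * snd w) - \<beta> * snd w * cos (s * snd w)) \<partial>M) = 0"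
    proof (rule stein_zero[OF mA _ CA LA, where B="\<lambda>p. cos (s * p)" and B'="\<lambda>p. (- 1) * s * sin (s * p)" and CB=1 and CF="s\<^sup>2 + \<bar>s\<bar> + \<beta> + \<beta> * \<bar>s\<bar>"
        and F="\<lambda>p. (- 1) * s * sin (s * p) - \<beta> * p * cos (s * p)"])
      show "((\<lambda>p. cos (s * p)) has_real_derivative (- 1) * s * sin (s * p)) (at p)" for p by (auto intro!: derivative_eq_intros)
      show "\<bar>- 1 * s * sin (s * p) - \<beta> * p * cos (s * p)\<bar> \<le> (s\<^sup>2 + \<bar>s\<bar> + \<beta> + \<beta> * \<bar>s\<bar>) * (1 + \<bar>p\<bar>)" for p by (rule gb) auto
      show "\<bar>- 1 * s * sin (s * p) - \<beta> * p * cos (s * p) - (- 1 * s * sin (s * y) - \<beta> * y * cos (s * y))\<bar>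
        \<le> (s\<^sup>2 + \<bar>s\<bar> + \<beta> + \<beta> * \<bar>s\<bar>) * (1 + \<bar>y\<bar>) * \<bar>p - y\<bar>" for p y
        by (rule gl) (auto simp: abs_cos_diff_le abs_sin_diff_le)
    qed auto
    then show ?thesis using trig_integrable(2)[of s] trig_integrable(3)[of s]
      by (simp add: sn_def yc_def right_diff_distrib mult.left_commute[of _ \<beta>] mult.left_commute[of _ s] mult.assoc)
  qed
  \<comment> \<open>The integrating factor: \<open>c s * E s\<close> and \<open>sn s * E s\<close>
    have derivative 0.\<close>
  define E where "E s = exp (s\<^sup>2 / (2 * \<beta>))" for s :: real
  have dE: "(E has_real_derivative s / \<beta> * E s) (at s)" for s
    unfolding E_def[abs_def] using \<beta> by (auto intro!: derivative_eq_intros)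
  have "((\<lambda>s. c s * E s) has_real_derivative 0) (at s)" for s
  proof -
    have "ys s = s / \<beta> * c s" using s1[of s] \<beta> by (simp add: field_simps)
    then have "c s * (s / \<beta> * E s) + - ys s * E s = 0" by simp
    then show ?thesis using DERIV_mult'[OF dc[of s] dE[of s]] by simp
  qed
  then have "c s * E s = c 0 * E 0" by (intro DERIV_isconst_all) simp
  then have "c s = c 0 * exp (- s\<^sup>2 / (2 * \<beta>))" by (simp add: E_def exp_minus field_simps)
  then show "(\<integral>w. A (fst w) * cos (s * snd w) \<partial>M) = (\<integral>w. A (fst w) \<partial>M) * exp (- s\<^sup>2 / (2 * \<beta>))" by (simp add: c_def)
  have "((\<lambda>s. sn s * E s) has_real_derivative 0) (at s)" for s
  proof -
    have "yc s = - (s / \<beta> * sn s)" using s2[of s] \<beta> by (simp add: field_simps)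
    then have "sn s * (s / \<beta> * E s) + yc s * E s = 0" by simp
    then show ?thesis using DERIV_mult'[OF ds[of s] dE[of s]] by simp
  qed
  then have "sn s * E s = sn 0 * E 0" by (intro DERIV_isconst_all) simp
  then show "(\<integral>w. A (fst w) * sin (s * snd w) \<partial>M) = 0" by (simp add: sn_def E_def)
qed

text \<open>Weight the measure by \<open>A\<close> and normalise. By \<open>trig_moments\<close> the
  rescaled velocity then has the characteristic function of the standard normal law, and Levy's
  uniqueness theorem applies. If the total weight is 0, both sides vanish.\<close>

lemma gaussian_velocity:
  assumes A0: "\<And>q. 0 \<le> A q" and S: "S \<in> sets borel"
  shows "(\<integral>w. A (fst w) * indicator S (snd w) \<partial>M) = (\<integral>w. A (fst w) \<partial>M) * measure (maxwell \<beta>) S"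
proof -
  define c0 where "c0 = (\<integral>w. A (fst w) \<partial>M)"
  have iA: "integrable M (\<lambda>w. A (fst w))" using trig_integrable(1)[of 0] by simp
  have iAS: "integrable M (\<lambda>w. A (fst w) * indicator S (snd w))"
    using iA by (rule Bochner_Integration.integrable_bound) (use S in \<open>auto simp: indicator_def\<close>)
  show ?thesis
  proof (cases "c0 = 0")
    case True
    have "(\<integral>w. A (fst w) * indicator S (snd w) \<partial>M) \<le> (\<integral>w. A (fst w) \<partial>M)"
      by (intro integral_mono iA iAS) (use A0 in \<open>auto simp: indicator_def\<close>)
    moreover have "0 \<le> (\<integral>w. A (fst w) * indicator S (snd w) \<partial>M)"
      by (intro Bochner_Integration.integral_nonneg) (use A0 in auto)
    ultimately show ?thesis using True by (simp add: c0_def)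
  next
    case False
    moreover have "0 \<le> c0" unfolding c0_def by (intro Bochner_Integration.integral_nonneg) (use A0 in auto)
    ultimately have c0: "c0 > 0" by simp
    define P where "P = density M (\<lambda>w. ennreal (A (fst w) / c0))"
    have ip: "(\<integral>w. f w \<partial>P) = (\<integral>w. A (fst w) * f w \<partial>M) / c0" if [measurable]: "f \<in> borel_measurable BB" for f :: "torus \<times> real \<Rightarrow> real"
      unfolding P_def using A0 c0 by (subst integral_real_density) auto
    have "emeasure P (space P) = (\<integral>\<^sup>+w. ennreal (A (fst w) / c0) \<partial>M)"
      unfolding P_def using sets.top[of M] by (subst emeasure_density) (auto intro!: nn_integral_cong)
    also have "\<dots> = ennreal (\<integral>w. A (fst w) / c0 \<partial>M)" using iA A0 c0 by (intro nn_integral_eq_integral) auto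
    also have "\<dots> = 1" using c0 by (simp add: c0_def)
    finally interpret P: prob_space P by (intro prob_spaceI)
    have sP [measurable_cong]: "sets P = sets BB" by (simp add: P_def)
    define N1 where "N1 = distr P borel (\<lambda>w. sqrt \<beta> * snd w)"
    interpret N1: real_distribution N1
      unfolding N1_def by (intro P.real_distribution_distr) measurable
    have "char N1 t = char std_normal_distribution t" for t
    proof -
      have m: "(\<lambda>w. iexp (t * (sqrt \<beta> * snd w))) \<in> borel_measurable P" by measurable
      have i: "integrable P (\<lambda>w. iexp (t * (sqrt \<beta> * snd w)))"
        by (rule P.integrable_const_bound[where B=1]) (use m in auto)
      have "char N1 t = (CLINT w|P. iexp (t * (sqrt \<beta> * snd w)))"
        unfolding char_def N1_def by (subst integral_distr) auto
      also have "\<dots> = complex_of_real (exp (- t\<^sup>2 / 2))"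
      proof (rule complex_eqI)
        have e: "- (t * sqrt \<beta>)\<^sup>2 / (2 * \<beta>) = - t\<^sup>2 / 2" using \<beta> by (simp add: power_mult_distrib)
        have "Re (CLINT w|P. iexp (t * (sqrt \<beta> * snd w))) = (\<integral>w. cos ((t * sqrt \<beta>) * snd w) \<partial>P)"
          by (subst integral_Re[OF i, symmetric]) (simp add: Re_exp mult.assoc)
        also have "\<dots> = c0 * exp (- t\<^sup>2 / 2) / c0" by (subst ip) (auto simp: trig_moments e[simplified] c0_def)
        finally show "Re (CLINT w|P. iexp (t * (sqrt \<beta> * snd w))) = Re (complex_of_real (exp (- t\<^sup>2 / 2)))" using c0 by simp
        have "Im (CLINT w|P. iexp (t * (sqrt \<beta> * snd w))) = (\<integral>w. sin ((t * sqrt \<beta>) * snd w) \<partial>P)"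
          by (subst integral_Im[OF i, symmetric]) (simp add: Im_exp mult.assoc)
        also have "\<dots> = 0" by (subst ip) (auto simp: trig_moments)
        finally show "Im (CLINT w|P. iexp (t * (sqrt \<beta> * snd w))) = Im (complex_of_real (exp (- t\<^sup>2 / 2)))" by simp
      qed
      also have "\<dots> = char std_normal_distribution t" by (simp add: char_std_normal_distribution)
      finally show ?thesis .
    qed
    then have N1: "N1 = std_normal_distribution"
      by (intro Levy_uniqueness N1.real_distribution_axioms real_dist_normal_dist ext)
    have "maxwell \<beta> = distr N1 borel (\<lambda>x. x / sqrt \<beta>)" using maxwell_eq_distr[OF \<beta>] N1 by simp
    also have "\<dots> = distr P borel snd"
      unfolding N1_def using \<beta> by (subst distr_distr) (auto simp: comp_def)
    finally have "measure (maxwell \<beta>) S = measure P (snd -` S \<inter> space P)"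
      using S by (simp add: measure_distr)
    also have "\<dots> = (\<integral>w. indicator (snd -` S \<inter> space P) w \<partial>P)" by simp
    also have "\<dots> = (\<integral>w. indicator S (snd w) \<partial>P)" by (intro Bochner_Integration.integral_cong) (auto simp: indicator_def)
    also have "\<dots> = (\<integral>w. A (fst w) * indicator S (snd w) \<partial>M) / c0" using S by (subst ip) auto
    finally show ?thesis using c0 by (simp add: c0_def)
  qed
qed

end

section \<open>Product structure of the steady state\<close>

abbreviation "\<nu> \<equiv> position_marginal M"

lemma sets_nu [simp, measurable_cong]: "sets \<nu> = sets borel"
  and space_nu [simp]: "space \<nu> = UNIV"
  by (simp_all add: position_marginal_def)

lemma prob_space_nu: "prob_space \<nu>"
  unfolding position_marginal_def by (rule M.prob_space_distr) measurable

text \<open>For fixed \<open>S\<close>, both sides are finite measures in the position set. They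
  agree on Lipschitz functions by \<open>gaussian_velocity\<close>, hence everywhere.\<close>

lemma measure_rectangle:
  assumes C: "C \<in> sets borel" and S: "S \<in> sets borel"
  shows "measure M (C \<times> S) = measure \<nu> C * measure (maxwell \<beta>) S"
proof -
  interpret N: prob_space "maxwell \<beta>" by (rule prob_space_maxwell[OF \<beta>])
  interpret nu: prob_space \<nu> by (rule prob_space_nu)
  define r where "r = measure (maxwell \<beta>) S"
  define P where "P = density M (\<lambda>w. ennreal (indicator S (snd w)))"
  define m1 where "m1 = distr P borel fst"
  define m2 where "m2 = density \<nu> (\<lambda>_. ennreal r)"
  have r0: "r \<ge> 0" by (simp add: r_def)
  have [measurable]: "C \<in> sets borel" "S \<in> sets borel" by (fact assms)+
  have sP [measurable_cong]: "sets P = sets BB" by (simp add: P_def)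
  have UM: "UNIV \<in> sets BB" using sets.top[of M] by simp
  have f1: "emeasure m1 X = ennreal (measure M (X \<times> S))" if [measurable]: "X \<in> sets borel" for X
  proof -
    have "emeasure m1 X = emeasure P (fst -` X \<inter> space P)" unfolding m1_def by (intro emeasure_distr) auto
    also have "\<dots> = (\<integral>\<^sup>+w. ennreal (indicator S (snd w)) * indicator (fst -` X \<inter> space P) w \<partial>M)"
    proof -
      have "fst -` X \<inter> space P \<in> sets P" by (rule measurable_sets[of fst P borel]) measurable
      then show ?thesis unfolding P_def by (subst emeasure_density) auto
    qed
    also have "\<dots> = (\<integral>\<^sup>+w. indicator (X \<times> S) w \<partial>M)"
      by (intro nn_integral_cong) (auto simp: indicator_def P_def split: prod.split)
    also have "\<dots> = emeasure M (X \<times> S)" by (intro nn_integral_indicator) auto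
    finally show ?thesis by (simp add: M.emeasure_eq_measure)
  qed
  have f2: "emeasure m2 X = ennreal (r * measure \<nu> X)" if "X \<in> sets borel" for X
    unfolding m2_def using that r0
    by (subst emeasure_density) (auto simp: nn_integral_cmult_indicator nu.emeasure_eq_measure ennreal_mult)
  have "m1 = m2"
  proof (rule measure_eqI_lipschitz)
    show "finite_measure m1" using f1[of UNIV] by (intro finite_measureI) (auto simp: m1_def)
    show "finite_measure m2" using f2[of UNIV] by (intro finite_measureI) (auto simp: m2_def)
    show "sets m1 = sets borel" "sets m2 = sets borel" by (simp_all add: m1_def m2_def)
    fix f :: "torus \<Rightarrow> real" and L assume f: "\<And>x. 0 \<le> f x" "\<And>x. f x \<le> (1 :: real)" "\<And>x y. \<bar>f x - f y\<bar> \<le> L * dist x y"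
    have "continuous_on UNIV f"
    proof -
      have "L-lipschitz_on UNIV f"
      proof (rule lipschitz_onI)
        show "dist (f x) (f y) \<le> L * dist x y" for x y using f(3) by (simp add: dist_real_def)
        show "0 \<le> L"
        proof (rule ccontr)
          assume "\<not> 0 \<le> L"
          moreover have "(0 :: torus) \<noteq> to_torus (1/2)"
          proof
            assume "(0 :: torus) = to_torus (1/2)"
            then have "cos_2pi 0 = cos_2pi (to_torus (1/2))" by simp
            then show False by simp
          qed
          then have "dist (0 :: torus) (to_torus (1/2)) > 0" by simp
          ultimately have "L * dist (0 :: torus) (to_torus (1/2)) < 0" by (simp add: mult_neg_pos)
          then show False using f(3)[of 0 "to_torus (1/2)"] by linarith
        qed
      qed
      then show ?thesis by (rule lipschitz_on_continuous_on)
    qed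
    then have [measurable]: "f \<in> borel_measurable borel" by (rule borel_measurable_continuous_onI)
    have "(\<integral>x. f x \<partial>m1) = (\<integral>w. f (fst w) \<partial>P)" unfolding m1_def by (rule integral_distr) measurable
    also have "\<dots> = (\<integral>w. f (fst w) * indicator S (snd w) \<partial>M)"
      unfolding P_def by (subst integral_real_density) (auto simp: mult.commute)
    also have "\<dots> = (\<integral>w. f (fst w) \<partial>M) * r"
      unfolding r_def
    proof (rule gaussian_velocity[where CA=1 and LA="L\<^sup>2"])
      show "\<bar>f q\<bar> \<le> 1" for q using f by simp
    qed (use f lipschitz_chord[OF f(3)] in auto)
    also have "\<dots> = (\<integral>x. f x \<partial>m2)"
      unfolding m2_def using r0 position_marginal_integral[OF pp, of f]
      by (subst integral_real_density) (auto simp: mult.commute)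
    finally show "(\<integral>x. f x \<partial>m1) = (\<integral>x. f x \<partial>m2)" .
  qed
  then have "ennreal (measure M (C \<times> S)) = ennreal (r * measure \<nu> C)" using f1[of C] f2[of C] by simp
  then show ?thesis using r0 by (simp add: r_def mult.commute)
qed

lemma M_product: "\<nu> \<Otimes>\<^sub>M maxwell \<beta> = M"
proof (rule pair_measure_eqI)
  interpret N: prob_space "maxwell \<beta>" by (rule prob_space_maxwell[OF \<beta>])
  interpret nu: prob_space \<nu> by (rule prob_space_nu)
  show "sigma_finite_measure \<nu>" "sigma_finite_measure (maxwell \<beta>)"
    by (rule nu.sigma_finite_measure_axioms N.sigma_finite_measure_axioms)+
  show "sets (\<nu> \<Otimes>\<^sub>M maxwell \<beta>) = sets M"
    by (simp cong: sets_pair_measure_cong)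
  show "emeasure \<nu> C * emeasure (maxwell \<beta>) S = emeasure M (C \<times> S)" if "C \<in> sets \<nu>" "S \<in> sets (maxwell \<beta>)" for C S
    using measure_rectangle[of C S] that
    by (simp add: nu.emeasure_eq_measure N.emeasure_eq_measure M.emeasure_eq_measure ennreal_mult)
qed

lemma integral_product:
  assumes f: "continuous_on UNIV f" and g: "integrable lborel (\<lambda>p. kappa \<beta> p * g p)" and gm [measurable]: "g \<in> borel_measurable borel"
  shows "integrable M (\<lambda>w. f (fst w) * g (snd w))"
    "(\<integral>w. f (fst w) * g (snd w) \<partial>M) = (\<integral>w. f (fst w) \<partial>M) * (\<integral>p. kappa \<beta> p * g p \<partial>lborel)"
proof -
  interpret N: prob_space "maxwell \<beta>" by (rule prob_space_maxwell[OF \<beta>])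
  interpret nu: prob_space \<nu> by (rule prob_space_nu)
  interpret P: pair_sigma_finite \<nu> "maxwell \<beta>" ..
  have [measurable]: "f \<in> borel_measurable borel" using f by (rule borel_measurable_continuous_onI)
  obtain C where C: "\<And>q. \<bar>f q\<bar> \<le> C" using continuous_imp_bounded_torus[OF f] by blast
  have fi: "integrable \<nu> f" by (rule nu.integrable_const_bound[where B=C]) (use C in auto)
  have k0: "0 \<le> kappa \<beta> p" for p using kappa_pos[OF \<beta>, of p] by simp
  have gi: "integrable (maxwell \<beta>) g" "(\<integral>p. g p \<partial>maxwell \<beta>) = (\<integral>p. kappa \<beta> p * g p \<partial>lborel)"
    unfolding maxwell_def using g k0 integrable_real_density[of "kappa \<beta>" lborel g] integral_real_density[of "kappa \<beta>" lborel g] by auto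
  have i: "integrable (\<nu> \<Otimes>\<^sub>M maxwell \<beta>) (\<lambda>w. f (fst w) * g (snd w))"
    by (rule P.Fubini_integrable) (use fi gi in \<open>auto simp: abs_mult\<close>)
  then show "integrable M (\<lambda>w. f (fst w) * g (snd w))" by (simp add: M_product)
  have "(\<integral>w. f (fst w) * g (snd w) \<partial>(\<nu> \<Otimes>\<^sub>M maxwell \<beta>)) = (\<integral>q. f q \<partial>\<nu>) * (\<integral>p. g p \<partial>maxwell \<beta>)"
    by (subst P.integral_fst'[OF i, symmetric]) simp
  then show "(\<integral>w. f (fst w) * g (snd w) \<partial>M) = (\<integral>w. f (fst w) \<partial>M) * (\<integral>p. kappa \<beta> p * g p \<partial>lborel)"
    by (simp add: M_product gi(2) position_marginal_integral[OF pp])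
qed

section \<open>Identification of the position marginal\<close>

lemma D_elem: "D \<in> torus_elem" and pot_elem: "pot \<in> torus_elem"
proof -
  have "(\<lambda>q. s1 * sin_2pi q + s2 * cos_2pi q) \<in> torus_elem" by (intro torus_elem.intros)
  then show "D \<in> torus_elem" by (simp add: D_def)
  have "(\<lambda>q. (s2 / (2 * pi)) * sin_2pi q + (- s1 / (2 * pi)) * cos_2pi q) \<in> torus_elem" by (intro torus_elem.intros)
  then show "pot \<in> torus_elem" by (simp add: pot_def[abs_def] diff_divide_distrib)
qed

text \<open>The reciprocal of the expected, unnormalised position density; weighting the marginal by
  it should produce a multiple of Lebesgue measure.\<close>

definition ex :: "torus \<Rightarrow> real" where "ex q = exp (\<beta> * pot q)"

lemma ex_elem: "ex \<in> torus_elem"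
  unfolding ex_def[abs_def] by (intro torus_elem.exp torus_elem.mult torus_elem.const pot_elem)

lemma ex_continuous: "continuous_on S ex" by (rule torus_elem_continuous[OF ex_elem])

lemma ex_pos: "ex q > 0" by (simp add: ex_def)

text \<open>Test with A = ex f and B(y) = y. Under the product structure y^2 averages to 1 / \<beta>
  and y to 0, so the integral of A' equals \<beta> times that of D A; since ex' = \<beta> D ex, only
  the term with f' survives.\<close>

lemma ex_deriv_zero:
  assumes f: "f \<in> torus_elem" "f' \<in> torus_elem" "\<And>q. has_tderiv f (f' q) q"
  shows "(\<integral>w. ex (fst w) * f' (fst w) \<partial>M) = 0"
proof -
  define A where "A q = ex q * f q" for q
  define A' where "A' q = \<beta> * D q * ex q * f q + ex q * f' q" for q
  have A: "A \<in> torus_elem" "A' \<in> torus_elem"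
    unfolding A_def[abs_def] A'_def[abs_def] by (intro torus_elem.intros ex_elem f D_elem)+
  have dA: "has_tderiv A (A' q) q" for q
    unfolding A_def A'_def ex_def by (intro has_tderiv_mult has_tderiv_exp has_tderiv_cmult pot_tderiv f)
  have c: "continuous_on UNIV A" "continuous_on UNIV A'" "continuous_on UNIV (\<lambda>q. D q * A q)"
    using torus_elem_continuous[OF A(1)] torus_elem_continuous[OF A(2)] torus_elem_continuous[OF torus_elem.mult[OF D_elem A(1)]] by auto
  note k = kappa_integrals[OF \<beta>]
  have "(\<integral>(x, y). A' x * (y * y) - D x * A x * 1 + \<gamma> * (A x * (- y * 1 + 0 / \<beta>)) \<partial>M) = 0"
    by (rule weak[where B="\<lambda>y. y" and C=1]) (auto intro: A dA smooth_elem.ident)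
  then have "0 = (\<integral>w. A' (fst w) * (snd w)\<^sup>2 - (D (fst w) * A (fst w)) * 1 - \<gamma> * (A (fst w) * snd w) \<partial>M)"
    by (simp add: split_beta' power2_eq_square)
  also have "\<dots> = (\<integral>w. A' (fst w) \<partial>M) * (1 / \<beta>) - (\<integral>w. D (fst w) * A (fst w) \<partial>M)"
    using integral_product[OF c(2), of "\<lambda>y. y\<^sup>2"] integral_product[OF c(1), of "\<lambda>y. y"] integral_product[OF c(3), of "\<lambda>y. 1"] k
    by simp
  finally have 1: "(\<integral>w. A' (fst w) \<partial>M) = \<beta> * (\<integral>w. D (fst w) * A (fst w) \<partial>M)" using \<beta> by (simp add: field_simps)
  have i: "integrable M (\<lambda>w. g (fst w))" if "g \<in> torus_elem" for g
    using integral_product(1)[OF torus_elem_continuous[OF that], of "\<lambda>_. 1"] k by simp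
  have "(\<integral>w. A' (fst w) \<partial>M) = (\<integral>w. \<beta> * (D (fst w) * A (fst w)) + ex (fst w) * f' (fst w) \<partial>M)"
    by (simp add: A'_def A_def mult_ac)
  also have "\<dots> = \<beta> * (\<integral>w. D (fst w) * A (fst w) \<partial>M) + (\<integral>w. ex (fst w) * f' (fst w) \<partial>M)"
    using i[OF torus_elem.mult[OF D_elem A(1)]] i[OF torus_elem.mult[OF ex_elem f(2)]] by simp
  finally show ?thesis using 1 by simp
qed

text \<open>By the previous lemma, the functional \<open>f \<mapsto> \<integral> e\<^bsup>\<beta>U\<^esup> f d\<nu>\<close> is invariant under translations, hence a multiple
  of Lebesgue measure.\<close>

lemma ex_integral_elem:
  assumes f: "f \<in> torus_elem"
  shows "(\<integral>w. ex (fst w) * f (fst w) \<partial>M) = (\<integral>w. ex (fst w) \<partial>M) * (\<integral>q. f q \<partial>torus_lebesgue)"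
proof -
  interpret P: pair_sigma_finite M torus_lebesgue
    by (intro pair_sigma_finite.intro M.sigma_finite_measure_axioms torus.sigma_finite_measure_axioms)
  interpret PP: prob_space "M \<Otimes>\<^sub>M torus_lebesgue"
    by (intro prob_space_pair M.prob_space_axioms torus.prob_space_axioms)
  obtain f' where f': "f' \<in> torus_elem" "\<And>q. has_tderiv f (f' q) q" using torus_elem_deriv[OF f] by blast
  have bd: "\<exists>C. \<forall>q. \<bar>g q\<bar> \<le> C" if "g \<in> torus_elem" for g
    using continuous_imp_bounded_torus[OF torus_elem_continuous[OF that]] by metis
  obtain Ce where Ce: "\<And>q. \<bar>ex q\<bar> \<le> Ce" using bd[OF ex_elem] by blast
  obtain C where C: "\<And>q. \<bar>f q\<bar> \<le> C" using bd[OF f] by blast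
  obtain C' where C': "\<And>q. \<bar>f' q\<bar> \<le> C'" using bd[OF f'(1)] by blast
  have nn: "Ce \<ge> 0" "C \<ge> 0" "C' \<ge> 0" using Ce[of 0] C[of 0] C'[of 0] by auto
  have [measurable]: "g \<in> borel_measurable borel" if "g \<in> torus_elem" for g
    by (rule borel_measurable_continuous_onI[OF torus_elem_continuous[OF that]])
  have me [measurable]: "ex \<in> borel_measurable borel" "f \<in> borel_measurable borel" "f' \<in> borel_measurable borel"
    using ex_elem f f' by measurable
  have inv: "(\<integral>w. ex (fst w) * f (fst w + h) \<partial>M) = (\<integral>w. ex (fst w) * f (fst w) \<partial>M)" for h
  proof -
    obtain t0 where t0: "h = to_torus t0" by (rule torus_cases_unit)
    have "((\<lambda>t. \<integral>w. ex (fst w) * f (fst w + to_torus t) \<partial>M) has_real_derivative 0) (at t)" for t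
    proof -
      have "((\<lambda>t. \<integral>w. ex (fst w) * f (fst w + to_torus t) \<partial>M) has_real_derivative (\<integral>w. ex (fst w) * f' (fst w + to_torus t) \<partial>M)) (at t)"
      proof (rule has_real_derivative_integral[where w="\<lambda>_. Ce * C'"])
        fix s w
        have "((\<lambda>h. f (fst w + to_torus s + to_torus h)) has_real_derivative f' (fst w + to_torus s)) (at 0)"
          using f'(2)[of "fst w + to_torus s"] by (simp add: has_tderiv_def)
        then have "((\<lambda>t. f (fst w + to_torus t)) has_real_derivative f' (fst w + to_torus s)) (at s)"
          using DERIV_shift[of "\<lambda>t. f (fst w + to_torus t)" _ 0 s] by (simp add: to_torus_add add_ac)
        then show "((\<lambda>t. ex (fst w) * f (fst w + to_torus t)) has_real_derivative ex (fst w) * f' (fst w + to_torus s)) (at s)"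
          by (rule DERIV_cmult)
        show "\<bar>ex (fst w) * f' (fst w + to_torus s)\<bar> \<le> Ce * C'"
          unfolding abs_mult using nn by (intro mult_mono Ce C') auto
      next
        show "integrable M (\<lambda>w. ex (fst w) * f (fst w + to_torus s))" for s
        proof (rule integrable_M_bounded)
          show "\<bar>ex (fst (x, y)) * f (fst (x, y) + to_torus s)\<bar> \<le> Ce * C" for x y
            unfolding abs_mult using nn by (intro mult_mono Ce C) auto
        qed measurable
      qed auto
      also have "(\<integral>w. ex (fst w) * f' (fst w + to_torus t) \<partial>M) = 0"
        by (rule ex_deriv_zero[OF torus_elem_shift[OF f] torus_elem_shift[OF f'(1)] has_tderiv_shift[OF f'(2)]])
      finally show ?thesis .
    qed
    from DERIV_isconst_all[of "\<lambda>t. \<integral>w. ex (fst w) * f (fst w + to_torus t) \<partial>M" t0 0] this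
    show ?thesis by (simp add: t0)
  qed
  have ad: "(\<lambda>z. f (fst z + snd z)) \<in> borel_measurable (borel \<Otimes>\<^sub>M borel)" by (rule torus_elem_add_measurable[OF f])
  have pr: "(\<lambda>z. (fst (fst z), snd z)) \<in> measurable (M \<Otimes>\<^sub>M torus_lebesgue) (borel \<Otimes>\<^sub>M borel)" by measurable
  have [measurable]: "(\<lambda>z. f (fst (fst z) + snd z)) \<in> borel_measurable (M \<Otimes>\<^sub>M torus_lebesgue)"
    using measurable_compose[OF pr ad] by simp
  have i: "integrable (M \<Otimes>\<^sub>M torus_lebesgue) (\<lambda>(w, h). ex (fst w) * f (fst w + h))"
  proof (rule PP.integrable_const_bound[where B="Ce * C"])
    show "AE x in M \<Otimes>\<^sub>M torus_lebesgue. norm (case x of (w, h) \<Rightarrow> ex (fst w) * f (fst w + h)) \<le> Ce * C"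
      using nn by (auto intro!: AE_I2 mult_mono Ce C simp: abs_mult)
    show "(\<lambda>(w, h). ex (fst w) * f (fst w + h)) \<in> borel_measurable (M \<Otimes>\<^sub>M torus_lebesgue)"
      unfolding split_beta' by measurable
  qed
  \<comment> \<open>Average the translation-invariant quantity over all translations; after Fubini
    the inner average is the Lebesgue integral of \<open>f\<close>.\<close>
  have "(\<integral>w. ex (fst w) * f (fst w) \<partial>M) = (\<integral>h. (\<integral>w. ex (fst w) * f (fst w + h) \<partial>M) \<partial>torus_lebesgue)"
    by (simp add: inv)
  also have "\<dots> = (\<integral>w. (\<integral>h. ex (fst w) * f (fst w + h) \<partial>torus_lebesgue) \<partial>M)"
    by (rule P.Fubini_integral[OF i])
  also have "\<dots> = (\<integral>w. ex (fst w) * (\<integral>q. f q \<partial>torus_lebesgue) \<partial>M)"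
  proof (intro Bochner_Integration.integral_cong refl)
    fix w :: "torus \<times> real"
    show "(\<integral>h. ex (fst w) * f (fst w + h) \<partial>torus_lebesgue) = ex (fst w) * (\<integral>q. f q \<partial>torus_lebesgue)"
      using integral_torus_shift[OF me(2), of "fst w"] by (simp add: add.commute)
  qed
  finally show ?thesis by simp
qed

text \<open>Approximate uniformly by elements of \<open>torus_elem\<close>; an approximation within
  \<open>d\<close> changes each side by at most \<open>c * d\<close>.\<close>

lemma ex_integral_continuous:
  assumes g: "continuous_on UNIV g"
  shows "(\<integral>w. ex (fst w) * g (fst w) \<partial>M) = (\<integral>w. ex (fst w) \<partial>M) * (\<integral>q. g q \<partial>torus_lebesgue)"
proof -
  define c where "c = (\<integral>w. ex (fst w) \<partial>M)"
  have k: "integrable M (\<lambda>w. h (fst w))" if "continuous_on UNIV h" for h :: "torus \<Rightarrow> real"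
    using integral_product(1)[OF that, of "\<lambda>_. 1"] kappa_integrals[OF \<beta>] by simp
  have c0: "c \<ge> 0" unfolding c_def by (intro Bochner_Integration.integral_nonneg) (simp add: less_imp_le[OF ex_pos])
  have "\<bar>(\<integral>w. ex (fst w) * g (fst w) \<partial>M) - c * (\<integral>q. g q \<partial>torus_lebesgue)\<bar> \<le> 2 * c * d" if d: "d > 0" for d
  proof -
    obtain f where f: "f \<in> torus_elem" "\<And>x. \<bar>g x - f x\<bar> < d"
      using torus_ring.Stone_Weierstrass_basic[OF g d] by auto
    have fc: "continuous_on UNIV f" by (rule torus_elem_continuous[OF f(1)])
    have i: "integrable M (\<lambda>w. ex (fst w) * g (fst w))" "integrable M (\<lambda>w. ex (fst w) * f (fst w))" "integrable M (\<lambda>w. ex (fst w))"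
      by (intro k continuous_intros ex_continuous g fc)+
    have "(\<integral>w. ex (fst w) * g (fst w) \<partial>M) \<le> (\<integral>w. ex (fst w) * f (fst w) + d * ex (fst w) \<partial>M)"
    proof (intro integral_mono Bochner_Integration.integrable_add integrable_mult_right i)
      fix w :: "torus \<times> real"
      have "ex (fst w) * g (fst w) \<le> ex (fst w) * (f (fst w) + d)"
        using f(2)[of "fst w"] ex_pos[of "fst w"] by (intro mult_left_mono) auto
      then show "ex (fst w) * g (fst w) \<le> ex (fst w) * f (fst w) + d * ex (fst w)" by (simp add: algebra_simps)
    qed
    moreover have "(\<integral>w. ex (fst w) * f (fst w) - d * ex (fst w) \<partial>M) \<le> (\<integral>w. ex (fst w) * g (fst w) \<partial>M)"
    proof (intro integral_mono Bochner_Integration.integrable_diff integrable_mult_right i)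
      fix w :: "torus \<times> real"
      have "ex (fst w) * (f (fst w) - d) \<le> ex (fst w) * g (fst w)"
        using f(2)[of "fst w"] ex_pos[of "fst w"] by (intro mult_left_mono) auto
      then show "ex (fst w) * f (fst w) - d * ex (fst w) \<le> ex (fst w) * g (fst w)" by (simp add: algebra_simps)
    qed
    moreover have "(\<integral>w. ex (fst w) * f (fst w) + d * ex (fst w) \<partial>M) = c * (\<integral>q. f q \<partial>torus_lebesgue) + d * c"
      "(\<integral>w. ex (fst w) * f (fst w) - d * ex (fst w) \<partial>M) = c * (\<integral>q. f q \<partial>torus_lebesgue) - d * c"
      using i ex_integral_elem[OF f(1)] by (simp_all add: c_def)
    moreover have "\<bar>c * (\<integral>q. f q \<partial>torus_lebesgue) - c * (\<integral>q. g q \<partial>torus_lebesgue)\<bar> \<le> c * d"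
    proof -
      have it: "integrable torus_lebesgue f" "integrable torus_lebesgue g" by (rule integrable_torus_continuous[OF fc] integrable_torus_continuous[OF g])+
      have "\<bar>\<integral>q. f q - g q \<partial>torus_lebesgue\<bar> \<le> (\<integral>q. \<bar>f q - g q\<bar> \<partial>torus_lebesgue)" by (rule integral_abs_bound)
      also have "\<dots> \<le> (\<integral>q. d \<partial>torus_lebesgue)"
        using f(2) it by (intro integral_mono) (auto simp: abs_minus_commute less_imp_le)
      finally have "\<bar>(\<integral>q. f q \<partial>torus_lebesgue) - (\<integral>q. g q \<partial>torus_lebesgue)\<bar> \<le> d" using it by simp
      then show ?thesis using c0 by (simp add: right_diff_distrib[symmetric] abs_mult mult_left_mono)
    qed
    ultimately show ?thesis unfolding abs_le_iff by (simp add: algebra_simps)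
  qed
  \<comment> \<open>Dividing by \<open>2 * c + 1\<close> rather than by \<open>2 * c\<close> works
    without knowing that \<open>c\<close> is positive.\<close>
  from this[of "d / (2 * c + 1)" for d]
  have "\<bar>(\<integral>w. ex (fst w) * g (fst w) \<partial>M) - c * (\<integral>q. g q \<partial>torus_lebesgue)\<bar> \<le> 0 + d" if "d > 0" for d
  proof -
    have "2 * c * (d / (2 * c + 1)) \<le> d" using c0 that by (simp add: field_simps)
    moreover have "d / (2 * c + 1) > 0" using c0 that by simp
    ultimately show ?thesis using \<open>\<And>d. 0 < d / (2 * c + 1) \<Longrightarrow> _ d\<close> by fastforce
  qed
  then have "\<bar>(\<integral>w. ex (fst w) * g (fst w) \<partial>M) - c * (\<integral>q. g q \<partial>torus_lebesgue)\<bar> \<le> 0" by (rule field_le_epsilon)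
  then show ?thesis by (simp add: c_def)
qed

text \<open>\<open>X\<close> and \<open>Y\<close> are the Fourier coefficients of
  \<open>- \<beta> * pot\<close>, so \<open>v\<close> is the reciprocal of \<open>ex\<close>; the
  remaining constant is fixed by total mass 1.\<close>

lemma M_eq_density:
  defines "X \<equiv> \<beta> * s1 / (2 * pi)" and "Y \<equiv> - \<beta> * s2 / (2 * pi)"
  shows "M = density phase_lebesgue (\<lambda>z. ennreal (wf \<beta> X Y z))"
proof -
  interpret N: prob_space "maxwell \<beta>" by (rule prob_space_maxwell[OF \<beta>])
  interpret nu: prob_space \<nu> by (rule prob_space_nu)
  define v where "v q = exp (X * cos_2pi q + Y * sin_2pi q)" for q
  have ve: "ex q * v q = 1" for q
  proof -
    have "\<beta> * pot q + (X * cos_2pi q + Y * sin_2pi q) = 0" by (simp add: pot_def X_def Y_def field_simps)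
    then show ?thesis unfolding ex_def v_def exp_add[symmetric] by simp
  qed
  have vc: "continuous_on UNIV v" unfolding v_def by (intro continuous_intros)
  have [measurable]: "v \<in> borel_measurable borel" using vc by (rule borel_measurable_continuous_onI)
  define c where "c = (\<integral>w. ex (fst w) \<partial>M)"
  have nu_int: "(\<integral>q. f q \<partial>\<nu>) = (\<integral>q. f q * (v q / Zf X Y) \<partial>torus_lebesgue)" if f: "continuous_on UNIV f" for f
  proof -
    have *: "(\<integral>w. f (fst w) \<partial>M) = c * (\<integral>q. v q * f q \<partial>torus_lebesgue)" if f: "continuous_on UNIV f" for f
    proof -
      have "(\<integral>w. f (fst w) \<partial>M) = (\<integral>w. ex (fst w) * (v (fst w) * f (fst w)) \<partial>M)"
        by (simp add: mult.assoc[symmetric] ve)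
      also have "\<dots> = c * (\<integral>q. v q * f q \<partial>torus_lebesgue)"
        unfolding c_def by (rule ex_integral_continuous) (intro continuous_intros vc f)
      finally show ?thesis .
    qed
    have "1 = c * Zf X Y" using *[of "\<lambda>_. 1"] M.prob_space by (simp add: Zf_def v_def)
    then have "c = 1 / Zf X Y" using Zf_pos[of X Y] by (simp add: field_simps)
    then show ?thesis
      using *[OF f] position_marginal_integral[OF pp borel_measurable_continuous_onI[OF f]] by (simp add: mult.commute)
  qed
  have v0: "v q / Zf X Y \<ge> 0" for q using Zf_pos[of X Y] by (simp add: v_def)
  have iv: "integrable torus_lebesgue (\<lambda>q. v q / Zf X Y)"
    using Zf_pos[of X Y] by (intro integrable_torus_continuous continuous_intros vc) auto
  have "\<nu> = density torus_lebesgue (\<lambda>q. ennreal (v q / Zf X Y))"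
  proof (rule measure_eqI_lipschitz)
    show "finite_measure \<nu>" by (rule nu.finite_measure_axioms)
    show "finite_measure (density torus_lebesgue (\<lambda>q. ennreal (v q / Zf X Y)))"
    proof (rule finite_measureI)
      have "emeasure (density torus_lebesgue (\<lambda>q. ennreal (v q / Zf X Y))) UNIV = (\<integral>\<^sup>+q. ennreal (v q / Zf X Y) \<partial>torus_lebesgue)"
        by (subst emeasure_density) auto
      also have "\<dots> = ennreal (\<integral>q. v q / Zf X Y \<partial>torus_lebesgue)" using v0 iv by (intro nn_integral_eq_integral) auto
      finally show "emeasure (density torus_lebesgue (\<lambda>q. ennreal (v q / Zf X Y))) (space (density torus_lebesgue (\<lambda>q. ennreal (v q / Zf X Y)))) \<noteq> \<infinity>"
        by simp
    qed
    fix f :: "torus \<Rightarrow> real" and L assume f: "\<And>x y. \<bar>f x - f y\<bar> \<le> L * dist x y"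
    have fc: "continuous_on UNIV f"
      unfolding continuous_on_iff
    proof safe
      fix x :: torus and d :: real assume d: "d > 0"
      have L: "L * t \<le> (\<bar>L\<bar> + 1) * t" if "t \<ge> 0" for t using that by (intro mult_right_mono) auto
      show "\<exists>e>0. \<forall>x'\<in>UNIV. dist x' x < e \<longrightarrow> dist (f x') (f x) < d"
      proof (intro exI conjI ballI impI)
        show "d / (\<bar>L\<bar> + 1) > 0" using d by simp
        fix x' assume "dist x' x < d / (\<bar>L\<bar> + 1)"
        then have "(\<bar>L\<bar> + 1) * dist x' x < d" by (simp add: pos_less_divide_eq mult.commute)
        then show "dist (f x') (f x) < d" using f[of x' x] L[of "dist x' x"] by (simp add: dist_real_def)
      qed
    qed
    show "(\<integral>x. f x \<partial>\<nu>) = (\<integral>x. f x \<partial>density torus_lebesgue (\<lambda>q. ennreal (v q / Zf X Y)))"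
      unfolding nu_int[OF fc] using v0 borel_measurable_continuous_onI[OF fc]
      by (subst integral_real_density) (auto simp: mult.commute)
  qed auto
  then have "M = density torus_lebesgue (\<lambda>q. ennreal (v q / Zf X Y)) \<Otimes>\<^sub>M maxwell \<beta>" using M_product by simp
  also have "\<dots> = density (torus_lebesgue \<Otimes>\<^sub>M lborel) (\<lambda>(q, p). ennreal (v q / Zf X Y) * ennreal (kappa \<beta> p))"
    unfolding maxwell_def
    by (rule pair_measure_density) (auto intro: lborel.sigma_finite_measure_axioms N.sigma_finite_measure_axioms[unfolded maxwell_def])
  also have "\<dots> = density phase_lebesgue (\<lambda>z. ennreal (wf \<beta> X Y z))"
    unfolding phase_lebesgue_def wf_def split_beta' v_def[symmetric]
    by (intro density_cong AE_I2)
       (auto simp: ennreal_mult[OF v0 less_imp_le[OF kappa_pos[OF \<beta>]], symmetric])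
  finally show ?thesis .
qed

end

text \<open>The steady state is the Gibbs measure of the field that it generates itself, so its two
  means satisfy a vector self-consistency equation. The confinement breaks its rotational symmetry
  and leaves only fields along the cosine.\<close>

theorem steady_state_imp_gibbs:
  assumes \<gamma>: "\<gamma> > 0" and \<beta>: "\<beta> > 0" and \<eta>: "\<eta> > 0" and st: "steady_state \<gamma> \<beta> \<eta> \<mu>"
  shows "\<exists>a. root \<beta> \<eta> a \<and> \<mu> = gibbs \<beta> a"
proof -
  have pp: "phase_prob \<mu>" and gen: "\<And>\<phi>. test_function \<phi> \<Longrightarrow> (\<integral>x. vfp_generator \<gamma> \<beta> \<eta> \<mu> \<phi> x \<partial>\<mu>) = 0"
    using st by (auto simp: steady_state_iff)
  define mc ms where "mc = mean_cos \<mu>" and "ms = mean_sin \<mu>"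
  define X Y where "X = \<beta> * (\<eta> + mc)" and "Y = \<beta> * ms"
  interpret kinetic \<mu> \<beta> \<gamma> "2 * pi * (\<eta> + mc)" "- 2 * pi * ms" "drift \<eta> \<mu>"
  proof
    show "drift \<eta> \<mu> = (\<lambda>q. 2 * pi * (\<eta> + mc) * sin_2pi q + - 2 * pi * ms * cos_2pi q)"
      by (simp add: fun_eq_iff drift_def mc_def ms_def algebra_simps)
    fix A A' :: "torus \<Rightarrow> real" and B B' B'' :: "real \<Rightarrow> real" and K
    assume A: "A \<in> torus_elem" and A': "\<And>q. has_tderiv A (A' q) q" and B: "B \<in> smooth_elem"
      and B': "\<And>y. (B has_real_derivative B' y) (at y)" and B'': "\<And>y. (B' has_real_derivative B'' y) (at y)"
      and K: "\<And>y. \<bar>y\<bar> > K \<Longrightarrow> B y = 0"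
    define \<phi> where "\<phi> = (\<lambda>(q, p). A q * B p)"
    have 1: "d_q \<phi> (q, p) = A' q * B p" for q p
    proof -
      have "has_tderiv (\<lambda>q. A q * B p) (A' q * B p + A q * 0) q" by (intro has_tderiv_mult A' has_tderiv_const)
      then show ?thesis unfolding d_q_def \<phi>_def by (simp add: torus_deriv_eq)
    qed
    have 2: "d_p \<phi> = (\<lambda>(q, p). A q * B' p)"
      unfolding d_p_def \<phi>_def using DERIV_imp_deriv[OF DERIV_cmult[OF B']] by (auto simp: fun_eq_iff)
    have 3: "d_p (d_p \<phi>) (q, p) = A q * B'' p" for q p
      unfolding 2 unfolding d_p_def using DERIV_imp_deriv[OF DERIV_cmult[OF B'']] by simp
    have "(\<integral>x. vfp_generator \<gamma> \<beta> \<eta> \<mu> \<phi> x \<partial>\<mu>) = 0"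
      by (rule gen) (use test_function_product[OF A B K] in \<open>simp add: \<phi>_def\<close>)
    also have "vfp_generator \<gamma> \<beta> \<eta> \<mu> \<phi> = (\<lambda>(x, y). A' x * (y * B y) - drift \<eta> \<mu> x * A x * B' y + \<gamma> * (A x * (- y * B' y + B'' y / \<beta>)))"
      unfolding vfp_generator_def drift_eq[OF pp]
      by (auto simp: fun_eq_iff 1 3 fun_cong[OF 2] algebra_simps)
    finally show "(\<integral>(x, y). A' x * (y * B y) - drift \<eta> \<mu> x * A x * B' y + \<gamma> * (A x * (- y * B' y + B'' y / \<beta>)) \<partial>\<mu>) = 0" .
  qed (use assms pp in auto)
  have X_eq: "\<beta> * (2 * pi * (\<eta> + mc)) / (2 * pi) = X" "- \<beta> * (- 2 * pi * ms) / (2 * pi) = Y"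
    by (simp_all add: X_def Y_def)
  have eq: "\<mu> = density phase_lebesgue (\<lambda>z. ennreal (wf \<beta> X Y z))"
    using M_eq_density unfolding X_eq .
  define r where "r = sqrt (X\<^sup>2 + Y\<^sup>2)"
  have m: "r * mc = X * R r" "r * ms = Y * R r"
    using mean_density_wf[OF \<beta>, of X Y] unfolding eq[symmetric] by (simp_all add: r_def mc_def ms_def)
  \<comment> \<open>A nonzero sine mean would force \<open>r = \<beta> * R r\<close>; the cosine
    equation then reads \<open>mc = \<eta> + mc\<close>, against \<open>\<eta> > 0\<close>.\<close>
  have "ms = 0"
  proof (rule ccontr)
    assume ms: "ms \<noteq> 0"
    then have "X\<^sup>2 + Y\<^sup>2 > 0" using \<beta> by (simp add: Y_def add_nonneg_pos)
    then have r: "r > 0" by (simp add: r_def)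
    have "r * ms = \<beta> * R r * ms" using m(2) by (simp add: Y_def mult_ac)
    then have "r = \<beta> * R r" using ms by simp
    then have "\<beta> * R r * mc = \<beta> * (\<eta> + mc) * R r" using m(1) by (simp add: X_def)
    then have "R r * \<beta> * mc = R r * \<beta> * (\<eta> + mc)" by (simp add: mult_ac)
    then have "mc = \<eta> + mc" using R_pos[OF r] \<beta> by simp
    then show False using \<eta> by simp
  qed
  then have \<mu>: "\<mu> = gibbs \<beta> X" using eq by (simp add: Y_def gibbs_eq)
  then have "mc = R X" using mean_wf_0(1)[OF \<beta>, of X] by (simp add: mc_def)
  then show ?thesis using \<mu> by (intro exI[of _ X]) (simp add: root_def X_def)
qed

section \<open>The free energy\<close>

text \<open>The entropy h ln h with its tangent at 1 subtracted: it is nonnegative and vanishes only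
  at 1, while the affine correction integrates to 0 between probability densities.\<close>

definition psi :: "real \<Rightarrow> real" where
  "psi h = h * ln h - h + 1"

lemma psi_1 [simp]: "psi 1 = 0"
  by (simp add: psi_def)

lemma psi_measurable [measurable]: "psi \<in> borel_measurable borel"
  unfolding psi_def[abs_def] by measurable

lemma psi_pos:
  assumes "h \<ge> 0" "h \<noteq> 1" shows "psi h > 0"
proof (cases "h = 0")
  case False
  then have h: "h > 0" using assms by simp
  have "ln (1 / h) \<noteq> 1 / h - 1" using ln_eq_minus_one[of "1 / h"] h assms(2) by auto
  then have "ln (1 / h) < 1 / h - 1" using h ln_le_minus_one[of "1 / h"] by (simp add: less_le)
  then have "h * ln (1 / h) < h * (1 / h - 1)" using h by simp
  then show ?thesis using h by (simp add: psi_def ln_div algebra_simps)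
qed (simp add: psi_def)

lemma psi_nonneg: "h \<ge> 0 \<Longrightarrow> psi h \<ge> 0"
  using psi_pos[of h] by (cases "h = 1") auto

lemma DERIV_psi: "h > 0 \<Longrightarrow> (psi has_real_derivative ln h) (at h)"
  unfolding psi_def[abs_def] by (auto intro!: derivative_eq_intros)

text \<open>A consequence of convexity and \<open>psi 1 = 0\<close>. It bounds the difference
  quotients at 1 by \<open>psi h\<close> uniformly in \<open>t\<close>, which is the domination
  required in \<open>critical_point_gibbs\<close>.\<close>

lemma psi_convex:
  assumes h: "h \<ge> 0" and t: "0 \<le> t" "t \<le> 1"
  shows "psi (1 + t * (h - 1)) \<le> t * psi h"
proof (cases "h = 0 \<or> t = 0 \<or> t = 1")
  case True
  then show ?thesis
  proof (elim disjE)
    assume "h = 0"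
    moreover have "(1 - t) * ln (1 - t) \<le> 0"
      using t by (cases "t = 1") (auto intro!: mult_nonneg_nonpos)
    ultimately show ?thesis by (simp add: psi_def)
  qed simp_all
next
  case False
  then have h: "h > 0" and t: "0 < t" "t < 1" using assms by auto
  have "convex_on {0<..} psi"
    by (rule convex_on_realI[where f' = ln]) (auto intro: DERIV_psi simp: connected_Ioi)
  from convex_onD[OF this, of t 1 h] show ?thesis using h t by (simp add: algebra_simps)
qed

lemma psi_quotient_tendsto:
  "((\<lambda>t. psi (1 + t * (h - 1)) / t) \<longlongrightarrow> 0) (at 0)"
proof -
  have "((\<lambda>t. psi (1 + t * (h - 1))) has_real_derivative ln 1 * (h - 1)) (at 0)"
  proof (rule DERIV_chain2[where f = psi and g = "\<lambda>t. 1 + t * (h - 1)"])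
    show "(psi has_real_derivative ln 1) (at (1 + 0 * (h - 1)))" using DERIV_psi[of 1] by simp
  qed (auto intro!: derivative_eq_intros)
  then show ?thesis by (simp add: has_field_derivative_iff)
qed

text \<open>The negative part of \<open>h + g\<close> is dominated by the absolute value of
  \<open>g\<close>, hence has a finite integral; the difference is therefore meaningful even if
  \<open>h\<close> has infinite integral.\<close>

lemma ereal_nn_integral_diff:
  fixes h g :: "'a \<Rightarrow> real"
  assumes [measurable]: "h \<in> borel_measurable M" and h: "\<And>x. h x \<ge> 0" and g: "integrable M g"
  shows "enn2ereal (\<integral>\<^sup>+x. ennreal (h x + g x) \<partial>M) - enn2ereal (\<integral>\<^sup>+x. ennreal (- (h x + g x)) \<partial>M)
    = enn2ereal (\<integral>\<^sup>+x. ennreal (h x) \<partial>M) + ereal (\<integral>x. g x \<partial>M)"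
proof (cases "(\<integral>\<^sup>+x. ennreal (h x) \<partial>M) = \<infinity>")
  case False
  have [measurable]: "g \<in> borel_measurable M" using g by simp
  have ih: "integrable M h" using False h by (intro integrableI_nonneg) (auto simp: less_top)
  define e where "e x = h x + g x" for x
  have ie: "integrable M e" unfolding e_def using ih g by simp
  define P N where "P = (\<integral>\<^sup>+x. ennreal (e x) \<partial>M)" and "N = (\<integral>\<^sup>+x. ennreal (- e x) \<partial>M)"
  have fin: "P \<noteq> \<infinity>" "N \<noteq> \<infinity>" using ie unfolding P_def N_def real_integrable_def by auto
  have "(\<integral>x. e x \<partial>M) = enn2real P - enn2real N" unfolding P_def N_def by (rule real_lebesgue_integral_def[OF ie])
  then have 1: "enn2real P - enn2real N = (\<integral>x. h x \<partial>M) + (\<integral>x. g x \<partial>M)" unfolding e_def using ih g by simp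
  have 2: "enn2ereal P = ereal (enn2real P)" "enn2ereal N = ereal (enn2real N)"
    using fin by (metis enn2ereal_ennreal enn2real_nonneg ennreal_enn2real infinity_ennreal_def less_top)+
  have 3: "enn2ereal (\<integral>\<^sup>+x. ennreal (h x) \<partial>M) = ereal (\<integral>x. h x \<partial>M)"
    using nn_integral_eq_integral[OF ih] h by (simp add: enn2ereal_ennreal Bochner_Integration.integral_nonneg)
  show ?thesis using 1 unfolding 3 e_def[symmetric] P_def[symmetric] N_def[symmetric] 2 by simp
next
  case True
  have [measurable]: "g \<in> borel_measurable M" using g by simp
  have ag: "(\<integral>\<^sup>+x. ennreal \<bar>g x\<bar> \<partial>M) < \<infinity>" using g unfolding integrable_iff_bounded by simp
  have "(\<integral>\<^sup>+x. ennreal (- (h x + g x)) \<partial>M) \<le> (\<integral>\<^sup>+x. ennreal \<bar>g x\<bar> \<partial>M)"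
  proof (rule nn_integral_mono, rule ennreal_leI)
    fix x show "- (h x + g x) \<le> \<bar>g x\<bar>" using h[of x] by linarith
  qed
  then have N: "(\<integral>\<^sup>+x. ennreal (- (h x + g x)) \<partial>M) \<noteq> \<infinity>" using ag by (auto simp: less_top top_unique)
  have "(\<integral>\<^sup>+x. ennreal (h x) \<partial>M) \<le> (\<integral>\<^sup>+x. ennreal (h x + g x) + ennreal \<bar>g x\<bar> \<partial>M)"
  proof (rule nn_integral_mono)
    fix x
    have "h x \<le> max 0 (h x + g x) + \<bar>g x\<bar>" by linarith
    then have "ennreal (h x) \<le> ennreal (max 0 (h x + g x) + \<bar>g x\<bar>)" by (rule ennreal_leI)
    also have "\<dots> = ennreal (max 0 (h x + g x)) + ennreal \<bar>g x\<bar>" by (rule ennreal_plus) auto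
    finally show "ennreal (h x) \<le> ennreal (h x + g x) + ennreal \<bar>g x\<bar>" by simp
  qed
  also have "\<dots> = (\<integral>\<^sup>+x. ennreal (h x + g x) \<partial>M) + (\<integral>\<^sup>+x. ennreal \<bar>g x\<bar> \<partial>M)"
    by (rule nn_integral_add) auto
  finally have P: "(\<integral>\<^sup>+x. ennreal (h x + g x) \<partial>M) = \<infinity>" using True ag by (auto simp: top_unique)
  obtain n where n: "enn2ereal (\<integral>\<^sup>+x. ennreal (- (h x + g x)) \<partial>M) = ereal n"
    using N by (metis enn2ereal_ennreal enn2real_nonneg ennreal_enn2real infinity_ennreal_def less_top)
  show ?thesis unfolding n P True by simp
qed

text \<open>The relative entropy of \<open>r\<close> with respect to \<open>wf\<close> when both
  have mass 1. The nonnegative integrand gives it a value in \<open>ennreal\<close> in all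
  cases.\<close>

definition KL :: "real \<Rightarrow> real \<Rightarrow> real \<Rightarrow> (torus \<times> real \<Rightarrow> real) \<Rightarrow> ennreal" where
  "KL \<beta> X Y r = (\<integral>\<^sup>+x. ennreal (wf \<beta> X Y x * psi (r x / wf \<beta> X Y x)) \<partial>phase_lebesgue)"

text \<open>What remains of the free energy at order parameter \<open>(A, B)\<close> when the
  entropy relative to the Gibbs measure of the field \<open>(X, Y)\<close> is split off. The
  logarithms are the normalising constants of the Maxwellian and of the position density.\<close>

definition field_energy :: "real \<Rightarrow> real \<Rightarrow> real \<Rightarrow> real \<Rightarrow> real \<Rightarrow> real \<Rightarrow> real" where
  "field_energy \<beta> \<eta> X Y A B = (X / \<beta> - \<eta> - A / 2) * A + (Y / \<beta> - B / 2) * B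
     + (ln (\<beta> / (2 * pi)) / 2 - ln (Zf X Y)) / \<beta>"

lemma ln_wf:
  assumes "\<beta> > 0"
  shows "ln (wf \<beta> X Y (q, p)) = X * cos_2pi q + Y * sin_2pi q - ln (Zf X Y) + ln (\<beta> / (2 * pi)) / 2 - \<beta> * p\<^sup>2 / 2"
  using assms Zf_pos[of X Y] by (simp add: wf_def kappa_def ln_mult ln_div ln_sqrt)

lemma RN_deriv_density_real:
  assumes "phase_prob (density phase_lebesgue (\<lambda>x. ennreal (r x)))"
    and [measurable]: "r \<in> borel_measurable (borel \<Otimes>\<^sub>M borel)" and r: "\<And>x. r x \<ge> 0"
  shows "AE x in phase_lebesgue. enn2real (RN_deriv phase_lebesgue (density phase_lebesgue (\<lambda>x. ennreal (r x))) x) = r x"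
proof -
  have "AE x in phase_lebesgue. ennreal (r x) = RN_deriv phase_lebesgue (density phase_lebesgue (\<lambda>x. ennreal (r x))) x"
    by (rule phase_sf.RN_deriv_unique) auto
  then show ?thesis by eventually_elim (metis enn2real_ennreal r)
qed

lemma density_integral_1:
  assumes pp: "phase_prob (density phase_lebesgue (\<lambda>x. ennreal (r x)))"
    and [measurable]: "r \<in> borel_measurable (borel \<Otimes>\<^sub>M borel)" and r: "\<And>x. r x \<ge> 0"
  shows "integrable phase_lebesgue r" "(\<integral>x. r x \<partial>phase_lebesgue) = 1"
proof -
  interpret D: prob_space "density phase_lebesgue (\<lambda>x. ennreal (r x))" using pp by (simp add: phase_prob_def)
  have "emeasure (density phase_lebesgue (\<lambda>x. ennreal (r x))) UNIV = (\<integral>\<^sup>+x. ennreal (r x) * indicator UNIV x \<partial>phase_lebesgue)"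
    by (rule emeasure_density) (use sets.top[of phase_lebesgue] in simp_all)
  then have 1: "(\<integral>\<^sup>+x. ennreal (r x) \<partial>phase_lebesgue) = 1" using D.emeasure_space_1 by simp
  show i: "integrable phase_lebesgue r" using 1 r by (intro integrableI_nonneg) auto
  have "ennreal (\<integral>x. r x \<partial>phase_lebesgue) = 1" using nn_integral_eq_integral[OF i] 1 r by simp
  then show "(\<integral>x. r x \<partial>phase_lebesgue) = 1" by simp
qed

text \<open>Write ln r = ln (r / w) + ln w. The summand - \<beta> p^2 / 2 of ln w cancels the
  kinetic energy, and what the field, the confinement and the interaction leave is linear in
  \<open>cos_2pi\<close> and \<open>sin_2pi\<close>, hence determined by the two means. The field is
  arbitrary and can be adapted to the application.\<close>

lemma free_energy_density:
  assumes \<beta>: "\<beta> > 0" and \<rho>: "\<rho> = density phase_lebesgue (\<lambda>x. ennreal (r x))"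
    and pp: "phase_prob \<rho>"
    and [measurable]: "r \<in> borel_measurable (borel \<Otimes>\<^sub>M borel)" and r: "\<And>x. r x \<ge> 0"
  shows "free_energy \<beta> \<eta> \<rho> = enn2ereal (ennreal (1 / \<beta>) * KL \<beta> X Y r)
     + ereal (field_energy \<beta> \<eta> X Y (mean_cos \<rho>) (mean_sin \<rho>))"
proof -
  define A B where "A = mean_cos \<rho>" and "B = mean_sin \<rho>"
  define w where "w = wf \<beta> X Y"
  have [measurable]: "w \<in> borel_measurable (borel \<Otimes>\<^sub>M borel)" by (simp add: w_def)
  have w: "w x > 0" for x using wf_pos[OF \<beta>] by (simp add: w_def)
  note ir = density_integral_1[OF pp[unfolded \<rho>] assms(4) r]
  have iw: "integrable phase_lebesgue w" "(\<integral>x. w x \<partial>phase_lebesgue) = 1"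
    using wf_integral_1[OF \<beta>] by (simp_all add: w_def)
  define c s where "c = (\<lambda>x :: torus \<times> real. cos_2pi (fst x))" and "s = (\<lambda>x :: torus \<times> real. sin_2pi (fst x))"
  have [measurable]: "c \<in> borel_measurable (borel \<Otimes>\<^sub>M borel)" "s \<in> borel_measurable (borel \<Otimes>\<^sub>M borel)"
    unfolding c_def s_def by measurable
  have cs: "\<bar>c x\<bar> \<le> 1" "\<bar>s x\<bar> \<le> 1" for x by (simp_all add: c_def s_def abs_le_iff)
  have irb: "integrable phase_lebesgue (\<lambda>x. r x * f x)" if [measurable]: "f \<in> borel_measurable (borel \<Otimes>\<^sub>M borel)" and f: "\<And>x. \<bar>f x\<bar> \<le> 1" for f :: "_ \<Rightarrow> real"
  proof (rule Bochner_Integration.integrable_bound[OF ir(1)])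
    show "AE x in phase_lebesgue. norm (r x * f x) \<le> norm (r x)"
      using f r by (intro AE_I2) (simp add: abs_mult mult_left_le)
  qed simp
  have irc: "integrable phase_lebesgue (\<lambda>x. r x * c x)" "integrable phase_lebesgue (\<lambda>x. r x * s x)"
    by (auto intro!: irb simp: cs)
  have AB: "(\<integral>x. r x * c x \<partial>phase_lebesgue) = A" "(\<integral>x. r x * s x \<partial>phase_lebesgue) = B"
    unfolding A_def B_def mean_cos_def mean_sin_def \<rho> c_def s_def
    by (subst integral_real_density; use r in auto)+
  define k where "k = (ln (\<beta> / (2 * pi)) / 2 - ln (Zf X Y)) / \<beta>"
  \<comment> \<open>Coefficients of cosine and sine: applied field over \<beta>, minus the
    confinement (in the cosine only), minus half of the self-interaction.\<close>
  define u v where "u = X / \<beta> - \<eta> - A / 2" and "v = Y / \<beta> - B / 2"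
  define h where "h x = 1 / \<beta> * (w x * psi (r x / w x))" for x
  \<comment> \<open>The first summand undoes the affine correction in \<open>psi\<close> and
    integrates to 0.\<close>
  define g where "g x = (r x - w x) / \<beta> + (u * (r x * c x) + v * (r x * s x) + k * r x)" for x
  have [measurable]: "h \<in> borel_measurable (borel \<Otimes>\<^sub>M borel)" unfolding h_def by measurable
  have h0: "h x \<ge> 0" for x unfolding h_def using \<beta> w[of x] r[of x] by (intro mult_nonneg_nonneg psi_nonneg) auto
  have ig: "integrable phase_lebesgue g" unfolding g_def using ir iw irc by simp
  have Ig: "(\<integral>x. g x \<partial>phase_lebesgue) = field_energy \<beta> \<eta> X Y A B"
    unfolding g_def using ir iw irc by (simp add: AB field_energy_def u_def v_def k_def)
  have eq: "AE x in phase_lebesgue. energy_integrand \<beta> \<eta> \<rho> x = h x + g x"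
    using RN_deriv_density_real[OF pp[unfolded \<rho>] assms(4) r]
  proof eventually_elim
    case (elim x)
    obtain q p where x: "x = (q, p)" by (cases x)
    have e: "energy_integrand \<beta> \<eta> \<rho> x = (1 / \<beta> * ln (r x) + p\<^sup>2 / 2 + V \<eta> q + 1 / 2 * (- (A * c x + B * s x))) * r x"
      using elim unfolding energy_integrand_def x
      by (simp add: W_conv_eq[OF pp] A_def B_def \<rho>[symmetric] c_def s_def Let_def)
    show ?case
    proof (cases "r x = 0")
      case True
      then show ?thesis unfolding e h_def g_def by (simp add: psi_def)
    next
      case False
      then have rx: "r x > 0" using r[of x] by simp
      have lw: "ln (w x) = X * c x + Y * s x + \<beta> * k - \<beta> * p\<^sup>2 / 2"
        unfolding w_def x ln_wf[OF \<beta>] using \<beta> by (simp add: c_def s_def k_def field_simps)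
      have "w x * psi (r x / w x) = r x * (ln (r x) - ln (w x)) - r x + w x"
        using w[of x] rx by (simp add: psi_def ln_div algebra_simps)
      then have hx: "h x = 1 / \<beta> * (r x * (ln (r x) - (X * c x + Y * s x + \<beta> * k - \<beta> * p\<^sup>2 / 2)) - r x + w x)"
        unfolding h_def lw by simp
      then have "h x = 1 / \<beta> * ln (r x) * r x - r x * (X / \<beta> * c x + Y / \<beta> * s x + k - p\<^sup>2 / 2) - (r x - w x) / \<beta>"
      proof -
        have "b' * (rx * (L - (X * cx + Y * sx + \<beta> * k - \<beta> * P)) - rx + wx)
          = b' * L * rx - rx * (b' * X * cx + b' * Y * sx + k - P) - b' * (rx - wx)"
          if "b' * \<beta> = 1" for b' rx L cx sx P wx :: real
          using that by algebra
        from this[of "1 / \<beta>" "r x" "ln (r x)" "c x" "s x" "p\<^sup>2 / 2" "w x"] \<beta>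
        show ?thesis unfolding hx by simp
      qed
      moreover have "V \<eta> q = - \<eta> * c x" by (simp add: V_def c_def x)
      ultimately show ?thesis unfolding e g_def u_def v_def by (simp add: algebra_simps)
    qed
  qed
  have ac: "absolutely_continuous phase_lebesgue \<rho>"
    unfolding \<rho> by (rule absolutely_continuousI_density) simp
  have "(\<integral>\<^sup>+x. ennreal (h x) \<partial>phase_lebesgue) = (\<integral>\<^sup>+x. ennreal (1 / \<beta>) * ennreal (w x * psi (r x / w x)) \<partial>phase_lebesgue)"
    unfolding h_def using \<beta> by (intro nn_integral_cong ennreal_mult') simp
  also have "\<dots> = ennreal (1 / \<beta>) * KL \<beta> X Y r"
    unfolding KL_def w_def by (rule nn_integral_cmult) measurable
  finally have Ih: "(\<integral>\<^sup>+x. ennreal (h x) \<partial>phase_lebesgue) = ennreal (1 / \<beta>) * KL \<beta> X Y r" .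
  have "free_energy \<beta> \<eta> \<rho> = enn2ereal (\<integral>\<^sup>+x. ennreal (h x + g x) \<partial>phase_lebesgue)
      - enn2ereal (\<integral>\<^sup>+x. ennreal (- (h x + g x)) \<partial>phase_lebesgue)"
  proof -
    have "(\<integral>\<^sup>+x. ennreal (energy_integrand \<beta> \<eta> \<rho> x) \<partial>phase_lebesgue) = (\<integral>\<^sup>+x. ennreal (h x + g x) \<partial>phase_lebesgue)"
      "(\<integral>\<^sup>+x. ennreal (- energy_integrand \<beta> \<eta> \<rho> x) \<partial>phase_lebesgue) = (\<integral>\<^sup>+x. ennreal (- (h x + g x)) \<partial>phase_lebesgue)"
      by (intro nn_integral_cong_AE; use eq in eventually_elim; simp)+
    then show ?thesis unfolding free_energy_def using ac by simp
  qed
  also have "\<dots> = enn2ereal (ennreal (1 / \<beta>) * KL \<beta> X Y r) + ereal (field_energy \<beta> \<eta> X Y A B)"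
    unfolding Ih[symmetric] Ig[symmetric] by (rule ereal_nn_integral_diff) (use h0 ig in auto)
  finally show ?thesis unfolding A_def B_def .
qed

lemma finite_free_energy_density:
  assumes "phase_prob \<rho>" "free_energy \<beta> \<eta> \<rho> \<noteq> \<infinity>"
  obtains r where "r \<in> borel_measurable (borel \<Otimes>\<^sub>M borel)" "\<And>x. r x \<ge> 0" "\<rho> = density phase_lebesgue (\<lambda>x. ennreal (r x))"
proof -
  have ac: "absolutely_continuous phase_lebesgue \<rho>" using assms(2) by (auto simp: free_energy_def split: if_splits)
  have sets: "sets \<rho> = sets phase_lebesgue" using assms(1) by (simp add: phase_prob_def)
  interpret \<rho>: prob_space \<rho> using assms(1) by (simp add: phase_prob_def)
  define r where "r x = enn2real (RN_deriv phase_lebesgue \<rho> x)" for x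
  have rm': "r \<in> borel_measurable phase_lebesgue"
    unfolding r_def by (rule borel_measurable_enn2real[OF borel_measurable_RN_deriv])
  then have rm: "r \<in> borel_measurable (borel \<Otimes>\<^sub>M borel)"
    unfolding measurable_cong_sets[OF sets_phase_lebesgue refl] .
  have "AE x in phase_lebesgue. RN_deriv phase_lebesgue \<rho> x \<noteq> \<infinity>"
    by (rule phase_sf.RN_deriv_finite[OF \<rho>.sigma_finite_measure_axioms ac sets])
  then have "AE x in phase_lebesgue. RN_deriv phase_lebesgue \<rho> x = ennreal (r x)"
    by (rule eventually_mono) (simp add: r_def less_top[symmetric])
  then have "density phase_lebesgue (RN_deriv phase_lebesgue \<rho>) = density phase_lebesgue (\<lambda>x. ennreal (r x))"
    by (rule density_cong[OF borel_measurable_RN_deriv measurable_compose[OF rm' measurable_ennreal]])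
  then have "\<rho> = density phase_lebesgue (\<lambda>x. ennreal (r x))"
    by (rule trans[OF phase_sf.density_RN_deriv[OF ac sets, symmetric]])
  moreover have "r x \<ge> 0" for x by (simp add: r_def)
  ultimately show ?thesis using rm that[of r] by blast
qed

lemma KL_eq_0_imp:
  assumes \<beta>: "\<beta> > 0" and [measurable]: "r \<in> borel_measurable (borel \<Otimes>\<^sub>M borel)" and r: "\<And>x. r x \<ge> 0"
    and 0: "KL \<beta> X Y r = 0"
  shows "density phase_lebesgue (\<lambda>x. ennreal (r x)) = density phase_lebesgue (\<lambda>x. ennreal (wf \<beta> X Y x))"
proof (rule density_cong)
  have "AE x in phase_lebesgue. ennreal (wf \<beta> X Y x * psi (r x / wf \<beta> X Y x)) = 0"
    using 0 unfolding KL_def by (subst (asm) nn_integral_0_iff_AE) auto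
  then show "AE x in phase_lebesgue. ennreal (r x) = ennreal (wf \<beta> X Y x)"
  proof eventually_elim
    case (elim x)
    have w: "wf \<beta> X Y x > 0" by (rule wf_pos[OF \<beta>])
    then have "psi (r x / wf \<beta> X Y x) \<le> 0" using elim by (simp add: ennreal_eq_0_iff mult_le_0_iff)
    then have "r x / wf \<beta> X Y x = 1" using psi_pos[of "r x / wf \<beta> X Y x"] r[of x] w by fastforce
    then show ?case using w by simp
  qed
qed measurable

lemma KL_self: "\<beta> > 0 \<Longrightarrow> KL \<beta> X Y (wf \<beta> X Y) = 0"
  unfolding KL_def using wf_pos[of \<beta> X Y] by (simp add: less_imp_neq[symmetric])

lemma free_energy_wf:
  assumes "\<beta> > 0" "\<mu> = density phase_lebesgue (\<lambda>x. ennreal (wf \<beta> X Y x))"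
  shows "free_energy \<beta> \<eta> \<mu> = ereal (field_energy \<beta> \<eta> X Y (mean_cos \<mu>) (mean_sin \<mu>))"
proof -
  have "phase_prob \<mu>" unfolding assms(2) by (rule phase_prob_wf[OF assms(1)])
  from free_energy_density[OF assms this wf_measurable less_imp_le[OF wf_pos[OF assms(1)]], of \<eta> X Y]
  show ?thesis by (simp add: KL_self[OF assms(1)] zero_ennreal.rep_eq)
qed

lemma free_energy_gibbs:
  assumes "\<beta> > 0"
  shows "free_energy \<beta> \<eta> (gibbs \<beta> a) = ereal (field_energy \<beta> \<eta> a 0 (R a) 0)"
  using free_energy_wf[OF assms gibbs_eq, of \<eta> a] by (simp add: mean_wf_0[OF assms])

section \<open>The global minimizer\<close>

text \<open>
  The lower bound \<open>\<phi>\<close> for the energy at order parameter of modulus \<open>s\<close>. Its critical points are the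
  solutions of \<open>s = R (\<beta> (\<eta> + s))\<close>, and \<open>a = \<beta> (\<eta> + s)\<close> turns this into the root equation.
\<close>

definition reduced_energy :: "real \<Rightarrow> real \<Rightarrow> real \<Rightarrow> real" where
  "reduced_energy \<beta> \<eta> s = s\<^sup>2 / 2 - ln (Z (\<beta> * (\<eta> + s))) / \<beta>"

lemma DERIV_reduced_energy:
  assumes "\<beta> > 0"
  shows "(reduced_energy \<beta> \<eta> has_real_derivative s - R (\<beta> * (\<eta> + s))) (at s)"
proof -
  have "((\<lambda>s. Z (\<beta> * (\<eta> + s))) has_real_derivative Zn 1 (\<beta> * (\<eta> + s)) * \<beta>) (at s)"
    by (rule DERIV_chain2[where f = Z, OF DERIV_Z]) (auto intro!: derivative_eq_intros)
  then have "((\<lambda>s. ln (Z (\<beta> * (\<eta> + s)))) has_real_derivative 1 / Z (\<beta> * (\<eta> + s)) * (Zn 1 (\<beta> * (\<eta> + s)) * \<beta>)) (at s)"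
    by (rule DERIV_chain2[where f = ln and g = "\<lambda>s. Z (\<beta> * (\<eta> + s))", OF DERIV_ln_divide[OF Z_pos]])
  from DERIV_diff[OF DERIV_cdivide[OF DERIV_power[OF DERIV_ident, of 2 s UNIV], of 2] DERIV_cdivide[OF this, of \<beta>]]
  show ?thesis unfolding reduced_energy_def[abs_def] using assms by (simp add: R_def Z_eq)
qed

text \<open>The derivative \<open>f\<close> has only the zero \<open>R a\<close> on the half line,
  by uniqueness of the positive root. It is negative at 0 and nonnegative from 1 on since
  \<open>R < 1\<close>, so it changes sign exactly there.\<close>

lemma reduced_energy_min:
  assumes \<beta>: "\<beta> > 0" and \<eta>: "\<eta> > 0" and a: "a > 0" "root \<beta> \<eta> a" and s: "s \<ge> 0" "s \<noteq> R a"
  shows "reduced_energy \<beta> \<eta> (R a) < reduced_energy \<beta> \<eta> s"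
proof -
  define f where "f s = s - R (\<beta> * (\<eta> + s))" for s
  have fc: "continuous_on S f" for S
    unfolding f_def by (intro continuous_intros continuous_on_compose2[OF R_continuous[of UNIV]]) auto
  have f0: "s = R a" if "s \<ge> 0" "f s = 0" for s
  proof -
    have "root \<beta> \<eta> (\<beta> * (\<eta> + s))" using that by (simp add: root_def f_def)
    moreover have "\<beta> * (\<eta> + s) > 0" using \<beta> \<eta> that by simp
    ultimately have "\<beta> * (\<eta> + s) = a" using ex1_positive_root[OF \<beta> \<eta>] a by blast
    then show ?thesis using that by (simp add: f_def)
  qed
  have fneg: "f s < 0" if s: "0 \<le> s" "s < R a" for s
  proof (rule ccontr)
    assume n: "\<not> f s < 0"
    have "f 0 < 0" using R_pos[of "\<beta> * \<eta>"] \<beta> \<eta> by (simp add: f_def)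
    then obtain x where "0 \<le> x" "x \<le> s" "f x = 0" using IVT'[of f 0 0 s] fc n s by auto
    then show False using f0[of x] s by auto
  qed
  have fpos: "f s > 0" if s: "s > R a" for s
  proof (rule ccontr)
    assume n: "\<not> f s > 0"
    have s0: "s > 0" using s R_pos[OF a(1)] by linarith
    have "f (max s 1) \<ge> 0"
    proof -
      have "R (\<beta> * (\<eta> + max s 1)) < 1" by (rule R_less_1)
      then show ?thesis by (simp add: f_def)
    qed
    then obtain x where "s \<le> x" "x \<le> max s 1" "f x = 0" using IVT'[of f s 0 "max s 1"] fc n by auto
    then show False using f0[of x] s s0 by auto
  qed
  have D: "(reduced_energy \<beta> \<eta> has_real_derivative f s) (at s)" for s
    unfolding f_def by (rule DERIV_reduced_energy[OF \<beta>])
  consider "s < R a" | "s > R a" using s by linarith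
  then show ?thesis
  proof cases
    case 1
    obtain z where "s < z" "z < R a" "reduced_energy \<beta> \<eta> (R a) - reduced_energy \<beta> \<eta> s = (R a - s) * f z"
      using MVT2[OF 1 D] by blast
    moreover have "(R a - s) * f z < 0" using 1 fneg[of z] calculation s by (intro mult_pos_neg) auto
    ultimately show ?thesis by linarith
  next
    case 2
    obtain z where "R a < z" "z < s" "reduced_energy \<beta> \<eta> s - reduced_energy \<beta> \<eta> (R a) = (s - R a) * f z"
      using MVT2[OF 2 D] by blast
    moreover have "(s - R a) * f z > 0" using 2 fpos[of z] calculation by (intro mult_pos_pos) auto
    ultimately show ?thesis by linarith
  qed
qed

lemma Z_strict_mono:
  assumes "0 \<le> a" "a < b" shows "Z a < Z b"
proof -
  obtain z where z: "a < z" "z < b" "Z b - Z a = (b - a) * Zn 1 z" using MVT2[OF assms(2) DERIV_Z] by blast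
  have "Zn 1 z > 0" using R_pos[of z] z assms Zn_0_pos[of z] by (simp add: R_def zero_less_divide_iff)
  then have "(b - a) * Zn 1 z > 0" using assms by simp
  then show ?thesis using z by linarith
qed

text \<open>For the field generated by \<open>(A, B)\<close> itself, the energy is
  \<open>s\<^sup>2 / 2 - ln (Z (\<beta> * t)) / \<beta>\<close> plus a constant, where
  \<open>s\<close> and \<open>t\<close> are the moduli of \<open>(A, B)\<close> and
  \<open>(\<eta> + A, B)\<close>. The triangle inequality \<open>t \<le> \<eta> + s\<close> and the
  monotonicity of \<open>Z\<close> reduce it to \<open>reduced_energy\<close> at
  \<open>s\<close>.\<close>

lemma field_energy_ge:
  assumes \<beta>: "\<beta> > 0" and \<eta>: "\<eta> > 0" and a: "a > 0" "root \<beta> \<eta> a"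
  shows "field_energy \<beta> \<eta> a 0 (R a) 0 \<le> field_energy \<beta> \<eta> (\<beta> * (\<eta> + A)) (\<beta> * B) A B" (is "?l \<le> ?r")
    and "field_energy \<beta> \<eta> a 0 (R a) 0 = field_energy \<beta> \<eta> (\<beta> * (\<eta> + A)) (\<beta> * B) A B \<Longrightarrow> A = R a \<and> B = 0"
proof -
  define s where "s = sqrt (A\<^sup>2 + B\<^sup>2)"
  define t where "t = sqrt ((\<eta> + A)\<^sup>2 + B\<^sup>2)"
  define K where "K = ln (\<beta> / (2 * pi)) / 2 / \<beta>"
  have s: "s \<ge> 0" "s\<^sup>2 = A\<^sup>2 + B\<^sup>2" by (simp_all add: s_def)
  have t: "t \<ge> 0" "t\<^sup>2 = (\<eta> + A)\<^sup>2 + B\<^sup>2" by (simp_all add: t_def)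
  have As: "A \<le> s" using real_sqrt_sum_squares_ge1[of A B] by (simp add: s_def)
  \<comment> \<open>The defect in the triangle inequality is kept explicit: equality means
    \<open>A = s\<close>, which the second claim needs.\<close>
  have ts: "t\<^sup>2 = (\<eta> + s)\<^sup>2 - 2 * \<eta> * (s - A)" unfolding t(2) power2_sum s(2) by (simp add: algebra_simps)
  have "t \<le> \<eta> + s"
    using ts As \<eta> s(1) by (intro power2_le_imp_le[of t]) (simp_all add: mult_nonneg_nonneg)
  have Zt: "Zf (\<beta> * (\<eta> + A)) (\<beta> * B) = Z (\<beta> * t)"
  proof -
    have "(\<beta> * (\<eta> + A))\<^sup>2 + (\<beta> * B)\<^sup>2 = \<beta>\<^sup>2 * ((\<eta> + A)\<^sup>2 + B\<^sup>2)" by (simp add: power2_eq_square algebra_simps)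
    then show ?thesis using \<beta> by (simp add: Zf_eq real_sqrt_mult t_def)
  qed
  have r: "?r = (s\<^sup>2 / 2 - ln (Z (\<beta> * t)) / \<beta>) + K"
    unfolding field_energy_def Zt s(2) K_def using \<beta> by (simp add: diff_divide_distrib add_divide_distrib power2_eq_square algebra_simps)
  have Za: "Zf a 0 = Z a" using a by (simp add: Zf_eq)
  have aR: "a = \<beta> * (\<eta> + R a)" using a by (simp add: root_def)
  have "a / \<beta> = \<eta> + R a" using aR \<beta> by (simp add: field_simps)
  then have l: "?l = reduced_energy \<beta> \<eta> (R a) + K"
    unfolding field_energy_def Za K_def reduced_energy_def aR[symmetric]
    by (simp add: diff_divide_distrib power2_eq_square)
  have Zts: "ln (Z (\<beta> * t)) / \<beta> \<le> ln (Z (\<beta> * (\<eta> + s))) / \<beta>" (is "?x \<le> ?y")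
    and Zts': "ln (Z (\<beta> * t)) / \<beta> = ln (Z (\<beta> * (\<eta> + s))) / \<beta> \<Longrightarrow> t = \<eta> + s"
  proof -
    have "?x < ?y" if "t \<noteq> \<eta> + s"
      using \<open>t \<le> \<eta> + s\<close> that t(1) \<beta> Z_pos Z_strict_mono[of "\<beta> * t" "\<beta> * (\<eta> + s)"] by (simp add: divide_strict_right_mono)
    then show "?x \<le> ?y" "?x = ?y \<Longrightarrow> t = \<eta> + s" by (cases "t = \<eta> + s"; force)+
  qed
  have m: "reduced_energy \<beta> \<eta> (R a) \<le> reduced_energy \<beta> \<eta> s"
    using reduced_energy_min[OF \<beta> \<eta> a s(1)] by (cases "s = R a") auto
  show "?l \<le> ?r" unfolding l r using Zts m by (simp add: reduced_energy_def)
  assume "?l = ?r"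
  then have "reduced_energy \<beta> \<eta> (R a) = reduced_energy \<beta> \<eta> s" "?x = ?y"
    unfolding l r using Zts m unfolding reduced_energy_def by linarith+
  then have sa: "s = R a" and "t = \<eta> + s" using reduced_energy_min[OF \<beta> \<eta> a s(1)] Zts' by fastforce+
  then have "A = s" using ts \<eta> by simp
  then show "A = R a \<and> B = 0" using sa s(2) by simp
qed

theorem global_minimizer_iff:
  assumes \<beta>: "\<beta> > 0" and \<eta>: "\<eta> > 0" and a: "a > 0" "root \<beta> \<eta> a"
  shows "global_minimizer \<beta> \<eta> \<mu> \<longleftrightarrow> \<mu> = gibbs \<beta> a"
proof -
  define m where "m = field_energy \<beta> \<eta> a 0 (R a) 0"
  have m: "free_energy \<beta> \<eta> (gibbs \<beta> a) = ereal m" unfolding m_def by (rule free_energy_gibbs[OF \<beta>])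
  have *: "ereal m \<le> free_energy \<beta> \<eta> \<rho> \<and> (free_energy \<beta> \<eta> \<rho> \<le> ereal m \<longrightarrow> \<rho> = gibbs \<beta> a)" if pp: "phase_prob \<rho>" for \<rho>
  proof (cases "free_energy \<beta> \<eta> \<rho> = \<infinity>")
    case False
    then obtain r where r: "r \<in> borel_measurable (borel \<Otimes>\<^sub>M borel)" "\<And>x. r x \<ge> 0" "\<rho> = density phase_lebesgue (\<lambda>x. ennreal (r x))"
      using finite_free_energy_density[OF pp] by blast
    define A B where "A = mean_cos \<rho>" and "B = mean_sin \<rho>"
    \<comment> \<open>The field generated by \<rho>. The quadratic part of
      \<open>field_energy\<close> is then plus (A^2 + B^2) / 2; a field chosen independently of
      \<rho> would leave it with a minus sign.\<close>
    define X Y where "X = \<beta> * (\<eta> + A)" and "Y = \<beta> * B"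
    define k where "k = ennreal (1 / \<beta>) * KL \<beta> X Y r"
    define e where "e = field_energy \<beta> \<eta> X Y A B"
    have F: "free_energy \<beta> \<eta> \<rho> = enn2ereal k + ereal e"
      unfolding k_def e_def A_def B_def by (rule free_energy_density[OF \<beta> r(3) pp r(1,2)])
    have me: "m \<le> e" "m = e \<Longrightarrow> A = R a \<and> B = 0"
      using field_energy_ge[OF \<beta> \<eta> a] unfolding m_def e_def X_def Y_def by blast+
    have k0: "enn2ereal k \<ge> 0" by simp
    have "ereal m \<le> free_energy \<beta> \<eta> \<rho>"
      unfolding F using add_mono[OF k0, of "ereal m" "ereal e"] me(1) by simp
    moreover have "\<rho> = gibbs \<beta> a" if le: "free_energy \<beta> \<eta> \<rho> \<le> ereal m"
    proof -
      obtain k' where k': "enn2ereal k = ereal k'" using le F by (cases "enn2ereal k") auto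
      have "k' \<ge> 0" using k0 k' by simp
      moreover have "k' + e \<le> m" using le unfolding F k' by simp
      ultimately have "k' = 0" "m = e" using me(1) by auto
      then have "KL \<beta> X Y r = 0" using k' \<beta> unfolding k_def
        by (metis enn2ereal_inject zero_ennreal.rep_eq zero_ereal_def mult_eq_0_iff ennreal_eq_0_iff not_less zero_less_divide_1_iff)
      from KL_eq_0_imp[OF \<beta> r(1,2) this] have "\<rho> = density phase_lebesgue (\<lambda>x. ennreal (wf \<beta> X Y x))"
        unfolding r(3) .
      moreover have "X = a" "Y = 0" using me(2)[OF \<open>m = e\<close>] a by (simp_all add: X_def Y_def root_def)
      ultimately show ?thesis by (simp add: gibbs_eq)
    qed
    ultimately show ?thesis by blast
  qed simp
  show ?thesis unfolding global_minimizer_def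
    using * m phase_prob_gibbs[OF \<beta>] by (metis (no_types))
qed

section \<open>Critical points and instability\<close>

lemma mixture_density:
  assumes [measurable]: "f \<in> borel_measurable (borel \<Otimes>\<^sub>M borel)" "g \<in> borel_measurable (borel \<Otimes>\<^sub>M borel)"
    and f: "\<And>x. f x \<ge> 0" and g: "\<And>x. g x \<ge> 0" and t: "0 \<le> t" "t \<le> 1"
  shows "mixture t (density phase_lebesgue (\<lambda>x. ennreal (f x))) (density phase_lebesgue (\<lambda>x. ennreal (g x)))
    = density phase_lebesgue (\<lambda>x. ennreal ((1 - t) * f x + t * g x))"
  unfolding mixture_def space_density sets_density
proof (subst (3) density_def, rule measure_of_eq)
  show "sets phase_lebesgue \<subseteq> Pow (space phase_lebesgue)" by (rule sets.space_closed)
  fix A assume "A \<in> sigma_sets (space phase_lebesgue) (sets phase_lebesgue)"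
  then have A: "A \<in> sets phase_lebesgue" by (simp only: sets.sigma_sets_eq)
  then have [measurable]: "A \<in> sets (borel \<Otimes>\<^sub>M borel)" by simp
  have "(\<integral>\<^sup>+x. ennreal ((1 - t) * f x + t * g x) * indicator A x \<partial>phase_lebesgue)
    = (\<integral>\<^sup>+x. ennreal (1 - t) * (ennreal (f x) * indicator A x) + ennreal t * (ennreal (g x) * indicator A x) \<partial>phase_lebesgue)"
    using t f g by (intro nn_integral_cong) (simp add: ennreal_mult ennreal_plus distrib_right mult.assoc)
  also have "\<dots> = ennreal (1 - t) * (\<integral>\<^sup>+x. ennreal (f x) * indicator A x \<partial>phase_lebesgue)
       + ennreal t * (\<integral>\<^sup>+x. ennreal (g x) * indicator A x \<partial>phase_lebesgue)"
    by (subst nn_integral_add) (simp_all add: nn_integral_cmult)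
  finally show "ennreal (1 - t) * emeasure (density phase_lebesgue (\<lambda>x. ennreal (f x))) A
      + ennreal t * emeasure (density phase_lebesgue (\<lambda>x. ennreal (g x))) A
    = (\<integral>\<^sup>+x. ennreal ((1 - t) * f x + t * g x) * indicator A x \<partial>phase_lebesgue)"
    using A by (simp add: emeasure_density)
qed

lemma mean_density:
  assumes [measurable]: "r \<in> borel_measurable (borel \<Otimes>\<^sub>M borel)" and r: "\<And>x. r x \<ge> 0"
  shows "mean_cos (density phase_lebesgue (\<lambda>x. ennreal (r x))) = (\<integral>x. r x * cos_2pi (fst x) \<partial>phase_lebesgue)"
    "mean_sin (density phase_lebesgue (\<lambda>x. ennreal (r x))) = (\<integral>x. r x * sin_2pi (fst x) \<partial>phase_lebesgue)"
  unfolding mean_cos_def mean_sin_def by (subst integral_real_density; use r in auto)+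

lemma integrable_density_moments:
  assumes "integrable phase_lebesgue r"
  shows "integrable phase_lebesgue (\<lambda>x. r x * cos_2pi (fst x))" "integrable phase_lebesgue (\<lambda>x. r x * sin_2pi (fst x))"
proof -
  have [measurable]: "r \<in> borel_measurable (borel \<Otimes>\<^sub>M borel)" using borel_measurable_integrable[OF assms] by simp
  have "\<bar>cos_2pi q\<bar> \<le> 1" "\<bar>sin_2pi q\<bar> \<le> 1" for q by (simp_all add: abs_le_iff)
  then show "integrable phase_lebesgue (\<lambda>x. r x * cos_2pi (fst x))" "integrable phase_lebesgue (\<lambda>x. r x * sin_2pi (fst x))"
    by (auto intro!: Bochner_Integration.integrable_bound[OF assms] simp: abs_mult mult_left_le)
qed

text \<open>The reference field is now the fixed field of the root. Along a segment the order
  parameter moves linearly in \<open>t\<close> and the field part changes by a pure multiple of t^2.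
  The relative entropy is of smaller order than \<open>t\<close> because \<open>psi\<close> has
  derivative 0 at 1.\<close>

theorem critical_point_gibbs:
  assumes \<beta>: "\<beta> > 0" and a: "root \<beta> \<eta> a"
  shows "critical_point \<beta> \<eta> (gibbs \<beta> a)"
  unfolding critical_point_def
proof (intro conjI allI impI)
  define m where "m = field_energy \<beta> \<eta> a 0 (R a) 0"
  have m: "free_energy \<beta> \<eta> (gibbs \<beta> a) = ereal m" unfolding m_def by (rule free_energy_gibbs[OF \<beta>])
  show "phase_prob (gibbs \<beta> a)" by (rule phase_prob_gibbs[OF \<beta>])
  show "\<bar>free_energy \<beta> \<eta> (gibbs \<beta> a)\<bar> \<noteq> \<infinity>" unfolding m by simp
  fix \<rho> assume "phase_prob \<rho> \<and> \<bar>free_energy \<beta> \<eta> \<rho>\<bar> \<noteq> \<infinity>"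
  then have pp: "phase_prob \<rho>" and fin: "\<bar>free_energy \<beta> \<eta> \<rho>\<bar> \<noteq> \<infinity>" by auto
  from fin have "free_energy \<beta> \<eta> \<rho> \<noteq> \<infinity>" by auto
  then obtain r where r [measurable]: "r \<in> borel_measurable (borel \<Otimes>\<^sub>M borel)" and r0: "\<And>x. r x \<ge> 0" and \<rho>: "\<rho> = density phase_lebesgue (\<lambda>x. ennreal (r x))"
    using finite_free_energy_density[OF pp] by blast
  define w where "w = wf \<beta> a 0"
  have [measurable]: "w \<in> borel_measurable (borel \<Otimes>\<^sub>M borel)" by (simp add: w_def)
  have w: "w x > 0" for x using wf_pos[OF \<beta>] by (simp add: w_def)
  have w0: "w x \<ge> 0" for x using w[of x] by simp
  have iw: "integrable phase_lebesgue w" "(\<integral>x. w x \<partial>phase_lebesgue) = 1"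
    using wf_integral_1[OF \<beta>] by (simp_all add: w_def)
  note ir = density_integral_1[OF pp[unfolded \<rho>] r r0]
  define A B where "A = mean_cos \<rho>" and "B = mean_sin \<rho>"
  define h where "h x = r x / w x" for x
  have h0: "h x \<ge> 0" for x using r0[of x] w[of x] by (simp add: h_def)
  have [measurable]: "h \<in> borel_measurable (borel \<Otimes>\<^sub>M borel)" unfolding h_def by measurable
  have ih: "integrable phase_lebesgue (\<lambda>x. w x * psi (h x))"
  proof (rule integrableI_nonneg)
    show "AE x in phase_lebesgue. 0 \<le> w x * psi (h x)" using w0 psi_nonneg[OF h0] by simp
    have "KL \<beta> a 0 r \<noteq> \<infinity>"
    proof
      assume "KL \<beta> a 0 r = \<infinity>"
      then have "free_energy \<beta> \<eta> \<rho> = \<infinity>"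
        unfolding free_energy_density[OF \<beta> \<rho> pp r r0, of \<eta> a 0] using \<beta> by (simp add: ennreal_mult_top)
      then show False using fin by simp
    qed
    then show "(\<integral>\<^sup>+x. ennreal (w x * psi (h x)) \<partial>phase_lebesgue) < \<infinity>" by (simp add: KL_def w_def h_def less_top)
  qed simp
  define k where "k t = (\<integral>x. w x * psi (1 + t * (h x - 1)) \<partial>phase_lebesgue)" for t
  have bnd: "0 \<le> w x * psi (1 + t * (h x - 1))" "w x * psi (1 + t * (h x - 1)) \<le> t * (w x * psi (h x))" if t: "0 \<le> t" "t \<le> 1" for t x
  proof -
    have "t * h x + (1 - t) \<ge> 0" using t h0[of x] by simp
    then have "1 + t * (h x - 1) \<ge> 0" by (simp add: algebra_simps)
    then show "0 \<le> w x * psi (1 + t * (h x - 1))" using w0 psi_nonneg by simp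
    show "w x * psi (1 + t * (h x - 1)) \<le> t * (w x * psi (h x))"
      using mult_left_mono[OF psi_convex[OF h0 t, of x] w0[of x]] by (simp add: mult_ac)
  qed
  \<comment> \<open>The root equation \<open>a / \<beta> = \<eta> + R a\<close> is what removes the
    linear term in \<open>t\<close>.\<close>
  have F: "free_energy \<beta> \<eta> (mixture t (gibbs \<beta> a) \<rho>) = ereal (m + k t / \<beta> - t\<^sup>2 * ((A - R a)\<^sup>2 + B\<^sup>2) / 2)" if t: "0 \<le> t" "t \<le> 1" for t
  proof -
    define g where "g x = (1 - t) * w x + t * r x" for x
    define \<sigma> where "\<sigma> = density phase_lebesgue (\<lambda>x. ennreal (g x))"
    have mix: "mixture t (gibbs \<beta> a) \<rho> = \<sigma>"
      unfolding gibbs_eq \<rho> g_def w_def[symmetric] \<sigma>_def by (rule mixture_density) (use r0 w0 t in auto)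
    have g: "g \<in> borel_measurable (borel \<Otimes>\<^sub>M borel)" "\<And>x. g x \<ge> 0"
      unfolding g_def using r0 w0 t by (auto intro!: add_nonneg_nonneg)
    have pps: "phase_prob \<sigma>"
      unfolding \<sigma>_def by (rule phase_prob_density) (use g ir iw in \<open>auto simp: g_def\<close>)
    have c: "mean_cos \<sigma> = (1 - t) * R a + t * A"
    proof -
      have "mean_cos \<sigma> = (\<integral>x. (1 - t) * (w x * cos_2pi (fst x)) + t * (r x * cos_2pi (fst x)) \<partial>phase_lebesgue)"
        unfolding \<sigma>_def mean_density[OF g] by (simp add: g_def algebra_simps)
      also have "\<dots> = (1 - t) * mean_cos (gibbs \<beta> a) + t * A"
        using integrable_density_moments[OF iw(1)] integrable_density_moments[OF ir(1)]
          mean_density[OF wf_measurable less_imp_le[OF wf_pos[OF \<beta>]], of a 0]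
        by (simp add: A_def \<rho> mean_density[OF r r0] gibbs_eq w_def)
      finally show ?thesis by (simp add: mean_wf_0[OF \<beta>])
    qed
    have s: "mean_sin \<sigma> = t * B"
    proof -
      have "mean_sin \<sigma> = (\<integral>x. (1 - t) * (w x * sin_2pi (fst x)) + t * (r x * sin_2pi (fst x)) \<partial>phase_lebesgue)"
        unfolding \<sigma>_def mean_density[OF g] by (simp add: g_def algebra_simps)
      also have "\<dots> = (1 - t) * mean_sin (gibbs \<beta> a) + t * B"
        using integrable_density_moments[OF iw(1)] integrable_density_moments[OF ir(1)]
          mean_density[OF wf_measurable less_imp_le[OF wf_pos[OF \<beta>]], of a 0]
        by (simp add: B_def \<rho> mean_density[OF r r0] gibbs_eq w_def)
      finally show ?thesis by (simp add: mean_wf_0[OF \<beta>])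
    qed
    have gh: "g x / w x = 1 + t * (h x - 1)" for x using w[of x] by (simp add: g_def h_def field_simps)
    have "integrable phase_lebesgue (\<lambda>x. w x * psi (1 + t * (h x - 1)))"
      using bnd[OF t] t by (intro Bochner_Integration.integrable_bound[OF integrable_mult_right[OF ih, of t]]) (auto simp: order_trans[OF bnd(2)[OF t] abs_ge_self])
    then have K: "KL \<beta> a 0 g = ennreal (k t)"
      unfolding KL_def w_def[symmetric] gh k_def using bnd[OF t] by (intro nn_integral_eq_integral) auto
    have k0: "k t \<ge> 0" unfolding k_def using bnd[OF t] by (intro Bochner_Integration.integral_nonneg) auto
    have "ennreal (1 / \<beta>) * KL \<beta> a 0 g = ennreal (k t / \<beta>)"
      unfolding K using \<beta> k0 by (simp add: ennreal_mult[symmetric])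
    then have "free_energy \<beta> \<eta> \<sigma> = ereal (k t / \<beta> + field_energy \<beta> \<eta> a 0 (mean_cos \<sigma>) (mean_sin \<sigma>))"
      using free_energy_density[OF \<beta> \<sigma>_def pps g, of \<eta> a 0] \<beta> k0 by (simp add: enn2ereal_ennreal)
    moreover have "field_energy \<beta> \<eta> a 0 (mean_cos \<sigma>) (mean_sin \<sigma>) = m - t\<^sup>2 * ((A - R a)\<^sup>2 + B\<^sup>2) / 2"
    proof -
      have "a / \<beta> = \<eta> + R a" using a \<beta> by (simp add: root_def field_simps)
      then show ?thesis unfolding c s m_def field_energy_def by (simp add: power2_eq_square field_simps)
    qed
    ultimately show ?thesis unfolding mix by simp
  qed
  \<comment> \<open>Pointwise the quotients tend to 0 by \<open>psi_quotient_tendsto\<close>;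
    convexity dominates them by \<open>w x * psi (h x)\<close>, integrable because \<rho> has finite
    energy.\<close>
  have k: "((\<lambda>t. k t / t) \<longlongrightarrow> 0) (at_right 0)"
  proof (rule tendsto_at_right_sequentially[of 0 1])
    fix S :: "nat \<Rightarrow> real" assume S: "\<And>n. 0 < S n" "\<And>n. S n < 1" "S \<longlonglongrightarrow> 0"
    have "(\<lambda>n. \<integral>x. w x * (psi (1 + S n * (h x - 1)) / S n) \<partial>phase_lebesgue) \<longlonglongrightarrow> (\<integral>x. w x * 0 \<partial>phase_lebesgue)"
    proof (rule integral_dominated_convergence[where w = "\<lambda>x. w x * psi (h x)"])
      show "AE x in phase_lebesgue. (\<lambda>n. w x * (psi (1 + S n * (h x - 1)) / S n)) \<longlonglongrightarrow> w x * 0"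
      proof (rule AE_I2, rule tendsto_mult_left)
        fix x
        have "filterlim S (at 0) sequentially"
          using S less_imp_neq[OF S(1)] by (auto simp: filterlim_at intro!: always_eventually)
        from filterlim_compose[OF psi_quotient_tendsto this]
        show "(\<lambda>n. psi (1 + S n * (h x - 1)) / S n) \<longlonglongrightarrow> 0" .
      qed
      fix n
      show "AE x in phase_lebesgue. norm (w x * (psi (1 + S n * (h x - 1)) / S n)) \<le> w x * psi (h x)"
      proof (rule AE_I2)
        fix x
        show "norm (w x * (psi (1 + S n * (h x - 1)) / S n)) \<le> w x * psi (h x)"
          using bnd[of "S n" x] S(1)[of n] S(2)[of n] by (simp add: pos_divide_le_eq mult.commute)
      qed
    qed (use ih in simp_all)
    then show "(\<lambda>n. k (S n) / S n) \<longlonglongrightarrow> 0" unfolding k_def by simp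
  qed simp
  have "((\<lambda>t. k t / t / \<beta> - t * ((A - R a)\<^sup>2 + B\<^sup>2) / 2) \<longlongrightarrow> 0 / \<beta> - 0 * ((A - R a)\<^sup>2 + B\<^sup>2) / 2) (at_right 0)"
    using \<beta> by (intro tendsto_intros k) auto
  then have "((\<lambda>t. k t / t / \<beta> - t * ((A - R a)\<^sup>2 + B\<^sup>2) / 2) \<longlongrightarrow> 0) (at_right 0)" by simp
  then show "((\<lambda>t. (real_of_ereal (free_energy \<beta> \<eta> (mixture t (gibbs \<beta> a) \<rho>)) - real_of_ereal (free_energy \<beta> \<eta> (gibbs \<beta> a))) / t) \<longlongrightarrow> 0) (at_right 0)"
  proof (rule Lim_transform_eventually)
    show "\<forall>\<^sub>F t in at_right 0. k t / t / \<beta> - t * ((A - R a)\<^sup>2 + B\<^sup>2) / 2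
       = (real_of_ereal (free_energy \<beta> \<eta> (mixture t (gibbs \<beta> a) \<rho>)) - real_of_ereal (free_energy \<beta> \<eta> (gibbs \<beta> a))) / t"
      unfolding eventually_at_right_field
    proof (intro exI[of _ 1] conjI allI impI)
      fix t :: real assume "0 < t" "t < 1"
      then show "k t / t / \<beta> - t * ((A - R a)\<^sup>2 + B\<^sup>2) / 2
       = (real_of_ereal (free_energy \<beta> \<eta> (mixture t (gibbs \<beta> a) \<rho>)) - real_of_ereal (free_energy \<beta> \<eta> (gibbs \<beta> a))) / t"
        using \<beta> by (simp add: F m power2_eq_square diff_divide_distrib)
    qed simp
  qed
qed

section \<open>Instability of the negative roots under rotation\<close>

lemma distr_wf_shift:
  assumes \<beta>: "\<beta> > 0"
  shows "distr (gibbs \<beta> a) (borel \<Otimes>\<^sub>M borel) (\<lambda>(q, p). (q + h, p))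
    = density phase_lebesgue (\<lambda>x. ennreal (wf \<beta> (a * cos_2pi h) (a * sin_2pi h) x))" (is "?D = ?E")
proof (rule measure_eqI)
  show "sets ?D = sets ?E" by simp
  fix S assume "S \<in> sets ?D"
  then have [measurable]: "S \<in> sets (borel \<Otimes>\<^sub>M borel)" by simp
  have ms: "measurable (gibbs \<beta> a) N = measurable (borel \<Otimes>\<^sub>M borel) N" for N
    by (rule phase_prob_measurable[OF phase_prob_gibbs[OF \<beta>]])
  have sh [measurable]: "(\<lambda>(q, p). (q + h, p)) \<in> borel \<Otimes>\<^sub>M borel \<rightarrow>\<^sub>M borel \<Otimes>\<^sub>M (borel :: real measure)" by measurable
  have w: "wf \<beta> a 0 (q, p) = wf \<beta> (a * cos_2pi h) (a * sin_2pi h) (q + h, p)" for q p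
  proof -
    have "(a * cos_2pi h)\<^sup>2 + (a * sin_2pi h)\<^sup>2 = a\<^sup>2 * ((sin_2pi h)\<^sup>2 + (cos_2pi h)\<^sup>2)"
      by (simp add: power_mult_distrib distrib_left)
    then have "Zf (a * cos_2pi h) (a * sin_2pi h) = Zf a 0"
      unfolding Zf_eq sin_cos_2pi_squared by simp
    moreover have "a * cos_2pi q = a * cos_2pi h * cos_2pi (q + h) + a * sin_2pi h * sin_2pi (q + h)"
      using cos_2pi_diff[of "q + h" h] by (simp add: mult_ac distrib_left[symmetric])
    ultimately show ?thesis by (simp add: wf_def)
  qed
  have "emeasure ?D S = (\<integral>\<^sup>+x. indicator S x \<partial>?D)" by simp
  also have "\<dots> = (\<integral>\<^sup>+x. indicator S (case x of (q, p) \<Rightarrow> (q + h, p)) \<partial>gibbs \<beta> a)"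
    by (rule nn_integral_distr) (simp_all add: ms sh)
  also have "\<dots> = (\<integral>\<^sup>+x. ennreal (wf \<beta> a 0 x) * indicator S (case x of (q, p) \<Rightarrow> (q + h, p)) \<partial>phase_lebesgue)"
    unfolding gibbs_eq by (rule nn_integral_density) simp_all
  also have "\<dots> = (\<integral>\<^sup>+x. (case x of (q, p) \<Rightarrow> ennreal (wf \<beta> (a * cos_2pi h) (a * sin_2pi h) (q + h, p)) * indicator S (q + h, p)) \<partial>phase_lebesgue)"
    by (intro nn_integral_cong) (auto simp: w)
  also have "\<dots> = (\<integral>\<^sup>+p. \<integral>\<^sup>+q. ennreal (wf \<beta> (a * cos_2pi h) (a * sin_2pi h) (q + h, p)) * indicator S (q + h, p) \<partial>torus_lebesgue \<partial>lborel)"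
    unfolding phase_lebesgue_def by (subst phase.nn_integral_snd[symmetric]) simp_all
  also have "\<dots> = (\<integral>\<^sup>+p. \<integral>\<^sup>+q. ennreal (wf \<beta> (a * cos_2pi h) (a * sin_2pi h) (q, p)) * indicator S (q, p) \<partial>torus_lebesgue \<partial>lborel)"
    by (intro nn_integral_cong nn_integral_torus_shift) measurable
  also have "\<dots> = (\<integral>\<^sup>+x. ennreal (wf \<beta> (a * cos_2pi h) (a * sin_2pi h) x) * indicator S x \<partial>phase_lebesgue)"
    unfolding phase_lebesgue_def by (subst phase.nn_integral_snd[symmetric]) simp_all
  also have "\<dots> = emeasure ?E S" by (simp add: emeasure_density)
  finally show "emeasure ?D S = emeasure ?E S" .
qed

text \<open>The coupling that pairs each point with its own translate leaves velocities fixed and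
  displaces positions by at most \<open>\<bar>t\<bar>\<close>.\<close>

lemma wasserstein2_sq_shift:
  assumes \<mu>: "phase_prob \<mu>"
  shows "wasserstein2_sq \<mu> (distr \<mu> (borel \<Otimes>\<^sub>M borel) (\<lambda>(q, p). (q + to_torus t, p))) \<le> ennreal (t\<^sup>2)"
proof -
  define T where "T = (\<lambda>(q :: torus, p :: real). (q + to_torus t, p))"
  define \<rho> where "\<rho> = distr \<mu> (borel \<Otimes>\<^sub>M borel) T"
  define \<pi> where "\<pi> = distr \<mu> (\<mu> \<Otimes>\<^sub>M \<rho>) (\<lambda>x. (x, T x))"
  interpret prob_space \<mu> using \<mu> by (simp add: phase_prob_def)
  have sm [measurable_cong]: "sets \<mu> = sets (borel \<Otimes>\<^sub>M borel)" using \<mu> by (simp add: phase_prob_def)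
  have sr [measurable_cong]: "sets \<rho> = sets (borel \<Otimes>\<^sub>M borel)" by (simp add: \<rho>_def)
  have T [measurable]: "T \<in> borel \<Otimes>\<^sub>M borel \<rightarrow>\<^sub>M borel \<Otimes>\<^sub>M borel" unfolding T_def by measurable
  have g [measurable]: "(\<lambda>x. (x, T x)) \<in> \<mu> \<rightarrow>\<^sub>M \<mu> \<Otimes>\<^sub>M \<rho>" by measurable
  have d1: "distr \<pi> \<mu> fst = \<mu>"
    unfolding \<pi>_def by (subst distr_distr) (simp_all add: comp_def distr_id)
  have d2: "distr \<pi> \<rho> snd = \<rho>"
  proof -
    have "distr \<pi> \<rho> snd = distr \<mu> \<rho> T" unfolding \<pi>_def by (subst distr_distr) (simp_all add: comp_def)
    also have "\<dots> = \<rho>" unfolding \<rho>_def by (rule distr_cong) simp_all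
    finally show ?thesis .
  qed
  have "\<pi> \<in> couplings \<mu> \<rho>" unfolding couplings_def using d1 d2 by (simp add: \<pi>_def)
  then have "wasserstein2_sq \<mu> \<rho> \<le> (\<integral>\<^sup>+z. ennreal ((dist (fst z) (snd z))\<^sup>2) \<partial>\<pi>)"
    unfolding wasserstein2_sq_def by (rule INF_lower)
  also have "\<dots> = (\<integral>\<^sup>+x. ennreal ((dist x (T x))\<^sup>2) \<partial>\<mu>)"
  proof -
    have [measurable]: "(\<lambda>z. dist (fst z) (snd z)) \<in> borel_measurable (\<mu> \<Otimes>\<^sub>M \<rho>)"
    proof (rule borel_measurable_dist)
      have "sets \<mu> = sets borel" "sets \<rho> = sets borel" unfolding sm sr borel_prod by auto
      then show "fst \<in> borel_measurable (\<mu> \<Otimes>\<^sub>M \<rho>)" "snd \<in> borel_measurable (\<mu> \<Otimes>\<^sub>M \<rho>)"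
        using measurable_fst[of \<mu> \<rho>] measurable_snd[of \<mu> \<rho>] measurable_cong_sets by blast+
    qed
    show ?thesis unfolding \<pi>_def by (subst nn_integral_distr) simp_all
  qed
  also have "\<dots> \<le> (\<integral>\<^sup>+x. ennreal (t\<^sup>2) \<partial>\<mu>)"
  proof (intro nn_integral_mono ennreal_leI)
    fix x :: "torus \<times> real"
    obtain q p where x: "x = (q, p)" by (cases x)
    obtain y where y: "q = to_torus y" by (rule torus_cases_unit)
    have "dist x (T x) = dist (to_torus y) (to_torus (y + t))"
      by (simp add: x y T_def dist_Pair_Pair to_torus_add)
    also have "\<dots> \<le> \<bar>t\<bar>" using dist_torus_le[of y "y + t"] by simp
    finally show "(dist x (T x))\<^sup>2 \<le> t\<^sup>2" by (metis abs_le_square_iff abs_of_nonneg zero_le_dist)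
  qed
  also have "\<dots> = ennreal (t\<^sup>2)" by (simp add: emeasure_space_1)
  finally show ?thesis unfolding \<rho>_def T_def .
qed

text \<open>Rotating the Gibbs measure costs no entropy and no interaction energy, and lowers the confinement energy.\<close>

theorem not_local_minimizer_gibbs:
  assumes \<beta>: "\<beta> > 0" and \<eta>: "\<eta> > 0" and a: "a < 0"
  shows "\<not> local_minimizer \<beta> \<eta> (gibbs \<beta> a)"
proof
  assume "local_minimizer \<beta> \<eta> (gibbs \<beta> a)"
  then obtain \<epsilon> where \<epsilon>: "\<epsilon> > 0" and
    min: "\<And>\<rho>. phase_prob \<rho> \<Longrightarrow> wasserstein2_sq (gibbs \<beta> a) \<rho> < ennreal (\<epsilon>\<^sup>2) \<Longrightarrow> free_energy \<beta> \<eta> (gibbs \<beta> a) \<le> free_energy \<beta> \<eta> \<rho>"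
    unfolding local_minimizer_def by blast
  \<comment> \<open>Half of \<epsilon> keeps the rotated measure in the Wasserstein ball; the cap
    1/2 excludes full turns, so that the cosine \<open>c\<close> is strictly below 1.\<close>
  define t where "t = min (\<epsilon> / 2) (1 / 2)"
  have t: "0 < t" "t < \<epsilon>" "t \<le> 1 / 2" using \<epsilon> by (auto simp: t_def)
  define c s where "c = cos_2pi (to_torus t)" and "s = sin_2pi (to_torus t)"
  have cs: "s\<^sup>2 + c\<^sup>2 = 1" unfolding c_def s_def by (rule sin_cos_2pi_squared)
  have c1: "c < 1"
  proof -
    have "c \<noteq> 1"
    proof
      assume c: "c = 1"
      then have "s = 0" using cs by simp
      with c have "to_torus t = 0" by (intro torus_eqI) (simp_all add: c_def s_def)
      then have "dist (to_torus t) (to_torus 0) = 0" unfolding zero_torus_def by (simp only: dist_self)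
      then have "t = of_int (round t)" unfolding dist_to_torus by simp
      then obtain k where k: "t = of_int k" by blast
      then have "0 < k" "k < 1" using t by auto
      then show False by simp
    qed
    then show ?thesis using cos_2pi_le[of "to_torus t"] unfolding c_def by linarith
  qed
  define \<rho> where "\<rho> = distr (gibbs \<beta> a) (borel \<Otimes>\<^sub>M borel) (\<lambda>(q, p). (q + to_torus t, p))"
  have \<rho>: "\<rho> = density phase_lebesgue (\<lambda>x. ennreal (wf \<beta> (a * c) (a * s) x))"
    unfolding \<rho>_def c_def s_def by (rule distr_wf_shift[OF \<beta>])
  have pp: "phase_prob \<rho>" unfolding \<rho> by (rule phase_prob_wf[OF \<beta>])
  have sq: "sqrt ((a * c)\<^sup>2 + (a * s)\<^sup>2) = - a"
  proof -
    have "(a * c)\<^sup>2 + (a * s)\<^sup>2 = a\<^sup>2 * (s\<^sup>2 + c\<^sup>2)" by (simp add: power_mult_distrib distrib_left)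
    then show ?thesis using a by (simp add: cs)
  qed
  have mean: "mean_cos \<rho> = R a * c" "mean_sin \<rho> = R a * s"
    using mean_density_wf[OF \<beta>, of "a * c" "a * s"] a unfolding sq \<rho>[symmetric] by (simp_all add: R_minus)
  have Zf: "Zf (a * c) (a * s) = Zf a 0" unfolding Zf_eq sq using a by simp
  have "free_energy \<beta> \<eta> \<rho> = ereal (field_energy \<beta> \<eta> (a * c) (a * s) (R a * c) (R a * s))"
    using free_energy_wf[OF \<beta> \<rho>, of \<eta>] unfolding mean .
  \<comment> \<open>The angle enters the quadratic terms only through
    \<open>s\<^sup>2 + c\<^sup>2 = 1\<close>; the confinement term is the only one that depends on
    \<open>c\<close>.\<close>
  moreover have "field_energy \<beta> \<eta> (a * c) (a * s) (R a * c) (R a * s) = field_energy \<beta> \<eta> a 0 (R a) 0 + \<eta> * R a * (1 - c)"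
  proof -
    have "field_energy \<beta> \<eta> (a * c) (a * s) (R a * c) (R a * s)
       = (a * R a / \<beta> - (R a)\<^sup>2 / 2) * (s\<^sup>2 + c\<^sup>2) - \<eta> * R a * c + (ln (\<beta> / (2 * pi)) / 2 - ln (Zf a 0)) / \<beta>"
      unfolding field_energy_def Zf by (simp add: power2_eq_square algebra_simps)
    then show ?thesis unfolding cs field_energy_def by (simp add: power2_eq_square algebra_simps)
  qed
  moreover have "\<eta> * R a * (1 - c) < 0"
    using \<eta> c1 R_strict_mono[OF a] by (simp add: mult_less_0_iff)
  ultimately have "free_energy \<beta> \<eta> \<rho> < free_energy \<beta> \<eta> (gibbs \<beta> a)"
    unfolding free_energy_gibbs[OF \<beta>] by simp
  moreover have "wasserstein2_sq (gibbs \<beta> a) \<rho> < ennreal (\<epsilon>\<^sup>2)"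
  proof (rule le_less_trans)
    show "wasserstein2_sq (gibbs \<beta> a) \<rho> \<le> ennreal (t\<^sup>2)"
      unfolding \<rho>_def by (rule wasserstein2_sq_shift[OF phase_prob_gibbs[OF \<beta>]])
    show "ennreal (t\<^sup>2) < ennreal (\<epsilon>\<^sup>2)" using t by (intro ennreal_lessI power_strict_mono) auto
  qed
  ultimately show False using min[OF pp] by simp
qed

section \<open>The set of steady states and the phase transition\<close>

lemma gibbs_inject:
  assumes "\<beta> > 0" shows "gibbs \<beta> a = gibbs \<beta> b \<longleftrightarrow> a = b"
proof
  assume "gibbs \<beta> a = gibbs \<beta> b"
  then have "R a = R b" using mean_wf_0(1)[OF assms] by metis
  then show "a = b" using R_strict_mono[of a b] R_strict_mono[of b a] by (metis less_irrefl linorder_neqE)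
qed simp

lemma steady_states_eq:
  assumes "\<gamma> > 0" "\<beta> > 0" "\<eta> > 0" and a: "a > 0" "root \<beta> \<eta> a"
  shows "{\<mu>. steady_state \<gamma> \<beta> \<eta> \<mu>} = insert (gibbs \<beta> a) ((\<lambda>b. gibbs \<beta> (- b)) ` {b. b > 0 \<and> gap \<beta> \<eta> b = 0})"
proof (intro equalityI subsetI)
  fix \<mu> assume "\<mu> \<in> {\<mu>. steady_state \<gamma> \<beta> \<eta> \<mu>}"
  then obtain x where x: "root \<beta> \<eta> x" "\<mu> = gibbs \<beta> x" using steady_state_imp_gibbs[OF assms(1-3)] by blast
  have "x \<noteq> 0" by (rule root_not_0[OF assms(2,3) x(1)])
  then consider "x > 0" | "x < 0" by linarith
  then show "\<mu> \<in> insert (gibbs \<beta> a) ((\<lambda>b. gibbs \<beta> (- b)) ` {b. b > 0 \<and> gap \<beta> \<eta> b = 0})"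
  proof cases
    case 1
    then have "x = a" using ex1_positive_root[OF assms(2,3)] a x(1) by blast
    then show ?thesis using x(2) by simp
  next
    case 2
    then show ?thesis using x root_minus_iff[OF assms(2), of \<eta> "- x"] by (intro insertI2 image_eqI[of _ _ "- x"]) auto
  qed
next
  fix \<mu> assume "\<mu> \<in> insert (gibbs \<beta> a) ((\<lambda>b. gibbs \<beta> (- b)) ` {b. b > 0 \<and> gap \<beta> \<eta> b = 0})"
  then show "\<mu> \<in> {\<mu>. steady_state \<gamma> \<beta> \<eta> \<mu>}"
    using gibbs_steady[OF assms(2)] a(2) root_minus_iff[OF assms(2)] by auto
qed

theorem lemma2p8:
  fixes \<gamma> \<eta> :: real
  assumes "\<gamma> > 0" and "0 < \<eta>" and "\<eta> < 1"
  shows "\<exists>a_min :: real \<Rightarrow> real.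
    (\<forall>\<beta>>0. a_min \<beta> > 0 \<and>
       (\<forall>\<mu>. global_minimizer \<beta> \<eta> \<mu> \<longleftrightarrow> \<mu> = gibbs \<beta> (a_min \<beta>))) \<and>
    (\<exists>!\<beta>\<^sub>c. \<beta>\<^sub>c > 0 \<and>
       (\<forall>\<beta>. 0 < \<beta> \<and> \<beta> < \<beta>\<^sub>c \<longrightarrow>
          {\<mu>. steady_state \<gamma> \<beta> \<eta> \<mu>} = {gibbs \<beta> (a_min \<beta>)}) \<and>
       (\<exists>a\<^sub>c. a\<^sub>c < 0 \<and>
          {\<mu>. steady_state \<gamma> \<beta>\<^sub>c \<eta> \<mu>} = {gibbs \<beta>\<^sub>c (a_min \<beta>\<^sub>c), gibbs \<beta>\<^sub>c a\<^sub>c} \<and>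
          card {\<mu>. steady_state \<gamma> \<beta>\<^sub>c \<eta> \<mu>} = 2) \<and>
       (\<forall>\<beta>>\<beta>\<^sub>c. \<exists>a\<^sub>1 a\<^sub>2. a\<^sub>2 < a\<^sub>1 \<and> a\<^sub>1 < 0 \<and>
          {\<mu>. steady_state \<gamma> \<beta> \<eta> \<mu>} = {gibbs \<beta> (a_min \<beta>), gibbs \<beta> a\<^sub>1, gibbs \<beta> a\<^sub>2} \<and>
          card {\<mu>. steady_state \<gamma> \<beta> \<eta> \<mu>} = 3)) \<and>
    (\<forall>\<beta>>0. \<forall>\<mu>. steady_state \<gamma> \<beta> \<eta> \<mu> \<and> \<mu> \<noteq> gibbs \<beta> (a_min \<beta>) \<longrightarrow>
       critical_point \<beta> \<eta> \<mu> \<and> \<not> local_minimizer \<beta> \<eta> \<mu>)"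
proof -
  have "\<exists>a_min. \<forall>\<beta>>0. a_min \<beta> > 0 \<and> root \<beta> \<eta> (a_min \<beta>)"
    using ex1_positive_root[OF _ assms(2)] by metis
  then obtain a_min where a: "\<And>\<beta>. \<beta> > 0 \<Longrightarrow> a_min \<beta> > 0" and ra: "\<And>\<beta>. \<beta> > 0 \<Longrightarrow> root \<beta> \<eta> (a_min \<beta>)"
    by blast
  define S where "S \<beta> = {\<mu>. steady_state \<gamma> \<beta> \<eta> \<mu>}" for \<beta>
  have S: "S \<beta> = insert (gibbs \<beta> (a_min \<beta>)) ((\<lambda>b. gibbs \<beta> (- b)) ` {b. b > 0 \<and> gap \<beta> \<eta> b = 0})" if "\<beta> > 0" for \<beta>
    unfolding S_def using steady_states_eq[OF assms(1) that assms(2) a ra] that by blast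
  obtain \<beta>c where \<beta>c: "\<beta>c > 0" and below: "\<And>\<beta>. 0 < \<beta> \<Longrightarrow> \<beta> < \<beta>c \<Longrightarrow> {b. b > 0 \<and> gap \<beta> \<eta> b = 0} = {}"
    and at: "\<exists>b>0. {b. b > 0 \<and> gap \<beta>c \<eta> b = 0} = {b}"
    and above: "\<And>\<beta>. \<beta> > \<beta>c \<Longrightarrow> \<exists>b1 b2. 0 < b1 \<and> b1 < b2 \<and> {b. b > 0 \<and> gap \<beta> \<eta> b = 0} = {b1, b2}"
    using ex_critical_value[OF assms(2,3)] that by meson
  define P where "P \<beta>\<^sub>c \<longleftrightarrow> \<beta>\<^sub>c > 0 \<and> (\<forall>\<beta>. 0 < \<beta> \<and> \<beta> < \<beta>\<^sub>c \<longrightarrow> S \<beta> = {gibbs \<beta> (a_min \<beta>)}) \<and>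
       (\<exists>a\<^sub>c. a\<^sub>c < 0 \<and> S \<beta>\<^sub>c = {gibbs \<beta>\<^sub>c (a_min \<beta>\<^sub>c), gibbs \<beta>\<^sub>c a\<^sub>c} \<and> card (S \<beta>\<^sub>c) = 2) \<and>
       (\<forall>\<beta>>\<beta>\<^sub>c. \<exists>a\<^sub>1 a\<^sub>2. a\<^sub>2 < a\<^sub>1 \<and> a\<^sub>1 < 0 \<and>
          S \<beta> = {gibbs \<beta> (a_min \<beta>), gibbs \<beta> a\<^sub>1, gibbs \<beta> a\<^sub>2} \<and> card (S \<beta>) = 3)" for \<beta>\<^sub>c
  have "P \<beta>c"
    unfolding P_def
  proof (intro conjI allI impI)
    show "\<beta>c > 0" by (rule \<beta>c)
    show "S \<beta> = {gibbs \<beta> (a_min \<beta>)}" if "0 < \<beta> \<and> \<beta> < \<beta>c" for \<beta>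
      using S[of \<beta>] below[of \<beta>] that by auto
    obtain b where b: "b > 0" "{b. b > 0 \<and> gap \<beta>c \<eta> b = 0} = {b}" using at by blast
    have Sc: "S \<beta>c = {gibbs \<beta>c (a_min \<beta>c), gibbs \<beta>c (- b)}" unfolding S[OF \<beta>c] b(2) by simp
    show "\<exists>a\<^sub>c. a\<^sub>c < 0 \<and> S \<beta>c = {gibbs \<beta>c (a_min \<beta>c), gibbs \<beta>c a\<^sub>c} \<and> card (S \<beta>c) = 2"
      using Sc b(1) a[OF \<beta>c] by (intro exI[of _ "- b"]) (simp add: gibbs_inject[OF \<beta>c])
    show "\<exists>a\<^sub>1 a\<^sub>2. a\<^sub>2 < a\<^sub>1 \<and> a\<^sub>1 < 0 \<and> S \<beta> = {gibbs \<beta> (a_min \<beta>), gibbs \<beta> a\<^sub>1, gibbs \<beta> a\<^sub>2} \<and> card (S \<beta>) = 3"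
      if "\<beta> > \<beta>c" for \<beta>
    proof -
      have \<beta>: "\<beta> > 0" using that \<beta>c by simp
      obtain b1 b2 where b: "0 < b1" "b1 < b2" "{b. b > 0 \<and> gap \<beta> \<eta> b = 0} = {b1, b2}" using above[OF \<open>\<beta> > \<beta>c\<close>] by blast
      have Sc: "S \<beta> = {gibbs \<beta> (a_min \<beta>), gibbs \<beta> (- b1), gibbs \<beta> (- b2)}" unfolding S[OF \<beta>] b(3) by simp
      show ?thesis
        using Sc b(1,2) a[OF \<beta>] by (intro exI[of _ "- b1"] exI[of _ "- b2"]) (simp add: gibbs_inject[OF \<beta>])
    qed
  qed
  \<comment> \<open>Were both critical, there would be a single steady state at \<open>x\<close> as
    a value below \<open>y\<close>, and two as a critical value.\<close>
  moreover have "\<not> x < y" if "P x" "P y" for x y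
  proof
    assume "x < y"
    moreover have "0 < x" using that(1) by (simp add: P_def)
    ultimately have "S x = {gibbs x (a_min x)}" using that(2) by (simp add: P_def)
    then have "card (S x) = 1" by simp
    moreover have "card (S x) = 2" using that(1) unfolding P_def by blast
    ultimately show False by simp
  qed
  ultimately have ex1: "\<exists>!\<beta>\<^sub>c. P \<beta>\<^sub>c" by (metis linorder_neqE)
  have crit: "critical_point \<beta> \<eta> \<mu> \<and> \<not> local_minimizer \<beta> \<eta> \<mu>"
    if \<beta>: "\<beta> > 0" and \<mu>: "steady_state \<gamma> \<beta> \<eta> \<mu>" "\<mu> \<noteq> gibbs \<beta> (a_min \<beta>)" for \<beta> \<mu>
  proof -
    have "\<mu> \<in> S \<beta>" using \<mu>(1) by (simp add: S_def)
    then obtain b where b: "b > 0" "gap \<beta> \<eta> b = 0" "\<mu> = gibbs \<beta> (- b)" unfolding S[OF \<beta>] using \<mu>(2) by blast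
    then show ?thesis
      using critical_point_gibbs[OF \<beta>, of \<eta> "- b"] root_minus_iff[OF \<beta>, of \<eta> b] not_local_minimizer_gibbs[OF \<beta> assms(2), of "- b"] by simp
  qed
  show ?thesis
  proof (intro exI[of _ a_min] conjI)
    show "\<forall>\<beta>>0. a_min \<beta> > 0 \<and> (\<forall>\<mu>. global_minimizer \<beta> \<eta> \<mu> \<longleftrightarrow> \<mu> = gibbs \<beta> (a_min \<beta>))"
      using a global_minimizer_iff[OF _ assms(2) a ra] by simp
  qed (use ex1 crit in \<open>simp_all only: P_def S_def, blast?\<close>)
qed

end
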